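(* Let $(W_1,S_1)$ and $(W_2,S_2)$ be finite Coxeter groups, let $W=W_1\times W_2$ with simple reflections $S=S_1\sqcup S_2$, and let $k$ be a good ring for $(W,S)$ (hence also for $(W_1,S_1)$ and $(W_2,S_2)$). If $(W_1,S_1)$ and $(W_2,S_2)$ satisfy the strong $W$-graph decomposition conjecture over $k$, then $(W,S)$ satisfies the strong $W$-graph decomposition conjecture over $k$.
   Context: Good ring. For a Coxeter group $(W,S)$, a subring $k\subseteq\mathbb{C}$ is called good if $2\cos(2\pi/\operatorname{ord}(st))\in k$ for all $s,t\in S$. $W$-graph algebra. Let $(W,S)$ be a Coxeter group with $S$ finite, $m_{st}=\operatorname{ord}(st)$. In $\mathbb{Z}\langle e_s,x_s\mid s\in S\rangle[v^{\pm1}]$ (free associative ring, $v$ central) put $\iota(T_s):=-v^{-1}e_s+v(1-e_s)+x_s$. For $s,t\in S$ with $m_{st}<\infty$ write $\underbrace{\iota(T_s)\iota(T_t)\iota(T_s)\cdots}_{m_{st}}-\underbrace{\iota(T_t)\iota(T_s)\iota(T_t)\cdots}_{m_{st}}=\sum_{\gamma\in\mathbb{Z}}y^\gamma(s,t)v^\gamma$ with $y^\gamma(s,t)\in\mathbb{Z}\langle e_s,x_s\rangle$. The $W$-graph algebra $\Omega=\Omega(W,S)$ is the quotient of $\mathbb{Z}\langle e_s,x_s\mid s\in S\rangle$ by the relations $e_s^2=e_s$, $e_se_t=e_te_s$, $e_sx_s=x_s$, $x_se_s=0$, and $y^\gamma(s,t)=0$ for all $s,t\in S$, $\gamma\in\mathbb{Z}$.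 Write $k\Omega=k\otimes_{\mathbb{Z}}\Omega$. For $I,J\subseteq S$, $s\in S$ put $E_I:=\prod_{t\in I}e_t\prod_{t\in S\setminus I}(1-e_t)$ and $X_{IJ}^s:=E_Ix_sE_J$. It is known that $X^s_{IJ}=0$ if $s\notin I\setminus J$ and $X_{IJ}^s=X_{IJ}^t$ for $s,t\in I\setminus J$; so for $I\setminus J\neq\emptyset$ write $X_{IJ}:=X_{IJ}^s$ for any $s\in I\setminus J$. Compatibility graph $\mathcal{Q}_W$: the directed graph with vertices the subsets of $S$ and an edge $I\leftarrow J$ iff $I\setminus J\neq\emptyset$ and no element of $I\setminus J$ commutes with an element of $J\setminus I$. The edge is an inclusion edge if $I\supseteq J$, and transversal otherwise (i.e. if $J\setminus I\ne\emptyset$). $\Psi=\Psi(W,S)$ is the subalgebra of $\Omega$ generated by all $E_I$ and all $X_{IJ}$ with $I\leftarrow J$ transversal; over $k$, $\Psi$ means the $k$-subalgebra of $k\Omega$ generated by these elements. Strong $W$-graph decomposition conjecture for a finite Coxeter group $(W,S)$ over a good ring $k$. Let $\operatorname{Irr}(W)$ be the set of irreducible complex characters and $d_\lambda$ the degree of $\lambda$. The conjecture asserts that there is a family $(F^\lambda)_{\lambda\in\operatorname{Irr}(W)}$ of elements of $k\Omega$ such that: (Z1) $F^\lambda F^\mu=\delta_{\lambda\mu}F^\lambda$ for all $\lambda,\mu$, and $1=\sum_\lambda F^\lambda$. (Z2) $E_IF^\lambda=F^\lambda E_I$ for all $\lambda\in\operatorname{Irr}(W)$, $I\subseteq S$.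 (Z3) There is a partial order $\preceq$ on $\operatorname{Irr}(W)$ such that $F^\lambda\, k\Omega\, F^\mu\neq0$ implies $\lambda\preceq\mu$. (Z4) For each $\lambda$ there is a surjective $k$-algebra morphism $\psi_\lambda:k^{d_\lambda\times d_\lambda}\to F^\lambda\,k\Omega\,F^\lambda$. (Z5) $F^\lambda X_{IJ}F^\lambda\in\Psi$ for all $\lambda$ and all edges $I\leftarrow J$ of $\mathcal{Q}_W$. (Z6) $F^\lambda\in\Psi$ for all $\lambda$. *)

theory Defs
  imports
    Complex_Main
    "HOL-Library.Poly_Mapping"
    "HOL-Algebra.Algebra"
    "HOL-Algebra.Algebraic_Closure_Type"
    "Jordan_Normal_Form.Matrix"
begin

section \<open>Coxeter groups and good rings\<close>

definition coxeter_step :: "('a, 'm) monoid_scheme \<Rightarrow> 'a set \<Rightarrow> 'a list \<Rightarrow> 'a list \<Rightarrow> bool" where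
  "coxeter_step G S u w \<longleftrightarrow>
     (\<exists>p q. \<exists>s\<in>S. \<exists>t\<in>S. group.ord G (s \<otimes>\<^bsub>G\<^esub> t) \<noteq> 0 \<and>
        u = p @ concat (replicate (group.ord G (s \<otimes>\<^bsub>G\<^esub> t)) [s, t]) @ q \<and> w = p @ q)"

text \<open>
  The last two conjuncts say that the monoid of words over \<open>S\<close> modulo the relations
  \<open>(s t)\<^sup>m = 1\<close>, \<open>m = ord (s t) < \<infinity>\<close>, maps isomorphically onto \<open>G\<close>. Since the relation for
  \<open>s = t\<close> is \<open>s s = 1\<close>, this monoid is the group with that presentation.
  Recall that \<open>group.ord G x = 0\<close> iff \<open>x\<close> has infinite order.
\<close>
definition coxeter_group :: "('a, 'm) monoid_scheme \<Rightarrow> 'a set \<Rightarrow> bool" where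
  "coxeter_group G S \<longleftrightarrow>
     group G \<and> S \<subseteq> carrier G \<and> (\<forall>s\<in>S. group.ord G s = 2) \<and>
     generate G S = carrier G \<and>
     (\<forall>u\<in>lists S. \<forall>w\<in>lists S.
        foldr (\<otimes>\<^bsub>G\<^esub>) u \<one>\<^bsub>G\<^esub> = foldr (\<otimes>\<^bsub>G\<^esub>) w \<one>\<^bsub>G\<^esub> \<longrightarrow> equivclp (coxeter_step G S) u w)"

definition finite_coxeter_group :: "('a, 'm) monoid_scheme \<Rightarrow> 'a set \<Rightarrow> bool" where
  "finite_coxeter_group G S \<longleftrightarrow> coxeter_group G S \<and> finite (carrier G)"

text \<open>For \<open>ord (s t) = \<infinity>\<close>, encoded as 0, the condition below reads \<open>2 cos 0 = 2 \<in> K\<close>.\<close>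
definition good_ring :: "complex set \<Rightarrow> ('a, 'm) monoid_scheme \<Rightarrow> 'a set \<Rightarrow> bool" where
  "good_ring K G S \<longleftrightarrow>
     subring K (ring_of_type_algebra :: complex ring) \<and>
     (\<forall>s\<in>S. \<forall>t\<in>S. complex_of_real (2 * cos (2 * pi / real (group.ord G (s \<otimes>\<^bsub>G\<^esub> t)))) \<in> K)"

definition prod_reflections ::
    "('a, 'm) monoid_scheme \<Rightarrow> 'a set \<Rightarrow> ('b, 'n) monoid_scheme \<Rightarrow> 'b set \<Rightarrow> ('a \<times> 'b) set" where
  "prod_reflections G1 S1 G2 S2 =
     (\<lambda>s. (s, \<one>\<^bsub>G2\<^esub>)) ` S1 \<union> (\<lambda>t. (\<one>\<^bsub>G1\<^esub>, t)) ` S2"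


section \<open>Free associative algebras\<close>

text \<open>
  The free monoid, written additively so that \<open>'g fmon \<Rightarrow>\<^sub>0 'c\<close> carries the convolution product
  of \<^theory>\<open>HOL-Library.Poly_Mapping\<close>, i.e. is the free associative \<open>'c\<close>-algebra on \<open>'g\<close>.
\<close>
datatype 'g fmon = Fmon (letters: "'g list")

instantiation fmon :: (type) monoid_add
begin

definition zero_fmon :: "'a fmon" where "zero_fmon = Fmon []"

definition plus_fmon :: "'a fmon \<Rightarrow> 'a fmon \<Rightarrow> 'a fmon" where
  "plus_fmon u w = Fmon (letters u @ letters w)"

instance
  by standard (simp_all add: zero_fmon_def plus_fmon_def)

end

datatype 's wgen = Gen_e 's | Gen_x 's

type_synonym ('s, 'c) free_alg = "'s wgen fmon \<Rightarrow>\<^sub>0 'c"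

definition free_e :: "'s \<Rightarrow> ('s, 'c::ring_1) free_alg" where
  "free_e s = Poly_Mapping.single (Fmon [Gen_e s]) 1"

definition free_x :: "'s \<Rightarrow> ('s, 'c::ring_1) free_alg" where
  "free_x s = Poly_Mapping.single (Fmon [Gen_x s]) 1"

text \<open>The ring \<open>K\<langle>e\<^sub>s, x\<^sub>s | s \<in> S\<rangle>\<close>.\<close>
definition free_ring :: "complex set \<Rightarrow> 's set \<Rightarrow> ('s, complex) free_alg ring" where
  "free_ring K S = (ring_of_type_algebra :: ('s, complex) free_alg ring)
     \<lparr>carrier := {p. range (Poly_Mapping.lookup p) \<subseteq> K \<and>
        (\<forall>w\<in>Poly_Mapping.keys p. set (letters w) \<subseteq> Gen_e ` S \<union> Gen_x ` S)}\<rparr>"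


section \<open>The W-graph algebra\<close>

text \<open>
  Laurent polynomials in a central variable \<open>v\<close> over a ring \<open>A\<close> are \<open>int \<Rightarrow>\<^sub>0 A\<close>;
  \<open>Poly_Mapping.single n a\<close> is \<open>a v\<^sup>n\<close>.
\<close>
definition iota_T :: "'s \<Rightarrow> (int \<Rightarrow>\<^sub>0 ('s, int) free_alg)" where
  "iota_T s = - Poly_Mapping.single (-1) (free_e s) + Poly_Mapping.single 1 (1 - free_e s)
              + Poly_Mapping.single 0 (free_x s)"

fun alternating :: "nat \<Rightarrow> 'a \<Rightarrow> 'a \<Rightarrow> 'a list" where
  "alternating 0 s t = []"
| "alternating (Suc n) s t = s # alternating n t s"

definition y_coeff :: "('s, 'm) monoid_scheme \<Rightarrow> 's \<Rightarrow> 's \<Rightarrow> int \<Rightarrow> ('s, int) free_alg" where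
  "y_coeff G s t \<gamma> =
     (let m = group.ord G (s \<otimes>\<^bsub>G\<^esub> t) in
      Poly_Mapping.lookup
        (prod_list (map iota_T (alternating m s t)) - prod_list (map iota_T (alternating m t s))) \<gamma>)"

text \<open>A relation \<open>a = b\<close> is represented by \<open>a - b\<close>.\<close>
definition wgraph_relations :: "('s, 'm) monoid_scheme \<Rightarrow> 's set \<Rightarrow> ('s, int) free_alg set" where
  "wgraph_relations G S =
     {free_e s * free_e s - free_e s | s. s \<in> S} \<union>
     {free_e s * free_e t - free_e t * free_e s | s t. s \<in> S \<and> t \<in> S} \<union>
     {free_e s * free_x s - free_x s | s. s \<in> S} \<union>
     {free_x s * free_e s | s. s \<in> S} \<union>
     {y_coeff G s t \<gamma> | s t \<gamma>. s \<in> S \<and> t \<in> S \<and> group.ord G (s \<otimes>\<^bsub>G\<^esub> t) \<noteq> 0}"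

definition wgraph_ideal :: "complex set \<Rightarrow> ('s, 'm) monoid_scheme \<Rightarrow> 's set \<Rightarrow> ('s, complex) free_alg set" where
  "wgraph_ideal K G S = Idl\<^bsub>free_ring K S\<^esub> (Poly_Mapping.map of_int ` wgraph_relations G S)"

text \<open>
  \<open>k \<otimes>\<^sub>\<int> \<Omega>\<close>, where \<open>\<Omega> = \<int>\<langle>e\<^sub>s, x\<^sub>s\<rangle> / (R)\<close>, is rendered by its presentation
  \<open>k\<langle>e\<^sub>s, x\<^sub>s\<rangle> / (R)\<close> with the same integral relations \<open>R\<close>; \<open>\<Omega>\<close> itself is the case \<open>K = \<int>\<close>.
\<close>
definition Omega :: "complex set \<Rightarrow> ('s, 'm) monoid_scheme \<Rightarrow> 's set \<Rightarrow> ('s, complex) free_alg set ring" where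
  "Omega K G S = free_ring K S Quot wgraph_ideal K G S"

definition omega_class ::
    "complex set \<Rightarrow> ('s, 'm) monoid_scheme \<Rightarrow> 's set \<Rightarrow> ('s, complex) free_alg \<Rightarrow> ('s, complex) free_alg set" where
  "omega_class K G S p = wgraph_ideal K G S +>\<^bsub>free_ring K S\<^esub> p"

definition omega_e where
  "omega_e K G S s = omega_class K G S (free_e s)"

definition omega_x where
  "omega_x K G S s = omega_class K G S (free_x s)"

text \<open>The structure map \<open>k \<rightarrow> k\<Omega>\<close>; the \<open>k\<close>-module structure of \<open>k\<Omega>\<close> is multiplication by its values.\<close>
definition omega_scalar where
  "omega_scalar K G S c = omega_class K G S (Poly_Mapping.single 0 c)"

text \<open>
  \<open>\<Omega>\<close> is not commutative, but \<^const>\<open>finprod\<close> is still the product of a finite family of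
  pairwise commuting elements, since such a product does not depend on the order of the factors
  (cf. the locale \<^locale>\<open>LCD\<close>).
\<close>
definition E_elt where
  "E_elt K G S I =
     finprod (Omega K G S) (omega_e K G S) I \<otimes>\<^bsub>Omega K G S\<^esub>
     finprod (Omega K G S) (\<lambda>t. \<one>\<^bsub>Omega K G S\<^esub> \<ominus>\<^bsub>Omega K G S\<^esub> omega_e K G S t) (S - I)"

definition Xs_elt where
  "Xs_elt K G S s I J =
     E_elt K G S I \<otimes>\<^bsub>Omega K G S\<^esub> omega_x K G S s \<otimes>\<^bsub>Omega K G S\<^esub> E_elt K G S J"

text \<open>Only used for \<open>I - J \<noteq> {}\<close>; independent of the choice of \<open>s\<close>.\<close>
definition X_elt where
  "X_elt K G S I J = Xs_elt K G S (SOME s. s \<in> I - J) I J"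


section \<open>The compatibility graph and the subalgebra \<open>\<Psi>\<close>\<close>

text \<open>The edge \<open>I \<leftarrow> J\<close>.\<close>
definition compat_edge :: "('s, 'm) monoid_scheme \<Rightarrow> 's set \<Rightarrow> 's set \<Rightarrow> 's set \<Rightarrow> bool" where
  "compat_edge G S I J \<longleftrightarrow>
     I \<subseteq> S \<and> J \<subseteq> S \<and> I - J \<noteq> {} \<and>
     \<not> (\<exists>s\<in>I - J. \<exists>t\<in>J - I. s \<otimes>\<^bsub>G\<^esub> t = t \<otimes>\<^bsub>G\<^esub> s)"

definition transversal_edge :: "('s, 'm) monoid_scheme \<Rightarrow> 's set \<Rightarrow> 's set \<Rightarrow> 's set \<Rightarrow> bool" where
  "transversal_edge G S I J \<longleftrightarrow> compat_edge G S I J \<and> \<not> J \<subseteq> I"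

text \<open>
  The scalars are central, so the \<open>k\<close>-subalgebra generated by a set is the subring generated by
  that set and the scalars.
\<close>
definition Psi :: "complex set \<Rightarrow> ('s, 'm) monoid_scheme \<Rightarrow> 's set \<Rightarrow> ('s, complex) free_alg set set" where
  "Psi K G S = generate_ring (Omega K G S)
     (omega_scalar K G S ` K \<union>
      {E_elt K G S I | I. I \<subseteq> S} \<union>
      {X_elt K G S I J | I J. transversal_edge G S I J})"


section \<open>Irreducible complex characters\<close>

definition matrix_rep :: "('a, 'm) monoid_scheme \<Rightarrow> nat \<Rightarrow> ('a \<Rightarrow> complex mat) \<Rightarrow> bool" where
  "matrix_rep G n \<rho> \<longleftrightarrow>
     \<rho> \<in> hom G (ring_mat TYPE(complex) n ()) \<and> \<rho> \<one>\<^bsub>G\<^esub> = 1\<^sub>m n"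

definition invariant_subspace ::
    "('a, 'm) monoid_scheme \<Rightarrow> nat \<Rightarrow> ('a \<Rightarrow> complex mat) \<Rightarrow> complex vec set \<Rightarrow> bool" where
  "invariant_subspace G n \<rho> U \<longleftrightarrow>
     U \<subseteq> carrier_vec n \<and> 0\<^sub>v n \<in> U \<and>
     (\<forall>u\<in>U. \<forall>w\<in>U. u + w \<in> U) \<and> (\<forall>c. \<forall>u\<in>U. c \<cdot>\<^sub>v u \<in> U) \<and>
     (\<forall>g\<in>carrier G. \<forall>u\<in>U. \<rho> g *\<^sub>v u \<in> U)"

definition irreducible_rep :: "('a, 'm) monoid_scheme \<Rightarrow> nat \<Rightarrow> ('a \<Rightarrow> complex mat) \<Rightarrow> bool" where
  "irreducible_rep G n \<rho> \<longleftrightarrow>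
     matrix_rep G n \<rho> \<and> n > 0 \<and>
     (\<forall>U. invariant_subspace G n \<rho> U \<longrightarrow> U = {0\<^sub>v n} \<or> U = carrier_vec n)"

text \<open>Characters are extensional functions, so that distinct elements of \<open>Irr\<close> differ on \<open>G\<close>.\<close>
definition Irr :: "('a, 'm) monoid_scheme \<Rightarrow> ('a \<Rightarrow> complex) set" where
  "Irr G = {\<lambda>g\<in>carrier G. \<Sum>i<n. \<rho> g $$ (i, i) | n \<rho>. irreducible_rep G n \<rho>}"

definition char_degree :: "('a, 'm) monoid_scheme \<Rightarrow> ('a \<Rightarrow> complex) \<Rightarrow> nat" where
  "char_degree G \<chi> = (THE d. \<chi> \<one>\<^bsub>G\<^esub> = of_nat d)"


section \<open>The strong W-graph decomposition conjecture\<close>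

definition mat_ring_over :: "complex set \<Rightarrow> nat \<Rightarrow> complex mat ring" where
  "mat_ring_over K d =
     (ring_mat TYPE(complex) d ()) \<lparr>carrier := {A \<in> carrier_mat d d. elements_mat A \<subseteq> K}\<rparr>"

text \<open>The ring \<open>f R f\<close> with unit \<open>f\<close>, for an idempotent \<open>f\<close>.\<close>
definition corner_ring :: "'r ring \<Rightarrow> 'r \<Rightarrow> 'r ring" where
  "corner_ring R f = R \<lparr>carrier := {f \<otimes>\<^bsub>R\<^esub> a \<otimes>\<^bsub>R\<^esub> f | a. a \<in> carrier R}, one := f\<rparr>"

definition surj_matrix_morphism where
  "surj_matrix_morphism K G S d f \<psi> \<longleftrightarrow>
     \<psi> \<in> Ring.ring_hom (mat_ring_over K d) (corner_ring (Omega K G S) f) \<and>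
     (\<forall>c\<in>K. \<forall>A\<in>carrier (mat_ring_over K d).
        \<psi> (c \<cdot>\<^sub>m A) = omega_scalar K G S c \<otimes>\<^bsub>Omega K G S\<^esub> \<psi> A) \<and>
     \<psi> ` carrier (mat_ring_over K d) = carrier (corner_ring (Omega K G S) f)"

definition strong_wgraph_decomposition ::
    "complex set \<Rightarrow> ('s, 'm) monoid_scheme \<Rightarrow> 's set \<Rightarrow>
     (('s \<Rightarrow> complex) \<Rightarrow> ('s, complex) free_alg set) \<Rightarrow> bool" where
  "strong_wgraph_decomposition K G S F \<longleftrightarrow>
     (\<forall>\<nu>\<in>Irr G. F \<nu> \<in> carrier (Omega K G S)) \<and>
     (\<forall>\<nu>\<in>Irr G. \<forall>\<mu>\<in>Irr G.
        F \<nu> \<otimes>\<^bsub>Omega K G S\<^esub> F \<mu> = (if \<nu> = \<mu> then F \<nu> else \<zero>\<^bsub>Omega K G S\<^esub>)) \<and>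
     \<one>\<^bsub>Omega K G S\<^esub> = finsum (Omega K G S) F (Irr G) \<and>
     (\<forall>\<nu>\<in>Irr G. \<forall>I. I \<subseteq> S \<longrightarrow>
        E_elt K G S I \<otimes>\<^bsub>Omega K G S\<^esub> F \<nu> = F \<nu> \<otimes>\<^bsub>Omega K G S\<^esub> E_elt K G S I) \<and>
     (\<exists>r. partial_order_on (Irr G) r \<and>
        (\<forall>\<nu>\<in>Irr G. \<forall>\<mu>\<in>Irr G.
           (\<exists>a\<in>carrier (Omega K G S).
              F \<nu> \<otimes>\<^bsub>Omega K G S\<^esub> a \<otimes>\<^bsub>Omega K G S\<^esub> F \<mu> \<noteq> \<zero>\<^bsub>Omega K G S\<^esub>)
           \<longrightarrow> (\<nu>, \<mu>) \<in> r)) \<and>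
     (\<forall>\<nu>\<in>Irr G. \<exists>\<psi>. surj_matrix_morphism K G S (char_degree G \<nu>) (F \<nu>) \<psi>) \<and>
     (\<forall>\<nu>\<in>Irr G. \<forall>I J. compat_edge G S I J \<longrightarrow>
        F \<nu> \<otimes>\<^bsub>Omega K G S\<^esub> X_elt K G S I J \<otimes>\<^bsub>Omega K G S\<^esub> F \<nu> \<in> Psi K G S) \<and>
     (\<forall>\<nu>\<in>Irr G. F \<nu> \<in> Psi K G S)"

definition strong_wgraph_conjecture :: "complex set \<Rightarrow> ('s, 'm) monoid_scheme \<Rightarrow> 's set \<Rightarrow> bool" where
  "strong_wgraph_conjecture K G S \<longleftrightarrow> (\<exists>F. strong_wgraph_decomposition K G S F)"

end

theory Submission
  imports Defs "Jordan_Normal_Form.Char_Poly" "HOL-Computational_Algebra.Fundamental_Theorem_Algebra"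
begin

text \<open>
  Let \<open>W = W\<^sub>1 \<times> W\<^sub>2\<close>. The inclusions of the reflections of the factors preserve the orders of products of two
  reflections, hence induce homomorphisms \<open>j\<^sub>1 : \<Omega>\<^sub>1 \<rightarrow> \<Omega>\<close> and \<open>j\<^sub>2 : \<Omega>\<^sub>2 \<rightarrow> \<Omega>\<close> (\<open>Omega_map\<close>). The irreducible
  characters of \<open>W\<close> are the products of those of the factors (\<open>outer_char_bij\<close>), and the idempotents of \<open>W\<close>
  are \<open>F\<^bsup>(\<nu>,\<mu>)\<^esup> = j\<^sub>1(F\<^sup>\<nu>) j\<^sub>2(F\<^sup>\<mu>)\<close>.

  The images of \<open>j\<^sub>1\<close> and \<open>j\<^sub>2\<close> do not commute with each other: for \<open>s \<in> S\<^sub>1\<close> and \<open>t \<in> S\<^sub>2\<close> the relation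
  \<open>T\<^sub>s T\<^sub>t = T\<^sub>t T\<^sub>s\<close> only says that \<open>x\<^sub>s x\<^sub>t = x\<^sub>t x\<^sub>s\<close> and \<open>[x\<^sub>s, e\<^sub>t] = [x\<^sub>t, e\<^sub>s]\<close> (\<open>commutator_swap\<close>). Three
  observations replace commutativity.

  \<^item> The images of \<open>\<Psi>\<^sub>1\<close> and \<open>\<Psi>\<^sub>2\<close> do commute, and they lie in \<open>\<Psi>\<close> (\<open>Psi_images_commute\<close>, \<open>j_Psi_Psi\<close>). Indeed
    \<open>(1 - e\<^sub>r) x\<^sub>t e\<^sub>r = 0\<close> whenever \<open>r \<noteq> t\<close> commute, and the elements \<open>a\<close> with \<open>(1 - e\<^sub>r) a e\<^sub>r = 0\<close> form a ring.
    If \<open>I \<leftarrow> J\<close> is transversal and \<open>r \<in> J - I\<close>, then \<open>E\<^sub>I a E\<^sub>J = 0\<close> for every such \<open>a\<close> (\<open>Tri_kill\<close>), and the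
    commutators that obstruct commutativity are of this kind. So the \<open>F\<^bsup>(\<nu>,\<mu>)\<^esup>\<close> are orthogonal idempotents
    with sum 1 that lie in \<open>\<Psi>\<close> and commute with all \<open>E\<^sub>I\<close>.

  \<^item> The idempotents \<open>Q\<^sub>\<mu> = j\<^sub>2(F\<^sup>\<mu>)\<close> satisfy the order condition in all of \<open>\<Omega>\<close> (\<open>image_idem_ordered\<close>). The elements
    \<open>a\<close> with \<open>Q\<^sub>\<mu> a Q\<^sub>\<mu>\<^sub>' = 0\<close> unless \<open>\<mu> \<preceq> \<mu>'\<close> form a ring \<open>T\<close>, which contains \<open>j\<^sub>2(\<Omega>\<^sub>2)\<close> and all \<open>e\<^sub>s\<close>. For \<open>s \<in> S\<^sub>1\<close>
    the derivation \<open>[x\<^sub>s, -]\<close> maps the generators of \<open>j\<^sub>2(\<Omega>\<^sub>2)\<close> into \<open>T\<close> by the swap above, hence all of \<open>j\<^sub>2(\<Omega>\<^sub>2)\<close>;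
    since \<open>Q\<^sub>\<mu> x\<^sub>s Q\<^sub>\<mu>\<^sub>' = Q\<^sub>\<mu> [x\<^sub>s, Q\<^sub>\<mu>\<^sub>'] Q\<^sub>\<mu>\<^sub>'\<close> for \<open>\<mu> \<noteq> \<mu>'\<close>, also \<open>x\<^sub>s \<in> T\<close>. By symmetry the products \<open>F\<^bsup>(\<nu>,\<mu>)\<^esup>\<close>
    satisfy the condition for the product order.

  \<^item> By antisymmetry of the order, \<open>a \<mapsto> F a F\<close> is multiplicative for each idempotent \<open>F\<close> of an ordered
    family (\<open>corner_mult\<close>). The assumption (Z5) controls this map on generators, so \<open>F\<^sup>\<nu> \<Omega>\<^sub>1 F\<^sup>\<nu> \<subseteq> \<Psi>\<^sub>1\<close> (\<open>corner_Psi\<close>)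
    and the images of the two corner algebras commute. Their matrix units multiply to matrix units of size
    \<open>d\<^sub>\<nu> d\<^sub>\<mu>\<close>. These span the corner of \<open>\<Omega>\<close> at \<open>F\<^bsup>(\<nu>,\<mu>)\<^esup>\<close>, because again by multiplicativity that corner is
    generated by the corners of the generators, each of which comes from one factor
    (\<open>prod_idem_surj_matrix_morphism\<close>).
\<close>

section \<open>Subspaces of column vectors\<close>

definition mat_trace :: "'a::comm_monoid_add mat \<Rightarrow> 'a" where
  "mat_trace A = (\<Sum>i<dim_row A. A $$ (i, i))"

lemma index_mult_mat_sum:
  assumes "A \<in> carrier_mat n m" "B \<in> carrier_mat m p" "i < n" "j < p"
  shows "(A * B) $$ (i, j) = (\<Sum>k<m. A $$ (i, k) * B $$ (k, j))"
  using assms by (auto simp: scalar_prod_def atLeast0LessThan intro!: sum.cong)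

lemma index_mult_mat_vec_sum:
  assumes "A \<in> carrier_mat n m" "v \<in> carrier_vec m" "i < n"
  shows "(A *\<^sub>v v) $ i = (\<Sum>k<m. A $$ (i, k) * v $ k)"
  using assms by (auto simp: scalar_prod_def atLeast0LessThan intro!: sum.cong)

lemma sum_one_mat_row:
  fixes f :: "nat \<Rightarrow> 'a::semiring_1"
  assumes "i < n"
  shows "(\<Sum>j<n. 1\<^sub>m n $$ (i, j) * f j) = f i"
proof -
  have "(\<Sum>j<n. 1\<^sub>m n $$ (i, j) * f j) = (\<Sum>j<n. if i = j then f j else 0)"
    using assms by (intro sum.cong) auto
  then show ?thesis using assms by simp
qed

lemma mat_trace_comm:
  fixes A B :: "'a::comm_ring_1 mat"
  assumes A: "A \<in> carrier_mat n m" and B: "B \<in> carrier_mat m n"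
  shows "mat_trace (A * B) = mat_trace (B * A)"
proof -
  have "mat_trace (A * B) = (\<Sum>i<n. \<Sum>k<m. A $$ (i, k) * B $$ (k, i))"
    unfolding mat_trace_def using A B
    by (auto simp: index_mult_mat_sum[OF A B] simp del: index_mult_mat(1) intro!: sum.cong)
  also have "\<dots> = (\<Sum>k<m. \<Sum>i<n. B $$ (k, i) * A $$ (i, k))"
    by (subst sum.swap) (simp add: mult.commute)
  also have "\<dots> = mat_trace (B * A)"
    unfolding mat_trace_def using A B
    by (auto simp: index_mult_mat_sum[OF B A] simp del: index_mult_mat(1) intro!: sum.cong)
  finally show ?thesis .
qed

lemma mat_trace_add:
  assumes "A \<in> carrier_mat n n" "B \<in> carrier_mat n n"
  shows "mat_trace (A + B) = mat_trace A + mat_trace B"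
  using assms by (auto simp: mat_trace_def sum.distrib)

lemma mat_trace_one: "mat_trace (1\<^sub>m n :: complex mat) = of_nat n"
  by (simp add: mat_trace_def)

lemma mat_eq_zeroI_cols:
  fixes A :: "complex mat"
  assumes A: "A \<in> carrier_mat n m" and z: "\<And>v. v \<in> carrier_vec m \<Longrightarrow> A *\<^sub>v v = 0\<^sub>v n"
  shows "A = 0\<^sub>m n m"
proof (rule eq_matI)
  fix i j assume ij: "i < dim_row (0\<^sub>m n m :: complex mat)" "j < dim_col (0\<^sub>m n m :: complex mat)"
  have "(A *\<^sub>v unit_vec m j) $ i = 0" using z[of "unit_vec m j"] ij by simp
  then show "A $$ (i, j) = 0\<^sub>m n m $$ (i, j)" using A ij
    by simp
qed (use A in auto)

text \<open>
  Padding both matrices with zeros to square matrices of size \<open>d > n\<close> keeps the product \<open>1\<close>, but makes a row vanish.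
\<close>

lemma left_inverse_dim_le:
  fixes P Q :: "complex mat"
  assumes P: "P \<in> carrier_mat n d" and Q: "Q \<in> carrier_mat d n" and QP: "Q * P = 1\<^sub>m d"
  shows "d \<le> n"
proof (rule ccontr)
  assume "\<not> d \<le> n"
  then have nd: "n < d" by simp
  define P' where "P' = mat d d (\<lambda>(i, j). if i < n then P $$ (i, j) else 0)"
  define Q' where "Q' = mat d d (\<lambda>(i, j). if j < n then Q $$ (i, j) else 0)"
  have "Q' * P' = 1\<^sub>m d"
  proof (rule eq_matI)
    fix i j assume "i < dim_row (1\<^sub>m d :: complex mat)" "j < dim_col (1\<^sub>m d :: complex mat)"
    then have ij: "i < d" "j < d" by auto
    have "(Q' * P') $$ (i, j) = (\<Sum>k<d. Q' $$ (i, k) * P' $$ (k, j))"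
      using ij by (intro index_mult_mat_sum) (auto simp: Q'_def P'_def)
    also have "\<dots> = (\<Sum>k<n. Q $$ (i, k) * P $$ (k, j))"
      using nd ij by (intro sum.mono_neutral_cong_right) (auto simp: Q'_def P'_def)
    also have "\<dots> = (Q * P) $$ (i, j)" using ij P Q by (simp add: index_mult_mat_sum del: index_mult_mat(1))
    finally show "(Q' * P') $$ (i, j) = 1\<^sub>m d $$ (i, j)" using QP by simp
  qed (auto simp: Q'_def P'_def)
  then have "det Q' * det P' = 1"
    using det_mult[of Q' d P'] by (simp add: Q'_def P'_def)
  moreover have "det P' = 0"
  proof -
    \<comment> \<open>Row \<open>n\<close> of \<open>P'\<close> lies below \<open>P\<close>.\<close>
    have eq: "P' = mat\<^sub>r d d (\<lambda>i. if i = n then 0\<^sub>v d else row P' i)"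
      using nd by (intro eq_matI) (auto simp: P'_def)
    have "det (mat\<^sub>r d d (\<lambda>i. if i = n then 0\<^sub>v d else row P' i)) = 0"
      by (rule det_row_0[OF nd]) (auto simp: P'_def)
    then show ?thesis by (metis eq)
  qed
  ultimately show False by simp
qed

definition subspace_vec :: "nat \<Rightarrow> complex vec set \<Rightarrow> bool" where
  "subspace_vec n U \<longleftrightarrow> U \<subseteq> carrier_vec n \<and> 0\<^sub>v n \<in> U \<and>
     (\<forall>u\<in>U. \<forall>w\<in>U. u + w \<in> U) \<and> (\<forall>c. \<forall>u\<in>U. c \<cdot>\<^sub>v u \<in> U)"

lemma subspace_image:
  assumes U: "subspace_vec n U" and P: "P \<in> carrier_mat n d"
    and c: "\<And>j. j < d \<Longrightarrow> col P j \<in> U" and v: "v \<in> carrier_vec d"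
  shows "P *\<^sub>v v \<in> U"
proof -
  have "k \<le> d \<Longrightarrow> vec n (\<lambda>i. \<Sum>j<k. P $$ (i, j) * v $ j) \<in> U" for k
  proof (induction k)
    case 0
    have "vec n (\<lambda>i. 0) = (0\<^sub>v n :: complex vec)" by auto
    then show ?case using U by (simp add: subspace_vec_def)
  next
    case (Suc k)
    have "vec n (\<lambda>i. \<Sum>j<Suc k. P $$ (i, j) * v $ j) =
        vec n (\<lambda>i. \<Sum>j<k. P $$ (i, j) * v $ j) + v $ k \<cdot>\<^sub>v col P k"
      using Suc.prems P by (intro eq_vecI) (auto simp: mult.commute)
    also have "\<dots> \<in> U" using Suc U c by (auto simp: subspace_vec_def)
    finally show ?case .
  qed
  from this[of d] have "vec n (\<lambda>i. \<Sum>j<d. P $$ (i, j) * v $ j) \<in> U" by simp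
  also have "vec n (\<lambda>i. \<Sum>j<d. P $$ (i, j) * v $ j) = P *\<^sub>v v"
    using P v by (intro eq_vecI) (auto simp: scalar_prod_def atLeast0LessThan intro!: sum.cong)
  finally show ?thesis .
qed

text \<open>
  The columns of \<open>P\<close> are a basis of \<open>U\<close>, and \<open>P Q\<close> is a projection onto \<open>U\<close>. A left inverse \<open>Q\<close> is carried along
  instead of linear independence, because \<open>left_inverse_dim_le\<close> then bounds the number of columns and a pair
  \<open>(P, Q)\<close> with the most columns works: a vector of \<open>U\<close> not fixed by \<open>P Q\<close> would give one more column.
\<close>

lemma subspace_basis:
  assumes U: "subspace_vec n U"
  obtains d P Q where "P \<in> carrier_mat n d" "Q \<in> carrier_mat d n" "Q * P = 1\<^sub>m d"
    "\<And>v. v \<in> carrier_vec d \<Longrightarrow> P *\<^sub>v v \<in> U" "\<And>u. u \<in> U \<Longrightarrow> P *\<^sub>v (Q *\<^sub>v u) = u"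
proof -
  define good where "good d \<longleftrightarrow> (\<exists>P Q. P \<in> carrier_mat n d \<and> Q \<in> carrier_mat d n \<and> Q * P = 1\<^sub>m d \<and>
    (\<forall>j<d. col P j \<in> U))" for d
  have "good 0" unfolding good_def
    by (rule exI[of _ "0\<^sub>m n 0"], rule exI[of _ "0\<^sub>m 0 n"]) auto
  moreover have "d \<le> n" if "good d" for d using that left_inverse_dim_le unfolding good_def by blast
  ultimately obtain d where d: "good d" and max: "\<And>d'. good d' \<Longrightarrow> d' \<le> d"
    using Nat.ex_has_greatest_nat[of good 0 n] by (metis le_trans)
  obtain P Q where P: "P \<in> carrier_mat n d" and Q: "Q \<in> carrier_mat d n" and QP: "Q * P = 1\<^sub>m d"
    and cols: "\<And>j. j < d \<Longrightarrow> col P j \<in> U" using d unfolding good_def by blast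
  have im: "P *\<^sub>v v \<in> U" if "v \<in> carrier_vec d" for v using subspace_image[OF U P cols that] .
  have PQu: "P *\<^sub>v (Q *\<^sub>v u) = u" if u: "u \<in> U" for u
  proof (rule ccontr)
    assume ne: "P *\<^sub>v (Q *\<^sub>v u) \<noteq> u"
    have un: "u \<in> carrier_vec n" using u U by (auto simp: subspace_vec_def)
    define w where "w = u + (-1) \<cdot>\<^sub>v (P *\<^sub>v (Q *\<^sub>v u))"
    have wn: "w \<in> carrier_vec n" using un P Q by (auto simp: w_def)
    have wU: "w \<in> U" unfolding w_def using u im[of "Q *\<^sub>v u"] U Q un
      by (auto simp: subspace_vec_def)
    have Qw: "Q *\<^sub>v w = 0\<^sub>v d"
    proof -
      have "Q *\<^sub>v w = Q *\<^sub>v u + (-1) \<cdot>\<^sub>v (Q *\<^sub>v (P *\<^sub>v (Q *\<^sub>v u)))"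
        unfolding w_def using P Q un
        by (subst mult_add_distrib_mat_vec[of _ d n]) (auto simp: mult_mat_vec)
      also have "Q *\<^sub>v (P *\<^sub>v (Q *\<^sub>v u)) = (Q * P) *\<^sub>v (Q *\<^sub>v u)"
        using P Q un by (subst assoc_mult_mat_vec[of Q d n P d]) auto
      also have "\<dots> = Q *\<^sub>v u" unfolding QP using Q un by simp
      finally show ?thesis using Q un by auto
    qed
    obtain i where i: "i < n" "w $ i \<noteq> 0"
    proof -
      have "\<exists>i<n. w $ i \<noteq> 0"
      proof (rule ccontr)
        assume "\<not> ?thesis"
        then have "u $ i = (P *\<^sub>v (Q *\<^sub>v u)) $ i" if "i < n" for i using that P Q un by (auto simp: w_def)
        then have "u = P *\<^sub>v (Q *\<^sub>v u)" using P Q un by (intro eq_vecI) auto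
        then show False using ne by simp
      qed
      then show ?thesis using that by blast
    qed
    \<comment> \<open>The new row has to vanish on the old columns and be 1 on \<open>w\<close>. The matrix \<open>1 - P Q\<close> annihilates \<open>P\<close> and
      fixes \<open>w\<close>, so its row at a nonzero coordinate of \<open>w\<close> does, once divided by that coordinate.\<close>
    define r where "r j = (1\<^sub>m n $$ (i, j) - (P * Q) $$ (i, j)) / w $ i" for j
    define P' where "P' = mat n (Suc d) (\<lambda>(a, j). if j < d then P $$ (a, j) else w $ a)"
    define Q' where "Q' = mat (Suc d) n (\<lambda>(a, j). if a < d then Q $$ (a, j) else r j)"
    have rP: "(\<Sum>j<n. r j * P $$ (j, b)) = 0" if b: "b < d" for b
    proof -
      have "(\<Sum>j<n. (P * Q) $$ (i, j) * P $$ (j, b)) = (P * Q * P) $$ (i, b)"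
        using b i P Q by (subst index_mult_mat_sum[of _ n n _ d]) auto
      also have "P * Q * P = P" using P Q QP by (simp add: assoc_mult_mat[of P n d Q n P d])
      finally have "(\<Sum>j<n. (P * Q) $$ (i, j) * P $$ (j, b)) = P $$ (i, b)" .
      moreover have "(\<Sum>j<n. 1\<^sub>m n $$ (i, j) * P $$ (j, b)) = P $$ (i, b)"
        using i(1) by (rule sum_one_mat_row)
      ultimately have "(\<Sum>j<n. (1\<^sub>m n $$ (i, j) - (P * Q) $$ (i, j)) * P $$ (j, b)) = 0"
        unfolding left_diff_distrib sum_subtractf by (simp only:) simp
      then show ?thesis unfolding r_def times_divide_eq_left sum_divide_distrib[symmetric] by (simp only:) simp
    qed
    have rw: "(\<Sum>j<n. r j * w $ j) = 1"
    proof -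
      have "(\<Sum>j<n. (P * Q) $$ (i, j) * w $ j) = ((P * Q) *\<^sub>v w) $ i"
        using i wn P Q by (intro index_mult_mat_vec_sum[symmetric]) auto
      also have "(P * Q) *\<^sub>v w = 0\<^sub>v n" using P Q wn Qw by (subst assoc_mult_mat_vec[of P n d Q n]) auto
      finally have "(\<Sum>j<n. (P * Q) $$ (i, j) * w $ j) = 0" using i by simp
      moreover have "(\<Sum>j<n. 1\<^sub>m n $$ (i, j) * w $ j) = w $ i"
        using i(1) by (rule sum_one_mat_row)
      ultimately have "(\<Sum>j<n. (1\<^sub>m n $$ (i, j) - (P * Q) $$ (i, j)) * w $ j) = w $ i"
        unfolding left_diff_distrib sum_subtractf by (simp only:) simp
      then show ?thesis unfolding r_def times_divide_eq_left sum_divide_distrib[symmetric] using i by (simp only:) simp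
    qed
    have "Q' * P' = 1\<^sub>m (Suc d)"
    proof (rule eq_matI)
      fix a b assume "a < dim_row (1\<^sub>m (Suc d) :: complex mat)" "b < dim_col (1\<^sub>m (Suc d) :: complex mat)"
      then have ab: "a < Suc d" "b < Suc d" by auto
      have e: "(Q' * P') $$ (a, b) = (\<Sum>j<n. (if a < d then Q $$ (a, j) else r j) * (if b < d then P $$ (j, b) else w $ j))"
        using ab by (subst index_mult_mat_sum[of _ "Suc d" n _ "Suc d"]) (auto simp: Q'_def P'_def)
      show "(Q' * P') $$ (a, b) = 1\<^sub>m (Suc d) $$ (a, b)"
      proof (cases "a < d")
        case True
        show ?thesis
        proof (cases "b < d")
          case b: True
          have "(Q' * P') $$ (a, b) = (Q * P) $$ (a, b)"
            unfolding e using True b P Q by (subst index_mult_mat_sum[of Q d n P d]) auto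
          then show ?thesis using QP True b by simp
        next
          case False
          then have "(Q' * P') $$ (a, b) = (Q *\<^sub>v w) $ a"
            unfolding e using True Q wn by (auto simp: scalar_prod_def atLeast0LessThan intro!: sum.cong)
          then show ?thesis using Qw True False ab by simp
        qed
      next
        case False
        then show ?thesis unfolding e using rP[of b] rw ab by auto
      qed
    qed (auto simp: Q'_def P'_def)
    moreover have "col P' j \<in> U" if "j < Suc d" for j
    proof (cases "j < d")
      case True
      then have "col P' j = col P j" using P by (intro eq_vecI) (auto simp: P'_def)
      then show ?thesis using cols True by simp
    next
      case False
      then have "col P' j = w" using P that wn by (intro eq_vecI) (auto simp: P'_def)
      then show ?thesis using wU by simp
    qed
    ultimately have "good (Suc d)" unfolding good_def
      by (intro exI[of _ P'] exI[of _ Q']) (auto simp: P'_def Q'_def)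
    then show False using max by fastforce
  qed
  show ?thesis using that[OF P Q QP im PQu] by blast
qed

section \<open>Schur orthogonality\<close>

locale finite_group = group G for G :: "('a, 'm) monoid_scheme" (structure) +
  assumes finite_carrier: "finite (carrier G)"

lemma mult_mat_zero_vec: "A \<in> carrier_mat n m \<Longrightarrow> A *\<^sub>v 0\<^sub>v m = (0\<^sub>v n :: 'a::semiring_0 vec)"
  by (intro eq_vecI) auto

lemma matrix_rep_carrier:
  "matrix_rep G n \<rho> \<Longrightarrow> g \<in> carrier G \<Longrightarrow> \<rho> g \<in> carrier_mat n n"
  by (simp add: matrix_rep_def hom_def ring_mat_def Pi_iff)

lemma matrix_rep_mult:
  "matrix_rep G n \<rho> \<Longrightarrow> g \<in> carrier G \<Longrightarrow> h \<in> carrier G \<Longrightarrow> \<rho> (g \<otimes>\<^bsub>G\<^esub> h) = \<rho> g * \<rho> h"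
  by (simp add: matrix_rep_def hom_def ring_mat_def Pi_iff)

lemma matrix_rep_one: "matrix_rep G n \<rho> \<Longrightarrow> \<rho> \<one>\<^bsub>G\<^esub> = 1\<^sub>m n"
  by (auto simp: matrix_rep_def)

lemma matrix_repI:
  assumes "\<And>g. g \<in> carrier G \<Longrightarrow> \<rho> g \<in> carrier_mat n n"
    and "\<And>g h. g \<in> carrier G \<Longrightarrow> h \<in> carrier G \<Longrightarrow> \<rho> (g \<otimes>\<^bsub>G\<^esub> h) = \<rho> g * \<rho> h"
    and "\<rho> \<one>\<^bsub>G\<^esub> = 1\<^sub>m n"
  shows "matrix_rep G n \<rho>"
  unfolding matrix_rep_def
proof (intro conjI homI)
  show "\<rho> g \<in> carrier (ring_mat TYPE(complex) n ())" if "g \<in> carrier G" for g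
    using assms(1)[OF that] by (simp only: ring_mat_simps)
  show "\<rho> (g \<otimes>\<^bsub>G\<^esub> h) = \<rho> g \<otimes>\<^bsub>ring_mat TYPE(complex) n ()\<^esub> \<rho> h"
    if "g \<in> carrier G" "h \<in> carrier G" for g h
    using assms(2)[OF that] by (simp only: ring_mat_simps)
qed (rule assms(3))

lemma matrix_rep_mult_entry:
  assumes "matrix_rep G n \<rho>" "g \<in> carrier G" "h \<in> carrier G" "i < n" "j < n"
  shows "\<rho> (g \<otimes>\<^bsub>G\<^esub> h) $$ (i, j) = (\<Sum>k<n. \<rho> g $$ (i, k) * \<rho> h $$ (k, j))"
  unfolding matrix_rep_mult[OF assms(1-3)]
  using index_mult_mat_sum[OF matrix_rep_carrier[OF assms(1,2)] matrix_rep_carrier[OF assms(1,3)] assms(4,5)] .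

definition rep_char :: "('a, 'm) monoid_scheme \<Rightarrow> ('a \<Rightarrow> complex mat) \<Rightarrow> 'a \<Rightarrow> complex" where
  "rep_char G \<rho> = (\<lambda>g\<in>carrier G. mat_trace (\<rho> g))"

lemma Irr_eq: "Irr G = {rep_char G \<rho> | n \<rho>. irreducible_rep G n \<rho>}"
proof -
  have "(\<lambda>g\<in>carrier G. \<Sum>i<n. \<rho> g $$ (i, i)) = rep_char G \<rho>" if "irreducible_rep G n \<rho>" for n \<rho>
    using that matrix_rep_carrier[of G n \<rho>]
    by (auto simp: rep_char_def mat_trace_def irreducible_rep_def fun_eq_iff)
  then have "x = (\<lambda>g\<in>carrier G. \<Sum>i<n. \<rho> g $$ (i, i)) \<and> irreducible_rep G n \<rho> \<longleftrightarrow>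
      x = rep_char G \<rho> \<and> irreducible_rep G n \<rho>" for x n \<rho> by auto
  then show ?thesis unfolding Irr_def by simp
qed

lemma rep_char_apply: "g \<in> carrier G \<Longrightarrow> rep_char G \<rho> g = mat_trace (\<rho> g)"
  by (simp add: rep_char_def)

lemma mat_trace_eq: "A \<in> carrier_mat n n \<Longrightarrow> mat_trace A = (\<Sum>i<n. A $$ (i, i))"
  by (auto simp: mat_trace_def)

lemma char_degree_rep_char:
  assumes "group G" "matrix_rep G n \<rho>"
  shows "char_degree G (rep_char G \<rho>) = n"
proof -
  have "rep_char G \<rho> \<one>\<^bsub>G\<^esub> = of_nat n"
    using assms by (simp add: rep_char_apply group.is_monoid matrix_rep_one mat_trace_one)
  then show ?thesis unfolding char_degree_def by auto
qed

lemma mat_eqI_vec: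
  fixes A B :: "complex mat"
  assumes "A \<in> carrier_mat n m" "B \<in> carrier_mat n m"
    and "\<And>v. v \<in> carrier_vec m \<Longrightarrow> A *\<^sub>v v = B *\<^sub>v v"
  shows "A = B"
proof (rule eq_matI)
  fix i j assume "i < dim_row B" "j < dim_col B"
  then show "A $$ (i, j) = B $$ (i, j)"
    using assms(1,2) arg_cong[OF assms(3)[of "unit_vec m j"], of "\<lambda>v. vec_index v i"] by simp
qed (use assms in auto)

text \<open>
  Schur's lemma: image and kernel of an intertwiner are invariant, hence the image is everything and the
  kernel is zero.
\<close>

lemma intertwiner_invertible:
  assumes r: "irreducible_rep G n \<rho>" and s: "irreducible_rep G m \<sigma>"
    and B: "B \<in> carrier_mat n m" and tw: "\<And>g. g \<in> carrier G \<Longrightarrow> \<rho> g * B = B * \<sigma> g"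
    and nz: "B \<noteq> 0\<^sub>m n m"
  obtains C where "C \<in> carrier_mat m n" "B * C = 1\<^sub>m n" "C * B = 1\<^sub>m m"
proof -
  have mr: "matrix_rep G n \<rho>" and ms: "matrix_rep G m \<sigma>"
    using r s by (auto simp: irreducible_rep_def)
  obtain v0 where v0: "v0 \<in> carrier_vec m" "B *\<^sub>v v0 \<noteq> 0\<^sub>v n"
    using mat_eq_zeroI_cols[OF B] nz by blast
  have twv: "\<rho> g *\<^sub>v (B *\<^sub>v v) = B *\<^sub>v (\<sigma> g *\<^sub>v v)" if "g \<in> carrier G" "v \<in> carrier_vec m" for g v
    using that B matrix_rep_carrier[OF mr] matrix_rep_carrier[OF ms] tw[of g]
    by (metis assoc_mult_mat_vec)
  define U where "U = (\<lambda>v. B *\<^sub>v v) ` carrier_vec m"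
  have "invariant_subspace G n \<rho> U" unfolding invariant_subspace_def
  proof (intro conjI ballI allI)
    show "U \<subseteq> carrier_vec n" using B by (auto simp: U_def)
    show "0\<^sub>v n \<in> U" unfolding U_def using B by (intro image_eqI[of _ _ "0\<^sub>v m"]) auto
    fix u assume "u \<in> U"
    then obtain v where v: "u = B *\<^sub>v v" "v \<in> carrier_vec m" by (auto simp: U_def)
    show "c \<cdot>\<^sub>v u \<in> U" for c
      unfolding U_def v(1) using v B by (intro image_eqI[of _ _ "c \<cdot>\<^sub>v v"]) (auto simp: mult_mat_vec)
    show "\<rho> g *\<^sub>v u \<in> U" if "g \<in> carrier G" for g
      unfolding U_def v(1) using v that twv matrix_rep_carrier[OF ms that] by auto
    fix w assume "w \<in> U"
    then obtain v' where v': "w = B *\<^sub>v v'" "v' \<in> carrier_vec m" by (auto simp: U_def)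
    show "u + w \<in> U" unfolding U_def v(1) v'(1) using v v' B
      by (intro image_eqI[of _ _ "v + v'"]) (auto simp: mult_add_distrib_mat_vec)
  qed
  then have "U = {0\<^sub>v n} \<or> U = carrier_vec n" using r by (auto simp: irreducible_rep_def)
  then have U: "U = carrier_vec n" using v0 by (auto simp: U_def)
  define V where "V = {v \<in> carrier_vec m. B *\<^sub>v v = 0\<^sub>v n}"
  have "invariant_subspace G m \<sigma> V" unfolding invariant_subspace_def
  proof (intro conjI ballI allI)
    show "V \<subseteq> carrier_vec m" "0\<^sub>v m \<in> V" using B by (auto simp: V_def)
    fix u assume u: "u \<in> V"
    show "c \<cdot>\<^sub>v u \<in> V" for c using u B by (auto simp: V_def mult_mat_vec)
    show "\<sigma> g *\<^sub>v u \<in> V" if g: "g \<in> carrier G" for g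
      using u matrix_rep_carrier[OF ms g] matrix_rep_carrier[OF mr g] twv[OF g, of u]
      by (auto simp: V_def mult_mat_zero_vec)
    fix w assume "w \<in> V"
    then show "u + w \<in> V" using u B by (auto simp: V_def mult_add_distrib_mat_vec)
  qed
  then have "V = {0\<^sub>v m} \<or> V = carrier_vec m" using s by (auto simp: irreducible_rep_def)
  then have V: "V = {0\<^sub>v m}" using v0 by (auto simp: V_def)
  have "\<exists>v. v \<in> carrier_vec m \<and> B *\<^sub>v v = unit_vec n i" for i
  proof -
    have "unit_vec n i \<in> U" unfolding U by simp
    then show ?thesis by (auto simp: U_def)
  qed
  then obtain c where c: "\<And>i. c i \<in> carrier_vec m" "\<And>i. B *\<^sub>v c i = unit_vec n i" by metis
  \<comment> \<open>The columns of \<open>C\<close> are preimages of the unit vectors, so \<open>C\<close> is a right inverse. By injectivity of \<open>B\<close> it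
    is also a left inverse.\<close>
  define C where "C = mat m n (\<lambda>(k, i). c i $ k)"
  have C: "C \<in> carrier_mat m n" by (simp add: C_def)
  have BC: "B * C = 1\<^sub>m n"
  proof (rule eq_matI)
    fix a i assume "a < dim_row (1\<^sub>m n :: complex mat)" "i < dim_col (1\<^sub>m n :: complex mat)"
    then have ai: "a < n" "i < n" by auto
    have "(B * C) $$ (a, i) = (\<Sum>k<m. B $$ (a, k) * C $$ (k, i))"
      using index_mult_mat_sum[OF B C ai] .
    also have "\<dots> = (\<Sum>k<m. B $$ (a, k) * c i $ k)" using ai by (auto simp: C_def)
    also have "\<dots> = (B *\<^sub>v c i) $ a" using index_mult_mat_vec_sum[OF B c(1) ai(1)] by simp
    finally show "(B * C) $$ (a, i) = 1\<^sub>m n $$ (a, i)" using c(2)[of i] ai by simp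
  qed (use B C in auto)
  have "C * B = 1\<^sub>m m"
  proof (rule mat_eqI_vec[of _ m m])
    fix v :: "complex vec" assume v: "v \<in> carrier_vec m"
    define w where "w = (C * B) *\<^sub>v v + (-1) \<cdot>\<^sub>v v"
    have "B *\<^sub>v w = (B * C) *\<^sub>v (B *\<^sub>v v) + (-1) \<cdot>\<^sub>v (B *\<^sub>v v)"
      unfolding w_def using B C v
      by (simp add: mult_add_distrib_mat_vec[of B n m] mult_mat_vec[of B n m] assoc_mult_mat_vec)
    also have "\<dots> = 0\<^sub>v n" unfolding BC using B v by (intro eq_vecI) auto
    finally have "w \<in> V" using v B C by (auto simp: V_def w_def)
    then have w0: "w = 0\<^sub>v m" using V by simp
    show "(C * B) *\<^sub>v v = 1\<^sub>m m *\<^sub>v v"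
    proof (rule eq_vecI)
      fix i assume "i < dim_vec (1\<^sub>m m *\<^sub>v v)"
      then have i: "i < m" by simp
      have "((C * B) *\<^sub>v v) $ i + - (v $ i) = w $ i" unfolding w_def using i v B C
        by (simp del: index_mult_mat_vec assoc_mult_mat_vec)
      then show "((C * B) *\<^sub>v v) $ i = (1\<^sub>m m *\<^sub>v v) $ i" using w0 i v
        by (simp del: index_mult_mat_vec assoc_mult_mat_vec)
    qed (use C v in auto)
  qed (use B C in auto)
  then show ?thesis using that C BC by blast
qed

lemma intertwiner_rep_char_eq:
  assumes G: "group G" and r: "irreducible_rep G n \<rho>" and s: "irreducible_rep G m \<sigma>"
    and B: "B \<in> carrier_mat n m" and tw: "\<And>g. g \<in> carrier G \<Longrightarrow> \<rho> g * B = B * \<sigma> g"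
    and nz: "B \<noteq> 0\<^sub>m n m"
  shows "rep_char G \<rho> = rep_char G \<sigma>"
proof -
  obtain C where C: "C \<in> carrier_mat m n" and BC: "B * C = 1\<^sub>m n" and CB: "C * B = 1\<^sub>m m"
    using intertwiner_invertible[OF r s B tw nz] by blast
  have "mat_trace (\<rho> g) = mat_trace (\<sigma> g)" if g: "g \<in> carrier G" for g
  proof -
    have rg: "\<rho> g \<in> carrier_mat n n" and sg: "\<sigma> g \<in> carrier_mat m m"
      using r s g matrix_rep_carrier by (auto simp: irreducible_rep_def)
    have "\<rho> g = \<rho> g * (B * C)" using rg BC by simp
    also have "\<dots> = B * \<sigma> g * C" using rg B C tw[OF g] by (metis assoc_mult_mat)
    also have "mat_trace (B * \<sigma> g * C) = mat_trace (C * (B * \<sigma> g))"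
      using B sg C by (intro mat_trace_comm) auto
    also have "C * (B * \<sigma> g) = \<sigma> g" 
      by (simp only: assoc_mult_mat[OF C B sg, symmetric] CB left_mult_one_mat[OF sg])
    finally show ?thesis .
  qed
  then show ?thesis by (auto simp: rep_char_def)
qed

text \<open>
  Over the complex numbers the matrix has an eigenspace, which is invariant because the matrix commutes with \<open>\<rho>\<close>.
\<close>

lemma commuting_mat_scalar:
  assumes r: "irreducible_rep G n \<rho>"
    and B: "B \<in> carrier_mat n n" and tw: "\<And>g. g \<in> carrier G \<Longrightarrow> \<rho> g * B = B * \<rho> g"
  obtains c where "B = c \<cdot>\<^sub>m 1\<^sub>m n"
proof -
  have mr: "matrix_rep G n \<rho>" and n: "n > 0" using r by (auto simp: irreducible_rep_def)
  have "\<not> constant (poly (char_poly B))"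
    using degree_monic_char_poly[OF B] n by (simp add: constant_degree)
  then obtain c where "poly (char_poly B) c = 0" using fundamental_theorem_of_algebra by blast
  then obtain v0 where v0: "v0 \<in> carrier_vec n" "v0 \<noteq> 0\<^sub>v n" "B *\<^sub>v v0 = c \<cdot>\<^sub>v v0"
    using eigenvalue_root_char_poly[OF B] B by (auto simp: eigenvalue_def eigenvector_def)
  define V where "V = {v \<in> carrier_vec n. B *\<^sub>v v = c \<cdot>\<^sub>v v}"
  have "invariant_subspace G n \<rho> V" unfolding invariant_subspace_def
  proof (intro conjI ballI allI)
    show "V \<subseteq> carrier_vec n" "0\<^sub>v n \<in> V" using B by (auto simp: V_def)
    fix u assume u: "u \<in> V"
    show "a \<cdot>\<^sub>v u \<in> V" for a
      using u B by (auto simp: V_def mult_mat_vec smult_smult_assoc mult.commute)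
    show "\<rho> g *\<^sub>v u \<in> V" if g: "g \<in> carrier G" for g
    proof -
      have rg: "\<rho> g \<in> carrier_mat n n" using matrix_rep_carrier[OF mr g] .
      have "B *\<^sub>v (\<rho> g *\<^sub>v u) = \<rho> g *\<^sub>v (B *\<^sub>v u)"
        using u rg B tw[OF g] by (metis (no_types, lifting) V_def assoc_mult_mat_vec mem_Collect_eq)
      also have "\<dots> = c \<cdot>\<^sub>v (\<rho> g *\<^sub>v u)" using u rg by (auto simp: V_def mult_mat_vec)
      finally show ?thesis using u rg by (auto simp: V_def)
    qed
    fix w assume "w \<in> V"
    then show "u + w \<in> V" using u B
      by (auto simp: V_def mult_add_distrib_mat_vec smult_add_distrib_vec)
  qed
  then have "V = {0\<^sub>v n} \<or> V = carrier_vec n" using r by (auto simp: irreducible_rep_def)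
  moreover have "v0 \<in> V" using v0 by (simp add: V_def)
  ultimately have V: "V = carrier_vec n" using v0(2) by auto
  have "B = c \<cdot>\<^sub>m 1\<^sub>m n"
  proof (rule eq_matI)
    fix i j assume "i < dim_row (c \<cdot>\<^sub>m 1\<^sub>m n)" "j < dim_col (c \<cdot>\<^sub>m 1\<^sub>m n)"
    then have ij: "i < n" "j < n" by auto
    have "unit_vec n j \<in> V" unfolding V by simp
    then have "(B *\<^sub>v unit_vec n j) $ i = (c \<cdot>\<^sub>v unit_vec n j) $ i" by (simp add: V_def)
    then show "B $$ (i, j) = (c \<cdot>\<^sub>m 1\<^sub>m n) $$ (i, j)" using ij B by simp
  qed (use B in auto)
  then show ?thesis using that by blast
qed

text \<open>
  This is \<open>\<Sum>\<^sub>g \<rho>(g) E\<^sub>j\<^sub>k \<sigma>(g\<^sup>-\<^sup>1)\<close> for the matrix unit \<open>E\<^sub>j\<^sub>k\<close>.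
\<close>

definition averaged_unit ::
    "('a, 'm) monoid_scheme \<Rightarrow> nat \<Rightarrow> nat \<Rightarrow> ('a \<Rightarrow> complex mat) \<Rightarrow> ('a \<Rightarrow> complex mat) \<Rightarrow> nat \<Rightarrow> nat \<Rightarrow> complex mat" where
  "averaged_unit G n m \<rho> \<sigma> j k =
     mat n m (\<lambda>(i, l). \<Sum>g\<in>carrier G. \<rho> g $$ (i, j) * \<sigma> (inv\<^bsub>G\<^esub> g) $$ (k, l))"

context finite_group
begin

text \<open>
  Substituting \<open>h g\<close> for \<open>g\<close> in the sum moves \<open>\<rho>(h)\<close> from the left to \<open>\<sigma>(h)\<close> on the right.
\<close>

lemma averaged_unit_intertwines:
  assumes mr: "matrix_rep G n \<rho>" and ms: "matrix_rep G m \<sigma>" and j: "j < n" and k: "k < m"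
    and h: "h \<in> carrier G"
  shows "\<rho> h * averaged_unit G n m \<rho> \<sigma> j k = averaged_unit G n m \<rho> \<sigma> j k * \<sigma> h"
proof (rule eq_matI)
  let ?B = "averaged_unit G n m \<rho> \<sigma> j k"
  have B: "?B \<in> carrier_mat n m" by (simp add: averaged_unit_def)
  have rh: "\<rho> h \<in> carrier_mat n n" and sh: "\<sigma> h \<in> carrier_mat m m"
    using matrix_rep_carrier[OF mr h] matrix_rep_carrier[OF ms h] .
  fix i l assume "i < dim_row (?B * \<sigma> h)" "l < dim_col (?B * \<sigma> h)"
  then have il: "i < n" "l < m" using B sh by auto
  have "(\<rho> h * ?B) $$ (i, l) = (\<Sum>p<n. \<rho> h $$ (i, p) * ?B $$ (p, l))"
    using index_mult_mat_sum[OF rh B il] .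
  also have "\<dots> = (\<Sum>p<n. \<Sum>g\<in>carrier G. \<rho> h $$ (i, p) * \<rho> g $$ (p, j) * \<sigma> (inv g) $$ (k, l))"
    using il by (simp add: averaged_unit_def sum_distrib_left mult.assoc)
  also have "\<dots> = (\<Sum>g\<in>carrier G. \<Sum>p<n. \<rho> h $$ (i, p) * \<rho> g $$ (p, j) * \<sigma> (inv g) $$ (k, l))"
    by (rule sum.swap)
  also have "\<dots> = (\<Sum>g\<in>carrier G. \<rho> (h \<otimes> g) $$ (i, j) * \<sigma> (inv g) $$ (k, l))"
    using h il j by (intro sum.cong) (auto simp: matrix_rep_mult_entry[OF mr] sum_distrib_right)
  also have "\<dots> = (\<Sum>g\<in>carrier G. \<rho> g $$ (i, j) * \<sigma> (inv g \<otimes> h) $$ (k, l))"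
  proof (rule sum.reindex_bij_witness[of _ "\<lambda>g. inv h \<otimes> g" "\<lambda>g. h \<otimes> g"])
    fix g assume g: "g \<in> carrier G"
    show "inv h \<otimes> (h \<otimes> g) = g" "h \<otimes> (inv h \<otimes> g) = g"
      using g h by (simp_all add: m_assoc[symmetric])
    show "\<rho> (h \<otimes> g) $$ (i, j) * \<sigma> (inv (h \<otimes> g) \<otimes> h) $$ (k, l) =
        \<rho> (h \<otimes> g) $$ (i, j) * \<sigma> (inv g) $$ (k, l)"
      using g h by (simp add: inv_mult_group m_assoc)
  qed (use h in auto)
  also have "\<dots> = (\<Sum>g\<in>carrier G. \<Sum>q<m. \<rho> g $$ (i, j) * \<sigma> (inv g) $$ (k, q) * \<sigma> h $$ (q, l))"
    using h il k by (intro sum.cong) (auto simp: matrix_rep_mult_entry[OF ms] sum_distrib_left mult.assoc)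
  also have "\<dots> = (\<Sum>q<m. \<Sum>g\<in>carrier G. \<rho> g $$ (i, j) * \<sigma> (inv g) $$ (k, q) * \<sigma> h $$ (q, l))"
    by (rule sum.swap)
  also have "\<dots> = (\<Sum>q<m. ?B $$ (i, q) * \<sigma> h $$ (q, l))"
    using il by (simp add: averaged_unit_def sum_distrib_right)
  also have "\<dots> = (?B * \<sigma> h) $$ (i, l)" using index_mult_mat_sum[OF B sh il] by simp
  finally show "(\<rho> h * ?B) $$ (i, l) = (?B * \<sigma> h) $$ (i, l)" .
qed (use mr ms h matrix_rep_carrier[OF mr h] matrix_rep_carrier[OF ms h] in \<open>auto simp: averaged_unit_def\<close>)

lemma schur_orthogonality_distinct:
  assumes r: "irreducible_rep G n \<rho>" and s: "irreducible_rep G m \<sigma>"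
    and ne: "rep_char G \<rho> \<noteq> rep_char G \<sigma>" and "i < n" "j < n" "k < m" "l < m"
  shows "(\<Sum>g\<in>carrier G. \<rho> g $$ (i, j) * \<sigma> (inv g) $$ (k, l)) = 0"
proof -
  let ?B = "averaged_unit G n m \<rho> \<sigma> j k"
  have "?B = 0\<^sub>m n m"
  proof (rule ccontr)
    assume "?B \<noteq> 0\<^sub>m n m"
    moreover have "?B \<in> carrier_mat n m" by (simp add: averaged_unit_def)
    moreover have "\<rho> g * ?B = ?B * \<sigma> g" if "g \<in> carrier G" for g
      using averaged_unit_intertwines[OF _ _ \<open>j < n\<close> \<open>k < m\<close> that] r s by (simp add: irreducible_rep_def)
    ultimately show False using intertwiner_rep_char_eq[OF is_group r s] ne by blast
  qed
  then have "?B $$ (i, l) = 0" using assms by simp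
  then show ?thesis using assms by (simp add: averaged_unit_def)
qed

text \<open>By Schur's lemma the averaged matrix unit is a scalar matrix; its trace determines the scalar.\<close>

lemma schur_orthogonality_same:
  assumes r: "irreducible_rep G n \<rho>" and ij: "i < n" "j < n" "k < n" "l < n"
  shows "(\<Sum>g\<in>carrier G. \<rho> g $$ (i, j) * \<rho> (inv g) $$ (k, l)) =
    (if i = l \<and> j = k then of_nat (card (carrier G)) / of_nat n else 0)"
proof -
  have mr: "matrix_rep G n \<rho>" and n: "n > 0" using r by (auto simp: irreducible_rep_def)
  let ?B = "averaged_unit G n n \<rho> \<rho> j k"
  have B: "?B \<in> carrier_mat n n" by (simp add: averaged_unit_def)
  obtain c where c: "?B = c \<cdot>\<^sub>m 1\<^sub>m n"
    using commuting_mat_scalar[OF r B averaged_unit_intertwines[OF mr mr ij(2,3)]] by blast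
  have ent: "(\<Sum>g\<in>carrier G. \<rho> g $$ (a, j) * \<rho> (inv g) $$ (k, b)) = (if a = b then c else 0)"
    if "a < n" "b < n" for a b
  proof -
    have "?B $$ (a, b) = (c \<cdot>\<^sub>m 1\<^sub>m n) $$ (a, b)" unfolding c ..
    then show ?thesis using that by (simp add: averaged_unit_def)
  qed
  \<comment> \<open>The trace of the averaged matrix unit, computed in two ways.\<close>
  have "of_nat n * c = (\<Sum>a<n. \<Sum>g\<in>carrier G. \<rho> g $$ (a, j) * \<rho> (inv g) $$ (k, a))"
    using ent by simp
  also have "\<dots> = (\<Sum>g\<in>carrier G. \<Sum>a<n. \<rho> (inv g) $$ (k, a) * \<rho> g $$ (a, j))"
    by (subst sum.swap) (simp add: mult.commute)
  also have "\<dots> = (\<Sum>g\<in>carrier G. \<rho> (inv g \<otimes> g) $$ (k, j))"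
    using ij by (intro sum.cong refl, subst matrix_rep_mult_entry[OF mr]) auto
  also have "\<dots> = (\<Sum>g\<in>carrier G. 1\<^sub>m n $$ (k, j))"
    by (intro sum.cong refl) (simp add: matrix_rep_one[OF mr])
  also have "\<dots> = (if j = k then of_nat (card (carrier G)) else 0)"
    using ij by simp
  finally have "c = (if j = k then of_nat (card (carrier G)) / of_nat n else 0)"
    using n by (auto simp: field_simps)
  then show ?thesis using ent[OF ij(1,4)] by simp
qed

lemma Irr_orthogonal:
  assumes "\<chi> \<in> Irr G" "\<chi>' \<in> Irr G"
  shows "(\<Sum>g\<in>carrier G. \<chi> g * \<chi>' (inv g)) = (if \<chi> = \<chi>' then of_nat (card (carrier G)) else 0)"
proof -
  obtain n \<rho> m \<sigma> where r: "irreducible_rep G n \<rho>" and s: "irreducible_rep G m \<sigma>"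
    and chi: "\<chi> = rep_char G \<rho>" "\<chi>' = rep_char G \<sigma>" using assms unfolding Irr_eq by blast
  have e: "(\<Sum>g\<in>carrier G. rep_char G \<rho> g * rep_char G \<sigma>' (inv g)) =
     (\<Sum>i<n. \<Sum>k<m. \<Sum>g\<in>carrier G. \<rho> g $$ (i, i) * \<sigma>' (inv g) $$ (k, k))"
    if s': "irreducible_rep G m \<sigma>'" for \<sigma>' m
  proof -
    have "(\<Sum>g\<in>carrier G. rep_char G \<rho> g * rep_char G \<sigma>' (inv g)) =
      (\<Sum>g\<in>carrier G. \<Sum>i<n. \<Sum>k<m. \<rho> g $$ (i, i) * \<sigma>' (inv g) $$ (k, k))"
      using r s' matrix_rep_carrier[of G n \<rho>] matrix_rep_carrier[of G m \<sigma>']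
      by (intro sum.cong refl) (simp add: rep_char_apply mat_trace_eq[of _ n] mat_trace_eq[of _ m]
          irreducible_rep_def sum_product)
    also have "\<dots> = (\<Sum>i<n. \<Sum>g\<in>carrier G. \<Sum>k<m. \<rho> g $$ (i, i) * \<sigma>' (inv g) $$ (k, k))"
      by (rule sum.swap)
    also have "\<dots> = (\<Sum>i<n. \<Sum>k<m. \<Sum>g\<in>carrier G. \<rho> g $$ (i, i) * \<sigma>' (inv g) $$ (k, k))"
      by (intro sum.cong refl sum.swap)
    finally show ?thesis .
  qed
  show ?thesis
  proof (cases "\<chi> = \<chi>'")
    case True
    have "n > 0" using r by (simp add: irreducible_rep_def)
    have "(\<Sum>g\<in>carrier G. \<chi> g * \<chi>' (inv g)) = (\<Sum>i<n. \<Sum>k<n. if i = k then of_nat (card (carrier G)) / of_nat n else 0)"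
      unfolding True[symmetric] unfolding chi(1) e[OF r]
      by (intro sum.cong refl) (simp add: schur_orthogonality_same[OF r])
    also have "\<dots> = of_nat (card (carrier G))" using \<open>n > 0\<close> by simp
    finally show ?thesis using True by simp
  next
    case False
    then have "(\<Sum>g\<in>carrier G. \<chi> g * \<chi>' (inv g)) = 0"
      unfolding chi e[OF s] using schur_orthogonality_distinct[OF r s] by simp
    then show ?thesis using False by simp
  qed
qed

text \<open>
  Orthogonality makes the \<open>T \<times> G\<close> matrix of values of a finite set \<open>T\<close> of irreducible characters right invertible,
  so \<open>T\<close> has at most \<open>|G|\<close> elements.
\<close>

lemma finite_Irr: "finite (Irr G)"
proof (rule ccontr)
  assume "infinite (Irr G)"
  then obtain T where T: "T \<subseteq> Irr G" "finite T" "card T = Suc (card (carrier G))"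
    using infinite_arbitrarily_large by blast
  let ?d = "Suc (card (carrier G))" and ?n = "card (carrier G)"
  obtain ch where ch: "bij_betw ch {..<?d} T" using ex_bij_betw_nat_finite[OF T(2)] T(3)
    by (auto simp: atLeast0LessThan)
  obtain el where el: "bij_betw el {..<?n} (carrier G)"
    using ex_bij_betw_nat_finite[OF finite_carrier] by (auto simp: atLeast0LessThan)
  have n0: "?n > 0" using finite_carrier one_closed by (auto simp: card_gt_0_iff)
  define P where "P = mat ?n ?d (\<lambda>(i, j). ch j (inv (el i)) / of_nat ?n)"
  define Q where "Q = mat ?d ?n (\<lambda>(j, i). ch j (el i))"
  have "Q * P = 1\<^sub>m ?d"
  proof (rule eq_matI)
    fix i j assume "i < dim_row (1\<^sub>m ?d :: complex mat)" "j < dim_col (1\<^sub>m ?d :: complex mat)"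
    then have ij: "i < ?d" "j < ?d" by auto
    then have I: "ch i \<in> Irr G" "ch j \<in> Irr G" using ch T by (auto simp: bij_betw_def)
    have "(Q * P) $$ (i, j) = (\<Sum>k<?n. ch i (el k) * (ch j (inv (el k)) / of_nat ?n))"
      using ij by (subst index_mult_mat_sum[of _ ?d ?n _ ?d]) (auto simp: Q_def P_def)
    also have "\<dots> = (\<Sum>g\<in>carrier G. ch i g * (ch j (inv g) / of_nat ?n))"
      using sum.reindex_bij_betw[OF el, of "\<lambda>g. ch i g * (ch j (inv g) / of_nat ?n)"] .
    also have "\<dots> = (\<Sum>g\<in>carrier G. ch i g * ch j (inv g)) / of_nat ?n"
      by (simp add: sum_divide_distrib)
    also have "\<dots> = 1\<^sub>m ?d $$ (i, j)"
      using ij n0 ch I by (auto simp: Irr_orthogonal bij_betw_def inj_on_def)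
    finally show "(Q * P) $$ (i, j) = 1\<^sub>m ?d $$ (i, j)" .
  qed (auto simp: P_def Q_def)
  then have "?d \<le> ?n" by (intro left_inverse_dim_le[of P _ _ Q]) (auto simp: P_def Q_def)
  then show False by simp
qed

end

section \<open>Decomposition of characters\<close>

lemma mat_assoc:
  "dim_col A = dim_row B \<Longrightarrow> dim_col B = dim_row C \<Longrightarrow> (A * B) * C = A * (B * (C :: complex mat))"
  by (rule assoc_mult_mat) auto

lemma invariant_subspaceD:
  assumes "invariant_subspace G n \<rho> U"
  shows "subspace_vec n U" and "g \<in> carrier G \<Longrightarrow> u \<in> U \<Longrightarrow> \<rho> g *\<^sub>v u \<in> U"
  using assms by (auto simp: invariant_subspace_def subspace_vec_def)

text \<open>
  In a basis adapted to a proper invariant subspace the representation is block triangular, and its diagonal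
  blocks are the two representations. Here \<open>P Q\<close> is a projection onto the subspace, \<open>1 - P Q = P' R\<close> is the
  complementary one, and the blocks are \<open>Q \<rho> P\<close> and \<open>R \<rho> P'\<close>; invariance says \<open>R \<rho> P = 0\<close>.
\<close>

lemma reducible_rep_trace_split:
  assumes G: "group G" and r: "matrix_rep G n \<rho>" and n: "n > 0" and red: "\<not> irreducible_rep G n \<rho>"
  obtains d1 \<rho>1 d2 \<rho>2 where "matrix_rep G d1 \<rho>1" "matrix_rep G d2 \<rho>2" "d1 < n" "d2 < n"
    "\<And>g. g \<in> carrier G \<Longrightarrow> mat_trace (\<rho> g) = mat_trace (\<rho>1 g) + mat_trace (\<rho>2 g)"
proof -
  interpret group G by (rule G)
  obtain U where U: "invariant_subspace G n \<rho> U" "U \<noteq> {0\<^sub>v n}" "U \<noteq> carrier_vec n"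
    using red r n by (auto simp: irreducible_rep_def)
  note Us = invariant_subspaceD(1)[OF U(1)]
  obtain d P Q where P: "P \<in> carrier_mat n d" and Q: "Q \<in> carrier_mat d n" and QP: "Q * P = 1\<^sub>m d"
    and PU: "\<And>v. v \<in> carrier_vec d \<Longrightarrow> P *\<^sub>v v \<in> U" and PQ: "\<And>u. u \<in> U \<Longrightarrow> P *\<^sub>v (Q *\<^sub>v u) = u"
    by (rule subspace_basis[OF Us]) (rule that)
  have Un: "U \<subseteq> carrier_vec n" using Us by (simp add: subspace_vec_def)
  \<comment> \<open>The kernel of \<open>Q\<close> is a complement of \<open>U\<close>; the projection onto it along \<open>U\<close> is \<open>E\<close>.\<close>
  define W where "W = {w \<in> carrier_vec n. Q *\<^sub>v w = 0\<^sub>v d}"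
  have Ws: "subspace_vec n W" using Q
    by (auto simp: subspace_vec_def W_def mult_mat_zero_vec mult_add_distrib_mat_vec mult_mat_vec)
  obtain d' P' Q' where P': "P' \<in> carrier_mat n d'" and Q': "Q' \<in> carrier_mat d' n"
    and QP': "Q' * P' = 1\<^sub>m d'"
    and PW: "\<And>v. v \<in> carrier_vec d' \<Longrightarrow> P' *\<^sub>v v \<in> W" and PQ': "\<And>w. w \<in> W \<Longrightarrow> P' *\<^sub>v (Q' *\<^sub>v w) = w"
    by (rule subspace_basis[OF Ws]) (rule that)
  define E where "E = 1\<^sub>m n - P * Q"
  have E: "E \<in> carrier_mat n n" using P Q by (auto simp: E_def)
  have rg: "\<rho> g \<in> carrier_mat n n" if "g \<in> carrier G" for g using matrix_rep_carrier[OF r that] .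
  have PQr: "P * Q * (\<rho> g * P) = \<rho> g * P" if g: "g \<in> carrier G" for g
  proof (rule mat_eqI_vec[of _ n d])
    fix v :: "complex vec" assume v: "v \<in> carrier_vec d"
    have u: "\<rho> g *\<^sub>v (P *\<^sub>v v) \<in> U" using invariant_subspaceD(2)[OF U(1) g PU[OF v]] .
    then show "P * Q * (\<rho> g * P) *\<^sub>v v = \<rho> g * P *\<^sub>v v"
      using PQ[OF u] P Q rg[OF g] v Un by (simp add: assoc_mult_mat_vec[of _ n n _ d])
  qed (use P Q rg[OF g] in auto)
  have QP0: "Q * P' = 0\<^sub>m d d'"
  proof (rule mat_eq_zeroI_cols)
    fix v :: "complex vec" assume v: "v \<in> carrier_vec d'"
    show "Q * P' *\<^sub>v v = 0\<^sub>v d" using PW[OF v] P' Q v by (simp add: W_def)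
  qed (use P' Q in auto)
  have QE: "Q * E = 0\<^sub>m d n"
  proof -
    have "Q * E = Q * 1\<^sub>m n - Q * (P * Q)" unfolding E_def using P Q by (intro mult_minus_distrib_mat) auto
    also have "Q * (P * Q) = Q" using P Q QP by (simp flip: assoc_mult_mat[of Q d n P d Q n])
    finally show ?thesis using Q by simp
  qed
  have PQE: "P' * Q' * E = E"
  proof (rule mat_eqI_vec[of _ n n])
    fix v :: "complex vec" assume v: "v \<in> carrier_vec n"
    have "Q *\<^sub>v (E *\<^sub>v v) = 0\<^sub>m d n *\<^sub>v v" using Q E v QE by (metis assoc_mult_mat_vec)
    then have "E *\<^sub>v v \<in> W" using E v by (auto simp: W_def)
    then show "P' * Q' * E *\<^sub>v v = E *\<^sub>v v"
      using PQ' P' Q' E v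
      by (simp add: assoc_mult_mat_vec[of P' n d' "Q' * E" n v] assoc_mult_mat_vec[of Q' d' n E n v])
  qed (use P' Q' E in auto)
  define R where "R = Q' * E"
  have R: "R \<in> carrier_mat d' n" using Q' E by (simp add: R_def)
  have PR: "P' * R = E" unfolding R_def using PQE P' Q' E by simp
  have EP: "E * P = 0\<^sub>m n d"
  proof -
    have "E * P = 1\<^sub>m n * P - P * Q * P" unfolding E_def using P Q by (intro minus_mult_distrib_mat) auto
    also have "P * Q * P = P" using P Q QP by (simp add: assoc_mult_mat[of P n d Q n P d])
    finally show ?thesis using P by simp
  qed
  have EP': "E * P' = P'"
  proof -
    have "E * P' = 1\<^sub>m n * P' - P * Q * P'" unfolding E_def using P Q P' by (intro minus_mult_distrib_mat) auto
    also have "P * Q * P' = 0\<^sub>m n d'" using P Q P' QP0 by (simp add: assoc_mult_mat[of P n d Q n P' d'])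
    finally show ?thesis using P' by auto
  qed
  have RP: "R * P' = 1\<^sub>m d'" unfolding R_def using EP' QP' Q' E P' by simp
  have EPQ: "P * Q + E = 1\<^sub>m n" using P Q by (intro eq_matI) (auto simp: E_def)
  have RrP: "R * (\<rho> g * P) = 0\<^sub>m d' d" if g: "g \<in> carrier G" for g
  proof -
    have "E * (\<rho> g * P) = 1\<^sub>m n * (\<rho> g * P) - P * Q * (\<rho> g * P)"
      unfolding E_def using P Q rg[OF g] by (intro minus_mult_distrib_mat) auto
    also have "\<dots> = 0\<^sub>m n d" unfolding PQr[OF g] using P rg[OF g] by auto
    finally show ?thesis unfolding R_def using Q' E P rg[OF g]
      by (simp add: assoc_mult_mat[of Q' d' n E n "\<rho> g * P" d])
  qed
  define \<rho>1 where "\<rho>1 g = Q * (\<rho> g * P)" for g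
  define \<rho>2 where "\<rho>2 g = R * (\<rho> g * P')" for g
  have r1: "matrix_rep G d \<rho>1"
  proof (rule matrix_repI)
    show "\<rho>1 \<one>\<^bsub>G\<^esub> = 1\<^sub>m d" unfolding \<rho>1_def matrix_rep_one[OF r] using P QP by simp
    fix g assume g: "g \<in> carrier G"
    show "\<rho>1 g \<in> carrier_mat d d" using P Q rg[OF g] by (auto simp: \<rho>1_def)
    fix h assume h: "h \<in> carrier G"
    have "\<rho>1 g * \<rho>1 h = Q * (\<rho> g * (P * Q * (\<rho> h * P)))"
      unfolding \<rho>1_def using P Q rg[OF g] rg[OF h] by (simp add: mat_assoc del: assoc_mult_mat)
    also have "\<dots> = Q * (\<rho> g * (\<rho> h * P))" unfolding PQr[OF h] ..
    also have "\<dots> = \<rho>1 (g \<otimes>\<^bsub>G\<^esub> h)" unfolding \<rho>1_def matrix_rep_mult[OF r g h]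
      using P Q rg[OF g] rg[OF h] by (simp add: mat_assoc del: assoc_mult_mat)
    finally show "\<rho>1 (g \<otimes>\<^bsub>G\<^esub> h) = \<rho>1 g * \<rho>1 h" ..
  qed
  have r2: "matrix_rep G d' \<rho>2"
  proof (rule matrix_repI)
    show "\<rho>2 \<one>\<^bsub>G\<^esub> = 1\<^sub>m d'" unfolding \<rho>2_def matrix_rep_one[OF r] using P' RP by simp
    fix g assume g: "g \<in> carrier G"
    show "\<rho>2 g \<in> carrier_mat d' d'" using P' R rg[OF g] by (auto simp: \<rho>2_def)
    fix h assume h: "h \<in> carrier G"
    define Z where "Z = \<rho> h * P'"
    have Z: "Z \<in> carrier_mat n d'" using rg[OF h] P' by (simp add: Z_def)
    have "\<rho>2 g * \<rho>2 h = R * \<rho> g * (P' * R) * Z"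
      unfolding \<rho>2_def Z_def using P' R rg[OF g] rg[OF h] by (simp add: mat_assoc del: assoc_mult_mat)
    also have "\<dots> = R * \<rho> g * (1\<^sub>m n - P * Q) * Z" unfolding PR E_def ..
    also have "R * \<rho> g * (1\<^sub>m n - P * Q) = R * \<rho> g * 1\<^sub>m n - R * \<rho> g * (P * Q)"
      using P Q R rg[OF g] by (intro mult_minus_distrib_mat) auto
    also have "R * \<rho> g * (P * Q) = R * (\<rho> g * P) * Q"
      using P Q R rg[OF g] by (simp add: mat_assoc del: assoc_mult_mat)
    also have "\<dots> = 0\<^sub>m d' n" unfolding RrP[OF g] using Q by simp
    also have "R * \<rho> g * 1\<^sub>m n - 0\<^sub>m d' n = R * \<rho> g" using R rg[OF g] by auto
    also have "R * \<rho> g * Z = \<rho>2 (g \<otimes>\<^bsub>G\<^esub> h)" unfolding \<rho>2_def matrix_rep_mult[OF r g h] Z_def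
      using P' R rg[OF g] rg[OF h] by (simp add: mat_assoc del: assoc_mult_mat)
    finally show "\<rho>2 (g \<otimes>\<^bsub>G\<^esub> h) = \<rho>2 g * \<rho>2 h" ..
  qed
  have tr: "mat_trace (\<rho> g) = mat_trace (\<rho>1 g) + mat_trace (\<rho>2 g)" if g: "g \<in> carrier G" for g
  proof -
    have a: "\<rho> g * (P * Q) + \<rho> g * E = \<rho> g"
      using mult_add_distrib_mat[of "\<rho> g" n n "P * Q" n E] EPQ rg[OF g] P Q E by simp
    have b: "\<rho> g * (P * Q) = (\<rho> g * P) * Q" "\<rho> g * E = (\<rho> g * P') * R"
      unfolding PR[symmetric] using P Q P' R rg[OF g] by (simp_all add: mat_assoc del: assoc_mult_mat)
    have "mat_trace (\<rho> g) = mat_trace ((\<rho> g * P) * Q + (\<rho> g * P') * R)"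
      unfolding b[symmetric] a ..
    also have "\<dots> = mat_trace ((\<rho> g * P) * Q) + mat_trace ((\<rho> g * P') * R)"
      using P Q P' R rg[OF g] by (intro mat_trace_add[of _ n]) auto
    also have "mat_trace ((\<rho> g * P) * Q) = mat_trace (\<rho>1 g)"
      unfolding \<rho>1_def using P Q rg[OF g] by (intro mat_trace_comm[of _ n d]) auto
    also have "mat_trace ((\<rho> g * P') * R) = mat_trace (\<rho>2 g)"
      unfolding \<rho>2_def using P' R rg[OF g] by (intro mat_trace_comm[of _ n d']) auto
    finally show ?thesis .
  qed
  \<comment> \<open>At the identity the trace formula says \<open>n = d + d'\<close>, so it remains to see that neither block is empty.\<close>
  have "mat_trace (1\<^sub>m n :: complex mat) = mat_trace (1\<^sub>m d) + mat_trace (1\<^sub>m d')"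
    using tr[OF one_closed]
    unfolding matrix_rep_one[OF r] matrix_rep_one[OF r1] matrix_rep_one[OF r2] .
  then have "(of_nat n :: complex) = of_nat (d + d')" by (simp only: mat_trace_one of_nat_add)
  then have nd: "n = d + d'" by (simp only: of_nat_eq_iff)
  have "d \<noteq> 0"
  proof
    assume d0: "d = 0"
    have "u = 0\<^sub>v n" if "u \<in> U" for u
    proof -
      have "P *\<^sub>v (Q *\<^sub>v u) = 0\<^sub>v n" using P Q d0 by (intro eq_vecI) (auto simp: scalar_prod_def)
      then show ?thesis using PQ[OF that] by simp
    qed
    then have "U = {0\<^sub>v n}" using Us by (auto simp: subspace_vec_def)
    then show False using U by simp
  qed
  moreover have "d' \<noteq> 0"
  proof
    assume d0: "d' = 0"
    have "E = 0\<^sub>m n n" unfolding PR[symmetric] using P' R d0 by (intro eq_matI) (auto simp: scalar_prod_def)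
    then have PQ1: "P * Q = 1\<^sub>m n" using EPQ P Q by simp
    have "carrier_vec n \<subseteq> U"
    proof
      fix v :: "complex vec" assume v: "v \<in> carrier_vec n"
      have "v = P *\<^sub>v (Q *\<^sub>v v)" using PQ1 P Q v by (metis assoc_mult_mat_vec one_mult_mat_vec)
      then show "v \<in> U" using PU[of "Q *\<^sub>v v"] Q v by simp
    qed
    then show False using U Un by blast
  qed
  ultimately have "d < n" "d' < n" using nd by auto
  then show ?thesis using that[OF r1 r2 _ _ tr] by blast
qed

text \<open>
  Characters are sums of irreducible ones, by induction on the degree. Stated as orthogonality, this fact
  involves no multiplicities.
\<close>

lemma rep_orthogonal_if_Irr_orthogonal:
  assumes G: "group G" and f: "\<And>\<chi>. \<chi> \<in> Irr G \<Longrightarrow> (\<Sum>g\<in>carrier G. f g * \<chi> g) = 0"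
    and r: "matrix_rep G n \<rho>"
  shows "(\<Sum>g\<in>carrier G. f g * mat_trace (\<rho> g)) = 0"
  using r
proof (induction n arbitrary: \<rho> rule: less_induct)
  case (less n)
  consider "n = 0" | "irreducible_rep G n \<rho>" | "n > 0" "\<not> irreducible_rep G n \<rho>" by auto
  then show ?case
  proof cases
    case 1
    have "mat_trace (\<rho> g) = 0" if "g \<in> carrier G" for g
      using matrix_rep_carrier[OF less.prems that] 1 by (simp add: mat_trace_def)
    then show ?thesis by simp
  next
    case 2
    then have "rep_char G \<rho> \<in> Irr G" unfolding Irr_eq by blast
    from f[OF this] show ?thesis by (simp add: rep_char_apply)
  next
    case 3
    obtain d1 \<rho>1 d2 \<rho>2 where d: "matrix_rep G d1 \<rho>1" "matrix_rep G d2 \<rho>2" "d1 < n" "d2 < n"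
      and t: "\<And>g. g \<in> carrier G \<Longrightarrow> mat_trace (\<rho> g) = mat_trace (\<rho>1 g) + mat_trace (\<rho>2 g)"
      using reducible_rep_trace_split[OF G less.prems 3] by blast
    show ?thesis using less.IH[OF d(3,1)] less.IH[OF d(4,2)] by (simp add: t distrib_left sum.distrib)
  qed
qed

context finite_group
begin

lemma regular_rep:
  obtains n \<rho> where "matrix_rep G n \<rho>"
    "\<And>g. g \<in> carrier G \<Longrightarrow> mat_trace (\<rho> g) = (if g = \<one> then of_nat (card (carrier G)) else 0)"
proof -
  let ?n = "card (carrier G)"
  obtain el where el: "bij_betw el {..<?n} (carrier G)"
    using ex_bij_betw_nat_finite[OF finite_carrier] by (auto simp: atLeast0LessThan)
  have elc: "el i \<in> carrier G" if "i < ?n" for i using el that by (auto simp: bij_betw_def)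
  have elinj: "el i = el j \<longleftrightarrow> i = j" if "i < ?n" "j < ?n" for i j
    using el that by (auto simp: bij_betw_def inj_on_def)
  define \<rho> :: "'a \<Rightarrow> complex mat" where "\<rho> g = mat ?n ?n (\<lambda>(i, j). if el i = g \<otimes> el j then 1 else 0)" for g
  have "matrix_rep G ?n \<rho>"
  proof (rule matrix_repI)
    show "\<rho> g \<in> carrier_mat ?n ?n" for g by (simp add: \<rho>_def)
    show "\<rho> \<one> = 1\<^sub>m ?n" by (rule eq_matI) (auto simp: \<rho>_def elc elinj)
    fix g h assume gh: "g \<in> carrier G" "h \<in> carrier G"
    show "\<rho> (g \<otimes> h) = \<rho> g * \<rho> h"
    proof (rule eq_matI)
      fix i j assume "i < dim_row (\<rho> g * \<rho> h)" "j < dim_col (\<rho> g * \<rho> h)"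
      then have ij: "i < ?n" "j < ?n" by (auto simp: \<rho>_def)
      have "(\<rho> g * \<rho> h) $$ (i, j) = (\<Sum>k<?n. \<rho> g $$ (i, k) * \<rho> h $$ (k, j))"
        using ij by (intro index_mult_mat_sum) (auto simp: \<rho>_def)
      also have "\<dots> = (\<Sum>k<?n. if el k = h \<otimes> el j then (if el i = g \<otimes> el k then 1 else 0) else 0)"
        using ij by (intro sum.cong refl) (simp add: \<rho>_def)
      also have "\<dots> = (\<Sum>x\<in>carrier G. if x = h \<otimes> el j then (if el i = g \<otimes> x then 1 else 0) else 0)"
        by (rule sum.reindex_bij_betw[OF el])
      also have "\<dots> = (if el i = g \<otimes> (h \<otimes> el j) then 1 else 0)"
        using finite_carrier gh elc[OF ij(2)] by simp
      finally show "\<rho> (g \<otimes> h) $$ (i, j) = (\<rho> g * \<rho> h) $$ (i, j)"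
        using ij gh elc[OF ij(2)] by (simp add: \<rho>_def m_assoc)
    qed (auto simp: \<rho>_def)
  qed
  moreover have "mat_trace (\<rho> g) = (if g = \<one> then of_nat ?n else 0)" if g: "g \<in> carrier G" for g
  proof -
    have "el i = g \<otimes> el i \<longleftrightarrow> g = \<one>" if "i < ?n" for i
      using elc[OF that] g by (metis l_one one_closed right_cancel)
    then show ?thesis by (simp add: mat_trace_def \<rho>_def)
  qed
  ultimately show ?thesis using that by blast
qed

end

section \<open>Irreducible characters of a direct product\<close>

text \<open>
  If the matrices \<open>\<rho>(g)\<close> span all matrices, then a subspace that contains a vector \<open>u\<close> with \<open>u\<^sub>q \<noteq> 0\<close> contains
  \<open>E\<^sub>p\<^sub>q u\<close>, a nonzero multiple of the \<open>p\<close>-th unit vector, for all \<open>p\<close>.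
\<close>

lemma irreducible_rep_if_spanning:
  assumes fin: "finite (carrier G)" and r: "matrix_rep G n \<rho>" and n: "n > 0"
    and span: "\<And>p q. p < n \<Longrightarrow> q < n \<Longrightarrow> \<exists>c. \<forall>a<n. \<forall>b<n.
      (\<Sum>g\<in>carrier G. c g * \<rho> g $$ (a, b)) = (if a = p \<and> b = q then 1 else 0)"
  shows "irreducible_rep G n \<rho>"
  unfolding irreducible_rep_def
proof (intro conjI allI impI)
  fix U assume inv: "invariant_subspace G n \<rho> U"
  note Us = invariant_subspaceD(1)[OF inv]
  show "U = {0\<^sub>v n} \<or> U = carrier_vec n"
  proof (cases "U \<subseteq> {0\<^sub>v n}")
    case True
    then show ?thesis using Us by (auto simp: subspace_vec_def)
  next
    case False
    then obtain u where u: "u \<in> U" "u \<noteq> 0\<^sub>v n" by blast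
    have un: "u \<in> carrier_vec n" using u Us by (auto simp: subspace_vec_def)
    have "\<exists>q<n. u $ q \<noteq> 0"
    proof (rule ccontr)
      assume "\<not> ?thesis"
      then have "u = 0\<^sub>v n" using un by (intro eq_vecI) auto
      then show False using u by simp
    qed
    then obtain q where q: "q < n" "u $ q \<noteq> 0" by blast
    have comb: "vec n (\<lambda>a. \<Sum>g\<in>Z. c g * (\<rho> g *\<^sub>v u) $ a) \<in> U" if "Z \<subseteq> carrier G" "finite Z" for c Z
      using that(2,1)
    proof (induction Z)
      case empty
      have "vec n (\<lambda>a. 0) = (0\<^sub>v n :: complex vec)" by auto
      then show ?case using Us by (simp add: subspace_vec_def)
    next
      case (insert x Z)
      have xc: "x \<in> carrier G" using insert.prems by simp
      have "vec n (\<lambda>a. \<Sum>g\<in>insert x Z. c g * (\<rho> g *\<^sub>v u) $ a) =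
          c x \<cdot>\<^sub>v (\<rho> x *\<^sub>v u) + vec n (\<lambda>a. \<Sum>g\<in>Z. c g * (\<rho> g *\<^sub>v u) $ a)"
        using insert.hyps matrix_rep_carrier[OF r xc] by (intro eq_vecI) auto
      also have "\<dots> \<in> U"
        using insert.IH insert.prems Us invariant_subspaceD(2)[OF inv xc u(1)]
        by (simp add: subspace_vec_def)
      finally show ?case .
    qed
    have unit: "unit_vec n p \<in> U" if p: "p < n" for p
    proof -
      obtain c where c: "\<And>a b. a < n \<Longrightarrow> b < n \<Longrightarrow>
          (\<Sum>g\<in>carrier G. c g * \<rho> g $$ (a, b)) = (if a = p \<and> b = q then 1 else 0)"
        using span[OF p q(1)] by blast
      have "vec n (\<lambda>a. \<Sum>g\<in>carrier G. c g * (\<rho> g *\<^sub>v u) $ a) = u $ q \<cdot>\<^sub>v unit_vec n p"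
      proof (rule eq_vecI)
        fix a assume "a < dim_vec (u $ q \<cdot>\<^sub>v unit_vec n p)"
        then have a: "a < n" by simp
        have "(\<Sum>g\<in>carrier G. c g * (\<rho> g *\<^sub>v u) $ a) =
            (\<Sum>g\<in>carrier G. \<Sum>b<n. c g * \<rho> g $$ (a, b) * u $ b)"
          using index_mult_mat_vec_sum[OF matrix_rep_carrier[OF r] un a]
          by (intro sum.cong refl) (simp add: sum_distrib_left mult.assoc)
        also have "\<dots> = (\<Sum>b<n. (\<Sum>g\<in>carrier G. c g * \<rho> g $$ (a, b)) * u $ b)"
          by (subst sum.swap) (simp add: sum_distrib_right)
        also have "\<dots> = (\<Sum>b<n. if b = q then (if a = p then u $ b else 0) else 0)"
          using a by (intro sum.cong refl) (auto simp: c)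
        also have "\<dots> = (u $ q \<cdot>\<^sub>v unit_vec n p) $ a" using q a p by auto
        finally show "vec n (\<lambda>a. \<Sum>g\<in>carrier G. c g * (\<rho> g *\<^sub>v u) $ a) $ a =
            (u $ q \<cdot>\<^sub>v unit_vec n p) $ a" using a by simp
      qed simp
      with comb[OF subset_refl fin, of c] have "u $ q \<cdot>\<^sub>v unit_vec n p \<in> U" by simp
      then have "(1 / u $ q) \<cdot>\<^sub>v (u $ q \<cdot>\<^sub>v unit_vec n p) \<in> U" using Us unfolding subspace_vec_def by blast
      then show ?thesis using q by (simp add: smult_smult_assoc)
    qed
    have "carrier_vec n \<subseteq> U"
    proof
      fix v :: "complex vec" assume v: "v \<in> carrier_vec n"
      have "col (1\<^sub>m n) j \<in> U" if "j < n" for j using unit[OF that] that by simp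
      from subspace_image[OF Us _ this v] v show "v \<in> U" by simp
    qed
    then show ?thesis using Us by (auto simp: subspace_vec_def)
  qed
qed (use r n in auto)

text \<open>
  Burnside's theorem. By orthogonality \<open>\<Sum>\<^sub>g \<rho>(g\<^sup>-\<^sup>1)\<^sub>q\<^sub>p \<rho>(g)\<close> is a nonzero multiple of the matrix unit \<open>E\<^sub>p\<^sub>q\<close>. Together with
  the converse above it turns irreducibility into a condition that is visibly inherited by tensor products.
\<close>

lemma (in finite_group) irreducible_rep_spanning:
  assumes r: "irreducible_rep G n \<rho>" and pq: "p < n" "q < n"
  shows "\<exists>c. \<forall>a<n. \<forall>b<n. (\<Sum>g\<in>carrier G. c g * \<rho> g $$ (a, b)) = (if a = p \<and> b = q then 1 else 0)"
proof -
  let ?\<kappa> = "of_nat n / of_nat (card (carrier G)) :: complex"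
  have nz: "of_nat n \<noteq> (0::complex)" "of_nat (card (carrier G)) \<noteq> (0::complex)"
    using r finite_carrier one_closed by (auto simp: irreducible_rep_def)
  have "(\<Sum>g\<in>carrier G. ?\<kappa> * \<rho> (inv g) $$ (q, p) * \<rho> g $$ (a, b)) = (if a = p \<and> b = q then 1 else 0)"
    if "a < n" "b < n" for a b
  proof -
    have "(\<Sum>g\<in>carrier G. ?\<kappa> * \<rho> (inv g) $$ (q, p) * \<rho> g $$ (a, b)) =
        ?\<kappa> * (\<Sum>g\<in>carrier G. \<rho> g $$ (a, b) * \<rho> (inv g) $$ (q, p))"
      by (simp add: sum_distrib_left mult_ac)
    then show ?thesis unfolding schur_orthogonality_same[OF r that(1,2) pq(2,1)] using nz by simp
  qed
  then show ?thesis by (intro exI[of _ "\<lambda>g. ?\<kappa> * \<rho> (inv g) $$ (q, p)"]) auto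
qed

text \<open>
  The basis vector \<open>e\<^sub>i \<otimes> e\<^sub>k\<close> has index \<open>i * n + k\<close>.
\<close>

definition kron_mat :: "nat \<Rightarrow> nat \<Rightarrow> complex mat \<Rightarrow> complex mat \<Rightarrow> complex mat" where
  "kron_mat m n A B = mat (m * n) (m * n) (\<lambda>(r, s). A $$ (r div n, s div n) * B $$ (r mod n, s mod n))"

lemma sum_div_mod:
  "(\<Sum>r<m * n. f (r div n) (r mod n)) = (\<Sum>i<m. \<Sum>k<n. f i (k::nat) :: 'a::comm_monoid_add)"
proof -
  have inner: "(\<Sum>r\<in>{i * n..<i * n + n}. f (r div n) (r mod n)) = (\<Sum>k<n. f i k)" for i
  proof (rule sum.reindex_bij_witness[of _ "\<lambda>k. i * n + k" "\<lambda>r. r - i * n"])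
    fix r assume r: "r \<in> {i * n..<i * n + n}"
    have "r div n = i" using r by (intro div_nat_eqI) (auto simp: mult.commute)
    moreover have "r mod n = r - i * n" using calculation by (metis minus_div_mult_eq_mod)
    ultimately show "f i (r - i * n) = f (r div n) (r mod n)" by simp
  qed auto
  have "(\<Sum>r<m * n. f (r div n) (r mod n)) = (\<Sum>i<m. \<Sum>r\<in>{i * n..<i * n + n}. f (r div n) (r mod n))"
    by (rule sum.nat_group[symmetric])
  then show ?thesis unfolding inner .
qed

lemma div_mod_less: "r < m * n \<Longrightarrow> r div n < m \<and> r mod n < (n::nat)"
  by (metis less_mult_imp_div_less mod_less_divisor mult_0_right neq0_conv not_less_zero)

lemma kron_mat_carrier: "kron_mat m n A B \<in> carrier_mat (m * n) (m * n)"
  by (simp add: kron_mat_def)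

lemma kron_mat_mult:
  assumes "A \<in> carrier_mat m m" "A' \<in> carrier_mat m m" "B \<in> carrier_mat n n" "B' \<in> carrier_mat n n"
  shows "kron_mat m n A B * kron_mat m n A' B' = kron_mat m n (A * A') (B * B')"
proof (rule eq_matI)
  fix r s assume "r < dim_row (kron_mat m n (A * A') (B * B'))" "s < dim_col (kron_mat m n (A * A') (B * B'))"
  then have rs: "r < m * n" "s < m * n" by (auto simp: kron_mat_def)
  note d = div_mod_less[OF rs(1)] div_mod_less[OF rs(2)]
  have "(kron_mat m n A B * kron_mat m n A' B') $$ (r, s) =
      (\<Sum>t<m * n. kron_mat m n A B $$ (r, t) * kron_mat m n A' B' $$ (t, s))"
    by (rule index_mult_mat_sum[OF kron_mat_carrier kron_mat_carrier rs])
  also have "\<dots> = (\<Sum>t<m * n. (A $$ (r div n, t div n) * A' $$ (t div n, s div n)) *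
      (B $$ (r mod n, t mod n) * B' $$ (t mod n, s mod n)))"
    using rs by (intro sum.cong refl) (simp add: kron_mat_def)
  also have "\<dots> = (\<Sum>i<m. \<Sum>k<n. (A $$ (r div n, i) * A' $$ (i, s div n)) *
      (B $$ (r mod n, k) * B' $$ (k, s mod n)))"
    by (rule sum_div_mod)
  also have "\<dots> = (A * A') $$ (r div n, s div n) * (B * B') $$ (r mod n, s mod n)"
    using assms d by (simp add: index_mult_mat_sum[of A m m A' m] index_mult_mat_sum[of B n n B' n]
        sum_product del: index_mult_mat(1))
  finally show "(kron_mat m n A B * kron_mat m n A' B') $$ (r, s) = kron_mat m n (A * A') (B * B') $$ (r, s)"
    using rs by (simp add: kron_mat_def)
qed (auto simp: kron_mat_def)

lemma kron_mat_one: "kron_mat m n (1\<^sub>m m) (1\<^sub>m n) = 1\<^sub>m (m * n)"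
proof (rule eq_matI)
  fix r s assume "r < dim_row (1\<^sub>m (m * n) :: complex mat)" "s < dim_col (1\<^sub>m (m * n) :: complex mat)"
  then have rs: "r < m * n" "s < m * n" by auto
  have "r = s \<longleftrightarrow> r div n = s div n \<and> r mod n = s mod n" by (metis div_mult_mod_eq)
  then show "kron_mat m n (1\<^sub>m m) (1\<^sub>m n) $$ (r, s) = 1\<^sub>m (m * n) $$ (r, s)"
    using rs div_mod_less[OF rs(1)] div_mod_less[OF rs(2)] by (auto simp: kron_mat_def)
qed (auto simp: kron_mat_def)

lemma kron_mat_trace:
  assumes "A \<in> carrier_mat m m" "B \<in> carrier_mat n n"
  shows "mat_trace (kron_mat m n A B) = mat_trace A * mat_trace B"
proof -
  have "mat_trace (kron_mat m n A B) = (\<Sum>r<m * n. A $$ (r div n, r div n) * B $$ (r mod n, r mod n))"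
    by (simp add: mat_trace_def kron_mat_def)
  also have "\<dots> = (\<Sum>i<m. \<Sum>k<n. A $$ (i, i) * B $$ (k, k))"
    by (rule sum_div_mod)
  also have "\<dots> = mat_trace A * mat_trace B"
    using assms by (simp add: mat_trace_eq[of A m] mat_trace_eq[of B n] sum_product)
  finally show ?thesis .
qed

definition outer_rep :: "nat \<Rightarrow> nat \<Rightarrow> ('a \<Rightarrow> complex mat) \<Rightarrow> ('b \<Rightarrow> complex mat) \<Rightarrow> 'a \<times> 'b \<Rightarrow> complex mat" where
  "outer_rep m n \<rho> \<sigma> = (\<lambda>(g, h). kron_mat m n (\<rho> g) (\<sigma> h))"

definition outer_char ::
    "('a, 'm) monoid_scheme \<Rightarrow> ('b, 'n) monoid_scheme \<Rightarrow> ('a \<Rightarrow> complex) \<Rightarrow> ('b \<Rightarrow> complex) \<Rightarrow> 'a \<times> 'b \<Rightarrow> complex" where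
  "outer_char G H \<chi> \<psi> = (\<lambda>(g, h)\<in>carrier G \<times> carrier H. \<chi> g * \<psi> h)"

lemma outer_char_apply:
  "g \<in> carrier G \<Longrightarrow> h \<in> carrier H \<Longrightarrow> outer_char G H \<chi> \<psi> (g, h) = \<chi> g * \<psi> h"
  by (simp add: outer_char_def)

lemma outer_rep_matrix_rep:
  assumes r: "matrix_rep G m \<rho>" and s: "matrix_rep H n \<sigma>"
  shows "matrix_rep (G \<times>\<times> H) (m * n) (outer_rep m n \<rho> \<sigma>)"
proof (rule matrix_repI)
  show "outer_rep m n \<rho> \<sigma> x \<in> carrier_mat (m * n) (m * n)" for x
    by (cases x) (simp add: outer_rep_def kron_mat_carrier)
  show "outer_rep m n \<rho> \<sigma> \<one>\<^bsub>G \<times>\<times> H\<^esub> = 1\<^sub>m (m * n)"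
    by (simp add: outer_rep_def matrix_rep_one[OF r] matrix_rep_one[OF s] kron_mat_one)
  fix x y assume "x \<in> carrier (G \<times>\<times> H)" "y \<in> carrier (G \<times>\<times> H)"
  then obtain g h g' h' where x: "x = (g, h)" "y = (g', h')"
    and c: "g \<in> carrier G" "g' \<in> carrier G" "h \<in> carrier H" "h' \<in> carrier H" by auto
  show "outer_rep m n \<rho> \<sigma> (x \<otimes>\<^bsub>G \<times>\<times> H\<^esub> y) = outer_rep m n \<rho> \<sigma> x * outer_rep m n \<rho> \<sigma> y"
    using c unfolding x
    by (simp add: outer_rep_def matrix_rep_mult[OF r] matrix_rep_mult[OF s] kron_mat_mult
        matrix_rep_carrier[OF r] matrix_rep_carrier[OF s])
qed

lemma outer_rep_char:
  assumes r: "matrix_rep G m \<rho>" and s: "matrix_rep H n \<sigma>"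
  shows "rep_char (G \<times>\<times> H) (outer_rep m n \<rho> \<sigma>) = outer_char G H (rep_char G \<rho>) (rep_char H \<sigma>)"
proof
  fix x show "rep_char (G \<times>\<times> H) (outer_rep m n \<rho> \<sigma>) x = outer_char G H (rep_char G \<rho>) (rep_char H \<sigma>) x"
  proof (cases x)
    case (Pair g h)
    then show ?thesis
      using matrix_rep_carrier[OF r, of g] matrix_rep_carrier[OF s, of h]
      by (auto simp: rep_char_def outer_char_def outer_rep_def kron_mat_trace)
  qed
qed

locale two_finite_groups = G: finite_group G + H: finite_group H
  for G :: "('a, 'm) monoid_scheme" and H :: "('b, 'n) monoid_scheme"
begin

lemma outer_rep_irreducible:
  assumes r: "irreducible_rep G m \<rho>" and s: "irreducible_rep H n \<sigma>"
  shows "irreducible_rep (G \<times>\<times> H) (m * n) (outer_rep m n \<rho> \<sigma>)"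
proof (rule irreducible_rep_if_spanning)
  show "finite (carrier (G \<times>\<times> H))" using G.finite_carrier H.finite_carrier by (simp add: DirProd_def)
  show "matrix_rep (G \<times>\<times> H) (m * n) (outer_rep m n \<rho> \<sigma>)"
    using r s outer_rep_matrix_rep[of G m \<rho> H n \<sigma>] by (simp add: irreducible_rep_def)
  show "m * n > 0" using r s by (simp add: irreducible_rep_def)
  fix p q assume pq: "p < m * n" "q < m * n"
  note dm = div_mod_less[OF pq(1)] div_mod_less[OF pq(2)]
  obtain c where c: "\<And>a b. a < m \<Longrightarrow> b < m \<Longrightarrow>
      (\<Sum>g\<in>carrier G. c g * \<rho> g $$ (a, b)) = (if a = p div n \<and> b = q div n then 1 else 0)"
    using G.irreducible_rep_spanning[OF r, of "p div n" "q div n"] dm by blast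
  obtain d where d: "\<And>a b. a < n \<Longrightarrow> b < n \<Longrightarrow>
      (\<Sum>h\<in>carrier H. d h * \<sigma> h $$ (a, b)) = (if a = p mod n \<and> b = q mod n then 1 else 0)"
    using H.irreducible_rep_spanning[OF s, of "p mod n" "q mod n"] dm by blast
  have "(\<Sum>x\<in>carrier (G \<times>\<times> H). (case x of (g, h) \<Rightarrow> c g * d h) * outer_rep m n \<rho> \<sigma> x $$ (a, b)) =
      (if a = p \<and> b = q then 1 else 0)" if ab: "a < m * n" "b < m * n" for a b
  proof -
    note dm' = div_mod_less[OF ab(1)] div_mod_less[OF ab(2)]
    have "(\<Sum>x\<in>carrier (G \<times>\<times> H). (case x of (g, h) \<Rightarrow> c g * d h) * outer_rep m n \<rho> \<sigma> x $$ (a, b)) =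
      (\<Sum>(g, h)\<in>carrier G \<times> carrier H. (c g * \<rho> g $$ (a div n, b div n)) * (d h * \<sigma> h $$ (a mod n, b mod n)))"
      using ab by (intro sum.cong) (auto simp: outer_rep_def kron_mat_def)
    also have "\<dots> = (\<Sum>g\<in>carrier G. c g * \<rho> g $$ (a div n, b div n)) *
        (\<Sum>h\<in>carrier H. d h * \<sigma> h $$ (a mod n, b mod n))"
      by (simp add: sum.cartesian_product[symmetric] sum_product)
    also have "\<dots> = (if a = p \<and> b = q then 1 else 0)"
    proof -
      have "a = p \<longleftrightarrow> a div n = p div n \<and> a mod n = p mod n" "b = q \<longleftrightarrow> b div n = q div n \<and> b mod n = q mod n"
        by (metis div_mult_mod_eq)+
      then show ?thesis using dm' by (auto simp: c d)
    qed
    finally show ?thesis .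
  qed
  then show "\<exists>c. \<forall>a<m * n. \<forall>b<m * n. (\<Sum>x\<in>carrier (G \<times>\<times> H). c x * outer_rep m n \<rho> \<sigma> x $$ (a, b)) =
      (if a = p \<and> b = q then 1 else 0)" by (intro exI[of _ "\<lambda>x. case x of (g, h) \<Rightarrow> c g * d h"]) blast
qed

lemma outer_char_Irr:
  assumes "\<chi> \<in> Irr G" "\<psi> \<in> Irr H"
  shows "outer_char G H \<chi> \<psi> \<in> Irr (G \<times>\<times> H)"
    and "char_degree (G \<times>\<times> H) (outer_char G H \<chi> \<psi>) = char_degree G \<chi> * char_degree H \<psi>"
proof -
  obtain m \<rho> n \<sigma> where r: "irreducible_rep G m \<rho>" "\<chi> = rep_char G \<rho>"
    and s: "irreducible_rep H n \<sigma>" "\<psi> = rep_char H \<sigma>" using assms unfolding Irr_eq by blast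
  have mr: "matrix_rep G m \<rho>" "matrix_rep H n \<sigma>" using r s by (auto simp: irreducible_rep_def)
  have e: "outer_char G H \<chi> \<psi> = rep_char (G \<times>\<times> H) (outer_rep m n \<rho> \<sigma>)"
    using outer_rep_char[OF mr] r s by simp
  show "outer_char G H \<chi> \<psi> \<in> Irr (G \<times>\<times> H)"
    unfolding e Irr_eq using outer_rep_irreducible[OF r(1) s(1)] by blast
  show "char_degree (G \<times>\<times> H) (outer_char G H \<chi> \<psi>) = char_degree G \<chi> * char_degree H \<psi>"
    unfolding e unfolding r(2) s(2)
    using char_degree_rep_char[OF DirProd_group[OF G.is_group H.is_group] outer_rep_matrix_rep[OF mr]]
      char_degree_rep_char[OF G.is_group mr(1)] char_degree_rep_char[OF H.is_group mr(2)] by simp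
qed

lemma finite_group_DirProd: "finite_group (G \<times>\<times> H)"
  using DirProd_group[OF G.is_group H.is_group] G.finite_carrier H.finite_carrier
  by (simp add: finite_group_def finite_group_axioms_def DirProd_def)

text \<open>
  Pairing \<open>\<chi> \<otimes> \<psi> = \<chi>' \<otimes> \<psi>'\<close> with itself gives \<open>\<langle>\<chi>, \<chi>'\<rangle> \<langle>\<psi>, \<psi>'\<rangle> = \<langle>\<chi>, \<chi>\<rangle> \<langle>\<psi>, \<psi>\<rangle> \<noteq> 0\<close>.
\<close>

lemma outer_char_inj:
  assumes "\<chi> \<in> Irr G" "\<psi> \<in> Irr H" "\<chi>' \<in> Irr G" "\<psi>' \<in> Irr H"
    and eq: "outer_char G H \<chi> \<psi> = outer_char G H \<chi>' \<psi>'"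
  shows "\<chi> = \<chi>' \<and> \<psi> = \<psi>'"
proof -
  have e: "\<chi> g * \<psi> h = \<chi>' g * \<psi>' h" if "g \<in> carrier G" "h \<in> carrier H" for g h
    using fun_cong[OF eq, of "(g, h)"] that by (simp add: outer_char_apply)
  have "(\<Sum>g\<in>carrier G. \<chi> g * \<chi>' (inv\<^bsub>G\<^esub> g)) * (\<Sum>h\<in>carrier H. \<psi> h * \<psi>' (inv\<^bsub>H\<^esub> h)) =
    (\<Sum>g\<in>carrier G. \<Sum>h\<in>carrier H. (\<chi> g * \<psi> h) * (\<chi>' (inv\<^bsub>G\<^esub> g) * \<psi>' (inv\<^bsub>H\<^esub> h)))"
    by (simp add: sum_product mult_ac)
  also have "\<dots> = (\<Sum>g\<in>carrier G. \<Sum>h\<in>carrier H. (\<chi> g * \<psi> h) * (\<chi> (inv\<^bsub>G\<^esub> g) * \<psi> (inv\<^bsub>H\<^esub> h)))"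
    by (intro sum.cong refl) (simp add: e)
  also have "\<dots> = (\<Sum>g\<in>carrier G. \<chi> g * \<chi> (inv\<^bsub>G\<^esub> g)) * (\<Sum>h\<in>carrier H. \<psi> h * \<psi> (inv\<^bsub>H\<^esub> h))"
    by (simp add: sum_product mult_ac)
  also have "\<dots> = of_nat (card (carrier G)) * of_nat (card (carrier H))"
    using assms by (simp add: G.Irr_orthogonal H.Irr_orthogonal)
  also have "\<dots> \<noteq> 0" using G.finite_carrier H.finite_carrier G.one_closed H.one_closed by auto
  finally show ?thesis using assms(1-4) by (auto simp: G.Irr_orthogonal H.Irr_orthogonal split: if_splits)
qed

text \<open>
  Otherwise \<open>\<chi>\<close> is orthogonal to all products of irreducible characters, hence to all products of characters, in
  particular to the product of the two regular characters. But that pairing is \<open>|G| |H| \<chi>(1)\<close>.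
\<close>

lemma Irr_DirProd_outer:
  assumes "\<chi> \<in> Irr (G \<times>\<times> H)"
  shows "\<exists>\<phi>\<in>Irr G. \<exists>\<psi>\<in>Irr H. \<chi> = outer_char G H \<phi> \<psi>"
proof (rule ccontr)
  assume neg: "\<not> ?thesis"
  interpret GH: finite_group "G \<times>\<times> H" by (rule finite_group_DirProd)
  obtain n \<tau> where t: "irreducible_rep (G \<times>\<times> H) n \<tau>" "\<chi> = rep_char (G \<times>\<times> H) \<tau>"
    using assms unfolding Irr_eq by blast
  have mt: "matrix_rep (G \<times>\<times> H) n \<tau>" and n: "n > 0" using t by (auto simp: irreducible_rep_def)
  have inv: "inv\<^bsub>G \<times>\<times> H\<^esub> (g, h) = (inv\<^bsub>G\<^esub> g, inv\<^bsub>H\<^esub> h)" if "g \<in> carrier G" "h \<in> carrier H" for g h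
    using inv_DirProd[OF G.is_group H.is_group that] .
  \<comment> \<open>The arguments of \<open>\<chi>\<close> are inverted, so that orthogonality becomes the vanishing of a plain sum, which
    extends from irreducible characters to all characters in one variable at a time.\<close>
  have orth: "(\<Sum>g\<in>carrier G. \<Sum>h\<in>carrier H. \<chi> (inv\<^bsub>G\<^esub> g, inv\<^bsub>H\<^esub> h) * (\<phi> g * \<psi> h)) = 0"
    if "\<phi> \<in> Irr G" "\<psi> \<in> Irr H" for \<phi> \<psi>
  proof -
    have "outer_char G H \<phi> \<psi> \<noteq> \<chi>" using neg that by blast
    then have "(\<Sum>x\<in>carrier (G \<times>\<times> H). outer_char G H \<phi> \<psi> x * \<chi> (inv\<^bsub>G \<times>\<times> H\<^esub> x)) = 0"
      using GH.Irr_orthogonal[OF outer_char_Irr(1)[OF that] assms] by simp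
    also have "(\<Sum>x\<in>carrier (G \<times>\<times> H). outer_char G H \<phi> \<psi> x * \<chi> (inv\<^bsub>G \<times>\<times> H\<^esub> x)) =
        (\<Sum>(g, h)\<in>carrier G \<times> carrier H. \<chi> (inv\<^bsub>G\<^esub> g, inv\<^bsub>H\<^esub> h) * (\<phi> g * \<psi> h))"
      by (intro sum.cong) (auto simp: outer_char_apply inv)
    finally show ?thesis by (simp add: sum.cartesian_product)
  qed
  obtain k \<rho> where \<rho>: "matrix_rep G k \<rho>"
    "\<And>g. g \<in> carrier G \<Longrightarrow> mat_trace (\<rho> g) = (if g = \<one>\<^bsub>G\<^esub> then of_nat (card (carrier G)) else 0)"
    using G.regular_rep by blast
  obtain l \<sigma> where \<sigma>: "matrix_rep H l \<sigma>"
    "\<And>h. h \<in> carrier H \<Longrightarrow> mat_trace (\<sigma> h) = (if h = \<one>\<^bsub>H\<^esub> then of_nat (card (carrier H)) else 0)"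
    using H.regular_rep by blast
  have inner: "(\<Sum>g\<in>carrier G. \<chi> (inv\<^bsub>G\<^esub> g, y) * mat_trace (\<rho> g)) =
      \<chi> (\<one>\<^bsub>G\<^esub>, y) * of_nat (card (carrier G))" for y
  proof -
    have "(\<Sum>g\<in>carrier G. \<chi> (inv\<^bsub>G\<^esub> g, y) * mat_trace (\<rho> g)) =
      (\<Sum>g\<in>carrier G. if g = \<one>\<^bsub>G\<^esub> then \<chi> (\<one>\<^bsub>G\<^esub>, y) * of_nat (card (carrier G)) else 0)"
      by (intro sum.cong refl) (simp add: \<rho>)
    then show ?thesis using G.finite_carrier by simp
  qed
  have total: "(\<Sum>h\<in>carrier H. (\<Sum>g\<in>carrier G. \<chi> (inv\<^bsub>G\<^esub> g, inv\<^bsub>H\<^esub> h) * mat_trace (\<rho> g)) * mat_trace (\<sigma> h)) = 0"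
    (is "?total = 0")
  proof (rule rep_orthogonal_if_Irr_orthogonal[OF H.is_group _ \<sigma>(1)])
    fix \<psi> assume p: "\<psi> \<in> Irr H"
    have "(\<Sum>g\<in>carrier G. (\<Sum>h\<in>carrier H. \<chi> (inv\<^bsub>G\<^esub> g, inv\<^bsub>H\<^esub> h) * \<psi> h) * mat_trace (\<rho> g)) = 0"
    proof (rule rep_orthogonal_if_Irr_orthogonal[OF G.is_group _ \<rho>(1)])
      fix \<phi> assume q: "\<phi> \<in> Irr G"
      show "(\<Sum>g\<in>carrier G. (\<Sum>h\<in>carrier H. \<chi> (inv\<^bsub>G\<^esub> g, inv\<^bsub>H\<^esub> h) * \<psi> h) * \<phi> g) = 0"
        using orth[OF q p] by (simp add: sum_distrib_left sum_distrib_right mult_ac)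
    qed
    also have "(\<Sum>g\<in>carrier G. (\<Sum>h\<in>carrier H. \<chi> (inv\<^bsub>G\<^esub> g, inv\<^bsub>H\<^esub> h) * \<psi> h) * mat_trace (\<rho> g)) =
        (\<Sum>h\<in>carrier H. (\<Sum>g\<in>carrier G. \<chi> (inv\<^bsub>G\<^esub> g, inv\<^bsub>H\<^esub> h) * mat_trace (\<rho> g)) * \<psi> h)"
      unfolding sum_distrib_right by (subst sum.swap) (simp add: mult_ac)
    finally show "(\<Sum>h\<in>carrier H. (\<Sum>g\<in>carrier G. \<chi> (inv\<^bsub>G\<^esub> g, inv\<^bsub>H\<^esub> h) * mat_trace (\<rho> g)) * \<psi> h) = 0" .
  qed
  have "0 = ?total" using total ..
  also have "?total = (\<Sum>h\<in>carrier H. \<chi> (\<one>\<^bsub>G\<^esub>, inv\<^bsub>H\<^esub> h) * of_nat (card (carrier G)) * mat_trace (\<sigma> h))"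
    unfolding inner ..
  also have "\<dots> =
    (\<Sum>h\<in>carrier H. if h = \<one>\<^bsub>H\<^esub> then \<chi> (\<one>\<^bsub>G\<^esub>, \<one>\<^bsub>H\<^esub>) * of_nat (card (carrier G)) * of_nat (card (carrier H)) else 0)"
    by (intro sum.cong refl) (simp add: \<sigma>)
  also have "\<dots> = \<chi> (\<one>\<^bsub>G\<^esub>, \<one>\<^bsub>H\<^esub>) * of_nat (card (carrier G)) * of_nat (card (carrier H))"
    using H.finite_carrier by simp
  also have "\<chi> (\<one>\<^bsub>G\<^esub>, \<one>\<^bsub>H\<^esub>) = of_nat n"
    using t(2) matrix_rep_one[OF mt] GH.one_closed by (simp add: rep_char_apply mat_trace_one)
  finally show False using n G.finite_carrier H.finite_carrier G.one_closed H.one_closed by auto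
qed

lemma outer_char_bij:
  "bij_betw (\<lambda>(\<chi>, \<psi>). outer_char G H \<chi> \<psi>) (Irr G \<times> Irr H) (Irr (G \<times>\<times> H))"
proof (rule bij_betw_imageI)
  show "inj_on (\<lambda>(\<chi>, \<psi>). outer_char G H \<chi> \<psi>) (Irr G \<times> Irr H)"
    using outer_char_inj by (auto simp: inj_on_def)
  show "(\<lambda>(\<chi>, \<psi>). outer_char G H \<chi> \<psi>) ` (Irr G \<times> Irr H) = Irr (G \<times>\<times> H)"
    using outer_char_Irr(1) Irr_DirProd_outer by (auto simp: image_iff)
qed

end

section \<open>Families of commuting idempotents\<close>

text \<open>
  The ring that this is applied to is not commutative, but the factors of the products commute with each other,
  which is enough for \<^const>\<open>finprod\<close> to behave.
\<close>

lemma (in monoid) finprod_insert_commuting: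
  assumes "finite A" "a \<notin> A" "f \<in> insert a A \<rightarrow> carrier G"
    and "\<And>x y. x \<in> insert a A \<Longrightarrow> y \<in> insert a A \<Longrightarrow> f x \<otimes> f y = f y \<otimes> f x"
  shows "finprod G f (insert a A) = f a \<otimes> finprod G f A"
proof -
  interpret LCD "insert a A" "carrier G" "(\<otimes>) \<circ> f"
  proof
    fix x y z assume xyz: "x \<in> insert a A" "y \<in> insert a A" "z \<in> carrier G"
    then have "f x \<in> carrier G" "f y \<in> carrier G" using assms(3) by auto
    then show "((\<otimes>) \<circ> f) x (((\<otimes>) \<circ> f) y z) = ((\<otimes>) \<circ> f) y (((\<otimes>) \<circ> f) x z)"
      using xyz assms(4)[OF xyz(1,2)] by (simp add: m_assoc[symmetric])
  qed (use assms(3) in auto)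
  show ?thesis
    using assms(1) foldD_insert[OF assms(1,2) insertI1 one_closed subset_insertI] by (simp add: finprod_def)
qed

lemma (in monoid) finprod_empty_monoid: "finprod G f {} = \<one>"
  by (auto simp: finprod_def foldD_def intro!: the_equality foldSetD.emptyI elim!: empty_foldSetDE)

context ring
begin

lemma subring_minus_closed: "subring H R \<Longrightarrow> a \<in> H \<Longrightarrow> b \<in> H \<Longrightarrow> a \<ominus> b \<in> H"
  by (simp add: a_minus_def subringE)

text \<open>The Leibniz rule for the derivation \<open>[x, -]\<close>.\<close>

lemma commutator_subring:
  assumes T: "subring T R" and x: "x \<in> carrier R"
  shows "subring {b \<in> T. x \<otimes> b \<ominus> b \<otimes> x \<in> T} R"
proof (rule subringI)
  note TR = subringE[OF T]
  have Tc: "b \<in> T \<Longrightarrow> b \<in> carrier R" for b using TR(1) by blast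
  show "{b \<in> T. x \<otimes> b \<ominus> b \<otimes> x \<in> T} \<subseteq> carrier R" using Tc by blast
  show "\<one> \<in> {b \<in> T. x \<otimes> b \<ominus> b \<otimes> x \<in> T}" using TR x by (simp add: a_minus_def r_neg)
  fix a assume a: "a \<in> {b \<in> T. x \<otimes> b \<ominus> b \<otimes> x \<in> T}"
  have "x \<otimes> (\<ominus> a) \<ominus> (\<ominus> a) \<otimes> x = \<ominus> (x \<otimes> a \<ominus> a \<otimes> x)"
    using a x Tc by (simp add: a_minus_def r_minus l_minus minus_add a_comm)
  then show "\<ominus> a \<in> {b \<in> T. x \<otimes> b \<ominus> b \<otimes> x \<in> T}" using a TR by simp
  fix b assume b: "b \<in> {b \<in> T. x \<otimes> b \<ominus> b \<otimes> x \<in> T}"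
  have c: "a \<in> carrier R" "b \<in> carrier R" using a b Tc by auto
  have "x \<otimes> (a \<oplus> b) \<ominus> (a \<oplus> b) \<otimes> x = (x \<otimes> a \<ominus> a \<otimes> x) \<oplus> (x \<otimes> b \<ominus> b \<otimes> x)"
    using c x by algebra
  then show "a \<oplus> b \<in> {b \<in> T. x \<otimes> b \<ominus> b \<otimes> x \<in> T}" using a b TR by simp
  have "x \<otimes> (a \<otimes> b) \<ominus> (a \<otimes> b) \<otimes> x = (x \<otimes> a \<ominus> a \<otimes> x) \<otimes> b \<oplus> a \<otimes> (x \<otimes> b \<ominus> b \<otimes> x)"
    using c x by algebra
  then show "a \<otimes> b \<in> {b \<in> T. x \<otimes> b \<ominus> b \<otimes> x \<in> T}" using a b TR by simp
qed

lemma centralizer_subring: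
  assumes x: "x \<in> carrier R"
  shows "subring {b \<in> carrier R. x \<otimes> b = b \<otimes> x} R"
proof (rule subringI)
  fix a b assume a: "a \<in> {b \<in> carrier R. x \<otimes> b = b \<otimes> x}"
  then show "\<ominus> a \<in> {b \<in> carrier R. x \<otimes> b = b \<otimes> x}" using x by (simp add: r_minus l_minus)
  assume b: "b \<in> {b \<in> carrier R. x \<otimes> b = b \<otimes> x}"
  show "a \<oplus> b \<in> {b \<in> carrier R. x \<otimes> b = b \<otimes> x}" using a b x by (simp add: r_distr l_distr)
  have "x \<otimes> (a \<otimes> b) = a \<otimes> b \<otimes> x" using a b x by (simp add: m_assoc flip: m_assoc[of x a b])
  then show "a \<otimes> b \<in> {b \<in> carrier R. x \<otimes> b = b \<otimes> x}" using a b x by simp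
qed (use x in auto)

text \<open>
  The condition says that \<open>a\<close> is block triangular for the decomposition \<open>1 = e + (1 - e)\<close>, which is visible for
  products after inserting this sum between the factors.
\<close>

lemma triangular_subring:
  assumes e: "e \<in> carrier R" "e \<otimes> e = e"
  shows "subring {a \<in> carrier R. (\<one> \<ominus> e) \<otimes> a \<otimes> e = \<zero>} R"
proof (rule subringI)
  let ?f = "\<one> \<ominus> e"
  have f: "?f \<in> carrier R" using e by simp
  have fe: "?f \<otimes> e = \<zero>" using e by (simp add: a_minus_def l_distr l_minus r_neg)
  show "\<one> \<in> {a \<in> carrier R. ?f \<otimes> a \<otimes> e = \<zero>}" using fe f by simp
  fix a b assume a: "a \<in> {a \<in> carrier R. ?f \<otimes> a \<otimes> e = \<zero>}"
  then show "\<ominus> a \<in> {a \<in> carrier R. ?f \<otimes> a \<otimes> e = \<zero>}" using f e by (simp add: r_minus l_minus)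
  assume b: "b \<in> {a \<in> carrier R. ?f \<otimes> a \<otimes> e = \<zero>}"
  show "a \<oplus> b \<in> {a \<in> carrier R. ?f \<otimes> a \<otimes> e = \<zero>}" using a b f e by (simp add: r_distr l_distr)
  have ab: "a \<in> carrier R" "b \<in> carrier R" using a b by auto
  have ef: "e \<oplus> ?f = \<one>" using e by algebra
  have "?f \<otimes> (a \<otimes> b) \<otimes> e = ?f \<otimes> (a \<otimes> (e \<oplus> ?f) \<otimes> b) \<otimes> e" unfolding ef using ab by simp
  also have "\<dots> = (?f \<otimes> a \<otimes> e) \<otimes> b \<otimes> e \<oplus> ?f \<otimes> a \<otimes> (?f \<otimes> b \<otimes> e)"
    using ab f e by (simp add: r_distr l_distr m_assoc)
  also have "\<dots> = \<zero>" using a b ab f e by simp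
  finally show "a \<otimes> b \<in> {a \<in> carrier R. ?f \<otimes> a \<otimes> e = \<zero>}" using ab by simp
qed (use e in auto)

text \<open>
  This is \<open>E\<^sub>I\<close> relative to a subset \<open>T\<close> of the index set. The set \<open>T\<close> varies because homomorphisms from the algebra
  of a factor map the \<open>E\<^sub>I\<close> of that factor to such relative projections.
\<close>

definition idem_proj :: "('i \<Rightarrow> 'a) \<Rightarrow> 'i set \<Rightarrow> 'i set \<Rightarrow> 'a" where
  "idem_proj e T I = finprod R e I \<otimes> finprod R (\<lambda>t. \<one> \<ominus> e t) (T - I)"

end

locale idem_family = ring R for R (structure) +
  fixes e :: "'i \<Rightarrow> 'a" and S :: "'i set"
  assumes finite_S: "finite S"
    and e_closed [simp]: "s \<in> S \<Longrightarrow> e s \<in> carrier R"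
    and e_idem: "s \<in> S \<Longrightarrow> e s \<otimes> e s = e s"
    and e_comm: "s \<in> S \<Longrightarrow> t \<in> S \<Longrightarrow> e s \<otimes> e t = e t \<otimes> e s"
begin

abbreviation f :: "'i \<Rightarrow> 'a" where "f t \<equiv> \<one> \<ominus> e t"
abbreviation E :: "'i set \<Rightarrow> 'i set \<Rightarrow> 'a" where "E \<equiv> idem_proj e"

lemma f_closed [simp]: "s \<in> S \<Longrightarrow> f s \<in> carrier R"
  by simp

lemma ef_comm: "s \<in> S \<Longrightarrow> t \<in> S \<Longrightarrow> e s \<otimes> f t = f t \<otimes> e s"
  by (simp add: a_minus_def r_distr l_distr r_minus l_minus e_comm)

lemma ff_comm: "s \<in> S \<Longrightarrow> t \<in> S \<Longrightarrow> f s \<otimes> f t = f t \<otimes> f s"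
  using ef_comm[of s t] by (simp add: a_minus_def[of R "\<one>" "e s"] r_distr l_distr r_minus l_minus)

lemma ef_zero: "s \<in> S \<Longrightarrow> e s \<otimes> f s = \<zero>" "s \<in> S \<Longrightarrow> f s \<otimes> e s = \<zero>"
  by (simp_all add: a_minus_def r_distr l_distr r_minus l_minus e_idem r_neg)

lemma ff_idem: "s \<in> S \<Longrightarrow> f s \<otimes> f s = f s"
  using ef_zero(1)[of s] by (simp add: a_minus_def[of R "\<one>" "e s"] l_distr l_minus del: ef_zero)

lemma e_plus_f: "s \<in> S \<Longrightarrow> e s \<oplus> f s = \<one>"
  using e_closed[of s] by algebra

lemma finprod_insert_e:
  "finite I \<Longrightarrow> t \<notin> I \<Longrightarrow> insert t I \<subseteq> S \<Longrightarrow> finprod R e (insert t I) = e t \<otimes> finprod R e I"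
  by (rule finprod_insert_commuting) (auto intro!: e_comm)

lemma finprod_insert_f:
  "finite I \<Longrightarrow> t \<notin> I \<Longrightarrow> insert t I \<subseteq> S \<Longrightarrow> finprod R f (insert t I) = f t \<otimes> finprod R f I"
  by (rule finprod_insert_commuting) (auto intro!: ff_comm)

lemma finprod_in_subring:
  assumes H: "subring H R" and I: "I \<subseteq> S" and eH: "\<And>t. t \<in> I \<Longrightarrow> e t \<in> H"
  shows "finprod R e I \<in> H" and "finprod R f I \<in> H"
proof -
  note HR = subringE[OF H]
  have "finite I" using I finite_S finite_subset by blast
  then have "finprod R e I \<in> H \<and> finprod R f I \<in> H" using I eH
  proof (induction I)
    case empty
    then show ?case using HR by (simp add: finprod_empty_monoid)
  next
    case (insert t I)
    then have "f t \<in> H" using HR subring_minus_closed[OF H] by simp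
    then show ?case using insert HR by (simp add: finprod_insert_e finprod_insert_f)
  qed
  then show "finprod R e I \<in> H" and "finprod R f I \<in> H" by auto
qed

lemma finprod_ef_closed [simp]:
  "J \<subseteq> S \<Longrightarrow> finprod R e J \<in> carrier R" "J \<subseteq> S \<Longrightarrow> finprod R f J \<in> carrier R"
  by (rule finprod_in_subring[OF carrier_is_subring]; auto)+

text \<open>
  Applied to centralizers and to rings of block triangular elements, this reduces most statements about \<open>E\<^sub>I\<close> to
  the idempotents \<open>e\<^sub>t\<close>.
\<close>

lemma E_in_subring:
  assumes "subring H R" "T \<subseteq> S" "I \<subseteq> T" "\<And>t. t \<in> T \<Longrightarrow> e t \<in> H"
  shows "E T I \<in> H"
  unfolding idem_proj_def
  using finprod_in_subring[OF assms(1), of I] finprod_in_subring[OF assms(1), of "T - I"] assms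
    subringE(6)[OF assms(1)] by blast

lemma E_closed [simp]: "T \<subseteq> S \<Longrightarrow> I \<subseteq> T \<Longrightarrow> E T I \<in> carrier R"
  by (rule E_in_subring[OF carrier_is_subring]) auto

lemma commutes_with_E:
  assumes "a \<in> carrier R" "T \<subseteq> S" "I \<subseteq> T" "\<And>t. t \<in> T \<Longrightarrow> a \<otimes> e t = e t \<otimes> a"
  shows "a \<otimes> E T I = E T I \<otimes> a"
proof -
  have "E T I \<in> {b \<in> carrier R. a \<otimes> b = b \<otimes> a}"
    by (rule E_in_subring[OF centralizer_subring[OF assms(1)] assms(2,3)]) (use assms(2,4) in auto)
  then show ?thesis by simp
qed

lemma e_E_comm: "T \<subseteq> S \<Longrightarrow> I \<subseteq> T \<Longrightarrow> t \<in> S \<Longrightarrow> E T I \<otimes> e t = e t \<otimes> E T I"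
  by (rule commutes_with_E[symmetric]) (auto intro!: e_comm)

lemma E_E_comm: "T \<subseteq> S \<Longrightarrow> I \<subseteq> T \<Longrightarrow> T' \<subseteq> S \<Longrightarrow> I' \<subseteq> T' \<Longrightarrow> E T I \<otimes> E T' I' = E T' I' \<otimes> E T I"
  by (rule commutes_with_E) (auto intro!: e_E_comm)

lemma E_empty: "E {} {} = \<one>"
  by (simp add: idem_proj_def finprod_empty_monoid)

lemma E_insert_insert:
  assumes "insert t T \<subseteq> S" "t \<notin> T" "I \<subseteq> T"
  shows "E (insert t T) (insert t I) = e t \<otimes> E T I"
proof -
  have I: "finite I" "t \<notin> I" "insert t I \<subseteq> S" "I \<subseteq> S" "T - I \<subseteq> S" "t \<in> S"
    using assms finite_S finite_subset[of I S] by auto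
  have c: "finprod R e I \<in> carrier R" "finprod R f (T - I) \<in> carrier R"
    using finprod_in_subring[OF carrier_is_subring I(4)] finprod_in_subring[OF carrier_is_subring I(5)] I
    by (auto simp: subset_iff)
  have d: "insert t T - insert t I = T - I" using assms(2) by blast
  show ?thesis unfolding idem_proj_def d finprod_insert_e[OF I(1-3)] using c I(6) by (simp add: m_assoc)
qed

lemma E_insert:
  assumes "insert t T \<subseteq> S" "t \<notin> T" "I \<subseteq> T"
  shows "E (insert t T) I = f t \<otimes> E T I"
proof -
  have fin: "finite (T - I)" using assms finite_S finite_subset[of "T - I" S] by auto
  have tI: "t \<notin> I" "t \<notin> T - I" "insert t (T - I) \<subseteq> S" "I \<subseteq> S" "T - I \<subseteq> S" "t \<in> S" using assms by auto
  have c: "finprod R e I \<in> carrier R" "finprod R f (T - I) \<in> carrier R"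
    using finprod_in_subring[OF carrier_is_subring tI(4)] finprod_in_subring[OF carrier_is_subring tI(5)] tI
    by (auto simp: subset_iff)
  have "f t \<otimes> finprod R e I = finprod R e I \<otimes> f t"
  proof -
    have "finprod R e I \<in> {b \<in> carrier R. f t \<otimes> b = b \<otimes> f t}"
      by (rule finprod_in_subring(1)[OF centralizer_subring[OF f_closed[OF tI(6)]] tI(4)])
        (use tI in \<open>auto simp: ef_comm\<close>)
    then show ?thesis by simp
  qed
  moreover have d: "insert t T - I = insert t (T - I)" using tI(1) by blast
  ultimately show ?thesis
    unfolding idem_proj_def d finprod_insert_f[OF fin tI(2,3)]
    by (simp only: m_assoc[OF c(1) f_closed[OF tI(6)] c(2), symmetric]
        m_assoc[OF f_closed[OF tI(6)] c, symmetric])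
qed

lemma e_E_in:
  assumes "T \<subseteq> S" "I \<subseteq> T" "t \<in> I"
  shows "e t \<otimes> E T I = E T I"
proof -
  have "E T I = e t \<otimes> E (T - {t}) (I - {t})"
  proof -
    have "insert t (T - {t}) = T" "insert t (I - {t}) = I" using assms by auto
    then show ?thesis using E_insert_insert[of t "T - {t}" "I - {t}"] assms by auto
  qed
  moreover have "E (T - {t}) (I - {t}) \<in> carrier R" using assms by (intro E_closed) auto
  moreover have "t \<in> S" using assms by auto
  ultimately show ?thesis by (simp add: e_idem flip: m_assoc)
qed

lemma f_E_out:
  assumes "T \<subseteq> S" "I \<subseteq> T" "t \<in> T - I"
  shows "f t \<otimes> E T I = E T I"
proof -
  have "E T I = f t \<otimes> E (T - {t}) I"
  proof -
    have "insert t (T - {t}) = T" using assms by auto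
    then show ?thesis using E_insert[of t "T - {t}" I] assms by auto
  qed
  moreover have "E (T - {t}) I \<in> carrier R" using assms by (intro E_closed) auto
  moreover have "t \<in> S" using assms by auto
  ultimately show ?thesis by (simp add: ff_idem flip: m_assoc)
qed

lemma e_E_out:
  assumes "T \<subseteq> S" "I \<subseteq> T" "t \<in> T - I"
  shows "e t \<otimes> E T I = \<zero>"
proof -
  have "t \<in> S" using assms by auto
  then have "e t \<otimes> (f t \<otimes> E T I) = \<zero>" using assms by (simp add: ef_zero flip: m_assoc)
  then show ?thesis using f_E_out[OF assms] by simp
qed

lemma E_e_in: "T \<subseteq> S \<Longrightarrow> I \<subseteq> T \<Longrightarrow> t \<in> I \<Longrightarrow> E T I \<otimes> e t = E T I"
  using e_E_in[of T I t] e_E_comm[of T I t] by auto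

lemma E_e_out: "T \<subseteq> S \<Longrightarrow> I \<subseteq> T \<Longrightarrow> t \<in> T - I \<Longrightarrow> E T I \<otimes> e t = \<zero>"
  using e_E_out[of T I t] e_E_comm[of T I t] by auto

lemma E_f_out: "T \<subseteq> S \<Longrightarrow> I \<subseteq> T \<Longrightarrow> t \<in> T - I \<Longrightarrow> E T I \<otimes> f t = E T I"
  using E_e_out[of T I t] by (auto simp: a_minus_def r_distr r_minus subset_iff)

lemma E_sum: "T \<subseteq> S \<Longrightarrow> (\<Oplus>I\<in>Pow T. E T I) = \<one>"
proof -
  assume T: "T \<subseteq> S"
  then have "finite T" using finite_S finite_subset by blast
  then show ?thesis using T
  proof (induction T)
    case empty
    then show ?case by (simp add: E_empty)
  next
    case (insert t T)
    have P: "Pow (insert t T) = Pow T \<union> insert t ` Pow T" by (rule Pow_insert)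
    have fin: "finite (Pow T)" using insert by simp
    have dis: "Pow T \<inter> insert t ` Pow T = {}" using insert by auto
    have tS: "t \<in> S" "T \<subseteq> S" using insert by auto
    have inj: "inj_on (insert t) (Pow T)" using insert.hyps by (auto simp: inj_on_def)
    have cl: "E T \<in> Pow T \<rightarrow> carrier R" using tS by auto
    have "(\<Oplus>I\<in>Pow (insert t T). E (insert t T) I) =
       (\<Oplus>I\<in>Pow T. E (insert t T) I) \<oplus> (\<Oplus>I\<in>insert t ` Pow T. E (insert t T) I)"
      unfolding P using fin dis insert.prems
      by (intro finsum_Un_disjoint) (auto intro!: E_closed)
    also have "(\<Oplus>I\<in>insert t ` Pow T. E (insert t T) I) = (\<Oplus>I\<in>Pow T. E (insert t T) (insert t I))"
      using insert.prems inj by (intro finsum_reindex) (auto intro!: E_closed)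
    also have "\<dots> = (\<Oplus>I\<in>Pow T. e t \<otimes> E T I)"
      using insert tS by (intro finsum_cong') (auto simp: E_insert_insert)
    also have "\<dots> = e t" using insert.IH tS cl fin by (subst finsum_rdistr[symmetric]) auto
    also have "(\<Oplus>I\<in>Pow T. E (insert t T) I) = (\<Oplus>I\<in>Pow T. f t \<otimes> E T I)"
      using insert tS by (intro finsum_cong') (auto simp: E_insert)
    also have "\<dots> = f t" using insert.IH tS cl fin by (subst finsum_rdistr[symmetric]) auto
    also have "f t \<oplus> e t = \<one>" using e_plus_f[OF tS(1)] tS by (simp add: a_comm)
    finally show ?case .
  qed
qed

lemma E_Un:
  assumes "A \<subseteq> S" "B \<subseteq> S" "A \<inter> B = {}" "I \<subseteq> A" "J \<subseteq> B"
  shows "E (A \<union> B) (I \<union> J) = E A I \<otimes> E B J"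
proof -
  have "finite A" using assms finite_S finite_subset by blast
  then show ?thesis using assms
  proof (induction A arbitrary: I)
    case empty
    then show ?case by (simp add: E_empty)
  next
    case (insert t A)
    have AS: "A \<subseteq> S" "t \<in> S" "A \<inter> B = {}" using insert by auto
    show ?case
    proof (cases "t \<in> I")
      case True
      let ?I = "I - {t}"
      have I: "?I \<subseteq> A" "I = insert t ?I" using insert True by auto
      have "E (insert t A \<union> B) (I \<union> J) = E (insert t (A \<union> B)) (insert t (?I \<union> J))"
      proof -
        have "I \<union> J = insert t (?I \<union> J)" using True by auto
        then show ?thesis by simp
      qed
      also have "\<dots> = e t \<otimes> E (A \<union> B) (?I \<union> J)" using insert I by (intro E_insert_insert) auto
      also have "\<dots> = e t \<otimes> (E A ?I \<otimes> E B J)" using insert.IH[OF AS(1) insert.prems(2) AS(3) I(1)] insert by simp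
      also have "\<dots> = e t \<otimes> E A ?I \<otimes> E B J" using AS I insert by (simp add: m_assoc)
      also have "e t \<otimes> E A ?I = E (insert t A) I"
        using E_insert_insert[of t A ?I] insert I by simp
      finally show ?thesis .
    next
      case False
      then have I: "I \<subseteq> A" using insert by auto
      have "E (insert t A \<union> B) (I \<union> J) = f t \<otimes> E (A \<union> B) (I \<union> J)"
      proof -
        have "insert t A \<union> B = insert t (A \<union> B)" by simp
        then show ?thesis using insert I by (simp only:) (rule E_insert, auto)
      qed
      also have "\<dots> = f t \<otimes> E A I \<otimes> E B J" using insert.IH[OF AS(1) insert.prems(2) AS(3) I] AS I insert
        by (simp add: m_assoc)
      also have "f t \<otimes> E A I = E (insert t A) I"
        using E_insert[of t A I] insert I by simp
      finally show ?thesis .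
    qed
  qed
qed

end

lemma idem_proj_hom:
  assumes 1: "idem_family R1 e1 S1" and 2: "idem_family R2 e2 S2"
    and h: "h \<in> Ring.ring_hom R1 R2" and inj: "inj_on \<iota> S1" and im: "\<iota> ` S1 \<subseteq> S2"
    and he: "\<And>s. s \<in> S1 \<Longrightarrow> h (e1 s) = e2 (\<iota> s)"
    and TI: "T \<subseteq> S1" "I \<subseteq> T"
  shows "h (ring.idem_proj R1 e1 T I) = ring.idem_proj R2 e2 (\<iota> ` T) (\<iota> ` I)"
proof -
  interpret A: idem_family R1 e1 S1 by (rule 1)
  interpret B: idem_family R2 e2 S2 by (rule 2)
  interpret H: ring_hom_ring R1 R2 h by (intro ring_hom_ringI2 A.ring_axioms B.ring_axioms h)
  have "finite T" using TI A.finite_S finite_subset by blast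
  then show ?thesis using TI
  proof (induction T arbitrary: I)
    case empty
    then show ?case using ring_hom_one[OF h] by (simp add: A.E_empty B.E_empty)
  next
    case (insert t T)
    have t: "t \<in> S1" "\<iota> t \<in> S2" "T \<subseteq> S1" using insert im by auto
    have nt: "\<iota> t \<notin> \<iota> ` T" using insert inj by (meson inj_on_image_mem_iff insert_subset)
    have imT: "insert (\<iota> t) (\<iota> ` T) \<subseteq> S2" using t im by blast
    have imC: "J \<subseteq> T \<Longrightarrow> B.E (\<iota> ` T) (\<iota> ` J) \<in> carrier R2" for J
      using imT by (intro B.E_closed) auto
    have hf: "h (A.f t) = B.f (\<iota> t)"
      using t by (simp add: a_minus_def he[OF t(1), symmetric])
    show ?case
    proof (cases "t \<in> I")
      case True
      then have I: "I - {t} \<subseteq> T" "I = insert t (I - {t})" using insert by auto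
      have eq: "\<iota> ` I = insert (\<iota> t) (\<iota> ` (I - {t}))" using I by auto
      have "h (A.E (insert t T) I) = h (e1 t \<otimes>\<^bsub>R1\<^esub> A.E T (I - {t}))"
        using A.E_insert_insert[of t T "I - {t}"] insert I by simp
      also have "\<dots> = e2 (\<iota> t) \<otimes>\<^bsub>R2\<^esub> B.E (\<iota> ` T) (\<iota> ` (I - {t}))"
        using ring_hom_mult[OF h] he t I insert.IH[OF t(3) I(1)] by simp
      also have "\<dots> = B.E (\<iota> ` insert t T) (\<iota> ` I)"
        unfolding eq image_insert by (rule B.E_insert_insert[OF imT nt image_mono[OF I(1)], symmetric])
      finally show ?thesis .
    next
      case False
      then have I: "I \<subseteq> T" using insert by auto
      have "h (A.E (insert t T) I) = h (A.f t \<otimes>\<^bsub>R1\<^esub> A.E T I)"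
        using A.E_insert[of t T I] insert I by simp
      also have "\<dots> = B.f (\<iota> t) \<otimes>\<^bsub>R2\<^esub> B.E (\<iota> ` T) (\<iota> ` I)"
        using ring_hom_mult[OF h] hf t I insert.IH[OF t(3) I(1)] by simp
      also have "\<dots> = B.E (\<iota> ` insert t T) (\<iota> ` I)"
        unfolding image_insert by (rule B.E_insert[OF imT nt image_mono[OF I], symmetric])
      finally show ?thesis .
    qed
  qed
qed

section \<open>Consequences of the W-graph relations\<close>

lemma (in idem_family) E_absorb:
  assumes T: "T \<subseteq> S" "I \<subseteq> T" and a: "a \<in> carrier R"
    and ea: "\<And>t. t \<in> I \<Longrightarrow> e t \<otimes> a = a" and fa: "\<And>t. t \<in> T - I \<Longrightarrow> e t \<otimes> a = \<zero>"
  shows "E T I \<otimes> a = a"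
proof -
  have fa': "f t \<otimes> a = a" if "t \<in> T - I" for t
    using fa[OF that] that T a by (auto simp: a_minus_def l_distr l_minus subset_iff)
  have e': "finprod R e J \<otimes> a = a" if "J \<subseteq> I" for J
  proof -
    have "finite J" using that T finite_S by (meson finite_subset)
    then show ?thesis using that
    proof (induction J)
      case (insert t J)
      have tJ: "insert t J \<subseteq> S" "t \<in> S" "J \<subseteq> S" using insert.prems T by auto
      show ?case
        using insert tJ a ea[of t] by (simp add: finprod_insert_e m_assoc)
    qed (use a in \<open>simp add: finprod_empty_monoid\<close>)
  qed
  have f': "finprod R f J \<otimes> a = a" if "J \<subseteq> T - I" for J
  proof -
    have "finite J" using that T finite_S finite_subset[of J S] by auto
    then show ?thesis using that
    proof (induction J)
      case (insert t J)
      have tJ: "insert t J \<subseteq> S" "t \<in> S" "J \<subseteq> S" using insert.prems T by auto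
      show ?case
        using insert tJ a fa'[of t] by (simp add: finprod_insert_f m_assoc)
    qed (use a in \<open>simp add: finprod_empty_monoid\<close>)
  qed
  have IS: "I \<subseteq> S" "T - I \<subseteq> S" using T by auto
  show ?thesis unfolding idem_proj_def using e'[of I] f'[of "T - I"] a IS by (simp add: m_assoc)
qed

lemma (in idem_family) E_idem: "T \<subseteq> S \<Longrightarrow> I \<subseteq> T \<Longrightarrow> E T I \<otimes> E T I = E T I"
  by (rule E_absorb) (auto simp: e_E_in e_E_out)

text \<open>
  The consequences of the relations of the W-graph algebra that the proof uses. The relation \<open>C\<close> stands for two
  distinct commuting reflections: \<open>cross\<close> and \<open>xx_comm\<close> are the coefficients of \<open>v\<^sup>-\<^sup>1\<close> and \<open>v\<^sup>0\<close> in their braid relation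
  \<open>T\<^sub>s T\<^sub>t = T\<^sub>t T\<^sub>s\<close>. In general \<open>x_indep\<close> is what remains of the coefficient of \<open>v\<^sup>m\<^sup>-\<^sup>1\<close> in a braid relation of length
  \<open>m\<close>; it makes \<open>X\<^sub>I\<^sub>J\<close> independent of the reflection.
\<close>

locale wgraph_ring = idem_family R e S for R (structure) and e :: "'i \<Rightarrow> 'a" and S +
  fixes x :: "'i \<Rightarrow> 'a" and C :: "'i \<Rightarrow> 'i \<Rightarrow> bool"
  assumes x_closed [simp]: "s \<in> S \<Longrightarrow> x s \<in> carrier R"
    and ex: "s \<in> S \<Longrightarrow> e s \<otimes> x s = x s"
    and xe: "s \<in> S \<Longrightarrow> x s \<otimes> e s = \<zero>"
    and cross: "s \<in> S \<Longrightarrow> t \<in> S \<Longrightarrow> C s t \<Longrightarrow> e s \<otimes> x t \<oplus> x s \<otimes> e t = e t \<otimes> x s \<oplus> x t \<otimes> e s"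
    and xx_comm: "s \<in> S \<Longrightarrow> t \<in> S \<Longrightarrow> C s t \<Longrightarrow> x s \<otimes> x t = x t \<otimes> x s"
    and x_indep: "s \<in> S \<Longrightarrow> t \<in> S \<Longrightarrow>
      e s \<otimes> (e t \<otimes> (x s \<otimes> (f s \<otimes> f t))) = e s \<otimes> (e t \<otimes> (x t \<otimes> (f s \<otimes> f t)))"
begin

lemma fx_zero: "s \<in> S \<Longrightarrow> f s \<otimes> x s = \<zero>"
  using ex[of s] by (simp add: a_minus_def l_distr l_minus r_neg)

text \<open>
  Multiply the cross relation by \<open>1 - e\<^sub>r\<close> on the left, which kills the side that starts with \<open>e\<^sub>r\<close> or \<open>x\<^sub>r\<close>, and by
  \<open>e\<^sub>r\<close> on the right, which kills \<open>x\<^sub>r\<close>.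
\<close>

lemma cross_triangular:
  assumes rt: "r \<in> S" "t \<in> S" "C r t"
  shows "f r \<otimes> x t \<otimes> e r = \<zero>"
proof -
  have "f r \<otimes> (e r \<otimes> x t \<oplus> x r \<otimes> e t) = (f r \<otimes> e r) \<otimes> x t \<oplus> (f r \<otimes> x r) \<otimes> e t"
    using rt by (simp add: r_distr m_assoc)
  also have "\<dots> = \<zero>" using rt by (simp add: ef_zero fx_zero)
  finally have 1: "f r \<otimes> (e t \<otimes> x r \<oplus> x t \<otimes> e r) = \<zero>" using cross[OF rt] by simp
  have "\<zero> = f r \<otimes> (e t \<otimes> x r \<oplus> x t \<otimes> e r) \<otimes> e r" using 1 rt by simp
  also have "\<dots> = f r \<otimes> (e t \<otimes> (x r \<otimes> e r)) \<oplus> f r \<otimes> (x t \<otimes> (e r \<otimes> e r))"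
    using rt by (simp add: r_distr l_distr m_assoc)
  also have "\<dots> = f r \<otimes> x t \<otimes> e r" using rt by (simp add: xe e_idem m_assoc)
  finally show ?thesis ..
qed

abbreviation Tri :: "'i \<Rightarrow> 'a set" where "Tri r \<equiv> {a \<in> carrier R. f r \<otimes> a \<otimes> e r = \<zero>}"

lemma Tri_subring: "r \<in> S \<Longrightarrow> subring (Tri r) R"
  by (rule triangular_subring) (auto simp: e_idem)

lemma e_Tri: "r \<in> S \<Longrightarrow> t \<in> S \<Longrightarrow> e t \<in> Tri r"
  by (simp add: m_assoc e_comm[of t r]) (simp add: ef_zero flip: m_assoc)

lemma x_Tri: "r \<in> S \<Longrightarrow> t \<in> S \<Longrightarrow> C r t \<Longrightarrow> x t \<in> Tri r"
  using cross_triangular by simp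

lemma commutator_swap:
  assumes st: "s \<in> S" "t \<in> S" "C s t"
  shows "x s \<otimes> e t \<ominus> e t \<otimes> x s = x t \<otimes> e s \<ominus> e s \<otimes> x t"
proof -
  have c: "x s \<otimes> e t \<in> carrier R" "e t \<otimes> x s \<in> carrier R" "x t \<otimes> e s \<in> carrier R" "e s \<otimes> x t \<in> carrier R"
    using st by auto
  have "x s \<otimes> e t \<ominus> e t \<otimes> x s = (e s \<otimes> x t \<oplus> x s \<otimes> e t) \<ominus> e s \<otimes> x t \<ominus> e t \<otimes> x s"
    using c by algebra
  also have "\<dots> = (e t \<otimes> x s \<oplus> x t \<otimes> e s) \<ominus> e s \<otimes> x t \<ominus> e t \<otimes> x s" unfolding cross[OF st] ..
  also have "\<dots> = x t \<otimes> e s \<ominus> e s \<otimes> x t" using c by algebra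
  finally show ?thesis .
qed

text \<open>
  A commutator of \<open>x\<^sub>s\<close> is controlled by membership of \<open>x\<^sub>t\<close> and \<open>e\<^sub>s\<close> alone; this is how information passes from one
  factor of a product to the other.
\<close>

lemma commutator_in_subring:
  assumes H: "subring H R" and st: "s \<in> S" "t \<in> S" "C s t" and m: "x t \<in> H" "e s \<in> H"
  shows "x s \<otimes> e t \<ominus> e t \<otimes> x s \<in> H"
  unfolding commutator_swap[OF st] using m subringE(6)[OF H] subring_minus_closed[OF H] by simp

text \<open>
  The projection \<open>E\<^sub>I\<close> absorbs \<open>1 - e\<^sub>r\<close> and \<open>E\<^sub>J\<close> absorbs \<open>e\<^sub>r\<close>.
\<close>

lemma Tri_kill:
  assumes "A \<subseteq> S" "I \<subseteq> A" "J \<subseteq> A" "r \<in> J - I" "a \<in> Tri r"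
  shows "E A I \<otimes> a \<otimes> E A J = \<zero>"
proof -
  have r: "r \<in> S" and a: "a \<in> carrier R" using assms by auto
  have "E A I \<otimes> a \<otimes> E A J = (E A I \<otimes> f r) \<otimes> a \<otimes> (e r \<otimes> E A J)"
    using assms by (simp add: E_f_out[of A I r] e_E_in[of A J r] subset_iff)
  also have "\<dots> = E A I \<otimes> (f r \<otimes> a \<otimes> e r) \<otimes> E A J"
    using r a E_closed[OF assms(1,2)] E_closed[OF assms(1,3)] by (simp add: m_assoc)
  also have "\<dots> = \<zero>" using assms by simp
  finally show ?thesis .
qed

text \<open>
  The commutator \<open>[x\<^sub>s, e\<^sub>t]\<close> is block triangular for \<open>e\<^sub>r\<close>, so it disappears between \<open>E\<^sub>I\<close> and \<open>E\<^sub>J\<close>.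
\<close>

lemma transversal_commutes_e:
  assumes A: "A \<subseteq> S" "I \<subseteq> A" "J \<subseteq> A" "r \<in> J - I" and s: "s \<in> A" and t: "t \<in> S" "C s t" "C r t"
  shows "(E A I \<otimes> x s \<otimes> E A J) \<otimes> e t = e t \<otimes> (E A I \<otimes> x s \<otimes> E A J)"
proof -
  have S: "r \<in> S" "s \<in> S" using A s by auto
  have c: "E A I \<in> carrier R" "E A J \<in> carrier R" using A by auto
  have "x s \<otimes> e t \<ominus> e t \<otimes> x s \<in> Tri r"
    by (rule commutator_in_subring[OF Tri_subring[OF S(1)]]) (use S t e_Tri[of r s] x_Tri[of r t] in auto)
  from Tri_kill[OF A this]
  have "E A I \<otimes> (x s \<otimes> e t) \<otimes> E A J \<ominus> E A I \<otimes> (e t \<otimes> x s) \<otimes> E A J = \<zero>"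
    using S t c by (simp add: a_minus_def r_distr l_distr r_minus l_minus)
  then have eq: "E A I \<otimes> (x s \<otimes> e t) \<otimes> E A J = E A I \<otimes> (e t \<otimes> x s) \<otimes> E A J"
    using S t c by (simp add: r_right_minus_eq)
  have "(E A I \<otimes> x s \<otimes> E A J) \<otimes> e t = E A I \<otimes> (x s \<otimes> e t) \<otimes> E A J"
    using S t c e_E_comm[OF A(1,3) t(1)] by (simp add: m_assoc)
  also have "\<dots> = (E A I \<otimes> e t) \<otimes> x s \<otimes> E A J" unfolding eq using S t c by (simp add: m_assoc)
  also have "\<dots> = e t \<otimes> (E A I \<otimes> x s \<otimes> E A J)"
    unfolding e_E_comm[OF A(1,2) t(1)] using S t c by (simp add: m_assoc)
  finally show ?thesis .
qed

text \<open>
  Moving \<open>E\<^sub>I\<^sub>'\<close> to the left past \<open>x\<^sub>s\<close> costs a commutator that is block triangular for \<open>e\<^sub>r\<close> and is killed between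
  \<open>E\<^sub>I\<close> and \<open>E\<^sub>J\<close>. The result is symmetric in the two factors, since \<open>x\<^sub>s\<close> and \<open>x\<^sub>t\<close> commute.
\<close>

lemma transversal_mult:
  assumes A: "A \<subseteq> S" "I \<subseteq> A" "J \<subseteq> A" "r \<in> J - I" and s: "s \<in> A"
    and B: "B \<subseteq> S" "I' \<subseteq> B" "J' \<subseteq> B" "r' \<in> J' - I'" and t: "t \<in> B"
    and C: "\<And>a b. a \<in> A \<Longrightarrow> b \<in> B \<Longrightarrow> C a b" "\<And>a b. a \<in> A \<Longrightarrow> b \<in> B \<Longrightarrow> C b a"
  shows "(E A I \<otimes> x s \<otimes> E A J) \<otimes> (E B I' \<otimes> x t \<otimes> E B J') =
    E A I \<otimes> E B I' \<otimes> (x s \<otimes> x t) \<otimes> (E A J \<otimes> E B J')"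
proof -
  have S: "r \<in> S" "s \<in> S" "t \<in> S" "r \<in> A" "r' \<in> B" using A B s t by auto
  have c [simp]: "E A I \<in> carrier R" "E A J \<in> carrier R" "E B I' \<in> carrier R" "E B J' \<in> carrier R"
    "x s \<in> carrier R" "x t \<in> carrier R"
    using A B S by auto
  note TR = Tri_subring[OF S(1)]
  \<comment> \<open>The commutator with \<open>E\<^sub>I\<^sub>'\<close> is triangular because the commutators with the \<open>e\<^sub>b\<close> are.\<close>
  have "E B I' \<in> {b \<in> Tri r. x s \<otimes> b \<ominus> b \<otimes> x s \<in> Tri r}"
  proof (rule E_in_subring[OF commutator_subring[OF TR] B(1,2)])
    fix b assume b: "b \<in> B"
    then have "b \<in> S" using B by auto
    have "x s \<otimes> e b \<ominus> e b \<otimes> x s \<in> Tri r"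
      by (rule commutator_in_subring[OF TR]) (use S C b s \<open>b \<in> S\<close> e_Tri[of r s] x_Tri[of r b] in auto)
    then show "e b \<in> {b \<in> Tri r. x s \<otimes> b \<ominus> b \<otimes> x s \<in> Tri r}"
      using e_Tri[OF S(1) \<open>b \<in> S\<close>] by blast
  qed simp
  then have D: "x s \<otimes> E B I' \<ominus> E B I' \<otimes> x s \<in> Tri r" by blast
  have "E B J' \<in> Tri r" by (rule E_in_subring[OF TR B(1,3)]) (use B e_Tri[OF S(1)] in blast)
  moreover have "x t \<in> Tri r" using x_Tri[OF S(1,3)] C t S by blast
  ultimately have "(x s \<otimes> E B I' \<ominus> E B I' \<otimes> x s) \<otimes> x t \<otimes> E B J' \<in> Tri r"
    using D subringE(6)[OF TR] by blast
  from Tri_kill[OF A this]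
  have 0: "E A I \<otimes> ((x s \<otimes> E B I' \<ominus> E B I' \<otimes> x s) \<otimes> x t \<otimes> E B J') \<otimes> E A J = \<zero>" .
  have "(E B I' \<otimes> x t \<otimes> E B J') \<otimes> E A J = E A J \<otimes> (E B I' \<otimes> x t \<otimes> E B J')"
    using A B S C t by (intro commutes_with_E transversal_commutes_e[OF B]) auto
  then have "(E A I \<otimes> x s \<otimes> E A J) \<otimes> (E B I' \<otimes> x t \<otimes> E B J') =
      E A I \<otimes> x s \<otimes> ((E B I' \<otimes> x t \<otimes> E B J') \<otimes> E A J)"
    by (simp add: m_assoc)
  also have "\<dots> = E A I \<otimes> ((x s \<otimes> E B I') \<otimes> x t \<otimes> E B J') \<otimes> E A J"
    by (simp add: m_assoc)
  also have "x s \<otimes> E B I' = (x s \<otimes> E B I' \<ominus> E B I' \<otimes> x s) \<oplus> E B I' \<otimes> x s"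
    by (simp add: a_minus_def a_assoc l_neg)
  also have "E A I \<otimes> (((x s \<otimes> E B I' \<ominus> E B I' \<otimes> x s) \<oplus> E B I' \<otimes> x s) \<otimes> x t \<otimes> E B J') \<otimes> E A J =
      E A I \<otimes> ((x s \<otimes> E B I' \<ominus> E B I' \<otimes> x s) \<otimes> x t \<otimes> E B J') \<otimes> E A J \<oplus>
      E A I \<otimes> ((E B I' \<otimes> x s) \<otimes> x t \<otimes> E B J') \<otimes> E A J"
    by (simp add: l_distr r_distr)
  also have "\<dots> = E A I \<otimes> ((E B I' \<otimes> x s) \<otimes> x t \<otimes> E B J') \<otimes> E A J"
    unfolding 0 by simp
  also have "\<dots> = E A I \<otimes> E B I' \<otimes> (x s \<otimes> x t) \<otimes> (E B J' \<otimes> E A J)"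
    by (simp add: m_assoc)
  also have "E B J' \<otimes> E A J = E A J \<otimes> E B J'" using A B by (intro E_E_comm) auto
  finally show ?thesis .
qed

lemma transversal_commute:
  assumes A: "A \<subseteq> S" "I \<subseteq> A" "J \<subseteq> A" "r \<in> J - I" and s: "s \<in> A"
    and B: "B \<subseteq> S" "I' \<subseteq> B" "J' \<subseteq> B" "r' \<in> J' - I'" and t: "t \<in> B"
    and C: "\<And>a b. a \<in> A \<Longrightarrow> b \<in> B \<Longrightarrow> C a b" "\<And>a b. a \<in> A \<Longrightarrow> b \<in> B \<Longrightarrow> C b a"
  shows "(E A I \<otimes> x s \<otimes> E A J) \<otimes> (E B I' \<otimes> x t \<otimes> E B J') =
    (E B I' \<otimes> x t \<otimes> E B J') \<otimes> (E A I \<otimes> x s \<otimes> E A J)"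
proof -
  have "E A I \<otimes> E B I' = E B I' \<otimes> E A I" "E A J \<otimes> E B J' = E B J' \<otimes> E A J"
    using A B by (auto intro!: E_E_comm)
  moreover have "x s \<otimes> x t = x t \<otimes> x s" using xx_comm[of s t] A B C s t by blast
  moreover have "(E A I \<otimes> x s \<otimes> E A J) \<otimes> (E B I' \<otimes> x t \<otimes> E B J') =
      E A I \<otimes> E B I' \<otimes> (x s \<otimes> x t) \<otimes> (E A J \<otimes> E B J')"
    by (rule transversal_mult[OF A s B t]) (use C in auto)
  moreover have "(E B I' \<otimes> x t \<otimes> E B J') \<otimes> (E A I \<otimes> x s \<otimes> E A J) =
      E B I' \<otimes> E A I \<otimes> (x t \<otimes> x s) \<otimes> (E B J' \<otimes> E A J)"
    by (rule transversal_mult[OF B t A s]) (use C in auto)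
  ultimately show ?thesis by simp
qed

text \<open>
  An element \<open>X\<^sub>I\<^sub>J\<close> of a factor commutes with the \<open>E\<^sub>K\<close> of the other factor, and these sum up to 1. So it is a sum of
  elements \<open>X\<close> of the product, again for transversal edges.
\<close>

lemma transversal_split:
  assumes A: "A \<subseteq> S" "I \<subseteq> A" "J \<subseteq> A" "r \<in> J - I" and s: "s \<in> A"
    and B: "B \<subseteq> S" "A \<inter> B = {}"
    and C: "\<And>a b. a \<in> A \<Longrightarrow> b \<in> B \<Longrightarrow> C a b"
  shows "E A I \<otimes> x s \<otimes> E A J = (\<Oplus>K\<in>Pow B. E (A \<union> B) (I \<union> K) \<otimes> x s \<otimes> E (A \<union> B) (J \<union> K))"
proof -
  let ?Y = "E A I \<otimes> x s \<otimes> E A J"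
  have S: "r \<in> A" "s \<in> S" using A s by auto
  have c [simp]: "E A I \<in> carrier R" "E A J \<in> carrier R" "x s \<in> carrier R" using A S by auto
  have "finite B" using B finite_S finite_subset by blast
  then have fin: "finite (Pow B)" by simp
  \<comment> \<open>As \<open>?Y\<close> commutes with the idempotent \<open>E\<^sub>K\<close>, one of the two copies of \<open>E\<^sub>K\<close> is redundant.\<close>
  have summand: "E (A \<union> B) (I \<union> K) \<otimes> x s \<otimes> E (A \<union> B) (J \<union> K) = E B K \<otimes> ?Y" if K: "K \<subseteq> B" for K
  proof -
    have cK [simp]: "E B K \<in> carrier R" using B K by auto
    have "E (A \<union> B) (I \<union> K) \<otimes> x s \<otimes> E (A \<union> B) (J \<union> K) = (E B K \<otimes> E A I) \<otimes> x s \<otimes> (E A J \<otimes> E B K)"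
      using A B K by (simp add: E_Un E_E_comm[of A I B K])
    also have "\<dots> = E B K \<otimes> (?Y \<otimes> E B K)" by (simp add: m_assoc)
    also have "?Y \<otimes> E B K = E B K \<otimes> ?Y"
      using B K C S s by (intro commutes_with_E transversal_commutes_e[OF A]) auto
    also have "E B K \<otimes> (E B K \<otimes> ?Y) = E B K \<otimes> ?Y"
      using E_idem[of B K] B K by (simp flip: m_assoc)
    finally show ?thesis .
  qed
  have "(\<Oplus>K\<in>Pow B. E (A \<union> B) (I \<union> K) \<otimes> x s \<otimes> E (A \<union> B) (J \<union> K)) = (\<Oplus>K\<in>Pow B. E B K \<otimes> ?Y)"
    using B by (intro finsum_cong') (auto simp: summand)
  also have "\<dots> = (\<Oplus>K\<in>Pow B. E B K) \<otimes> ?Y"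
    using fin B by (intro finsum_ldistr[symmetric]) auto
  also have "\<dots> = ?Y" using E_sum[OF B(1)] by simp
  finally show ?thesis ..
qed

lemma E_split:
  assumes A: "A \<subseteq> S" "I \<subseteq> A" and B: "B \<subseteq> S" "A \<inter> B = {}"
  shows "E A I = (\<Oplus>K\<in>Pow B. E (A \<union> B) (I \<union> K))"
proof -
  have "finite B" using B finite_S finite_subset by blast
  then have fin: "finite (Pow B)" by simp
  have "(\<Oplus>K\<in>Pow B. E (A \<union> B) (I \<union> K)) = (\<Oplus>K\<in>Pow B. E A I \<otimes> E B K)"
    using A B by (intro finsum_cong') (auto simp: E_Un)
  also have "\<dots> = E A I \<otimes> (\<Oplus>K\<in>Pow B. E B K)"
    using fin A B by (intro finsum_rdistr[symmetric]) auto
  also have "\<dots> = E A I" using E_sum[OF B(1)] A by simp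
  finally show ?thesis ..
qed

abbreviation X_elem :: "'i \<Rightarrow> 'i set \<Rightarrow> 'i set \<Rightarrow> 'a" where
  "X_elem s I J \<equiv> E S I \<otimes> x s \<otimes> E S J"

lemma X_elem_zero:
  assumes "I \<subseteq> S" "J \<subseteq> S" "s \<in> S" "s \<notin> I - J"
  shows "X_elem s I J = \<zero>"
proof (cases "s \<in> I")
  case True
  then have "s \<in> J" using assms by auto
  then have "X_elem s I J = E S I \<otimes> (x s \<otimes> e s) \<otimes> E S J"
    using assms e_E_in[of S J s] by (simp add: m_assoc)
  then show ?thesis using assms by (simp add: xe)
next
  case False
  then have "X_elem s I J = (E S I \<otimes> e s) \<otimes> x s \<otimes> E S J" using assms ex[of s] by (simp add: m_assoc)
  also have "E S I \<otimes> e s = \<zero>" using E_e_out[of S I s] assms False by simp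
  finally show ?thesis using assms by simp
qed

text \<open>
  Between \<open>E\<^sub>I\<close> and \<open>E\<^sub>J\<close> the factors \<open>e\<^sub>s e\<^sub>t\<close> and \<open>(1 - e\<^sub>s) (1 - e\<^sub>t)\<close> in the relation \<open>x_indep\<close> are absorbed.
\<close>

lemma X_elem_indep:
  assumes "I \<subseteq> S" "J \<subseteq> S" "s \<in> I - J" "t \<in> I - J"
  shows "X_elem s I J = X_elem t I J"
proof -
  have S: "s \<in> S" "t \<in> S" using assms by auto
  have c [simp]: "E S I \<in> carrier R" "E S J \<in> carrier R" "x s \<in> carrier R" "x t \<in> carrier R"
    using S assms by auto
  have I: "E S I = E S I \<otimes> e s \<otimes> e t" using E_e_in[of S I] assms by simp
  have J: "E S J = f s \<otimes> (f t \<otimes> E S J)" using f_E_out[of S J] assms S by simp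
  have "X_elem u I J = E S I \<otimes> (e s \<otimes> (e t \<otimes> (x u \<otimes> (f s \<otimes> f t)))) \<otimes> E S J" if "u \<in> S" for u
  proof -
    have "X_elem u I J = (E S I \<otimes> e s \<otimes> e t) \<otimes> x u \<otimes> (f s \<otimes> (f t \<otimes> E S J))" using I J by simp
    then show ?thesis using that S by (simp add: m_assoc)
  qed
  then show ?thesis using x_indep[OF S] S by simp
qed

text \<open>
  If \<open>p \<in> I - J\<close> commutes with \<open>q \<in> J - I\<close>, then \<open>x\<^sub>p\<close> is block triangular for \<open>e\<^sub>q\<close>.
\<close>

lemma X_elem_nonedge:
  assumes IJ: "I \<subseteq> S" "J \<subseteq> S" "s \<in> I - J" and pq: "p \<in> I - J" "q \<in> J - I" "C q p"
  shows "X_elem s I J = \<zero>"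
proof -
  have S: "p \<in> S" "q \<in> S" using assms by auto
  have "X_elem s I J = X_elem p I J" by (rule X_elem_indep[OF IJ pq(1)])
  also have "\<dots> = \<zero>" using Tri_kill[OF subset_refl IJ(1,2) pq(2) x_Tri[OF S(2,1) pq(3)]] .
  finally show ?thesis .
qed

lemma x_decomp:
  assumes s: "s \<in> S"
  shows "x s = (\<Oplus>I\<in>Pow S. \<Oplus>J\<in>Pow S. X_elem s I J)"
proof -
  have fin: "finite (Pow S)" using finite_S by simp
  have "(\<Oplus>I\<in>Pow S. \<Oplus>J\<in>Pow S. X_elem s I J) = (\<Oplus>I\<in>Pow S. E S I \<otimes> x s)"
  proof (intro finsum_cong')
    fix I assume I: "I \<in> Pow S"
    have "(\<Oplus>J\<in>Pow S. X_elem s I J) = E S I \<otimes> x s \<otimes> (\<Oplus>J\<in>Pow S. E S J)"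
      using fin I s by (intro finsum_rdistr[symmetric]) auto
    then show "(\<Oplus>J\<in>Pow S. X_elem s I J) = E S I \<otimes> x s" using E_sum[of S] I s by simp
  qed (use s in auto)
  also have "\<dots> = (\<Oplus>I\<in>Pow S. E S I) \<otimes> x s"
    using fin s by (intro finsum_ldistr[symmetric]) auto
  also have "\<dots> = x s" using E_sum[of S] s by simp
  finally show ?thesis ..
qed

lemma e_decomp:
  assumes s: "s \<in> S"
  shows "e s = (\<Oplus>I\<in>Pow S. if s \<in> I then E S I else \<zero>)"
proof -
  have fin: "finite (Pow S)" using finite_S by simp
  have "(\<Oplus>I\<in>Pow S. if s \<in> I then E S I else \<zero>) = (\<Oplus>I\<in>Pow S. e s \<otimes> E S I)"
    using s by (intro finsum_cong') (auto simp: e_E_in e_E_out)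
  also have "\<dots> = e s \<otimes> (\<Oplus>I\<in>Pow S. E S I)"
    using fin s by (intro finsum_rdistr[symmetric]) auto
  also have "\<dots> = e s" using E_sum[of S] s by simp
  finally show ?thesis ..
qed

end

section \<open>Free algebras and coefficients of braid words\<close>

text \<open>
  The push-forward of \<open>\<Sum> c\<^sub>u u\<close> to \<open>\<Sum> \<phi>(c\<^sub>u) g(u)\<close>; on monoid algebras it is a ring homomorphism when \<open>g\<close> is a monoid
  homomorphism and \<open>\<phi>\<close> a ring homomorphism.
\<close>

definition pm_transform :: "('u \<Rightarrow> 'w) \<Rightarrow> ('c \<Rightarrow> 'd) \<Rightarrow> ('u \<Rightarrow>\<^sub>0 'c::zero) \<Rightarrow> ('w \<Rightarrow>\<^sub>0 'd::comm_monoid_add)" where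
  "pm_transform g \<phi> p = (\<Sum>u\<in>Poly_Mapping.keys p. Poly_Mapping.single (g u) (\<phi> (Poly_Mapping.lookup p u)))"

lemma poly_mapping_sum_single:
  "(\<Sum>u\<in>Poly_Mapping.keys p. Poly_Mapping.single u (Poly_Mapping.lookup p u)) = p"
proof (rule poly_mapping_eqI)
  fix w
  have "(\<Sum>u\<in>Poly_Mapping.keys p. Poly_Mapping.lookup (Poly_Mapping.single u (Poly_Mapping.lookup p u)) w) =
      (\<Sum>u\<in>Poly_Mapping.keys p. if u = w then Poly_Mapping.lookup p u else 0)"
    by (intro sum.cong) (auto simp: lookup_single)
  then show "Poly_Mapping.lookup (\<Sum>u\<in>Poly_Mapping.keys p. Poly_Mapping.single u (Poly_Mapping.lookup p u)) w =
      Poly_Mapping.lookup p w"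
    by (auto simp: lookup_sum in_keys_iff)
qed

lemma poly_mapping_mult_sum:
  fixes p q :: "'u::monoid_add \<Rightarrow>\<^sub>0 'c::semiring_0"
  shows "p * q = (\<Sum>u\<in>Poly_Mapping.keys p. \<Sum>w\<in>Poly_Mapping.keys q.
    Poly_Mapping.single (u + w) (Poly_Mapping.lookup p u * Poly_Mapping.lookup q w))"
proof -
  have "p * q = (\<Sum>u\<in>Poly_Mapping.keys p. Poly_Mapping.single u (Poly_Mapping.lookup p u)) *
      (\<Sum>w\<in>Poly_Mapping.keys q. Poly_Mapping.single w (Poly_Mapping.lookup q w))"
    by (simp only: poly_mapping_sum_single)
  then show ?thesis by (simp add: sum_product mult_single)
qed

lemma pm_transform_superset:
  assumes "\<phi> 0 = 0" "finite Z" "Poly_Mapping.keys p \<subseteq> Z"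
  shows "pm_transform g \<phi> p = (\<Sum>u\<in>Z. Poly_Mapping.single (g u) (\<phi> (Poly_Mapping.lookup p u)))"
  unfolding pm_transform_def using assms
  by (intro sum.mono_neutral_left) (auto simp: in_keys_iff)

lemma pm_transform_single: "\<phi> 0 = 0 \<Longrightarrow> pm_transform g \<phi> (Poly_Mapping.single u c) = Poly_Mapping.single (g u) (\<phi> c)"
  using pm_transform_superset[of \<phi> "{u}" "Poly_Mapping.single u c" g] by (simp add: lookup_single)

lemma pm_transform_zero: "pm_transform g \<phi> 0 = 0"
  by (simp add: pm_transform_def)

lemma pm_transform_add:
  assumes "\<phi> 0 = 0" "\<And>a b. \<phi> (a + b) = \<phi> a + \<phi> b"
  shows "pm_transform g \<phi> (p + q) = pm_transform g \<phi> p + pm_transform g \<phi> q"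
proof -
  let ?Z = "Poly_Mapping.keys p \<union> Poly_Mapping.keys q"
  have "pm_transform g \<phi> r = (\<Sum>u\<in>?Z. Poly_Mapping.single (g u) (\<phi> (Poly_Mapping.lookup r u)))"
    if "Poly_Mapping.keys r \<subseteq> ?Z" for r
    using that by (intro pm_transform_superset assms(1)) auto
  then show ?thesis using Poly_Mapping.keys_add[of p q]
    by (simp add: assms(2) lookup_add single_add sum.distrib)
qed

lemma pm_transform_sum:
  assumes "\<phi> 0 = 0" "\<And>a b. \<phi> (a + b) = \<phi> a + \<phi> b" "finite Z"
  shows "pm_transform g \<phi> (\<Sum>z\<in>Z. p z) = (\<Sum>z\<in>Z. pm_transform g \<phi> (p z))"
  using assms(3) by (induction Z) (simp_all add: pm_transform_zero pm_transform_add[of \<phi>] assms)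

lemma pm_transform_mult:
  fixes \<phi> :: "'c::semiring_0 \<Rightarrow> 'd::semiring_0"
  assumes "\<phi> 0 = 0" "\<And>a b. \<phi> (a + b) = \<phi> a + \<phi> b" "\<And>a b. \<phi> (a * b) = \<phi> a * \<phi> b"
    and "\<And>u w. g (u + w) = g u + g w"
  shows "pm_transform g \<phi> (p * q) = pm_transform g \<phi> p * pm_transform g \<phi> q"
proof -
  have "pm_transform g \<phi> (p * q) = (\<Sum>u\<in>Poly_Mapping.keys p. \<Sum>w\<in>Poly_Mapping.keys q.
    Poly_Mapping.single (g u + g w) (\<phi> (Poly_Mapping.lookup p u) * \<phi> (Poly_Mapping.lookup q w)))"
    unfolding poly_mapping_mult_sum[of p q]
    by (simp add: pm_transform_sum[of \<phi>] assms pm_transform_single[of \<phi>])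
  then show ?thesis by (simp add: pm_transform_def sum_product mult_single)
qed

lemma map_eq_pm_transform:
  assumes "\<phi> 0 = 0"
  shows "Poly_Mapping.map \<phi> p = pm_transform (\<lambda>u. u) \<phi> p"
proof (rule poly_mapping_eqI)
  fix w
  have "Poly_Mapping.lookup (pm_transform (\<lambda>u. u) \<phi> p) w =
      (\<Sum>u\<in>Poly_Mapping.keys p. if u = w then \<phi> (Poly_Mapping.lookup p u) else 0)"
    unfolding pm_transform_def lookup_sum by (intro sum.cong) (auto simp: lookup_single)
  then show "Poly_Mapping.lookup (Poly_Mapping.map \<phi> p) w = Poly_Mapping.lookup (pm_transform (\<lambda>u. u) \<phi> p) w"
    using assms by (auto simp: Poly_Mapping.map.rep_eq in_keys_iff when_def)
qed

definition rename_letters :: "('s \<Rightarrow> 't) \<Rightarrow> ('s, 'c::ring_1) free_alg \<Rightarrow> ('t, 'c) free_alg" where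
  "rename_letters \<iota> = pm_transform (map_fmon (map_wgen \<iota>)) (\<lambda>c. c)"

definition of_int_coeffs :: "('s, int) free_alg \<Rightarrow> ('s, 'c::ring_1) free_alg" where
  "of_int_coeffs = Poly_Mapping.map of_int"

lemma map_fmon_add: "map_fmon h (u + w) = map_fmon h u + map_fmon h w"
  by (cases u; cases w) (simp add: plus_fmon_def)

lemma map_fmon_zero: "map_fmon h 0 = 0"
  by (simp add: zero_fmon_def)

lemma rename_letters_simps:
  "rename_letters \<iota> (p + q) = rename_letters \<iota> p + rename_letters \<iota> q"
  "rename_letters \<iota> (p * q) = rename_letters \<iota> p * rename_letters \<iota> q"
  "rename_letters \<iota> 1 = 1"
  "rename_letters \<iota> (free_e s) = free_e (\<iota> s)"
  "rename_letters \<iota> (free_x s) = free_x (\<iota> s)"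
  "rename_letters \<iota> (Poly_Mapping.single 0 c) = Poly_Mapping.single 0 c"
proof -
  show "rename_letters \<iota> (p + q) = rename_letters \<iota> p + rename_letters \<iota> q"
    by (simp add: rename_letters_def pm_transform_add)
  show "rename_letters \<iota> (p * q) = rename_letters \<iota> p * rename_letters \<iota> q"
    by (simp add: rename_letters_def pm_transform_mult map_fmon_add)
  show c: "rename_letters \<iota> (Poly_Mapping.single 0 c) = Poly_Mapping.single 0 c" for c
    by (simp add: rename_letters_def pm_transform_single map_fmon_zero)
  show "rename_letters \<iota> 1 = 1" using c[of 1] by (simp only: single_one)
  show "rename_letters \<iota> (free_e s) = free_e (\<iota> s)" "rename_letters \<iota> (free_x s) = free_x (\<iota> s)"
    by (simp_all add: rename_letters_def pm_transform_single free_e_def free_x_def)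
qed

lemma of_int_coeffs_simps:
  "of_int_coeffs (p + q) = of_int_coeffs p + of_int_coeffs q"
  "of_int_coeffs (p * q) = of_int_coeffs p * of_int_coeffs q"
  "of_int_coeffs 1 = 1"
  "of_int_coeffs (free_e s) = free_e s"
  "of_int_coeffs (free_x s) = free_x s"
  "of_int_coeffs (p - q) = of_int_coeffs p - of_int_coeffs q"
proof -
  have t: "of_int_coeffs = pm_transform (\<lambda>u. u) of_int"
    by (rule ext) (simp add: of_int_coeffs_def map_eq_pm_transform)
  show add: "of_int_coeffs (p + q) = of_int_coeffs p + of_int_coeffs q" for p q
    unfolding t by (rule pm_transform_add) auto
  show "of_int_coeffs (p - q) = of_int_coeffs p - of_int_coeffs q"
    by (simp add: eq_diff_eq flip: add)
  show "of_int_coeffs (p * q) = of_int_coeffs p * of_int_coeffs q"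
    unfolding t by (rule pm_transform_mult) auto
  have "of_int_coeffs (Poly_Mapping.single 0 1) = Poly_Mapping.single 0 1"
    unfolding t by (subst pm_transform_single) auto
  then show "of_int_coeffs 1 = 1" by (simp only: single_one)
  show "of_int_coeffs (free_e s) = free_e s" "of_int_coeffs (free_x s) = free_x s"
    unfolding t free_e_def free_x_def by (subst pm_transform_single; simp)+
qed

text \<open>
  The coefficient of \<open>v\<^sup>\<gamma>\<close> in the product of the \<open>T\<^sub>s = - v\<^sup>-\<^sup>1 e\<^sub>s + v (1 - e\<^sub>s) + x\<^sub>s\<close> over a word. The recursion makes
  sense in every ring, so that homomorphisms can be applied to it coefficient by coefficient.
\<close>

primrec word_coeff :: "('a, 'm) ring_scheme \<Rightarrow> ('s \<Rightarrow> 'a) \<Rightarrow> ('s \<Rightarrow> 'a) \<Rightarrow> 's list \<Rightarrow> int \<Rightarrow> 'a" where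
  "word_coeff R e x [] \<gamma> = (if \<gamma> = 0 then \<one>\<^bsub>R\<^esub> else \<zero>\<^bsub>R\<^esub>)"
| "word_coeff R e x (s # ws) \<gamma> =
     \<ominus>\<^bsub>R\<^esub> (e s \<otimes>\<^bsub>R\<^esub> word_coeff R e x ws (\<gamma> + 1)) \<oplus>\<^bsub>R\<^esub>
     (\<one>\<^bsub>R\<^esub> \<ominus>\<^bsub>R\<^esub> e s) \<otimes>\<^bsub>R\<^esub> word_coeff R e x ws (\<gamma> - 1) \<oplus>\<^bsub>R\<^esub>
     x s \<otimes>\<^bsub>R\<^esub> word_coeff R e x ws \<gamma>"

lemma ring_from_type_ring_1: "ring (ring_of_type_algebra :: 'a::ring_1 ring)"
proof -
  have "\<exists>y. x + y = 0" for x :: 'a using add.right_inverse by blast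
  then show ?thesis
    unfolding ring_of_type_algebra_def
    by unfold_locales (auto simp: algebra_simps Units_def intro: exI[of _ "- _"])
qed

lemma type_ring_simps:
  "carrier (ring_of_type_algebra :: 'a::ring_1 ring) = UNIV"
  "x \<otimes>\<^bsub>ring_of_type_algebra\<^esub> y = x * (y :: 'a)"
  "x \<oplus>\<^bsub>ring_of_type_algebra\<^esub> y = x + y"
  "\<one>\<^bsub>ring_of_type_algebra\<^esub> = (1 :: 'a)"
  "\<zero>\<^bsub>ring_of_type_algebra\<^esub> = (0 :: 'a)"
  "\<ominus>\<^bsub>ring_of_type_algebra\<^esub> x = - x"
  "x \<ominus>\<^bsub>ring_of_type_algebra\<^esub> y = x - y"
proof -
  interpret ring "ring_of_type_algebra :: 'a ring" by (rule ring_from_type_ring_1)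
  show neg: "\<ominus>\<^bsub>ring_of_type_algebra\<^esub> x = - x" for x :: 'a
    by (rule minus_equality) (auto simp: ring_of_type_algebra_def)
  show "x \<ominus>\<^bsub>ring_of_type_algebra\<^esub> y = x - y"
    by (simp add: a_minus_def neg) (simp add: ring_of_type_algebra_def)
qed (auto simp: ring_of_type_algebra_def)

lemma lookup_single_times:
  fixes a :: "'a::semiring_0" and q :: "int \<Rightarrow>\<^sub>0 'a"
  shows "Poly_Mapping.lookup (Poly_Mapping.single n a * q) \<gamma> = a * Poly_Mapping.lookup q (\<gamma> - n)"
proof -
  have shift: "n + m = \<gamma> \<longleftrightarrow> m = \<gamma> - n" for m by auto
  have "Poly_Mapping.single n a * q =
      (\<Sum>m\<in>Poly_Mapping.keys q. Poly_Mapping.single n a * Poly_Mapping.single m (Poly_Mapping.lookup q m))"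
    unfolding sum_distrib_left[symmetric] poly_mapping_sum_single ..
  then have "Poly_Mapping.lookup (Poly_Mapping.single n a * q) \<gamma> =
      (\<Sum>m\<in>Poly_Mapping.keys q. if m = \<gamma> - n then a * Poly_Mapping.lookup q m else 0)"
    by (simp only: mult_single lookup_sum lookup_single) (simp only: when_def shift)
  then show ?thesis by (auto simp: in_keys_iff)
qed

lemma lookup_iota_times:
  "Poly_Mapping.lookup (iota_T s * q) \<gamma> = - (free_e s * Poly_Mapping.lookup q (\<gamma> + 1)) +
     (1 - free_e s) * Poly_Mapping.lookup q (\<gamma> - 1) + free_x s * Poly_Mapping.lookup q \<gamma>"
proof -
  have "iota_T s * q = - (Poly_Mapping.single (-1) (free_e s) * q) +
      Poly_Mapping.single 1 (1 - free_e s) * q + Poly_Mapping.single 0 (free_x s) * q"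
    by (simp add: iota_T_def distrib_right left_diff_distrib)
  then show ?thesis by (simp add: lookup_add lookup_minus lookup_single_times)
qed

lemma word_coeff_iota:
  "Poly_Mapping.lookup (prod_list (map iota_T ws)) \<gamma> = word_coeff ring_of_type_algebra free_e free_x ws \<gamma>"
proof (induction ws arbitrary: \<gamma>)
  case Nil
  then show ?case by (simp add: type_ring_simps lookup_one when_def)
next
  case (Cons s ws)
  show ?case by (simp add: lookup_iota_times Cons.IH type_ring_simps)
qed

lemma word_coeff_closed:
  assumes "ring R" "\<And>s. s \<in> set ws \<Longrightarrow> e s \<in> carrier R" "\<And>s. s \<in> set ws \<Longrightarrow> x s \<in> carrier R"
  shows "word_coeff R e x ws \<gamma> \<in> carrier R"
proof -
  interpret ring R by fact
  show ?thesis using assms(2,3) by (induction ws arbitrary: \<gamma>) auto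
qed

lemma word_coeff_hom:
  assumes R: "ring R" and R': "ring R'" and h: "h \<in> Ring.ring_hom R R'"
    and c: "\<And>s. s \<in> set ws \<Longrightarrow> e s \<in> carrier R" "\<And>s. s \<in> set ws \<Longrightarrow> x s \<in> carrier R"
    and he: "\<And>s. s \<in> set ws \<Longrightarrow> h (e s) = e' (\<iota> s)" "\<And>s. s \<in> set ws \<Longrightarrow> h (x s) = x' (\<iota> s)"
  shows "h (word_coeff R e x ws \<gamma>) = word_coeff R' e' x' (map \<iota> ws) \<gamma>"
proof -
  interpret ring_hom_ring R R' h by (intro ring_hom_ringI2 R R' h)
  show ?thesis using c he
  proof (induction ws arbitrary: \<gamma>)
    case (Cons s ws)
    have cl: "word_coeff R e x ws \<gamma> \<in> carrier R" for \<gamma>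
      using Cons.prems by (intro word_coeff_closed R) auto
    have m: "e s \<in> carrier R" "x s \<in> carrier R" "h (e s) = e' (\<iota> s)" "h (x s) = x' (\<iota> s)"
      using Cons.prems by auto
    have "e' (\<iota> s) \<in> carrier R'" using m hom_closed by metis
    then show ?case using Cons cl m by (simp add: a_minus_def)
  qed simp
qed

lemma set_alternating: "set (alternating n s t) \<subseteq> {s, t}"
  by (induction n arbitrary: s t) auto

lemma map_alternating: "map \<iota> (alternating n s t) = alternating n (\<iota> s) (\<iota> t)"
  by (induction n arbitrary: s t) auto

lemma length_alternating: "length (alternating n s t) = n"
  by (induction n arbitrary: s t) auto

section \<open>The presentation of the W-graph algebra\<close>

locale good_coeffs =
  fixes K :: "complex set"
  assumes K_subring: "subring K (ring_of_type_algebra :: complex ring)"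
begin

lemma K_closed:
  "0 \<in> K" "1 \<in> K" "a \<in> K \<Longrightarrow> - a \<in> K" "a \<in> K \<Longrightarrow> b \<in> K \<Longrightarrow> a * b \<in> K" "a \<in> K \<Longrightarrow> b \<in> K \<Longrightarrow> a + b \<in> K"
  using subringE[OF K_subring] by (auto simp: type_ring_simps)

lemma K_sum: "(\<And>i. i \<in> Z \<Longrightarrow> c i \<in> K) \<Longrightarrow> (\<Sum>i\<in>Z. c i) \<in> K"
  by (induction Z rule: infinite_finite_induct) (auto simp: K_closed)

abbreviation FC :: "'s set \<Rightarrow> ('s, complex) free_alg set" where
  "FC S \<equiv> carrier (free_ring K S)"

lemma FC_iff: "p \<in> FC S \<longleftrightarrow> (\<forall>w. Poly_Mapping.lookup p w \<in> K) \<and>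
    (\<forall>w\<in>Poly_Mapping.keys p. set (letters w) \<subseteq> Gen_e ` S \<union> Gen_x ` S)"
  by (auto simp: free_ring_def)

lemma FC_subring: "subring (FC S) (ring_of_type_algebra :: ('s, complex) free_alg ring)"
proof -
  interpret ring "ring_of_type_algebra :: ('s, complex) free_alg ring" by (rule ring_from_type_ring_1)
  show ?thesis
  proof (rule subringI)
    show "FC S \<subseteq> carrier ring_of_type_algebra" by (simp add: type_ring_simps)
    have "(1 :: ('s, complex) free_alg) \<in> FC S"
      by (auto simp: FC_iff lookup_one when_def K_closed zero_fmon_def split: if_splits)
    then show "\<one>\<^bsub>ring_of_type_algebra\<^esub> \<in> FC S" by (simp add: type_ring_simps)
    fix p q assume p: "p \<in> FC S"
    show "\<ominus>\<^bsub>ring_of_type_algebra\<^esub> p \<in> FC S"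
      using p by (auto simp: type_ring_simps FC_iff K_closed in_keys_iff)
    assume q: "q \<in> FC S"
    have "set (letters w) \<subseteq> Gen_e ` S \<union> Gen_x ` S" if w: "w \<in> Poly_Mapping.keys (p + q)" for w
      using p q w Poly_Mapping.keys_add[of p q] unfolding FC_iff by blast
    then have "p + q \<in> FC S" using p q by (simp add: FC_iff lookup_add K_closed)
    then show "p \<oplus>\<^bsub>ring_of_type_algebra\<^esub> q \<in> FC S" by (simp add: type_ring_simps)
    have "Poly_Mapping.lookup (p * q) w \<in> K" for w
      using p q unfolding poly_mapping_mult_sum[of p q] lookup_sum lookup_single when_def
      by (intro K_sum) (simp add: FC_iff K_closed)
    moreover have "set (letters w) \<subseteq> Gen_e ` S \<union> Gen_x ` S" if w: "w \<in> Poly_Mapping.keys (p * q)" for w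
    proof -
      obtain a b where "a \<in> Poly_Mapping.keys p" "b \<in> Poly_Mapping.keys q" "w = a + b"
        using w keys_mult[of p q] by blast
      then have "set (letters a) \<subseteq> Gen_e ` S \<union> Gen_x ` S" "set (letters b) \<subseteq> Gen_e ` S \<union> Gen_x ` S"
        "w = a + b" using p q by (auto simp: FC_iff)
      then show ?thesis by (simp add: plus_fmon_def)
    qed
    ultimately have "p * q \<in> FC S" by (simp add: FC_iff)
    then show "p \<otimes>\<^bsub>ring_of_type_algebra\<^esub> q \<in> FC S" by (simp add: type_ring_simps)
  qed
qed

lemma free_ring_ring: "ring (free_ring K S)"
proof -
  interpret ring "ring_of_type_algebra :: ('s, complex) free_alg ring" by (rule ring_from_type_ring_1)
  have "free_ring K S = ring_of_type_algebra\<lparr>carrier := FC S\<rparr>" by (simp add: free_ring_def)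
  then show ?thesis using subring_is_ring[OF FC_subring[of S]] by simp
qed

lemma free_ring_simps:
  "p \<otimes>\<^bsub>free_ring K S\<^esub> q = p * q"
  "p \<oplus>\<^bsub>free_ring K S\<^esub> q = p + q"
  "\<one>\<^bsub>free_ring K S\<^esub> = 1"
  "\<zero>\<^bsub>free_ring K S\<^esub> = 0"
  by (auto simp: free_ring_def ring_of_type_algebra_def)

lemma FC_closed:
  "0 \<in> FC S" "1 \<in> FC S" "p \<in> FC S \<Longrightarrow> q \<in> FC S \<Longrightarrow> p + q \<in> FC S"
  "p \<in> FC S \<Longrightarrow> q \<in> FC S \<Longrightarrow> p * q \<in> FC S" "p \<in> FC S \<Longrightarrow> - p \<in> FC S"
  "p \<in> FC S \<Longrightarrow> q \<in> FC S \<Longrightarrow> p - q \<in> FC S"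
proof -
  note R = subringE[OF FC_subring[of S], unfolded type_ring_simps]
  show "0 \<in> FC S" by (rule R(2))
  show "1 \<in> FC S" by (rule R(3))
  show "p \<in> FC S \<Longrightarrow> q \<in> FC S \<Longrightarrow> p + q \<in> FC S" by (rule R(7))
  show "p \<in> FC S \<Longrightarrow> q \<in> FC S \<Longrightarrow> p * q \<in> FC S" by (rule R(6))
  show "p \<in> FC S \<Longrightarrow> - p \<in> FC S" by (rule R(5))
  show "p \<in> FC S \<Longrightarrow> q \<in> FC S \<Longrightarrow> p - q \<in> FC S"
    using R(7)[of p "- q"] R(5)[of q] by simp
qed

lemma free_ring_minus:
  assumes "p \<in> FC S" shows "\<ominus>\<^bsub>free_ring K S\<^esub> p = - p"
proof -
  interpret ring "free_ring K S" by (rule free_ring_ring)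
  show ?thesis using assms by (intro minus_equality) (auto simp: free_ring_simps FC_closed)
qed

lemma FC_gens:
  "s \<in> S \<Longrightarrow> free_e s \<in> FC S" "s \<in> S \<Longrightarrow> free_x s \<in> FC S" "c \<in> K \<Longrightarrow> Poly_Mapping.single 0 c \<in> FC S"
  by (auto simp: FC_iff free_e_def free_x_def lookup_single when_def K_closed zero_fmon_def)

text \<open>
  Induction over polynomials in noncommuting letters, in the form in which it yields generation statements.
\<close>

lemma FC_induct:
  assumes H: "subring H (free_ring K S)"
    and g: "\<And>s. s \<in> S \<Longrightarrow> free_e s \<in> H" "\<And>s. s \<in> S \<Longrightarrow> free_x s \<in> H"
    and c: "\<And>c. c \<in> K \<Longrightarrow> Poly_Mapping.single 0 c \<in> H"
  shows "FC S \<subseteq> H"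
proof
  note HR = subringE[OF H, unfolded free_ring_simps]
  have mono: "Poly_Mapping.single (Fmon ls) 1 \<in> H" if "set ls \<subseteq> Gen_e ` S \<union> Gen_x ` S" for ls
    using that
  proof (induction ls)
    case Nil
    then show ?case using HR(3) by (simp only: single_one flip: zero_fmon_def)
  next
    case (Cons l ls)
    have "Poly_Mapping.single (Fmon (l # ls)) (1::complex) = Poly_Mapping.single (Fmon [l]) 1 * Poly_Mapping.single (Fmon ls) 1"
      by (simp add: mult_single plus_fmon_def)
    moreover have "Poly_Mapping.single (Fmon [l]) 1 \<in> H"
      using Cons.prems g by (auto simp: free_e_def free_x_def)
    ultimately show ?case using Cons HR(6) by simp
  qed
  fix p assume p: "p \<in> FC S"
  have sg: "Poly_Mapping.single u (Poly_Mapping.lookup p u) \<in> H" if u: "u \<in> Poly_Mapping.keys p" for u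
  proof -
    have "Poly_Mapping.single u (Poly_Mapping.lookup p u) =
        Poly_Mapping.single 0 (Poly_Mapping.lookup p u) * Poly_Mapping.single (Fmon (letters u)) 1"
      by (simp add: mult_single)
    moreover have "Poly_Mapping.lookup p u \<in> K" "set (letters u) \<subseteq> Gen_e ` S \<union> Gen_x ` S"
      using p u by (auto simp: FC_iff)
    ultimately show ?thesis using c mono[of "letters u"] HR(6) by metis
  qed
  have "(\<Sum>u\<in>Z. Poly_Mapping.single u (Poly_Mapping.lookup p u)) \<in> H" if "Z \<subseteq> Poly_Mapping.keys p" for Z
    using finite_subset[OF that finite_keys] that
    by (induction Z) (use HR sg in auto)
  from this[OF subset_refl] show "p \<in> H" by (simp only: poly_mapping_sum_single)
qed

end

text \<open>
  With the relations stated for elements of an arbitrary ring, the W-graph algebra is determined by its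
  universal property (\<open>Omega_relations\<close>, \<open>Omega_universal\<close>, \<open>Omega_generated\<close>).
\<close>

definition satisfies_relations ::
    "('r, 'n) ring_scheme \<Rightarrow> ('s, 'm) monoid_scheme \<Rightarrow> 's set \<Rightarrow> ('s \<Rightarrow> 'r) \<Rightarrow> ('s \<Rightarrow> 'r) \<Rightarrow> bool" where
  "satisfies_relations R G S e x \<longleftrightarrow>
     (\<forall>s\<in>S. e s \<in> carrier R \<and> x s \<in> carrier R \<and> e s \<otimes>\<^bsub>R\<^esub> e s = e s \<and>
        e s \<otimes>\<^bsub>R\<^esub> x s = x s \<and> x s \<otimes>\<^bsub>R\<^esub> e s = \<zero>\<^bsub>R\<^esub>) \<and>
     (\<forall>s\<in>S. \<forall>t\<in>S. e s \<otimes>\<^bsub>R\<^esub> e t = e t \<otimes>\<^bsub>R\<^esub> e s) \<and>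
     (\<forall>s\<in>S. \<forall>t\<in>S. \<forall>\<gamma>. group.ord G (s \<otimes>\<^bsub>G\<^esub> t) \<noteq> 0 \<longrightarrow>
        word_coeff R e x (alternating (group.ord G (s \<otimes>\<^bsub>G\<^esub> t)) s t) \<gamma> =
        word_coeff R e x (alternating (group.ord G (s \<otimes>\<^bsub>G\<^esub> t)) t s) \<gamma>)"

context good_coeffs
begin

lemma of_int_word_coeff:
  assumes "set ws \<subseteq> S"
  shows "of_int_coeffs (word_coeff ring_of_type_algebra free_e free_x ws \<gamma>) =
    word_coeff (free_ring K S) free_e free_x ws \<gamma>"
proof -
  have "of_int_coeffs \<in> Ring.ring_hom ring_of_type_algebra ring_of_type_algebra"
    by (rule ring_hom_memI) (auto simp: type_ring_simps of_int_coeffs_simps)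
  then have 1: "of_int_coeffs (word_coeff ring_of_type_algebra free_e free_x ws \<gamma>) =
      word_coeff ring_of_type_algebra free_e free_x (map id ws) \<gamma>"
    by (intro word_coeff_hom ring_from_type_ring_1) (auto simp: type_ring_simps of_int_coeffs_simps)
  have h: "(\<lambda>p. p) \<in> Ring.ring_hom (free_ring K S) ring_of_type_algebra"
    by (simp add: Ring.ring_hom_def type_ring_simps free_ring_simps)
  have "word_coeff (free_ring K S) free_e free_x ws \<gamma> =
      word_coeff ring_of_type_algebra free_e free_x (map id ws) \<gamma>"
    using assms by (intro word_coeff_hom[OF free_ring_ring ring_from_type_ring_1 h]) (auto intro: FC_gens)
  then show ?thesis using 1 by simp
qed

lemma y_coeff_of_int:
  assumes "s \<in> S" "t \<in> S"
  shows "of_int_coeffs (y_coeff G s t \<gamma>) =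
    word_coeff (free_ring K S) free_e free_x (alternating (group.ord G (s \<otimes>\<^bsub>G\<^esub> t)) s t) \<gamma> -
    word_coeff (free_ring K S) free_e free_x (alternating (group.ord G (s \<otimes>\<^bsub>G\<^esub> t)) t s) \<gamma>"
proof -
  let ?m = "group.ord G (s \<otimes>\<^bsub>G\<^esub> t)"
  have st: "set (alternating ?m s t) \<subseteq> S" "set (alternating ?m t s) \<subseteq> S"
    using set_alternating[of ?m] assms by fastforce+
  show ?thesis
    unfolding y_coeff_def Let_def lookup_minus of_int_coeffs_simps(6) word_coeff_iota of_int_word_coeff[OF st(1)]
      of_int_word_coeff[OF st(2)] ..
qed

lemma wgraph_relations_of_int:
  fixes S :: "'s set"
  shows "of_int_coeffs ` wgraph_relations G S =
     {free_e s * free_e s - free_e s | s. s \<in> S} \<union>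
     {free_e s * free_e t - free_e t * free_e s | s t. s \<in> S \<and> t \<in> S} \<union>
     {free_e s * free_x s - free_x s | s. s \<in> S} \<union>
     {free_x s * free_e s | s. s \<in> S} \<union>
     {word_coeff (free_ring K S) free_e free_x (alternating (group.ord G (s \<otimes>\<^bsub>G\<^esub> t)) s t) \<gamma> -
      word_coeff (free_ring K S) free_e free_x (alternating (group.ord G (s \<otimes>\<^bsub>G\<^esub> t)) t s) \<gamma>
      | s t \<gamma>. s \<in> S \<and> t \<in> S \<and> group.ord G (s \<otimes>\<^bsub>G\<^esub> t) \<noteq> 0}" (is "_ = ?R")
proof -
  have "of_int_coeffs ` {free_e s * free_e s - free_e s | s. s \<in> S} =
      ({of_int_coeffs (free_e s * free_e s - free_e s) | s. s \<in> S} :: ('s, complex) free_alg set)"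
    "of_int_coeffs ` {free_e s * free_e t - free_e t * free_e s | s t. s \<in> S \<and> t \<in> S} =
      ({of_int_coeffs (free_e s * free_e t - free_e t * free_e s) | s t. s \<in> S \<and> t \<in> S} :: ('s, complex) free_alg set)"
    "of_int_coeffs ` {free_e s * free_x s - free_x s | s. s \<in> S} =
      ({of_int_coeffs (free_e s * free_x s - free_x s) | s. s \<in> S} :: ('s, complex) free_alg set)"
    "of_int_coeffs ` {free_x s * free_e s | s. s \<in> S} = ({of_int_coeffs (free_x s * free_e s) | s. s \<in> S} :: ('s, complex) free_alg set)"
    by blast+
  moreover have "of_int_coeffs ` {y_coeff G s t \<gamma> | s t \<gamma>. s \<in> S \<and> t \<in> S \<and> group.ord G (s \<otimes>\<^bsub>G\<^esub> t) \<noteq> 0} =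
     {word_coeff (free_ring K S) free_e free_x (alternating (group.ord G (s \<otimes>\<^bsub>G\<^esub> t)) s t) \<gamma> -
      word_coeff (free_ring K S) free_e free_x (alternating (group.ord G (s \<otimes>\<^bsub>G\<^esub> t)) t s) \<gamma>
      | s t \<gamma>. s \<in> S \<and> t \<in> S \<and> group.ord G (s \<otimes>\<^bsub>G\<^esub> t) \<noteq> 0}" (is "?A = ?B")
  proof
    show "?A \<subseteq> ?B"
    proof
      fix p assume "p \<in> ?A"
      then obtain s t \<gamma> where "p = of_int_coeffs (y_coeff G s t \<gamma>)" "s \<in> S" "t \<in> S"
        "group.ord G (s \<otimes>\<^bsub>G\<^esub> t) \<noteq> 0" by blast
      then show "p \<in> ?B" using y_coeff_of_int[of s S t G \<gamma>] by blast
    qed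
    show "?B \<subseteq> ?A"
    proof
      fix p assume "p \<in> ?B"
      then obtain s t \<gamma> where p: "p = word_coeff (free_ring K S) free_e free_x (alternating (group.ord G (s \<otimes>\<^bsub>G\<^esub> t)) s t) \<gamma> -
          word_coeff (free_ring K S) free_e free_x (alternating (group.ord G (s \<otimes>\<^bsub>G\<^esub> t)) t s) \<gamma>"
        and st: "s \<in> S" "t \<in> S" "group.ord G (s \<otimes>\<^bsub>G\<^esub> t) \<noteq> 0" by blast
      have "p = of_int_coeffs (y_coeff G s t \<gamma>)" unfolding p y_coeff_of_int[OF st(1,2)] ..
      then show "p \<in> ?A" using st by blast
    qed
  qed
  ultimately show ?thesis
    unfolding wgraph_relations_def image_Un by (simp only: of_int_coeffs_simps)
qed

lemma relation_generators_FC: "of_int_coeffs ` wgraph_relations G S \<subseteq> FC S"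
proof -
  have w: "word_coeff (free_ring K S) free_e free_x ws \<gamma> \<in> FC S" if "set ws \<subseteq> S" for ws \<gamma>
    using that by (intro word_coeff_closed free_ring_ring) (auto intro: FC_gens)
  have a: "word_coeff (free_ring K S) free_e free_x (alternating m s t) \<gamma> \<in> FC S" if "s \<in> S" "t \<in> S" for m s t \<gamma>
    using that set_alternating[of m s t] by (intro w) auto
  show ?thesis unfolding wgraph_relations_of_int
    by (auto intro!: FC_closed(6) FC_closed(4) FC_gens a)
qed

lemma wgraph_ideal_eq: "wgraph_ideal K G S = Idl\<^bsub>free_ring K S\<^esub> (of_int_coeffs ` wgraph_relations G S)"
  by (simp add: wgraph_ideal_def of_int_coeffs_def[abs_def])

lemma wgraph_ideal_ideal: "ideal (wgraph_ideal K G S) (free_ring K S)"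
  unfolding wgraph_ideal_eq by (rule ring.genideal_ideal[OF free_ring_ring relation_generators_FC])

lemma hom_kills_relations_iff:
  assumes R: "ring R" and h: "h \<in> Ring.ring_hom (free_ring K S) R"
  shows "(\<forall>p\<in>of_int_coeffs ` wgraph_relations G S. h p = \<zero>\<^bsub>R\<^esub>) \<longleftrightarrow>
    satisfies_relations R G S (\<lambda>s. h (free_e s)) (\<lambda>s. h (free_x s))"
proof -
  interpret h: ring_hom_ring "free_ring K S" R h by (intro ring_hom_ringI2 free_ring_ring R h)
  have m: "h (p - q) = \<zero>\<^bsub>R\<^esub> \<longleftrightarrow> h p = h q" if pq: "p \<in> FC S" "q \<in> FC S" for p q
  proof -
    have "h (p - q) = h (p \<oplus>\<^bsub>free_ring K S\<^esub> \<ominus>\<^bsub>free_ring K S\<^esub> q)"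
      using pq by (simp add: free_ring_minus free_ring_simps)
    also have "\<dots> = h p \<ominus>\<^bsub>R\<^esub> h q" using pq by (simp only: h.hom_add h.hom_a_inv h.R.a_inv_closed a_minus_def)
    finally show ?thesis using pq by simp
  qed
  have g: "free_e s \<in> FC S" "free_x s \<in> FC S" if "s \<in> S" for s
    by (rule FC_gens(1)[OF that], rule FC_gens(2)[OF that])
  have mult: "h (p * q) = h p \<otimes>\<^bsub>R\<^esub> h q" if "p \<in> FC S" "q \<in> FC S" for p q
    using h.hom_mult[OF that] by (simp only: free_ring_simps)
  have w: "word_coeff (free_ring K S) free_e free_x (alternating m s t) \<gamma> \<in> FC S"
      "h (word_coeff (free_ring K S) free_e free_x (alternating m s t) \<gamma>) =
       word_coeff R (\<lambda>s. h (free_e s)) (\<lambda>s. h (free_x s)) (alternating m s t) \<gamma>"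
    if "s \<in> S" "t \<in> S" for m s t \<gamma>
  proof -
    have st: "set (alternating m s t) \<subseteq> S" using that set_alternating[of m s t] by auto
    show "word_coeff (free_ring K S) free_e free_x (alternating m s t) \<gamma> \<in> FC S"
      using st by (intro word_coeff_closed free_ring_ring) (auto intro: FC_gens)
    show "h (word_coeff (free_ring K S) free_e free_x (alternating m s t) \<gamma>) =
       word_coeff R (\<lambda>s. h (free_e s)) (\<lambda>s. h (free_x s)) (alternating m s t) \<gamma>"
      using word_coeff_hom[OF free_ring_ring R h, of "alternating m s t" free_e free_x "\<lambda>s. h (free_e s)" id "\<lambda>s. h (free_x s)" \<gamma>]
        st g by (simp add: subset_iff)
  qed
  have "(\<forall>p\<in>of_int_coeffs ` wgraph_relations G S. h p = \<zero>\<^bsub>R\<^esub>) \<longleftrightarrow>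
     (\<forall>s\<in>S. h (free_e s * free_e s - free_e s) = \<zero>\<^bsub>R\<^esub>) \<and>
     (\<forall>s\<in>S. \<forall>t\<in>S. h (free_e s * free_e t - free_e t * free_e s) = \<zero>\<^bsub>R\<^esub>) \<and>
     (\<forall>s\<in>S. h (free_e s * free_x s - free_x s) = \<zero>\<^bsub>R\<^esub>) \<and>
     (\<forall>s\<in>S. h (free_x s * free_e s) = \<zero>\<^bsub>R\<^esub>) \<and>
     (\<forall>s\<in>S. \<forall>t\<in>S. \<forall>\<gamma>. group.ord G (s \<otimes>\<^bsub>G\<^esub> t) \<noteq> 0 \<longrightarrow>
       h (word_coeff (free_ring K S) free_e free_x (alternating (group.ord G (s \<otimes>\<^bsub>G\<^esub> t)) s t) \<gamma> -
      word_coeff (free_ring K S) free_e free_x (alternating (group.ord G (s \<otimes>\<^bsub>G\<^esub> t)) t s) \<gamma>) = \<zero>\<^bsub>R\<^esub>)"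
    unfolding wgraph_relations_of_int by blast
  also have "\<dots> \<longleftrightarrow> satisfies_relations R G S (\<lambda>s. h (free_e s)) (\<lambda>s. h (free_x s))"
    unfolding satisfies_relations_def using g w by (simp add: m mult FC_closed) blast
  finally show ?thesis .
qed

abbreviation \<pi> :: "('s, 'm) monoid_scheme \<Rightarrow> 's set \<Rightarrow> ('s, complex) free_alg \<Rightarrow> ('s, complex) free_alg set" where
  "\<pi> \<equiv> omega_class K"

lemma Omega_ring: "ring (Omega K G S)"
  unfolding Omega_def by (rule ideal.quotient_is_ring[OF wgraph_ideal_ideal])

lemma omega_class_hom: "\<pi> G S \<in> Ring.ring_hom (free_ring K S) (Omega K G S)"
  unfolding Omega_def omega_class_def[abs_def] by (rule ideal.rcos_ring_hom[OF wgraph_ideal_ideal])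

lemma Omega_carrier: "carrier (Omega K G S) = \<pi> G S ` FC S"
  by (auto simp: Omega_def FactRing_def A_RCOSETS_def' omega_class_def)

lemma omega_class_zero_iff:
  assumes "p \<in> FC S"
  shows "\<pi> G S p = \<zero>\<^bsub>Omega K G S\<^esub> \<longleftrightarrow> p \<in> wgraph_ideal K G S"
proof -
  interpret ideal "wgraph_ideal K G S" "free_ring K S" by (rule wgraph_ideal_ideal)
  have z: "\<zero>\<^bsub>Omega K G S\<^esub> = wgraph_ideal K G S" by (simp add: Omega_def FactRing_def)
  show ?thesis unfolding z omega_class_def
    using assms a_rcos_const a_rcos_self by blast
qed

lemma Omega_relations: "satisfies_relations (Omega K G S) G S (omega_e K G S) (omega_x K G S)"
proof -
  have "\<pi> G S p = \<zero>\<^bsub>Omega K G S\<^esub>" if "p \<in> of_int_coeffs ` wgraph_relations G S" for p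
  proof -
    have "p \<in> wgraph_ideal K G S" unfolding wgraph_ideal_eq
      using ring.genideal_self[OF free_ring_ring relation_generators_FC] that by blast
    then show ?thesis using omega_class_zero_iff that relation_generators_FC by blast
  qed
  then show ?thesis
    using hom_kills_relations_iff[OF Omega_ring[of G S] omega_class_hom[of G S], of G]
    by (simp add: omega_e_def[abs_def] omega_x_def[abs_def])
qed

lemma Omega_universal:
  assumes R: "ring R" and h: "h \<in> Ring.ring_hom (free_ring K S) R"
    and rel: "satisfies_relations R G S (\<lambda>s. h (free_e s)) (\<lambda>s. h (free_x s))"
  obtains j where "j \<in> Ring.ring_hom (Omega K G S) R" "\<And>p. p \<in> FC S \<Longrightarrow> j (\<pi> G S p) = h p"
proof -
  interpret F: ring "free_ring K S" by (rule free_ring_ring)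
  interpret h: ring_hom_ring "free_ring K S" R h by (intro ring_hom_ringI2 free_ring_ring R h)
  interpret P: ring_hom_ring "free_ring K S" "Omega K G S" "\<pi> G S"
    by (intro ring_hom_ringI2 free_ring_ring Omega_ring omega_class_hom)
  have sub: "wgraph_ideal K G S \<subseteq> a_kernel (free_ring K S) R h"
    unfolding wgraph_ideal_eq
  proof (rule F.genideal_minimal[OF h.kernel_is_ideal])
    have "\<forall>p\<in>of_int_coeffs ` wgraph_relations G S. h p = \<zero>\<^bsub>R\<^esub>"
      using hom_kills_relations_iff[OF R h, of G] rel by simp
    then show "of_int_coeffs ` wgraph_relations G S \<subseteq> a_kernel (free_ring K S) R h"
      using relation_generators_FC[of G S] unfolding a_kernel_def' by blast
  qed
  have ker: "h p = \<zero>\<^bsub>R\<^esub>" if "p \<in> wgraph_ideal K G S" for p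
    using subsetD[OF sub that] unfolding a_kernel_def' by (elim CollectE conjE)
  \<comment> \<open>Evaluation at a representative; the choice is irrelevant because the ideal lies in the kernel of \<open>h\<close>.\<close>
  define j where "j c = h (SOME p. p \<in> FC S \<and> \<pi> G S p = c)" for c
  have j: "j (\<pi> G S p) = h p" if p: "p \<in> FC S" for p
  proof -
    define q where "q = (SOME q. q \<in> FC S \<and> \<pi> G S q = \<pi> G S p)"
    have q: "q \<in> FC S \<and> \<pi> G S q = \<pi> G S p" unfolding q_def by (rule someI) (use p in simp)
    have qp: "q \<ominus>\<^bsub>free_ring K S\<^esub> p \<in> FC S" using p q by (intro F.minus_closed) auto
    have "\<pi> G S (q \<ominus>\<^bsub>free_ring K S\<^esub> p) = \<zero>\<^bsub>Omega K G S\<^esub>"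
      using p q by (simp add: a_minus_def P.S.r_neg)
    then have "h (q \<ominus>\<^bsub>free_ring K S\<^esub> p) = \<zero>\<^bsub>R\<^esub>"
      by (intro ker) (simp add: omega_class_zero_iff[OF qp])
    moreover have "h (q \<ominus>\<^bsub>free_ring K S\<^esub> p) = h q \<ominus>\<^bsub>R\<^esub> h p"
      using p q by (simp only: a_minus_def h.hom_add h.hom_a_inv F.a_inv_closed)
    moreover have "h q \<in> carrier R" "h p \<in> carrier R" using p q h.hom_closed by blast+
    ultimately have "h q = h p" using h.S.r_right_minus_eq by metis
    then show ?thesis by (simp add: j_def q_def)
  qed
  have "j \<in> Ring.ring_hom (Omega K G S) R"
  proof (rule ring_hom_memI)
    fix a assume "a \<in> carrier (Omega K G S)"
    then obtain p where p: "a = \<pi> G S p" "p \<in> FC S" unfolding Omega_carrier by blast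
    show "j a \<in> carrier R" using p j by simp
    fix b assume "b \<in> carrier (Omega K G S)"
    then obtain q where q: "b = \<pi> G S q" "q \<in> FC S" unfolding Omega_carrier by blast
    show "j (a \<otimes>\<^bsub>Omega K G S\<^esub> b) = j a \<otimes>\<^bsub>R\<^esub> j b"
      using p q by (simp add: j flip: P.hom_mult)
    show "j (a \<oplus>\<^bsub>Omega K G S\<^esub> b) = j a \<oplus>\<^bsub>R\<^esub> j b"
      using p q by (simp add: j flip: P.hom_add)
  next
    show "j \<one>\<^bsub>Omega K G S\<^esub> = \<one>\<^bsub>R\<^esub>"
      using j[OF F.one_closed] by simp
  qed
  then show ?thesis using that j by blast
qed

lemma omega_scalar_closed: "c \<in> K \<Longrightarrow> omega_scalar K G S c \<in> carrier (Omega K G S)"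
  unfolding omega_scalar_def Omega_carrier using FC_gens(3) by blast

lemma Omega_generated:
  assumes H: "subring H (Omega K G S)"
    and g: "\<And>s. s \<in> S \<Longrightarrow> omega_e K G S s \<in> H" "\<And>s. s \<in> S \<Longrightarrow> omega_x K G S s \<in> H"
    and c: "\<And>c. c \<in> K \<Longrightarrow> omega_scalar K G S c \<in> H"
  shows "H = carrier (Omega K G S)"
proof -
  interpret F: ring "free_ring K S" by (rule free_ring_ring)
  interpret P: ring_hom_ring "free_ring K S" "Omega K G S" "\<pi> G S"
    by (intro ring_hom_ringI2 free_ring_ring Omega_ring omega_class_hom)
  note HR = subringE[OF H]
  have "FC S \<subseteq> {p \<in> FC S. \<pi> G S p \<in> H}"
  proof (rule FC_induct)
    show "subring {p \<in> FC S. \<pi> G S p \<in> H} (free_ring K S)"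
      by (rule F.subringI) (use HR in auto)
  qed (use g c FC_gens in \<open>auto simp: omega_e_def omega_x_def omega_scalar_def\<close>)
  then have "carrier (Omega K G S) \<subseteq> H" unfolding Omega_carrier by blast
  then show ?thesis using HR(1) by blast
qed

lemma omega_scalar_central:
  assumes c: "c \<in> K" and a: "a \<in> carrier (Omega K G S)"
  shows "omega_scalar K G S c \<otimes>\<^bsub>Omega K G S\<^esub> a = a \<otimes>\<^bsub>Omega K G S\<^esub> omega_scalar K G S c"
proof -
  interpret P: ring_hom_ring "free_ring K S" "Omega K G S" "\<pi> G S"
    by (intro ring_hom_ringI2 free_ring_ring Omega_ring omega_class_hom)
  obtain p where p: "a = \<pi> G S p" "p \<in> FC S" using a unfolding Omega_carrier by blast
  have "Poly_Mapping.single 0 c * p = p * Poly_Mapping.single 0 c"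
  proof -
    have "Poly_Mapping.single 0 c * (\<Sum>u\<in>Poly_Mapping.keys p. Poly_Mapping.single u (Poly_Mapping.lookup p u)) =
        (\<Sum>u\<in>Poly_Mapping.keys p. Poly_Mapping.single u (Poly_Mapping.lookup p u)) * Poly_Mapping.single 0 c"
      by (simp add: sum_distrib_left sum_distrib_right mult_single mult.commute)
    then show ?thesis by (simp only: poly_mapping_sum_single)
  qed
  then show ?thesis
    using p FC_gens(3)[OF c, of S] P.hom_mult[of "Poly_Mapping.single 0 c" p] P.hom_mult[of p "Poly_Mapping.single 0 c"]
    by (simp add: omega_scalar_def free_ring_simps)
qed

lemma omega_scalar_hom:
  "c \<in> K \<Longrightarrow> d \<in> K \<Longrightarrow> omega_scalar K G S (c + d) = omega_scalar K G S c \<oplus>\<^bsub>Omega K G S\<^esub> omega_scalar K G S d"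
  "c \<in> K \<Longrightarrow> d \<in> K \<Longrightarrow> omega_scalar K G S (c * d) = omega_scalar K G S c \<otimes>\<^bsub>Omega K G S\<^esub> omega_scalar K G S d"
  "omega_scalar K G S 1 = \<one>\<^bsub>Omega K G S\<^esub>"
  "omega_scalar K G S 0 = \<zero>\<^bsub>Omega K G S\<^esub>"
proof -
  interpret P: ring_hom_ring "free_ring K S" "Omega K G S" "\<pi> G S"
    by (intro ring_hom_ringI2 free_ring_ring Omega_ring omega_class_hom)
  show "omega_scalar K G S 1 = \<one>\<^bsub>Omega K G S\<^esub>"
    using P.hom_one by (simp add: omega_scalar_def free_ring_simps)
  show "omega_scalar K G S 0 = \<zero>\<^bsub>Omega K G S\<^esub>"
    using P.hom_zero by (simp add: omega_scalar_def free_ring_simps)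
  assume cd: "c \<in> K" "d \<in> K"
  note g = FC_gens(3)[OF cd(1), of S] FC_gens(3)[OF cd(2), of S]
  show "omega_scalar K G S (c + d) = omega_scalar K G S c \<oplus>\<^bsub>Omega K G S\<^esub> omega_scalar K G S d"
    using P.hom_add[OF g] by (simp add: omega_scalar_def free_ring_simps single_add)
  show "omega_scalar K G S (c * d) = omega_scalar K G S c \<otimes>\<^bsub>Omega K G S\<^esub> omega_scalar K G S d"
    using P.hom_mult[OF g] by (simp add: omega_scalar_def free_ring_simps mult_single)
qed

text \<open>
  The relations only involve the orders of products of two generators, so a map of generators that preserves
  these orders extends to the W-graph algebras.
\<close>

lemma Omega_map:
  fixes \<iota> :: "'s \<Rightarrow> 't"
  assumes im: "\<And>s. s \<in> S' \<Longrightarrow> \<iota> s \<in> S"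
    and ord: "\<And>s t. s \<in> S' \<Longrightarrow> t \<in> S' \<Longrightarrow> group.ord G (\<iota> s \<otimes>\<^bsub>G\<^esub> \<iota> t) = group.ord G' (s \<otimes>\<^bsub>G'\<^esub> t)"
  obtains j where "j \<in> Ring.ring_hom (Omega K G' S') (Omega K G S)"
    "\<And>s. s \<in> S' \<Longrightarrow> j (omega_e K G' S' s) = omega_e K G S (\<iota> s)"
    "\<And>s. s \<in> S' \<Longrightarrow> j (omega_x K G' S' s) = omega_x K G S (\<iota> s)"
    "\<And>c. c \<in> K \<Longrightarrow> j (omega_scalar K G' S' c) = omega_scalar K G S c"
proof -
  interpret F: ring "free_ring K S" by (rule free_ring_ring)
  interpret F': ring "free_ring K S'" by (rule free_ring_ring)
  define h where "h p = \<pi> G S (rename_letters \<iota> p)" for p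
  have ren: "rename_letters \<iota> p \<in> FC S" if "p \<in> FC S'" for p
  proof -
    have neg: "rename_letters \<iota> (- p) = - (rename_letters \<iota> p :: ('t, complex) free_alg)" for p
    proof -
      have "rename_letters \<iota> (- p) + rename_letters \<iota> p = (rename_letters \<iota> (- p + p) :: ('t, complex) free_alg)"
        by (simp only: rename_letters_simps)
      also have "\<dots> = 0" by (simp add: rename_letters_def pm_transform_zero)
      finally show ?thesis by (simp add: eq_neg_iff_add_eq_0)
    qed
    have "FC S' \<subseteq> {p \<in> FC S'. rename_letters \<iota> p \<in> FC S}"
    proof (rule FC_induct)
      show "subring {p \<in> FC S'. rename_letters \<iota> p \<in> FC S} (free_ring K S')"
        by (rule F'.subringI)
          (auto simp: free_ring_simps free_ring_minus rename_letters_simps neg intro!: FC_closed)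
    qed (auto simp: rename_letters_simps intro!: FC_gens im)
    then show ?thesis using that by blast
  qed
  have "rename_letters \<iota> \<in> Ring.ring_hom (free_ring K S') (free_ring K S)"
    by (rule ring_hom_memI) (auto simp: free_ring_simps rename_letters_simps ren)
  from ring_hom_trans[OF this omega_class_hom]
  have h: "h \<in> Ring.ring_hom (free_ring K S') (Omega K G S)" by (simp add: h_def[abs_def] comp_def)
  have he: "h (free_e s) = omega_e K G S (\<iota> s)" "h (free_x s) = omega_x K G S (\<iota> s)" for s
    by (simp_all add: h_def rename_letters_simps omega_e_def omega_x_def)
  have rel: "satisfies_relations (Omega K G S) G' S' (\<lambda>s. h (free_e s)) (\<lambda>s. h (free_x s))"
  proof -
    have w: "word_coeff (Omega K G S) (\<lambda>s. omega_e K G S (\<iota> s)) (\<lambda>s. omega_x K G S (\<iota> s)) ws \<gamma> =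
      word_coeff (Omega K G S) (omega_e K G S) (omega_x K G S) (map \<iota> ws) \<gamma>" for ws \<gamma>
      by (induction ws arbitrary: \<gamma>) auto
    show ?thesis
      using Omega_relations[of G S] im ord
      unfolding satisfies_relations_def he w map_alternating by metis
  qed
  obtain j where j: "j \<in> Ring.ring_hom (Omega K G' S') (Omega K G S)"
      "\<And>p. p \<in> FC S' \<Longrightarrow> j (\<pi> G' S' p) = h p"
    using Omega_universal[OF Omega_ring h rel] by blast
  show ?thesis
    by (rule that[OF j(1)])
      (auto simp: omega_e_def omega_x_def omega_scalar_def j(2) FC_gens h_def rename_letters_simps)
qed

end

section \<open>Braid relations\<close>

text \<open>
  The leading coefficient is the product of the \<open>1 - e\<^sub>u\<close> over the word, because only the terms \<open>v (1 - e\<^sub>u)\<close> raise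
  the exponent; \<open>(1 - e\<^sub>s) (1 - e\<^sub>t)\<close> absorbs all of them.
\<close>

lemma (in idem_family) word_coeff_top:
  assumes x: "\<And>s. s \<in> S \<Longrightarrow> x s \<in> carrier R"
    and st: "s \<in> S" "t \<in> S" and ws: "set ws \<subseteq> {s, t}"
  shows "int (length ws) < \<gamma> \<Longrightarrow> word_coeff R e x ws \<gamma> = \<zero>"
    and "word_coeff R e x ws (int (length ws)) \<otimes> (f s \<otimes> f t) = f s \<otimes> f t"
proof -
  have cl: "word_coeff R e x us \<gamma> \<in> carrier R" if "set us \<subseteq> {s, t}" for us \<gamma>
    using that st x by (intro word_coeff_closed ring_axioms) auto
  have top: "\<forall>\<gamma>. int (length ws) < \<gamma> \<longrightarrow> word_coeff R e x ws \<gamma> = \<zero>" using ws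
  proof (induction ws)
    case (Cons u us)
    then have "u \<in> S" using st by auto
    then show ?case using Cons x by simp
  qed simp
  then show "int (length ws) < \<gamma> \<Longrightarrow> word_coeff R e x ws \<gamma> = \<zero>" by blast
  show "word_coeff R e x ws (int (length ws)) \<otimes> (f s \<otimes> f t) = f s \<otimes> f t" using ws
  proof (induction ws)
    case (Cons u us)
    then have u: "u \<in> S" "u = s \<or> u = t" "set us \<subseteq> {s, t}" using st by auto
    have z: "word_coeff R e x us \<gamma> = \<zero>" if "int (length us) < \<gamma>" for \<gamma>
      using u(3) that
    proof (induction us arbitrary: \<gamma>)
      case (Cons u us)
      then have "u \<in> S" using st by auto
      then show ?case using Cons x by simp
    qed simp
    have "word_coeff R e x (u # us) (int (length (u # us))) = f u \<otimes> word_coeff R e x us (int (length us))"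
      using u x cl[OF u(3)] by (simp add: z)
    then have "word_coeff R e x (u # us) (int (length (u # us))) \<otimes> (f s \<otimes> f t) =
        f u \<otimes> (word_coeff R e x us (int (length us)) \<otimes> (f s \<otimes> f t))"
      using u cl[OF u(3)] st by (simp add: m_assoc)
    also have "\<dots> = f u \<otimes> (f s \<otimes> f t)" using Cons.IH[OF u(3)] by simp
    also have "\<dots> = f s \<otimes> f t"
    proof (cases "u = s")
      case True
      then show ?thesis using st ff_idem[OF st(1)] by (simp flip: m_assoc)
    next
      case False
      then have "u = t" using u by simp
      then have "f u \<otimes> (f s \<otimes> f t) = (f s \<otimes> f t) \<otimes> f t"
        using st by (simp add: ff_comm[OF st(2,1)] flip: m_assoc)
      also have "\<dots> = f s \<otimes> (f t \<otimes> f t)" using st by (simp add: m_assoc)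
      finally have "f u \<otimes> (f s \<otimes> f t) = f s \<otimes> (f t \<otimes> f t)" .
      then show ?thesis using ff_idem[OF st(2)] by simp
    qed
    finally show ?case .
  qed (use st in simp)
qed

lemma coxeter_ord_commuting:
  assumes G: "group G" and st: "s \<in> carrier G" "t \<in> carrier G" "group.ord G s = 2" "group.ord G t = 2"
    and c: "s \<noteq> t" "s \<otimes>\<^bsub>G\<^esub> t = t \<otimes>\<^bsub>G\<^esub> s"
  shows "group.ord G (s \<otimes>\<^bsub>G\<^esub> t) = 2"
proof -
  interpret group G by (rule G)
  have sq: "s \<otimes>\<^bsub>G\<^esub> s = \<one>\<^bsub>G\<^esub>" "t \<otimes>\<^bsub>G\<^esub> t = \<one>\<^bsub>G\<^esub>"
    using pow_ord_eq_1[OF st(1)] pow_ord_eq_1[OF st(2)] st by (simp_all add: numeral_2_eq_2)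
  let ?u = "s \<otimes>\<^bsub>G\<^esub> t"
  have "?u \<otimes>\<^bsub>G\<^esub> ?u = (s \<otimes>\<^bsub>G\<^esub> t) \<otimes>\<^bsub>G\<^esub> (t \<otimes>\<^bsub>G\<^esub> s)" using c by simp
  also have "\<dots> = s \<otimes>\<^bsub>G\<^esub> (t \<otimes>\<^bsub>G\<^esub> t) \<otimes>\<^bsub>G\<^esub> s" using st by (simp add: m_assoc)
  also have "\<dots> = \<one>\<^bsub>G\<^esub>" using st sq by simp
  finally have "?u [^]\<^bsub>G\<^esub> (2::nat) = \<one>\<^bsub>G\<^esub>" using st by (simp add: numeral_2_eq_2)
  then have "ord ?u dvd 2" using pow_eq_id st by simp
  moreover have "ord ?u \<noteq> 1"
  proof
    assume "ord ?u = 1"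
    then have "?u = \<one>\<^bsub>G\<^esub>" using ord_eq_1 st by simp
    then have "s \<otimes>\<^bsub>G\<^esub> t = s \<otimes>\<^bsub>G\<^esub> s" using sq by simp
    then show False using st c by simp
  qed
  ultimately show ?thesis using prime_nat_iff two_is_prime_nat by blast
qed

definition commuting_pair :: "('s, 'm) monoid_scheme \<Rightarrow> 's \<Rightarrow> 's \<Rightarrow> bool" where
  "commuting_pair G s t \<longleftrightarrow> s \<noteq> t \<and> s \<otimes>\<^bsub>G\<^esub> t = t \<otimes>\<^bsub>G\<^esub> s"

text \<open>
  For commuting \<open>s\<close> and \<open>t\<close> the braid relation has length 2 and its coefficients are written out. For the relation
  \<open>x_indep\<close> take the coefficient of \<open>v\<^sup>m\<^sup>-\<^sup>1\<close> between \<open>e\<^sub>s e\<^sub>t\<close> and \<open>(1 - e\<^sub>s) (1 - e\<^sub>t)\<close>. A factor \<open>1 - e\<close> at the start of the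
  word is killed on the left, so the first letter contributes \<open>x\<close>, and the others contribute their leading
  coefficients, which are absorbed on the right.
\<close>

lemma wgraph_ring_if_relations:
  assumes R: "ring R" and rel: "satisfies_relations R G S e x"
    and G: "group G" and S: "S \<subseteq> carrier G" "\<And>s. s \<in> S \<Longrightarrow> group.ord G s = 2" "finite S"
    and fin: "\<And>s t. s \<in> S \<Longrightarrow> t \<in> S \<Longrightarrow> group.ord G (s \<otimes>\<^bsub>G\<^esub> t) \<noteq> 0"
  shows "wgraph_ring R e S x (commuting_pair G)"
proof -
  interpret R: ring R by (rule R)
  note r = rel[unfolded satisfies_relations_def]
  interpret idem_family R e S
    using r S(3) by unfold_locales blast+
  have x: "x s \<in> carrier R" if "s \<in> S" for s using r that by blast
  have braid: "word_coeff R e x (alternating (group.ord G (s \<otimes>\<^bsub>G\<^esub> t)) s t) \<gamma> =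
      word_coeff R e x (alternating (group.ord G (s \<otimes>\<^bsub>G\<^esub> t)) t s) \<gamma>" if "s \<in> S" "t \<in> S" for s t \<gamma>
    using r that fin by blast
  have m2: "word_coeff R e x [s, t] \<gamma> = word_coeff R e x [t, s] \<gamma>"
    if "s \<in> S" "t \<in> S" "commuting_pair G s t" for s t \<gamma>
    using braid[of s t \<gamma>] coxeter_ord_commuting[OF G, of s t] that S
    by (auto simp: commuting_pair_def numeral_2_eq_2 subset_iff)
  show ?thesis
  proof
    show "x s \<in> carrier R" "e s \<otimes>\<^bsub>R\<^esub> x s = x s" "x s \<otimes>\<^bsub>R\<^esub> e s = \<zero>\<^bsub>R\<^esub>" if "s \<in> S" for s
      using r that by blast+
    fix s t assume st: "s \<in> S" "t \<in> S"
    note xs = x[OF st(1)] x[OF st(2)]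
    show "e s \<otimes>\<^bsub>R\<^esub> (e t \<otimes>\<^bsub>R\<^esub> (x s \<otimes>\<^bsub>R\<^esub> (f s \<otimes>\<^bsub>R\<^esub> f t))) =
        e s \<otimes>\<^bsub>R\<^esub> (e t \<otimes>\<^bsub>R\<^esub> (x t \<otimes>\<^bsub>R\<^esub> (f s \<otimes>\<^bsub>R\<^esub> f t)))"
    proof -
      obtain m where m: "group.ord G (s \<otimes>\<^bsub>G\<^esub> t) = Suc m" using fin[OF st] not0_implies_Suc by blast
      have key: "e s \<otimes>\<^bsub>R\<^esub> (e t \<otimes>\<^bsub>R\<^esub> (word_coeff R e x (u # alternating m v u) (int m) \<otimes>\<^bsub>R\<^esub> (f s \<otimes>\<^bsub>R\<^esub> f t))) =
          e s \<otimes>\<^bsub>R\<^esub> (e t \<otimes>\<^bsub>R\<^esub> (x u \<otimes>\<^bsub>R\<^esub> (f s \<otimes>\<^bsub>R\<^esub> f t)))"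
        if uv: "(u = s \<and> v = t) \<or> (u = t \<and> v = s)" for u v
      proof -
        let ?ws = "alternating m v u"
        have u: "u \<in> S" and ws: "set ?ws \<subseteq> {s, t}" and len: "length ?ws = m"
          using uv st set_alternating[of m v u] by (auto simp: length_alternating)
        have cl [simp]: "word_coeff R e x ?ws \<gamma> \<in> carrier R" for \<gamma>
          using ws st x by (intro word_coeff_closed R) auto
        have z: "word_coeff R e x ?ws (int m + 1) = \<zero>\<^bsub>R\<^esub>"
          using word_coeff_top(1)[OF x st ws] len by simp
        have tp: "word_coeff R e x ?ws (int m) \<otimes>\<^bsub>R\<^esub> (f s \<otimes>\<^bsub>R\<^esub> f t) = f s \<otimes>\<^bsub>R\<^esub> f t"
          using word_coeff_top(2)[OF x st ws] len by simp
        have "word_coeff R e x (u # ?ws) (int m) =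
            f u \<otimes>\<^bsub>R\<^esub> word_coeff R e x ?ws (int m - 1) \<oplus>\<^bsub>R\<^esub> x u \<otimes>\<^bsub>R\<^esub> word_coeff R e x ?ws (int m)"
          using u x by (simp add: z)
        then have "word_coeff R e x (u # ?ws) (int m) \<otimes>\<^bsub>R\<^esub> (f s \<otimes>\<^bsub>R\<^esub> f t) =
            f u \<otimes>\<^bsub>R\<^esub> (word_coeff R e x ?ws (int m - 1) \<otimes>\<^bsub>R\<^esub> (f s \<otimes>\<^bsub>R\<^esub> f t)) \<oplus>\<^bsub>R\<^esub> x u \<otimes>\<^bsub>R\<^esub> (f s \<otimes>\<^bsub>R\<^esub> f t)"
          using u x st by (simp add: R.l_distr R.m_assoc tp)
        moreover have "e s \<otimes>\<^bsub>R\<^esub> (e t \<otimes>\<^bsub>R\<^esub> (f u \<otimes>\<^bsub>R\<^esub> c)) = \<zero>\<^bsub>R\<^esub>" if c: "c \<in> carrier R" for c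
        proof -
          have "e s \<otimes>\<^bsub>R\<^esub> (e t \<otimes>\<^bsub>R\<^esub> (f u \<otimes>\<^bsub>R\<^esub> c)) = e s \<otimes>\<^bsub>R\<^esub> (e t \<otimes>\<^bsub>R\<^esub> f u) \<otimes>\<^bsub>R\<^esub> c"
            using st u c by (simp add: R.m_assoc)
          also have "e s \<otimes>\<^bsub>R\<^esub> (e t \<otimes>\<^bsub>R\<^esub> f u) = \<zero>\<^bsub>R\<^esub>"
          proof (cases "u = t")
            case True
            then show ?thesis using st ef_zero(1)[OF st(2)] by simp
          next
            case False
            then have "u = s" using uv by auto
            then have "e s \<otimes>\<^bsub>R\<^esub> (e t \<otimes>\<^bsub>R\<^esub> f u) = (e s \<otimes>\<^bsub>R\<^esub> f s) \<otimes>\<^bsub>R\<^esub> e t"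
              using st ef_comm[OF st(2,1)] by (simp add: R.m_assoc)
            then show ?thesis using st ef_zero(1)[OF st(1)] by simp
          qed
          finally show ?thesis using c by simp
        qed
        ultimately show ?thesis using st u x by (simp add: R.r_distr)
      qed
      have "word_coeff R e x (s # alternating m t s) (int m) = word_coeff R e x (t # alternating m s t) (int m)"
        using braid[OF st, of "int m"] m by simp
      then show ?thesis using key[of s t] key[of t s] by simp
    qed
    assume c: "commuting_pair G s t"
    have es: "e s \<in> carrier R" "e t \<in> carrier R" using st by auto
    have "word_coeff R e x [s, t] (-1) = \<ominus>\<^bsub>R\<^esub> (e s \<otimes>\<^bsub>R\<^esub> x t) \<ominus>\<^bsub>R\<^esub> x s \<otimes>\<^bsub>R\<^esub> e t"
      "word_coeff R e x [t, s] (-1) = \<ominus>\<^bsub>R\<^esub> (e t \<otimes>\<^bsub>R\<^esub> x s) \<ominus>\<^bsub>R\<^esub> x t \<otimes>\<^bsub>R\<^esub> e s"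
      using es xs by (simp_all add: R.r_minus a_minus_def)
    then have "\<ominus>\<^bsub>R\<^esub> (e s \<otimes>\<^bsub>R\<^esub> x t \<oplus>\<^bsub>R\<^esub> x s \<otimes>\<^bsub>R\<^esub> e t) = \<ominus>\<^bsub>R\<^esub> (e t \<otimes>\<^bsub>R\<^esub> x s \<oplus>\<^bsub>R\<^esub> x t \<otimes>\<^bsub>R\<^esub> e s)"
      using m2[OF st c, of "-1"] es xs by (simp add: R.minus_add a_minus_def)
    then show "e s \<otimes>\<^bsub>R\<^esub> x t \<oplus>\<^bsub>R\<^esub> x s \<otimes>\<^bsub>R\<^esub> e t = e t \<otimes>\<^bsub>R\<^esub> x s \<oplus>\<^bsub>R\<^esub> x t \<otimes>\<^bsub>R\<^esub> e s"
      using es xs R.minus_minus by (metis R.add.m_closed R.m_closed)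
    \<comment> \<open>The part of the \<open>v\<^sup>0\<close> coefficient that is symmetric in \<open>s\<close> and \<open>t\<close>.\<close>
    define A where "A = \<ominus>\<^bsub>R\<^esub> (e s \<otimes>\<^bsub>R\<^esub> f t) \<oplus>\<^bsub>R\<^esub> \<ominus>\<^bsub>R\<^esub> (f s \<otimes>\<^bsub>R\<^esub> e t)"
    have A: "A \<in> carrier R" using es st by (simp add: A_def)
    have "word_coeff R e x [s, t] 0 = A \<oplus>\<^bsub>R\<^esub> x s \<otimes>\<^bsub>R\<^esub> x t"
      using es xs st by (simp add: R.r_minus A_def)
    moreover have "word_coeff R e x [t, s] 0 =
        \<ominus>\<^bsub>R\<^esub> (e t \<otimes>\<^bsub>R\<^esub> f s) \<oplus>\<^bsub>R\<^esub> \<ominus>\<^bsub>R\<^esub> (f t \<otimes>\<^bsub>R\<^esub> e s) \<oplus>\<^bsub>R\<^esub> x t \<otimes>\<^bsub>R\<^esub> x s"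
      using es xs st by (simp add: R.r_minus)
    moreover have "\<ominus>\<^bsub>R\<^esub> (e t \<otimes>\<^bsub>R\<^esub> f s) \<oplus>\<^bsub>R\<^esub> \<ominus>\<^bsub>R\<^esub> (f t \<otimes>\<^bsub>R\<^esub> e s) = A"
      unfolding A_def ef_comm[OF st] ef_comm[OF st(2,1)] using es st by (intro R.a_comm) auto
    ultimately have "A \<oplus>\<^bsub>R\<^esub> x s \<otimes>\<^bsub>R\<^esub> x t = A \<oplus>\<^bsub>R\<^esub> x t \<otimes>\<^bsub>R\<^esub> x s"
      using m2[OF st c, of 0] by metis
    then show "x s \<otimes>\<^bsub>R\<^esub> x t = x t \<otimes>\<^bsub>R\<^esub> x s"
      using A xs by (simp only: R.add.l_cancel R.m_closed)
  qed
qed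

section \<open>Complete systems of idempotents\<close>

context ring
begin

lemma finsum_Times_mult:
  assumes "finite A" "finite B" "p \<in> A \<rightarrow> carrier R" "q \<in> B \<rightarrow> carrier R"
  shows "(\<Oplus>z\<in>A \<times> B. p (fst z) \<otimes> q (snd z)) = (\<Oplus>a\<in>A. p a) \<otimes> (\<Oplus>b\<in>B. q b)"
  using assms(1,3)
proof (induction A)
  case empty
  then show ?case using assms by simp
next
  case (insert a A)
  have pc: "p a \<in> carrier R" "p \<in> A \<rightarrow> carrier R" "\<And>i. i \<in> A \<Longrightarrow> p i \<in> carrier R"
    using insert.prems by auto
  have qc: "b \<in> B \<Longrightarrow> q b \<in> carrier R" for b using assms(4) by auto
  have "insert a A \<times> B = Pair a ` B \<union> A \<times> B" by auto
  then have "(\<Oplus>z\<in>insert a A \<times> B. p (fst z) \<otimes> q (snd z)) =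
      (\<Oplus>z\<in>Pair a ` B. p (fst z) \<otimes> q (snd z)) \<oplus> (\<Oplus>z\<in>A \<times> B. p (fst z) \<otimes> q (snd z))"
    using insert.hyps pc qc assms(2) by (simp only:) (intro finsum_Un_disjoint; auto)
  also have "(\<Oplus>z\<in>Pair a ` B. p (fst z) \<otimes> q (snd z)) = (\<Oplus>b\<in>B. p a \<otimes> q b)"
    using pc qc by (subst finsum_reindex) (auto simp: inj_on_def)
  also have "\<dots> = p a \<otimes> (\<Oplus>b\<in>B. q b)"
    using pc assms by (intro finsum_rdistr[symmetric]) auto
  finally show ?case
    using insert pc assms(4) by (simp add: l_distr)
qed

lemma finsum_in_subring:
  assumes H: "subring H R" and c: "\<And>i. i \<in> A \<Longrightarrow> g i \<in> H"
  shows "(\<Oplus>i\<in>A. g i) \<in> H"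
proof (cases "finite A")
  case True
  then show ?thesis using c
  proof (induction A)
    case (insert i A)
    have "g \<in> A \<rightarrow> carrier R" "g i \<in> carrier R" using insert.prems subringE(1)[OF H] by auto
    then show ?case using insert subringE(7)[OF H] by simp
  qed (use subringE(2)[OF H] in simp)
qed (use subringE(2)[OF H] in simp)

lemma finsum_single_nonzero:
  assumes "finite A" "i \<in> A" "g \<in> A \<rightarrow> carrier R" "\<And>j. j \<in> A \<Longrightarrow> j \<noteq> i \<Longrightarrow> g j = \<zero>"
  shows "(\<Oplus>j\<in>A. g j) = g i"
proof -
  have "(\<Oplus>j\<in>A. g j) = (\<Oplus>j\<in>A. if i = j then g j else \<zero>)"
    using assms by (intro finsum_cong') auto
  also have "\<dots> = g i" using assms by (intro add.finprod_singleton) auto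
  finally show ?thesis .
qed

end

locale complete_idempotents = ring R for R (structure) +
  fixes L :: "'l set" and F :: "'l \<Rightarrow> 'a"
  assumes finite_L: "finite L"
    and F_closed [simp]: "\<nu> \<in> L \<Longrightarrow> F \<nu> \<in> carrier R"
    and F_orth: "\<nu> \<in> L \<Longrightarrow> \<mu> \<in> L \<Longrightarrow> F \<nu> \<otimes> F \<mu> = (if \<nu> = \<mu> then F \<nu> else \<zero>)"
    and F_sum: "(\<Oplus>\<nu>\<in>L. F \<nu>) = \<one>"
begin

lemma insert_idempotents:
  assumes "a \<in> carrier R" "b \<in> carrier R"
  shows "a \<otimes> b = (\<Oplus>\<nu>\<in>L. a \<otimes> F \<nu> \<otimes> b)"
proof -
  have "a \<otimes> b = a \<otimes> (\<Oplus>\<nu>\<in>L. F \<nu>) \<otimes> b" unfolding F_sum using assms by simp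
  also have "a \<otimes> (\<Oplus>\<nu>\<in>L. F \<nu>) = (\<Oplus>\<nu>\<in>L. a \<otimes> F \<nu>)" using finite_L assms by (intro finsum_rdistr) auto
  also have "(\<Oplus>\<nu>\<in>L. a \<otimes> F \<nu>) \<otimes> b = (\<Oplus>\<nu>\<in>L. a \<otimes> F \<nu> \<otimes> b)"
    using finite_L assms by (intro finsum_ldistr) auto
  finally show ?thesis .
qed

text \<open>
  Inserting \<open>1 = \<Sum> F\<^sub>\<kappa>\<close> between the factors of a product, transitivity leaves no nonzero summand, as for the
  matrices of an incidence algebra.
\<close>

lemma incidence_subring:
  assumes r: "partial_order_on L r"
  shows "subring {a \<in> carrier R. \<forall>\<nu>\<in>L. \<forall>\<mu>\<in>L. (\<nu>, \<mu>) \<notin> r \<longrightarrow> F \<nu> \<otimes> a \<otimes> F \<mu> = \<zero>} R" (is "subring ?T R")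
proof (rule subringI)
  have refl: "(\<nu>, \<nu>) \<in> r" if "\<nu> \<in> L" for \<nu>
    using r that by (auto simp: partial_order_on_def preorder_on_def refl_on_def)
  have trans: "(\<nu>, \<mu>) \<in> r \<Longrightarrow> (\<mu>, \<kappa>) \<in> r \<Longrightarrow> (\<nu>, \<kappa>) \<in> r" for \<nu> \<mu> \<kappa>
    using r by (meson partial_order_on_def preorder_on_def transD)
  show "\<one> \<in> ?T" using refl by (auto simp: F_orth)
  fix a assume a: "a \<in> ?T"
  then show "\<ominus> a \<in> ?T" by (simp add: r_minus l_minus)
  fix b assume b: "b \<in> ?T"
  show "a \<oplus> b \<in> ?T" using a b by (simp add: r_distr l_distr)
  have ab: "a \<in> carrier R" "b \<in> carrier R" using a b by auto
  have "F \<nu> \<otimes> (a \<otimes> b) \<otimes> F \<mu> = \<zero>" if nm: "\<nu> \<in> L" "\<mu> \<in> L" "(\<nu>, \<mu>) \<notin> r" for \<nu> \<mu>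
  proof -
    have "F \<nu> \<otimes> (a \<otimes> b) \<otimes> F \<mu> = (F \<nu> \<otimes> a) \<otimes> (b \<otimes> F \<mu>)" using nm ab by (simp add: m_assoc)
    also have "\<dots> = (\<Oplus>\<kappa>\<in>L. F \<nu> \<otimes> a \<otimes> F \<kappa> \<otimes> (b \<otimes> F \<mu>))"
      using nm ab by (intro insert_idempotents) auto
    also have "\<dots> = (\<Oplus>\<kappa>\<in>L. \<zero>)"
    proof (intro finsum_cong')
      fix \<kappa> assume k: "\<kappa> \<in> L"
      have "F \<kappa> \<otimes> F \<kappa> = F \<kappa>" using k by (simp add: F_orth)
      then have e: "F \<nu> \<otimes> a \<otimes> F \<kappa> \<otimes> (b \<otimes> F \<mu>) = (F \<nu> \<otimes> a \<otimes> F \<kappa>) \<otimes> (F \<kappa> \<otimes> b \<otimes> F \<mu>)"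
        using nm k ab by (simp add: m_assoc) (simp flip: m_assoc)
      have "(\<nu>, \<kappa>) \<notin> r \<or> (\<kappa>, \<mu>) \<notin> r" using trans nm by blast
      then have "F \<nu> \<otimes> a \<otimes> F \<kappa> = \<zero> \<or> F \<kappa> \<otimes> b \<otimes> F \<mu> = \<zero>" using a b nm k by blast
      then show "F \<nu> \<otimes> a \<otimes> F \<kappa> \<otimes> (b \<otimes> F \<mu>) = \<zero>" unfolding e using nm k ab by auto
    qed auto
    finally show ?thesis by simp
  qed
  then show "a \<otimes> b \<in> ?T" using ab by simp
qed auto

end

locale ordered_idempotents = complete_idempotents R L F for R (structure) and L :: "'l set" and F +
  fixes r :: "('l \<times> 'l) set"
  assumes r_order: "partial_order_on L r"
    and F_ordered: "\<nu> \<in> L \<Longrightarrow> \<mu> \<in> L \<Longrightarrow> a \<in> carrier R \<Longrightarrow> F \<nu> \<otimes> a \<otimes> F \<mu> \<noteq> \<zero> \<Longrightarrow> (\<nu>, \<mu>) \<in> r"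
begin

text \<open>
  Insert \<open>1 = \<Sum> F\<^sub>\<mu>\<close> between \<open>a\<close> and \<open>b\<close>. For \<open>\<mu> \<noteq> \<nu>\<close> one of \<open>F\<^sub>\<nu> a F\<^sub>\<mu>\<close> and \<open>F\<^sub>\<mu> b F\<^sub>\<nu>\<close> vanishes, by antisymmetry.
\<close>

lemma corner_mult:
  assumes l: "\<nu> \<in> L" and ab: "a \<in> carrier R" "b \<in> carrier R"
  shows "F \<nu> \<otimes> (a \<otimes> b) \<otimes> F \<nu> = (F \<nu> \<otimes> a \<otimes> F \<nu>) \<otimes> (F \<nu> \<otimes> b \<otimes> F \<nu>)"
proof -
  have "F \<nu> \<otimes> (a \<otimes> b) \<otimes> F \<nu> = (F \<nu> \<otimes> a) \<otimes> (b \<otimes> F \<nu>)" using l ab by (simp add: m_assoc)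
  also have "\<dots> = (\<Oplus>\<mu>\<in>L. F \<nu> \<otimes> a \<otimes> F \<mu> \<otimes> (b \<otimes> F \<nu>))"
    using l ab by (intro insert_idempotents) auto
  also have "\<dots> = F \<nu> \<otimes> a \<otimes> F \<nu> \<otimes> (b \<otimes> F \<nu>)"
  proof (rule finsum_single_nonzero[OF finite_L l])
    fix \<mu> assume m: "\<mu> \<in> L" "\<mu> \<noteq> \<nu>"
    have "F \<mu> \<otimes> F \<mu> = F \<mu>" using m by (simp add: F_orth)
    then have e: "F \<nu> \<otimes> a \<otimes> F \<mu> \<otimes> (b \<otimes> F \<nu>) = (F \<nu> \<otimes> a \<otimes> F \<mu>) \<otimes> (F \<mu> \<otimes> b \<otimes> F \<nu>)"
      using l m ab by (simp add: m_assoc) (simp flip: m_assoc)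
    have "\<not> ((\<nu>, \<mu>) \<in> r \<and> (\<mu>, \<nu>) \<in> r)"
      using m r_order by (auto simp: partial_order_on_def antisym_def)
    then have "F \<nu> \<otimes> a \<otimes> F \<mu> = \<zero> \<or> F \<mu> \<otimes> b \<otimes> F \<nu> = \<zero>"
      using F_ordered[OF l m(1) ab(1)] F_ordered[OF m(1) l ab(2)] by blast
    then show "F \<nu> \<otimes> a \<otimes> F \<mu> \<otimes> (b \<otimes> F \<nu>) = \<zero>" unfolding e using l m ab by auto
  qed (use l ab in auto)
  also have "\<dots> = F \<nu> \<otimes> a \<otimes> (F \<nu> \<otimes> F \<nu>) \<otimes> (b \<otimes> F \<nu>)" using l by (simp add: F_orth)
  also have "\<dots> = (F \<nu> \<otimes> a \<otimes> F \<nu>) \<otimes> (F \<nu> \<otimes> b \<otimes> F \<nu>)"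
    using l ab by (simp add: m_assoc)
  finally show ?thesis .
qed

end

section \<open>Matrix units\<close>

definition unit_mat :: "nat \<Rightarrow> nat \<Rightarrow> nat \<Rightarrow> complex mat" where
  "unit_mat d i j = mat d d (\<lambda>(a, b). if a = i \<and> b = j then 1 else 0)"

lemma unit_mat_carrier [simp]: "unit_mat d i j \<in> carrier_mat d d"
  by (simp add: unit_mat_def)

lemma unit_mat_mult:
  assumes "i < d" "j < d" "k < d" "l < d"
  shows "unit_mat d i j * unit_mat d k l = (if j = k then unit_mat d i l else 0\<^sub>m d d)"
proof (rule eq_matI)
  fix a b assume "a < dim_row (if j = k then unit_mat d i l else 0\<^sub>m d d)" "b < dim_col (if j = k then unit_mat d i l else 0\<^sub>m d d)"
  then have ab: "a < d" "b < d" by (auto simp: unit_mat_def split: if_splits)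
  have "(unit_mat d i j * unit_mat d k l) $$ (a, b) = (\<Sum>c<d. unit_mat d i j $$ (a, c) * unit_mat d k l $$ (c, b))"
    by (rule index_mult_mat_sum[OF unit_mat_carrier unit_mat_carrier ab])
  also have "\<dots> = (\<Sum>c<d. if c = j then (if a = i \<and> j = k \<and> b = l then 1 else 0) else 0)"
    using ab by (intro sum.cong) (auto simp: unit_mat_def)
  finally show "(unit_mat d i j * unit_mat d k l) $$ (a, b) = (if j = k then unit_mat d i l else 0\<^sub>m d d) $$ (a, b)"
    using ab assms by (auto simp: unit_mat_def)
qed (auto simp: unit_mat_def)

context good_coeffs
begin

lemma mat_ring_over_iff:
  "A \<in> carrier (mat_ring_over K d) \<longleftrightarrow> A \<in> carrier_mat d d \<and> (\<forall>i<d. \<forall>j<d. A $$ (i, j) \<in> K)"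
proof -
  have "elements_mat A \<subseteq> K \<longleftrightarrow> (\<forall>i<d. \<forall>j<d. A $$ (i, j) \<in> K)" if "A \<in> carrier_mat d d"
  proof
    assume "elements_mat A \<subseteq> K"
    then show "\<forall>i<d. \<forall>j<d. A $$ (i, j) \<in> K" using elements_matI[OF that _ _ refl] by blast
  next
    assume "\<forall>i<d. \<forall>j<d. A $$ (i, j) \<in> K"
    then show "elements_mat A \<subseteq> K"
      using that by (intro subsetI) (drule elements_matD, elim exE conjE, simp)
  qed
  then show ?thesis by (simp add: mat_ring_over_def cong: conj_cong)
qed

lemma mat_ring_over_ops:
  "A \<otimes>\<^bsub>mat_ring_over K d\<^esub> B = A * B" "A \<oplus>\<^bsub>mat_ring_over K d\<^esub> B = A + B" "\<one>\<^bsub>mat_ring_over K d\<^esub> = 1\<^sub>m d"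
  by (simp_all add: mat_ring_over_def ring_mat_def)

lemma mat_ring_over_closed:
  "0\<^sub>m d d \<in> carrier (mat_ring_over K d)" "1\<^sub>m d \<in> carrier (mat_ring_over K d)"
  "unit_mat d i j \<in> carrier (mat_ring_over K d)"
  "A \<in> carrier (mat_ring_over K d) \<Longrightarrow> B \<in> carrier (mat_ring_over K d) \<Longrightarrow> A + B \<in> carrier (mat_ring_over K d)"
  "A \<in> carrier (mat_ring_over K d) \<Longrightarrow> B \<in> carrier (mat_ring_over K d) \<Longrightarrow> A * B \<in> carrier (mat_ring_over K d)"
  "c \<in> K \<Longrightarrow> A \<in> carrier (mat_ring_over K d) \<Longrightarrow> c \<cdot>\<^sub>m A \<in> carrier (mat_ring_over K d)"
proof -
  show "A \<in> carrier (mat_ring_over K d) \<Longrightarrow> B \<in> carrier (mat_ring_over K d) \<Longrightarrow> A * B \<in> carrier (mat_ring_over K d)"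
    unfolding mat_ring_over_iff
    by (auto simp: index_mult_mat_sum[of A d d B d] K_closed simp del: index_mult_mat(1) intro!: K_sum)
qed (auto simp: mat_ring_over_iff unit_mat_def K_closed)

text \<open>A matrix is built up by filling in one entry after the other, in row-major order.\<close>

lemma mat_ring_induct [consumes 1, case_names zero add]:
  assumes A: "A \<in> carrier (mat_ring_over K d)" and z: "P (0\<^sub>m d d)"
    and add: "\<And>B c i j. B \<in> carrier (mat_ring_over K d) \<Longrightarrow> P B \<Longrightarrow> c \<in> K \<Longrightarrow> i < d \<Longrightarrow> j < d \<Longrightarrow> P (B + c \<cdot>\<^sub>m unit_mat d i j)"
  shows "P A"
proof -
  \<comment> \<open>The first \<open>n\<close> entries of \<open>A\<close>, the remaining ones replaced by 0.\<close>
  define A' where "A' n = mat d d (\<lambda>(i, j). if i * d + j < n then A $$ (i, j) else 0)" for n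
  have ind: "A' n \<in> carrier (mat_ring_over K d) \<and> P (A' n)" if "n \<le> d * d" for n
    using that
  proof (induction n)
    case 0
    have "A' 0 = 0\<^sub>m d d" by (rule eq_matI) (auto simp: A'_def)
    then show ?case using z mat_ring_over_closed(1) by simp
  next
    case (Suc n)
    let ?i = "n div d" and ?j = "n mod d"
    have ij: "?i < d" "?j < d" using div_mod_less[of n d d] Suc.prems by auto
    have "A' (Suc n) = A' n + A $$ (?i, ?j) \<cdot>\<^sub>m unit_mat d ?i ?j"
    proof (rule eq_matI)
      fix a b assume "a < dim_row (A' n + A $$ (?i, ?j) \<cdot>\<^sub>m unit_mat d ?i ?j)" "b < dim_col (A' n + A $$ (?i, ?j) \<cdot>\<^sub>m unit_mat d ?i ?j)"
      then have ab: "a < d" "b < d" by (auto simp: unit_mat_def)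
      have "a * d + b = n \<longleftrightarrow> a = ?i \<and> b = ?j" using ab by auto
      then show "A' (Suc n) $$ (a, b) = (A' n + A $$ (?i, ?j) \<cdot>\<^sub>m unit_mat d ?i ?j) $$ (a, b)"
        using ab by (auto simp: A'_def unit_mat_def less_Suc_eq)
    qed (auto simp: A'_def unit_mat_def)
    moreover have "A $$ (?i, ?j) \<in> K" using A ij by (simp add: mat_ring_over_iff)
    ultimately show ?case using Suc ij by (simp add: add mat_ring_over_closed)
  qed
  have "A' (d * d) = A"
  proof (rule eq_matI)
    fix a b assume "a < dim_row A" "b < dim_col A"
    then have ab: "a < d" "b < d" using A by (auto simp: mat_ring_over_iff)
    have "a * d + b < d * d"
    proof -
      have "a * d + b < Suc a * d" using ab by simp
      also have "\<dots> \<le> d * d" using ab by (intro mult_le_mono1) simp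
      finally show ?thesis .
    qed
    then show "A' (d * d) $$ (a, b) = A $$ (a, b)" using ab by (simp add: A'_def)
  qed (use A in \<open>auto simp: A'_def mat_ring_over_iff\<close>)
  then show ?thesis using ind[of "d * d"] by simp
qed

end

text \<open>
  The sum of the \<open>c i i\<close> need not be 1, so \<open>mat_hom\<close> below is a homomorphism onto an algebra with its own unit.
\<close>

locale matrix_units = good_coeffs K + ring R for K and R (structure) +
  fixes scal :: "complex \<Rightarrow> 'a" and d :: nat and c :: "nat \<Rightarrow> nat \<Rightarrow> 'a"
  assumes scal_closed [simp]: "z \<in> K \<Longrightarrow> scal z \<in> carrier R"
    and scal_central: "z \<in> K \<Longrightarrow> a \<in> carrier R \<Longrightarrow> scal z \<otimes> a = a \<otimes> scal z"
    and scal_add: "z \<in> K \<Longrightarrow> w \<in> K \<Longrightarrow> scal (z + w) = scal z \<oplus> scal w"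
    and scal_mult: "z \<in> K \<Longrightarrow> w \<in> K \<Longrightarrow> scal (z * w) = scal z \<otimes> scal w"
    and scal_one: "scal 1 = \<one>" and scal_zero: "scal 0 = \<zero>"
    and c_closed [simp]: "i < d \<Longrightarrow> j < d \<Longrightarrow> c i j \<in> carrier R"
    and c_mult: "i < d \<Longrightarrow> j < d \<Longrightarrow> k < d \<Longrightarrow> l < d \<Longrightarrow> c i j \<otimes> c k l = (if j = k then c i l else \<zero>)"
begin

abbreviation M where "M \<equiv> carrier (mat_ring_over K d)"

definition mat_hom :: "complex mat \<Rightarrow> 'a" where
  "mat_hom A = (\<Oplus>p\<in>{..<d} \<times> {..<d}. scal (A $$ p) \<otimes> c (fst p) (snd p))"

lemma entry: "A \<in> M \<Longrightarrow> p \<in> {..<d} \<times> {..<d} \<Longrightarrow> A $$ p \<in> K"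
  by (cases p) (simp add: mat_ring_over_iff)

lemma mat_hom_closed [simp]: "A \<in> M \<Longrightarrow> mat_hom A \<in> carrier R"
  unfolding mat_hom_def using entry by (intro finsum_closed) auto

lemma mat_hom_add: "A \<in> M \<Longrightarrow> B \<in> M \<Longrightarrow> mat_hom (A + B) = mat_hom A \<oplus> mat_hom B"
proof -
  assume A: "A \<in> M" and B: "B \<in> M"
  have "mat_hom (A + B) = (\<Oplus>p\<in>{..<d} \<times> {..<d}. scal (A $$ p) \<otimes> c (fst p) (snd p) \<oplus> scal (B $$ p) \<otimes> c (fst p) (snd p))"
    unfolding mat_hom_def
  proof (intro finsum_cong')
    fix p assume p: "p \<in> {..<d} \<times> {..<d}"
    then have "(A + B) $$ p = A $$ p + B $$ p" using A B by (cases p) (auto simp: mat_ring_over_iff)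
    then show "scal ((A + B) $$ p) \<otimes> c (fst p) (snd p) =
        scal (A $$ p) \<otimes> c (fst p) (snd p) \<oplus> scal (B $$ p) \<otimes> c (fst p) (snd p)"
      using p entry[OF A p] entry[OF B p] by (auto simp: scal_add l_distr)
  qed (use entry[OF A] entry[OF B] in auto)
  also have "\<dots> = mat_hom A \<oplus> mat_hom B" unfolding mat_hom_def
    using entry[OF A] entry[OF B] by (intro finsum_addf) auto
  finally show ?thesis .
qed

lemma mat_hom_smult: "k \<in> K \<Longrightarrow> A \<in> M \<Longrightarrow> mat_hom (k \<cdot>\<^sub>m A) = scal k \<otimes> mat_hom A"
proof -
  assume k: "k \<in> K" and A: "A \<in> M"
  have "mat_hom (k \<cdot>\<^sub>m A) = (\<Oplus>p\<in>{..<d} \<times> {..<d}. scal k \<otimes> (scal (A $$ p) \<otimes> c (fst p) (snd p)))"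
    unfolding mat_hom_def
  proof (intro finsum_cong')
    fix p assume p: "p \<in> {..<d} \<times> {..<d}"
    then have "(k \<cdot>\<^sub>m A) $$ p = k * A $$ p" using A by (cases p) (auto simp: mat_ring_over_iff)
    then show "scal ((k \<cdot>\<^sub>m A) $$ p) \<otimes> c (fst p) (snd p) = scal k \<otimes> (scal (A $$ p) \<otimes> c (fst p) (snd p))"
      using p k entry[OF A p] by (auto simp: scal_mult m_assoc)
  qed (use k entry[OF A] in auto)
  also have "\<dots> = scal k \<otimes> mat_hom A" unfolding mat_hom_def
    using k entry[OF A] by (intro finsum_rdistr[symmetric]) auto
  finally show ?thesis .
qed

lemma mat_hom_zero: "mat_hom (0\<^sub>m d d) = \<zero>"
proof -
  have "0\<^sub>m d d = 0 \<cdot>\<^sub>m (0\<^sub>m d d :: complex mat)" by auto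
  then show ?thesis
    using mat_hom_smult[OF K_closed(1) mat_ring_over_closed(1)] by (simp add: scal_zero mat_ring_over_closed)
qed

lemma mat_hom_unit: "i < d \<Longrightarrow> j < d \<Longrightarrow> mat_hom (unit_mat d i j) = c i j"
proof -
  assume ij: "i < d" "j < d"
  have "mat_hom (unit_mat d i j) = scal (unit_mat d i j $$ (i, j)) \<otimes> c (fst (i, j)) (snd (i, j))"
    unfolding mat_hom_def
  proof (rule finsum_single_nonzero)
    fix p assume "p \<in> {..<d} \<times> {..<d}" "p \<noteq> (i, j)"
    then show "scal (unit_mat d i j $$ p) \<otimes> c (fst p) (snd p) = \<zero>"
      by (cases p) (auto simp: unit_mat_def scal_zero)
  qed (use ij entry[OF mat_ring_over_closed(3)] in auto)
  then show ?thesis using ij by (simp add: unit_mat_def scal_one)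
qed

lemma mat_hom_mult_unit:
  assumes A: "A \<in> M" and kl: "k < d" "l < d"
  shows "mat_hom (A * unit_mat d k l) = mat_hom A \<otimes> c k l"
  using A
proof (induction A rule: mat_ring_induct)
  case zero
  then show ?case using kl by (simp add: mat_hom_zero left_mult_zero_mat[OF unit_mat_carrier])
next
  case (add B a i j)
  have Bc: "B \<in> carrier_mat d d" using add by (simp add: mat_ring_over_iff)
  have "(B + a \<cdot>\<^sub>m unit_mat d i j) * unit_mat d k l =
      B * unit_mat d k l + (a \<cdot>\<^sub>m unit_mat d i j) * unit_mat d k l"
    by (rule add_mult_distrib_mat[OF Bc _ unit_mat_carrier]) simp
  also have "(a \<cdot>\<^sub>m unit_mat d i j) * unit_mat d k l = a \<cdot>\<^sub>m (unit_mat d i j * unit_mat d k l)"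
    by (rule mult_smult_assoc_mat[OF unit_mat_carrier unit_mat_carrier])
  finally have "mat_hom ((B + a \<cdot>\<^sub>m unit_mat d i j) * unit_mat d k l) =
      mat_hom B \<otimes> c k l \<oplus> scal a \<otimes> mat_hom (unit_mat d i j * unit_mat d k l)"
    using add by (simp add: mat_hom_add mat_hom_smult mat_ring_over_closed)
  also have "mat_hom (unit_mat d i j * unit_mat d k l) = c i j \<otimes> c k l"
    using add kl by (simp add: unit_mat_mult mat_hom_unit mat_hom_zero c_mult)
  also have "mat_hom B \<otimes> c k l \<oplus> scal a \<otimes> (c i j \<otimes> c k l) = (mat_hom B \<oplus> scal a \<otimes> c i j) \<otimes> c k l"
    using add kl by (simp add: l_distr m_assoc)
  also have "mat_hom B \<oplus> scal a \<otimes> c i j = mat_hom (B + a \<cdot>\<^sub>m unit_mat d i j)"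
    using add by (simp add: mat_hom_add mat_hom_smult mat_hom_unit mat_ring_over_closed)
  finally show ?case .
qed

lemma mat_hom_mult:
  assumes A: "A \<in> M" and B: "B \<in> M"
  shows "mat_hom (A * B) = mat_hom A \<otimes> mat_hom B"
  using B
proof (induction B rule: mat_ring_induct)
  case zero
  have "A * 0\<^sub>m d d = 0\<^sub>m d d" using A by (intro right_mult_zero_mat) (simp add: mat_ring_over_iff)
  then show ?case using A by (simp add: mat_hom_zero)
next
  case (add B a i j)
  have c: "A \<in> carrier_mat d d" "B \<in> carrier_mat d d" using A add by (auto simp: mat_ring_over_iff)
  have "A * (B + a \<cdot>\<^sub>m unit_mat d i j) = A * B + A * (a \<cdot>\<^sub>m unit_mat d i j)"
    using c by (intro mult_add_distrib_mat) auto
  also have "A * (a \<cdot>\<^sub>m unit_mat d i j) = a \<cdot>\<^sub>m (A * unit_mat d i j)"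
    by (rule mult_smult_distrib[OF c(1) unit_mat_carrier])
  finally have "mat_hom (A * (B + a \<cdot>\<^sub>m unit_mat d i j)) =
      mat_hom A \<otimes> mat_hom B \<oplus> scal a \<otimes> (mat_hom A \<otimes> c i j)"
    using A add by (simp add: mat_hom_add mat_hom_smult mat_hom_mult_unit mat_ring_over_closed)
  also have "scal a \<otimes> (mat_hom A \<otimes> c i j) = mat_hom A \<otimes> (scal a \<otimes> c i j)"
  proof -
    have "scal a \<otimes> (mat_hom A \<otimes> c i j) = (scal a \<otimes> mat_hom A) \<otimes> c i j" using A add by (simp add: m_assoc)
    also have "\<dots> = (mat_hom A \<otimes> scal a) \<otimes> c i j" using scal_central[of a "mat_hom A"] A add by simp
    finally show ?thesis using A add by (simp add: m_assoc)
  qed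
  also have "mat_hom A \<otimes> mat_hom B \<oplus> mat_hom A \<otimes> (scal a \<otimes> c i j) = mat_hom A \<otimes> (mat_hom B \<oplus> scal a \<otimes> c i j)"
    using A add by (simp add: r_distr)
  also have "mat_hom B \<oplus> scal a \<otimes> c i j = mat_hom (B + a \<cdot>\<^sub>m unit_mat d i j)"
    using add by (simp add: mat_hom_add mat_hom_smult mat_hom_unit mat_ring_over_closed)
  finally show ?case .
qed

end

section \<open>The W-graph algebra of a finite group with reflections\<close>

locale wgraph_setup = good_coeffs K + finite_group G
  for K :: "complex set" and G :: "('s, 'm) monoid_scheme" (structure) +
  fixes S :: "'s set"
  assumes S_carrier: "S \<subseteq> carrier G"
    and S_ord: "s \<in> S \<Longrightarrow> group.ord G s = 2"
begin

lemma ord_nonzero: "g \<in> carrier G \<Longrightarrow> group.ord G g \<noteq> 0"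
proof -
  assume g: "g \<in> carrier G"
  have "ord g dvd Coset.order G" using pow_order_eq_1[OF g] pow_eq_id[OF g] by simp
  moreover have "Coset.order G > 0" using order_gt_0_iff_finite finite_carrier by simp
  ultimately show ?thesis by auto
qed

abbreviation \<Omega> where "\<Omega> \<equiv> Omega K G S"

sublocale W: wgraph_ring \<Omega> "omega_e K G S" S "omega_x K G S" "commuting_pair G"
proof (rule wgraph_ring_if_relations)
  show "finite S" using S_carrier finite_carrier finite_subset by blast
  show "group.ord G (s \<otimes> t) \<noteq> 0" if "s \<in> S" "t \<in> S" for s t
    using that S_carrier by (intro ord_nonzero) auto
qed (use Omega_ring Omega_relations is_group S_carrier S_ord in auto)

lemma E_elt_eq: "E_elt K G S I = W.E S I"
  by (simp add: E_elt_def W.idem_proj_def)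

lemma X_elt_eq:
  assumes "I \<subseteq> S" "J \<subseteq> S" "s \<in> I - J"
  shows "X_elt K G S I J = W.X_elem s I J"
proof -
  have "(SOME s. s \<in> I - J) \<in> I - J" by (rule someI[of "\<lambda>s. s \<in> I - J"]) (rule assms(3))
  then show ?thesis
    unfolding X_elt_def Xs_elt_def E_elt_eq using W.X_elem_indep[OF assms(1,2) _ assms(3)] by simp
qed

lemma transversal_edgeD:
  assumes "transversal_edge G S I J"
  obtains s r where "I \<subseteq> S" "J \<subseteq> S" "s \<in> I - J" "r \<in> J - I"
  using assms unfolding transversal_edge_def compat_edge_def by blast

abbreviation Psi_gens where
  "Psi_gens \<equiv> omega_scalar K G S ` K \<union> {E_elt K G S I | I. I \<subseteq> S} \<union>
      {X_elt K G S I J | I J. transversal_edge G S I J}"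

lemma Psi_gens_carrier: "Psi_gens \<subseteq> carrier \<Omega>"
proof -
  have 1: "X_elt K G S I J \<in> carrier \<Omega>" if tr: "transversal_edge G S I J" for I J
  proof -
    obtain s r where sr: "I \<subseteq> S" "J \<subseteq> S" "s \<in> I - J" "r \<in> J - I" using transversal_edgeD[OF tr] .
    then have "s \<in> S" by blast
    then show ?thesis using sr by (simp add: X_elt_eq[OF sr(1-3)])
  qed
  have 2: "E_elt K G S I \<in> carrier \<Omega>" if "I \<subseteq> S" for I using that by (simp add: E_elt_eq)
  have 3: "omega_scalar K G S c \<in> carrier \<Omega>" if "c \<in> K" for c by (rule omega_scalar_closed[OF that])
  show ?thesis using 1 2 3 by blast
qed

lemma Psi_subring: "subring (Psi K G S) \<Omega>"
  unfolding Psi_def by (rule W.generate_ring_is_subring[OF Psi_gens_carrier])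

lemma Psi_minimal: "subring H \<Omega> \<Longrightarrow> Psi_gens \<subseteq> H \<Longrightarrow> Psi K G S \<subseteq> H"
  unfolding Psi_def by (rule W.generate_ring_min_subring1[OF Psi_gens_carrier])

lemma Psi_gens_Psi: "Psi_gens \<subseteq> Psi K G S"
  unfolding Psi_def by (auto intro!: generate_ring.incl)

lemma Psi_carrier: "Psi K G S \<subseteq> carrier \<Omega>"
  using subringE(1)[OF Psi_subring] .

lemma scalar_Psi: "c \<in> K \<Longrightarrow> omega_scalar K G S c \<in> Psi K G S"
  using Psi_gens_Psi by blast

lemma E_Psi: "I \<subseteq> S \<Longrightarrow> W.E S I \<in> Psi K G S"
  unfolding E_elt_eq[symmetric] by (rule subsetD[OF Psi_gens_Psi]) blast

lemma e_Psi: "s \<in> S \<Longrightarrow> omega_e K G S s \<in> Psi K G S"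
  unfolding W.e_decomp[of s]
  by (intro W.finsum_in_subring[OF Psi_subring]) (simp add: E_Psi subringE(2)[OF Psi_subring])

end

locale wgraph_decomp = wgraph_setup K G S for K and G :: "('s, 'm) monoid_scheme" (structure) and S +
  fixes F
  assumes decomp: "strong_wgraph_decomposition K G S F"
begin

lemma decomp_facts:
  "\<nu> \<in> Irr G \<Longrightarrow> F \<nu> \<in> carrier \<Omega>"
  "\<nu> \<in> Irr G \<Longrightarrow> \<mu> \<in> Irr G \<Longrightarrow> F \<nu> \<otimes>\<^bsub>\<Omega>\<^esub> F \<mu> = (if \<nu> = \<mu> then F \<nu> else \<zero>\<^bsub>\<Omega>\<^esub>)"
  "finsum \<Omega> F (Irr G) = \<one>\<^bsub>\<Omega>\<^esub>"
  "\<nu> \<in> Irr G \<Longrightarrow> I \<subseteq> S \<Longrightarrow> W.E S I \<otimes>\<^bsub>\<Omega>\<^esub> F \<nu> = F \<nu> \<otimes>\<^bsub>\<Omega>\<^esub> W.E S I"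
  "\<nu> \<in> Irr G \<Longrightarrow> \<exists>\<psi>. surj_matrix_morphism K G S (char_degree G \<nu>) (F \<nu>) \<psi>"
  "\<nu> \<in> Irr G \<Longrightarrow> compat_edge G S I J \<Longrightarrow> F \<nu> \<otimes>\<^bsub>\<Omega>\<^esub> X_elt K G S I J \<otimes>\<^bsub>\<Omega>\<^esub> F \<nu> \<in> Psi K G S"
  "\<nu> \<in> Irr G \<Longrightarrow> F \<nu> \<in> Psi K G S"
proof -
  note d1 = decomp[unfolded strong_wgraph_decomposition_def E_elt_eq]
  note d2 = conjunct2[OF d1] note d3 = conjunct2[OF d2] note d4 = conjunct2[OF d3]
  note d5 = conjunct2[OF d4] note d6 = conjunct2[OF d5] note d7 = conjunct2[OF d6]
  show "\<nu> \<in> Irr G \<Longrightarrow> F \<nu> \<in> carrier \<Omega>" by (rule bspec[OF conjunct1[OF d1]])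
  show "\<nu> \<in> Irr G \<Longrightarrow> \<mu> \<in> Irr G \<Longrightarrow> F \<nu> \<otimes>\<^bsub>\<Omega>\<^esub> F \<mu> = (if \<nu> = \<mu> then F \<nu> else \<zero>\<^bsub>\<Omega>\<^esub>)"
    by (rule bspec[OF bspec[OF conjunct1[OF d2]]])
  show "finsum \<Omega> F (Irr G) = \<one>\<^bsub>\<Omega>\<^esub>" by (rule conjunct1[OF d3, symmetric])
  show "\<nu> \<in> Irr G \<Longrightarrow> I \<subseteq> S \<Longrightarrow> W.E S I \<otimes>\<^bsub>\<Omega>\<^esub> F \<nu> = F \<nu> \<otimes>\<^bsub>\<Omega>\<^esub> W.E S I"
    by (rule conjunct1[OF d4, rule_format])
  show "\<nu> \<in> Irr G \<Longrightarrow> \<exists>\<psi>. surj_matrix_morphism K G S (char_degree G \<nu>) (F \<nu>) \<psi>"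
    by (rule bspec[OF conjunct1[OF d6]])
  show "\<nu> \<in> Irr G \<Longrightarrow> compat_edge G S I J \<Longrightarrow> F \<nu> \<otimes>\<^bsub>\<Omega>\<^esub> X_elt K G S I J \<otimes>\<^bsub>\<Omega>\<^esub> F \<nu> \<in> Psi K G S"
    by (rule conjunct1[OF d7, rule_format])
  show "\<nu> \<in> Irr G \<Longrightarrow> F \<nu> \<in> Psi K G S" by (rule bspec[OF conjunct2[OF d7]])
qed

lemma ex_order: "\<exists>r. ordered_idempotents \<Omega> (Irr G) F r"
proof -
  note d1 = decomp[unfolded strong_wgraph_decomposition_def]
  note d2 = conjunct2[OF d1] note d3 = conjunct2[OF d2] note d4 = conjunct2[OF d3] note d5 = conjunct2[OF d4]
  obtain r where r: "partial_order_on (Irr G) r"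
    "\<forall>\<nu>\<in>Irr G. \<forall>\<mu>\<in>Irr G. (\<exists>a\<in>carrier \<Omega>. F \<nu> \<otimes>\<^bsub>\<Omega>\<^esub> a \<otimes>\<^bsub>\<Omega>\<^esub> F \<mu> \<noteq> \<zero>\<^bsub>\<Omega>\<^esub>) \<longrightarrow> (\<nu>, \<mu>) \<in> r"
    using conjunct1[OF d5] by (elim exE conjE)
  have "ordered_idempotents \<Omega> (Irr G) F r"
  proof
    show "(\<nu>, \<mu>) \<in> r" if "\<nu> \<in> Irr G" "\<mu> \<in> Irr G" "a \<in> carrier \<Omega>"
      "F \<nu> \<otimes>\<^bsub>\<Omega>\<^esub> a \<otimes>\<^bsub>\<Omega>\<^esub> F \<mu> \<noteq> \<zero>\<^bsub>\<Omega>\<^esub>" for \<nu> \<mu> a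
      using bspec[OF bspec[OF r(2) that(1)] that(2)] that(3,4) by (elim impE) (rule bexI)
  qed (rule finite_Irr decomp_facts(1) decomp_facts(2) decomp_facts(3) r(1); assumption)+
  then show ?thesis by (rule exI)
qed

text \<open>
  An order on the irreducible characters as in (Z3). It is fixed here so that the order conditions for different
  factors can refer to it.
\<close>

definition ord_rel where "ord_rel = (SOME r. ordered_idempotents \<Omega> (Irr G) F r)"

sublocale D: ordered_idempotents \<Omega> "Irr G" F ord_rel
  unfolding ord_rel_def by (rule someI_ex[OF ex_order])

lemma F_commutes_e:
  assumes "\<nu> \<in> Irr G" "s \<in> S"
  shows "F \<nu> \<otimes>\<^bsub>\<Omega>\<^esub> omega_e K G S s = omega_e K G S s \<otimes>\<^bsub>\<Omega>\<^esub> F \<nu>"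
proof -
  have "omega_e K G S s \<in> {b \<in> carrier \<Omega>. F \<nu> \<otimes>\<^bsub>\<Omega>\<^esub> b = b \<otimes>\<^bsub>\<Omega>\<^esub> F \<nu>}"
    unfolding W.e_decomp[OF assms(2)]
    using assms decomp_facts(4) by (intro W.finsum_in_subring[OF W.centralizer_subring]) auto
  then show ?thesis by simp
qed

text \<open>
  Write \<open>x\<^sub>s\<close> as the sum of its parts \<open>E\<^sub>I x\<^sub>s E\<^sub>J\<close>. Those that belong to edges of the compatibility graph are covered
  by (Z5), and the others vanish.
\<close>

lemma corner_x_Psi:
  assumes n: "\<nu> \<in> Irr G" and s: "s \<in> S"
  shows "F \<nu> \<otimes>\<^bsub>\<Omega>\<^esub> omega_x K G S s \<otimes>\<^bsub>\<Omega>\<^esub> F \<nu> \<in> Psi K G S"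
proof -
  have fin: "finite (Pow S)" using W.finite_S by simp
  have t: "F \<nu> \<otimes>\<^bsub>\<Omega>\<^esub> W.X_elem s I J \<otimes>\<^bsub>\<Omega>\<^esub> F \<nu> \<in> Psi K G S" if IJ: "I \<subseteq> S" "J \<subseteq> S" for I J
  proof (cases "s \<in> I - J \<and> compat_edge G S I J")
    case True
    then show ?thesis using decomp_facts(6)[OF n, of I J] X_elt_eq[OF IJ, of s] by simp
  next
    case False
    have "W.X_elem s I J = \<zero>\<^bsub>\<Omega>\<^esub>"
    proof (cases "s \<in> I - J")
      case True
      then have "\<not> compat_edge G S I J" using False by blast
      then obtain p q where pq: "p \<in> I - J" "q \<in> J - I" "p \<otimes> q = q \<otimes> p"
        using True IJ unfolding compat_edge_def by blast
      have "commuting_pair G q p" using pq unfolding commuting_pair_def by auto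
      then show ?thesis using W.X_elem_nonedge[OF IJ True pq(1,2)] by blast
    next
      case False
      then show ?thesis using W.X_elem_zero[OF IJ s] by simp
    qed
    then show ?thesis using n subringE(2)[OF Psi_subring] by simp
  qed
  have "F \<nu> \<otimes>\<^bsub>\<Omega>\<^esub> omega_x K G S s \<otimes>\<^bsub>\<Omega>\<^esub> F \<nu> =
      (\<Oplus>\<^bsub>\<Omega>\<^esub>I\<in>Pow S. \<Oplus>\<^bsub>\<Omega>\<^esub>J\<in>Pow S. F \<nu> \<otimes>\<^bsub>\<Omega>\<^esub> W.X_elem s I J \<otimes>\<^bsub>\<Omega>\<^esub> F \<nu>)"
  proof -
    have "F \<nu> \<otimes>\<^bsub>\<Omega>\<^esub> (\<Oplus>\<^bsub>\<Omega>\<^esub>I\<in>Pow S. \<Oplus>\<^bsub>\<Omega>\<^esub>J\<in>Pow S. W.X_elem s I J) \<otimes>\<^bsub>\<Omega>\<^esub> F \<nu> =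
        (\<Oplus>\<^bsub>\<Omega>\<^esub>I\<in>Pow S. F \<nu> \<otimes>\<^bsub>\<Omega>\<^esub> (\<Oplus>\<^bsub>\<Omega>\<^esub>J\<in>Pow S. W.X_elem s I J) \<otimes>\<^bsub>\<Omega>\<^esub> F \<nu>)"
      using fin n s by (subst W.finsum_rdistr) (auto simp: W.finsum_ldistr)
    also have "\<dots> = (\<Oplus>\<^bsub>\<Omega>\<^esub>I\<in>Pow S. \<Oplus>\<^bsub>\<Omega>\<^esub>J\<in>Pow S. F \<nu> \<otimes>\<^bsub>\<Omega>\<^esub> W.X_elem s I J \<otimes>\<^bsub>\<Omega>\<^esub> F \<nu>)"
    proof (intro W.finsum_cong')
      fix I assume I: "I \<in> Pow S"
      show "F \<nu> \<otimes>\<^bsub>\<Omega>\<^esub> (\<Oplus>\<^bsub>\<Omega>\<^esub>J\<in>Pow S. W.X_elem s I J) \<otimes>\<^bsub>\<Omega>\<^esub> F \<nu> =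
          (\<Oplus>\<^bsub>\<Omega>\<^esub>J\<in>Pow S. F \<nu> \<otimes>\<^bsub>\<Omega>\<^esub> W.X_elem s I J \<otimes>\<^bsub>\<Omega>\<^esub> F \<nu>)"
        using fin n s I by (subst W.finsum_rdistr) (auto simp: W.finsum_ldistr)
    qed (use n s in auto)
    finally show ?thesis using W.x_decomp[OF s] by simp
  qed
  also have "\<dots> \<in> Psi K G S"
    using t by (intro W.finsum_in_subring[OF Psi_subring]) auto
  finally show ?thesis .
qed

text \<open>Since \<open>a \<mapsto> F a F\<close> is multiplicative, it suffices to consider generators.\<close>

lemma corner_Psi:
  assumes n: "\<nu> \<in> Irr G" and a: "a \<in> carrier \<Omega>"
  shows "F \<nu> \<otimes>\<^bsub>\<Omega>\<^esub> a \<otimes>\<^bsub>\<Omega>\<^esub> F \<nu> \<in> Psi K G S"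
proof -
  let ?H = "{a \<in> carrier \<Omega>. F \<nu> \<otimes>\<^bsub>\<Omega>\<^esub> a \<otimes>\<^bsub>\<Omega>\<^esub> F \<nu> \<in> Psi K G S}"
  note P = subringE[OF Psi_subring]
  have idem: "F \<nu> \<otimes>\<^bsub>\<Omega>\<^esub> F \<nu> = F \<nu>" using decomp_facts(2)[OF n n] by simp
  have "subring ?H \<Omega>"
  proof (rule W.subringI)
    show "\<one>\<^bsub>\<Omega>\<^esub> \<in> ?H" using n decomp_facts(7)[OF n] idem by simp
    fix a b assume a: "a \<in> ?H"
    then show "\<ominus>\<^bsub>\<Omega>\<^esub> a \<in> ?H" using n P(5) by (simp add: W.r_minus W.l_minus)
    assume b: "b \<in> ?H"
    show "a \<oplus>\<^bsub>\<Omega>\<^esub> b \<in> ?H" using a b n P(7) by (simp add: W.r_distr W.l_distr)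
    show "a \<otimes>\<^bsub>\<Omega>\<^esub> b \<in> ?H" using a b D.corner_mult[OF n, of a b] P(6) by simp
  qed auto
  then have "?H = carrier \<Omega>"
  proof (rule Omega_generated)
    fix s assume s: "s \<in> S"
    have "F \<nu> \<otimes>\<^bsub>\<Omega>\<^esub> omega_e K G S s \<otimes>\<^bsub>\<Omega>\<^esub> F \<nu> = omega_e K G S s \<otimes>\<^bsub>\<Omega>\<^esub> F \<nu>"
      using n s idem by (simp add: F_commutes_e W.m_assoc)
    then show "omega_e K G S s \<in> ?H" using s n P(6)[OF e_Psi[OF s] decomp_facts(7)[OF n]] by simp
    show "omega_x K G S s \<in> ?H" using s corner_x_Psi[OF n s] by simp
  next
    fix c assume c: "c \<in> K"
    note cc = omega_scalar_closed[OF c, of G S]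
    have "F \<nu> \<otimes>\<^bsub>\<Omega>\<^esub> omega_scalar K G S c \<otimes>\<^bsub>\<Omega>\<^esub> F \<nu> = omega_scalar K G S c \<otimes>\<^bsub>\<Omega>\<^esub> F \<nu>"
      using n cc idem by (simp add: W.m_assoc flip: omega_scalar_central[OF c])
    then show "omega_scalar K G S c \<in> ?H" using cc P(6)[OF scalar_Psi[OF c] decomp_facts(7)[OF n]] by simp
  qed
  then show ?thesis using a by blast
qed

end

section \<open>A factor of a product\<close>

text \<open>
  A factor \<open>G'\<close> of a product \<open>G\<close>: its reflections are mapped to reflections of \<open>G\<close>, and all further reflections of
  \<open>G\<close>, those in \<open>B\<close>, commute with the image. The homomorphism \<open>j\<close> is the induced one between the W-graph algebras.
\<close>

locale wgraph_factor = P: wgraph_setup K G S + Q: wgraph_setup K G' S'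
  for K and G :: "('s, 'm) monoid_scheme" and S and G' :: "('t, 'n) monoid_scheme" and S' +
  fixes \<iota> :: "'t \<Rightarrow> 's" and B :: "'s set" and j
  assumes inj: "inj_on \<iota> S'"
    and S_eq: "S = \<iota> ` S' \<union> B" and disj: "\<iota> ` S' \<inter> B = {}"
    and cross_comm: "s \<in> S' \<Longrightarrow> b \<in> B \<Longrightarrow> \<iota> s \<otimes>\<^bsub>G\<^esub> b = b \<otimes>\<^bsub>G\<^esub> \<iota> s"
    and comm_iff: "s \<in> S' \<Longrightarrow> t \<in> S' \<Longrightarrow> \<iota> s \<otimes>\<^bsub>G\<^esub> \<iota> t = \<iota> t \<otimes>\<^bsub>G\<^esub> \<iota> s \<longleftrightarrow> s \<otimes>\<^bsub>G'\<^esub> t = t \<otimes>\<^bsub>G'\<^esub> s"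
    and j_hom: "j \<in> Ring.ring_hom (Omega K G' S') (Omega K G S)"
    and j_e: "s \<in> S' \<Longrightarrow> j (omega_e K G' S' s) = omega_e K G S (\<iota> s)"
    and j_x: "s \<in> S' \<Longrightarrow> j (omega_x K G' S' s) = omega_x K G S (\<iota> s)"
    and j_scalar: "c \<in> K \<Longrightarrow> j (omega_scalar K G' S' c) = omega_scalar K G S c"
begin

abbreviation A where "A \<equiv> \<iota> ` S'"

sublocale J: ring_hom_ring "Omega K G' S'" "Omega K G S" j
  by (intro ring_hom_ringI2 P.Omega_ring P.Omega_ring j_hom)

lemma AS: "A \<subseteq> S" and BS: "B \<subseteq> S"
  using S_eq by auto

lemma cross_pair:
  "a \<in> A \<Longrightarrow> b \<in> B \<Longrightarrow> commuting_pair G a b" "a \<in> A \<Longrightarrow> b \<in> B \<Longrightarrow> commuting_pair G b a"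
  using disj cross_comm unfolding commuting_pair_def by (blast, metis disjoint_iff imageE)

lemma j_E:
  assumes "I \<subseteq> S'"
  shows "j (Q.W.E S' I) = P.W.E A (\<iota> ` I)"
proof (rule idem_proj_hom)
  show "idem_family (Omega K G' S') (omega_e K G' S') S'" "idem_family (Omega K G S) (omega_e K G S) S"
    by unfold_locales
qed (use assms inj AS j_hom j_e in auto)

lemma preimage_subring:
  assumes "subring H P.\<Omega>"
  shows "subring {a \<in> carrier Q.\<Omega>. j a \<in> H} Q.\<Omega>"
  by (rule Q.W.subringI) (use subringE[OF assms] in auto)

lemma j_image_in_subring:
  assumes H: "subring H P.\<Omega>" and c: "\<And>c. c \<in> K \<Longrightarrow> omega_scalar K G S c \<in> H"
    and g: "\<And>a. a \<in> A \<Longrightarrow> omega_e K G S a \<in> H" "\<And>a. a \<in> A \<Longrightarrow> omega_x K G S a \<in> H"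
    and a: "a \<in> carrier Q.\<Omega>"
  shows "j a \<in> H"
proof -
  have "{a \<in> carrier Q.\<Omega>. j a \<in> H} = carrier Q.\<Omega>"
    by (rule P.Omega_generated[OF preimage_subring[OF H]])
      (use c g in \<open>auto simp: j_e j_x j_scalar P.omega_scalar_closed\<close>)
  then show ?thesis using a by blast
qed

text \<open>
  The generators of \<open>\<Psi>\<close> of the factor are mapped to relative projections and to elements \<open>E\<^sub>I x\<^sub>s E\<^sub>J\<close> formed with
  relative projections, for transversal edges.
\<close>

lemma j_Psi_in_subring:
  assumes H: "subring H P.\<Omega>" and c: "\<And>c. c \<in> K \<Longrightarrow> omega_scalar K G S c \<in> H"
    and E: "\<And>I. I \<subseteq> A \<Longrightarrow> P.W.E A I \<in> H"
    and X: "\<And>I J s r. I \<subseteq> A \<Longrightarrow> J \<subseteq> A \<Longrightarrow> s \<in> I - J \<Longrightarrow> r \<in> J - I \<Longrightarrow> compat_edge G S I J \<Longrightarrow>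
      P.W.E A I \<otimes>\<^bsub>P.\<Omega>\<^esub> omega_x K G S s \<otimes>\<^bsub>P.\<Omega>\<^esub> P.W.E A J \<in> H"
    and a: "a \<in> Psi K G' S'"
  shows "j a \<in> H"
proof -
  have "Psi K G' S' \<subseteq> {a \<in> carrier Q.\<Omega>. j a \<in> H}"
  proof (rule Q.Psi_minimal[OF preimage_subring[OF H]])
    have 1: "j (omega_scalar K G' S' c) \<in> H" if "c \<in> K" for c using c[OF that] j_scalar[OF that] by simp
    have 2: "j (E_elt K G' S' I) \<in> H" if "I \<subseteq> S'" for I
      unfolding Q.E_elt_eq j_E[OF that] using that by (intro E) auto
    have 3: "j (X_elt K G' S' I J) \<in> H" if tr: "transversal_edge G' S' I J" for I J
    proof -
      obtain s r where sr: "I \<subseteq> S'" "J \<subseteq> S'" "s \<in> I - J" "r \<in> J - I" using Q.transversal_edgeD[OF tr] .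
      have sS: "s \<in> S'" using sr by auto
      have d: "\<iota> ` I - \<iota> ` J = \<iota> ` (I - J)" "\<iota> ` J - \<iota> ` I = \<iota> ` (J - I)"
        using inj sr by (auto simp: inj_on_def)+
      have "compat_edge G S (\<iota> ` I) (\<iota> ` J)"
      proof -
        have "\<not> (\<exists>s\<in>I - J. \<exists>t\<in>J - I. s \<otimes>\<^bsub>G'\<^esub> t = t \<otimes>\<^bsub>G'\<^esub> s)"
          using tr unfolding transversal_edge_def compat_edge_def by blast
        then have "\<not> (\<exists>s\<in>I - J. \<exists>t\<in>J - I. \<iota> s \<otimes>\<^bsub>G\<^esub> \<iota> t = \<iota> t \<otimes>\<^bsub>G\<^esub> \<iota> s)"
          using comm_iff sr by (meson DiffD1 subset_iff)
        moreover have "\<iota> ` I \<subseteq> S" "\<iota> ` J \<subseteq> S" using sr AS by blast+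
        moreover have "I - J \<noteq> {}" using sr by blast
        ultimately show ?thesis unfolding compat_edge_def d by simp
      qed
      moreover have "j (X_elt K G' S' I J) = P.W.E A (\<iota> ` I) \<otimes>\<^bsub>P.\<Omega>\<^esub> omega_x K G S (\<iota> s) \<otimes>\<^bsub>P.\<Omega>\<^esub> P.W.E A (\<iota> ` J)"
        unfolding Q.X_elt_eq[OF sr(1-3)] using sr sS by (simp add: j_E j_x)
      ultimately show ?thesis using X[of "\<iota> ` I" "\<iota> ` J" "\<iota> s" "\<iota> r"] sr d by auto
    qed
    show "Q.Psi_gens \<subseteq> {a \<in> carrier Q.\<Omega>. j a \<in> H}" using Q.Psi_gens_carrier 1 2 3 by blast
  qed
  then show ?thesis using a by blast
qed

text \<open>
  Multiplying by \<open>1 = \<Sum> E\<^sub>K\<close> over the subsets \<open>K\<close> of \<open>B\<close> writes the images of the generators as sums of generators.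
\<close>

lemma j_Psi_Psi:
  assumes "a \<in> Psi K G' S'"
  shows "j a \<in> Psi K G S"
proof (rule j_Psi_in_subring[OF P.Psi_subring P.scalar_Psi _ _ assms])
  fix I assume I: "I \<subseteq> A"
  show "P.W.E A I \<in> Psi K G S"
    unfolding P.W.E_split[OF AS I BS disj] S_eq[symmetric]
    by (rule P.W.finsum_in_subring[OF P.Psi_subring], rule P.E_Psi) (use AS BS I in blast)
next
  fix I J s r assume IJ: "I \<subseteq> A" "J \<subseteq> A" "s \<in> I - J" "r \<in> J - I" and ed: "compat_edge G S I J"
  have "P.W.E A I \<otimes>\<^bsub>P.\<Omega>\<^esub> omega_x K G S s \<otimes>\<^bsub>P.\<Omega>\<^esub> P.W.E A J =
      (\<Oplus>\<^bsub>P.\<Omega>\<^esub>L\<in>Pow B. P.W.X_elem s (I \<union> L) (J \<union> L))"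
    using P.W.transversal_split[OF AS IJ(1,2,4) _ BS disj cross_pair(1)] IJ S_eq by auto
  also have "\<dots> \<in> Psi K G S"
  proof (rule P.W.finsum_in_subring[OF P.Psi_subring])
    fix L assume L: "L \<in> Pow B"
    have d: "(I \<union> L) - (J \<union> L) = I - J" "(J \<union> L) - (I \<union> L) = J - I" using L IJ disj by auto
    have sub: "I \<union> L \<subseteq> S" "J \<union> L \<subseteq> S" using L IJ AS BS by auto
    \<comment> \<open>Adding \<open>L\<close> to both ends changes neither of the two differences.\<close>
    have "transversal_edge G S (I \<union> L) (J \<union> L)"
    proof -
      have "r \<in> J \<union> L" "r \<notin> I \<union> L" using IJ L disj by auto
      then have "\<not> J \<union> L \<subseteq> I \<union> L" by blast
      then show ?thesis using ed sub unfolding transversal_edge_def compat_edge_def d by simp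
    qed
    then have "X_elt K G S (I \<union> L) (J \<union> L) \<in> Psi K G S" using P.Psi_gens_Psi by blast
    then show "P.W.X_elem s (I \<union> L) (J \<union> L) \<in> Psi K G S"
      using P.X_elt_eq[OF sub, of s] IJ(3) d by auto
  qed
  finally show "P.W.E A I \<otimes>\<^bsub>P.\<Omega>\<^esub> omega_x K G S s \<otimes>\<^bsub>P.\<Omega>\<^esub> P.W.E A J \<in> Psi K G S" .
qed

lemma j_Psi_commutes_e:
  assumes a: "a \<in> Psi K G' S'" and b: "b \<in> B"
  shows "omega_e K G S b \<otimes>\<^bsub>P.\<Omega>\<^esub> j a = j a \<otimes>\<^bsub>P.\<Omega>\<^esub> omega_e K G S b"
proof -
  have bS: "b \<in> S" using b BS by auto
  note e = P.W.e_closed[OF bS]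
  have "j a \<in> {y \<in> carrier P.\<Omega>. omega_e K G S b \<otimes>\<^bsub>P.\<Omega>\<^esub> y = y \<otimes>\<^bsub>P.\<Omega>\<^esub> omega_e K G S b}"
  proof (rule j_Psi_in_subring[OF P.W.centralizer_subring[OF e] _ _ _ a])
    fix c assume "c \<in> K"
    then show "omega_scalar K G S c \<in> {y \<in> carrier P.\<Omega>. omega_e K G S b \<otimes>\<^bsub>P.\<Omega>\<^esub> y = y \<otimes>\<^bsub>P.\<Omega>\<^esub> omega_e K G S b}"
      using P.omega_scalar_closed[of c G S] P.omega_scalar_central[of c _ G S] e by simp
  next
    fix I assume "I \<subseteq> A"
    then show "P.W.E A I \<in> {y \<in> carrier P.\<Omega>. omega_e K G S b \<otimes>\<^bsub>P.\<Omega>\<^esub> y = y \<otimes>\<^bsub>P.\<Omega>\<^esub> omega_e K G S b}"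
      using P.W.e_E_comm[OF AS _ bS] AS by simp
  next
    fix I J s r assume IJ: "I \<subseteq> A" "J \<subseteq> A" "s \<in> I - J" "r \<in> J - I" and ed: "compat_edge G S I J"
    have m: "s \<in> A" "r \<in> A" "s \<in> S" using IJ AS by auto
    have "(P.W.E A I \<otimes>\<^bsub>P.\<Omega>\<^esub> omega_x K G S s \<otimes>\<^bsub>P.\<Omega>\<^esub> P.W.E A J) \<otimes>\<^bsub>P.\<Omega>\<^esub> omega_e K G S b =
        omega_e K G S b \<otimes>\<^bsub>P.\<Omega>\<^esub> (P.W.E A I \<otimes>\<^bsub>P.\<Omega>\<^esub> omega_x K G S s \<otimes>\<^bsub>P.\<Omega>\<^esub> P.W.E A J)"
      by (rule P.W.transversal_commutes_e[OF AS IJ(1,2,4) m(1) bS cross_pair(1)[OF m(1) b] cross_pair(1)[OF m(2) b]])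
    then show "P.W.E A I \<otimes>\<^bsub>P.\<Omega>\<^esub> omega_x K G S s \<otimes>\<^bsub>P.\<Omega>\<^esub> P.W.E A J \<in>
        {y \<in> carrier P.\<Omega>. omega_e K G S b \<otimes>\<^bsub>P.\<Omega>\<^esub> y = y \<otimes>\<^bsub>P.\<Omega>\<^esub> omega_e K G S b}"
      using AS IJ m by simp
  qed
  then show ?thesis by simp
qed

end

section \<open>Idempotents of a factor\<close>

text \<open>
  The matrix morphism of (Z4), unfolded; its values lie in \<open>\<Psi>\<close> because the whole corner does.
\<close>

lemma (in wgraph_decomp) corner_morphism:
  assumes n: "\<nu> \<in> Irr G" and sm: "surj_matrix_morphism K G S d (F \<nu>) \<psi>"
  shows "U \<in> carrier (mat_ring_over K d) \<Longrightarrow> \<psi> U \<in> Psi K G S"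
    and "U \<in> carrier (mat_ring_over K d) \<Longrightarrow> Y \<in> carrier (mat_ring_over K d) \<Longrightarrow> \<psi> (U + Y) = \<psi> U \<oplus>\<^bsub>\<Omega>\<^esub> \<psi> Y"
    and "U \<in> carrier (mat_ring_over K d) \<Longrightarrow> Y \<in> carrier (mat_ring_over K d) \<Longrightarrow> \<psi> (U * Y) = \<psi> U \<otimes>\<^bsub>\<Omega>\<^esub> \<psi> Y"
    and "z \<in> K \<Longrightarrow> U \<in> carrier (mat_ring_over K d) \<Longrightarrow> \<psi> (z \<cdot>\<^sub>m U) = omega_scalar K G S z \<otimes>\<^bsub>\<Omega>\<^esub> \<psi> U"
    and "\<psi> (1\<^sub>m d) = F \<nu>"
    and "a \<in> carrier \<Omega> \<Longrightarrow> \<exists>U\<in>carrier (mat_ring_over K d). F \<nu> \<otimes>\<^bsub>\<Omega>\<^esub> a \<otimes>\<^bsub>\<Omega>\<^esub> F \<nu> = \<psi> U"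
proof -
  note sm' = sm[unfolded surj_matrix_morphism_def]
  note h = conjunct1[OF sm'] and sc = conjunct1[OF conjunct2[OF sm']] and im = conjunct2[OF conjunct2[OF sm']]
  have cc: "carrier (corner_ring \<Omega> (F \<nu>)) = {F \<nu> \<otimes>\<^bsub>\<Omega>\<^esub> a \<otimes>\<^bsub>\<Omega>\<^esub> F \<nu> | a. a \<in> carrier \<Omega>}"
    by (simp add: corner_ring_def)
  show "\<psi> U \<in> Psi K G S" if "U \<in> carrier (mat_ring_over K d)"
  proof -
    have "\<psi> U \<in> {F \<nu> \<otimes>\<^bsub>\<Omega>\<^esub> a \<otimes>\<^bsub>\<Omega>\<^esub> F \<nu> | a. a \<in> carrier \<Omega>}" using ring_hom_closed[OF h that] cc by simp
    then obtain a where "a \<in> carrier \<Omega>" "\<psi> U = F \<nu> \<otimes>\<^bsub>\<Omega>\<^esub> a \<otimes>\<^bsub>\<Omega>\<^esub> F \<nu>" by (elim CollectE exE conjE)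
    then show ?thesis using corner_Psi[OF n] by simp
  qed
  show "\<psi> (U + Y) = \<psi> U \<oplus>\<^bsub>\<Omega>\<^esub> \<psi> Y" "\<psi> (U * Y) = \<psi> U \<otimes>\<^bsub>\<Omega>\<^esub> \<psi> Y"
    if "U \<in> carrier (mat_ring_over K d)" "Y \<in> carrier (mat_ring_over K d)"
    using ring_hom_add[OF h that] ring_hom_mult[OF h that] by (simp_all add: mat_ring_over_ops corner_ring_def)
  show "\<psi> (z \<cdot>\<^sub>m U) = omega_scalar K G S z \<otimes>\<^bsub>\<Omega>\<^esub> \<psi> U" if "z \<in> K" "U \<in> carrier (mat_ring_over K d)"
    by (rule bspec[OF bspec[OF sc that(1)] that(2)])
  show "\<psi> (1\<^sub>m d) = F \<nu>" using ring_hom_one[OF h] by (simp add: mat_ring_over_ops corner_ring_def)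
  show "\<exists>U\<in>carrier (mat_ring_over K d). F \<nu> \<otimes>\<^bsub>\<Omega>\<^esub> a \<otimes>\<^bsub>\<Omega>\<^esub> F \<nu> = \<psi> U" if "a \<in> carrier \<Omega>"
  proof -
    have "F \<nu> \<otimes>\<^bsub>\<Omega>\<^esub> a \<otimes>\<^bsub>\<Omega>\<^esub> F \<nu> \<in> \<psi> ` carrier (mat_ring_over K d)" unfolding im cc using that by (intro CollectI exI conjI) (rule refl)
    then show ?thesis by (elim imageE) (rule bexI)
  qed
qed

locale factor_decomp = wgraph_factor K G S G' S' \<iota> B j + QD: wgraph_decomp K G' S' F
  for K and G :: "('s, 'm) monoid_scheme" and S and G' :: "('t, 'n) monoid_scheme" and S' \<iota> B j F
begin

definition image_idem where "image_idem \<nu> = j (F \<nu>)"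

lemma image_idem_closed [simp]: "\<nu> \<in> Irr G' \<Longrightarrow> image_idem \<nu> \<in> carrier P.\<Omega>"
  unfolding image_idem_def by (intro J.hom_closed QD.decomp_facts(1))

lemma image_idem_complete: "complete_idempotents P.\<Omega> (Irr G') image_idem"
proof
  show "finite (Irr G')" by (rule Q.finite_Irr)
  show "image_idem \<nu> \<in> carrier P.\<Omega>" if "\<nu> \<in> Irr G'" for \<nu> using that by simp
  show "image_idem \<nu> \<otimes>\<^bsub>P.\<Omega>\<^esub> image_idem \<mu> = (if \<nu> = \<mu> then image_idem \<nu> else \<zero>\<^bsub>P.\<Omega>\<^esub>)"
    if "\<nu> \<in> Irr G'" "\<mu> \<in> Irr G'" for \<nu> \<mu>
  proof -
    have "image_idem \<nu> \<otimes>\<^bsub>P.\<Omega>\<^esub> image_idem \<mu> = j (F \<nu> \<otimes>\<^bsub>Q.\<Omega>\<^esub> F \<mu>)"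
      unfolding image_idem_def using that QD.decomp_facts(1) by simp
    then show ?thesis using QD.decomp_facts(2)[OF that] by (simp add: image_idem_def)
  qed
  have "(\<Oplus>\<^bsub>P.\<Omega>\<^esub>\<nu>\<in>Irr G'. image_idem \<nu>) = j (finsum Q.\<Omega> F (Irr G'))"
    unfolding image_idem_def using QD.decomp_facts(1) by (subst J.hom_finsum) (auto simp: comp_def)
  then show "(\<Oplus>\<^bsub>P.\<Omega>\<^esub>\<nu>\<in>Irr G'. image_idem \<nu>) = \<one>\<^bsub>P.\<Omega>\<^esub>" using QD.decomp_facts(3) by simp
qed

sublocale PI: complete_idempotents P.\<Omega> "Irr G'" image_idem
  by (rule image_idem_complete)

lemma image_idem_Psi: "\<nu> \<in> Irr G' \<Longrightarrow> image_idem \<nu> \<in> Psi K G S"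
  unfolding image_idem_def by (intro j_Psi_Psi QD.decomp_facts(7))

lemma image_idem_commutes_e:
  assumes n: "\<nu> \<in> Irr G'" and s: "s \<in> S"
  shows "image_idem \<nu> \<otimes>\<^bsub>P.\<Omega>\<^esub> omega_e K G S s = omega_e K G S s \<otimes>\<^bsub>P.\<Omega>\<^esub> image_idem \<nu>"
proof (cases "s \<in> A")
  case True
  then obtain t where t: "s = \<iota> t" "t \<in> S'" by blast
  have "j (F \<nu> \<otimes>\<^bsub>Q.\<Omega>\<^esub> omega_e K G' S' t) = j (omega_e K G' S' t \<otimes>\<^bsub>Q.\<Omega>\<^esub> F \<nu>)"
    using QD.F_commutes_e[OF n t(2)] by simp
  then show ?thesis using n t QD.decomp_facts(1)[OF n] by (simp add: image_idem_def j_e)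
next
  case False
  then have "s \<in> B" using s S_eq by auto
  then show ?thesis unfolding image_idem_def using j_Psi_commutes_e[OF QD.decomp_facts(7)[OF n]] by simp
qed

text \<open>
  The ring \<open>?T\<close> of elements that respect the order contains the image of \<open>j\<close> and all \<open>e\<^sub>s\<close>. For a reflection \<open>b\<close> outside
  the factor, \<open>[x\<^sub>b, -]\<close> maps the image of \<open>j\<close> into \<open>?T\<close>, since by the cross relation it does so on the generators.
  For \<open>\<nu> \<noteq> \<mu>\<close> the orthogonality of the idempotents gives \<open>F\<^sub>\<nu> x\<^sub>b F\<^sub>\<mu> = F\<^sub>\<nu> [x\<^sub>b, F\<^sub>\<mu>] F\<^sub>\<mu>\<close>, so that \<open>x\<^sub>b \<in> ?T\<close> as well.
\<close>

lemma image_idem_ordered: "ordered_idempotents P.\<Omega> (Irr G') image_idem QD.ord_rel"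
proof -
  let ?r = "QD.ord_rel"
  note r = QD.D.r_order
  let ?T = "{a \<in> carrier P.\<Omega>. \<forall>\<nu>\<in>Irr G'. \<forall>\<mu>\<in>Irr G'. (\<nu>, \<mu>) \<notin> ?r \<longrightarrow>
      image_idem \<nu> \<otimes>\<^bsub>P.\<Omega>\<^esub> a \<otimes>\<^bsub>P.\<Omega>\<^esub> image_idem \<mu> = \<zero>\<^bsub>P.\<Omega>\<^esub>}"
  have T: "subring ?T P.\<Omega>" by (rule PI.incidence_subring[OF r])
  have refl: "(\<nu>, \<nu>) \<in> ?r" if "\<nu> \<in> Irr G'" for \<nu>
    using r that by (auto simp: partial_order_on_def preorder_on_def refl_on_def)
  have orth: "image_idem \<nu> \<otimes>\<^bsub>P.\<Omega>\<^esub> image_idem \<mu> = \<zero>\<^bsub>P.\<Omega>\<^esub>" if "\<nu> \<in> Irr G'" "\<mu> \<in> Irr G'" "(\<nu>, \<mu>) \<notin> ?r" for \<nu> \<mu>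
    using PI.F_orth[OF that(1,2)] refl[OF that(1)] that(3) by (cases "\<nu> = \<mu>") simp_all
  have jT: "j a \<in> ?T" if a: "a \<in> carrier Q.\<Omega>" for a
  proof -
    have "image_idem \<nu> \<otimes>\<^bsub>P.\<Omega>\<^esub> j a \<otimes>\<^bsub>P.\<Omega>\<^esub> image_idem \<mu> = \<zero>\<^bsub>P.\<Omega>\<^esub>"
      if "\<nu> \<in> Irr G'" "\<mu> \<in> Irr G'" "(\<nu>, \<mu>) \<notin> ?r" for \<nu> \<mu>
    proof -
      have "image_idem \<nu> \<otimes>\<^bsub>P.\<Omega>\<^esub> j a \<otimes>\<^bsub>P.\<Omega>\<^esub> image_idem \<mu> = j (F \<nu> \<otimes>\<^bsub>Q.\<Omega>\<^esub> a \<otimes>\<^bsub>Q.\<Omega>\<^esub> F \<mu>)"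
        unfolding image_idem_def using that a QD.decomp_facts(1) by simp
      moreover have "F \<nu> \<otimes>\<^bsub>Q.\<Omega>\<^esub> a \<otimes>\<^bsub>Q.\<Omega>\<^esub> F \<mu> = \<zero>\<^bsub>Q.\<Omega>\<^esub>"
        using QD.D.F_ordered[OF that(1,2) a] that(3) by metis
      ultimately show ?thesis by simp
    qed
    then show ?thesis using a by simp
  qed
  have eT: "omega_e K G S s \<in> ?T" if s: "s \<in> S" for s
  proof -
    have "image_idem \<nu> \<otimes>\<^bsub>P.\<Omega>\<^esub> omega_e K G S s \<otimes>\<^bsub>P.\<Omega>\<^esub> image_idem \<mu> = \<zero>\<^bsub>P.\<Omega>\<^esub>"
      if "\<nu> \<in> Irr G'" "\<mu> \<in> Irr G'" "(\<nu>, \<mu>) \<notin> ?r" for \<nu> \<mu>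
      using s that by (simp add: image_idem_commutes_e P.W.m_assoc orth)
    then show ?thesis using s by simp
  qed
  have sT: "omega_scalar K G S c \<in> ?T" if "c \<in> K" for c
    using jT[OF P.omega_scalar_closed[OF that]] j_scalar[OF that] by simp
  have xA: "omega_x K G S s \<in> ?T" if s: "s \<in> A" for s
  proof -
    obtain t where "s = \<iota> t" "t \<in> S'" using s by blast
    then show ?thesis using jT[of "omega_x K G' S' t"] j_x[of t] by simp
  qed
  have xB: "omega_x K G S b \<in> ?T" if b: "b \<in> B" for b
  proof -
    have bS: "b \<in> S" using b BS by auto
    let ?x = "omega_x K G S b"
    let ?H = "{y \<in> ?T. ?x \<otimes>\<^bsub>P.\<Omega>\<^esub> y \<ominus>\<^bsub>P.\<Omega>\<^esub> y \<otimes>\<^bsub>P.\<Omega>\<^esub> ?x \<in> ?T}"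
    have x: "?x \<in> carrier P.\<Omega>" using bS by simp
    have H: "subring ?H P.\<Omega>" by (rule P.W.commutator_subring[OF T x])
    have zT: "\<zero>\<^bsub>P.\<Omega>\<^esub> \<in> ?T" by (rule subringE(2)[OF T])
    have comm0: "y \<in> ?H" if "y \<in> ?T" "?x \<otimes>\<^bsub>P.\<Omega>\<^esub> y = y \<otimes>\<^bsub>P.\<Omega>\<^esub> ?x" for y
    proof -
      have "y \<in> carrier P.\<Omega>" using that by blast
      then have "?x \<otimes>\<^bsub>P.\<Omega>\<^esub> y \<ominus>\<^bsub>P.\<Omega>\<^esub> y \<otimes>\<^bsub>P.\<Omega>\<^esub> ?x = \<zero>\<^bsub>P.\<Omega>\<^esub>"
        using that(2) x by (simp add: P.W.r_right_minus_eq)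
      then show ?thesis using that(1) zT by simp
    qed
    have jH: "j a \<in> ?H" if a: "a \<in> carrier Q.\<Omega>" for a
    proof (rule j_image_in_subring[OF H _ _ _ a])
      fix c assume "c \<in> K"
      then show "omega_scalar K G S c \<in> ?H"
        using sT P.omega_scalar_central[of c ?x G S] x by (intro comm0) simp_all
    next
      fix s assume s: "s \<in> A"
      have sS: "s \<in> S" using s AS by auto
      have "?x \<otimes>\<^bsub>P.\<Omega>\<^esub> omega_e K G S s \<ominus>\<^bsub>P.\<Omega>\<^esub> omega_e K G S s \<otimes>\<^bsub>P.\<Omega>\<^esub> ?x \<in> ?T"
        by (rule P.W.commutator_in_subring[OF T bS sS cross_pair(2)[OF s b] xA[OF s] eT[OF bS]])
      then show "omega_e K G S s \<in> ?H" using eT[OF sS] by simp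
      show "omega_x K G S s \<in> ?H"
        by (rule comm0[OF xA[OF s] P.W.xx_comm[OF bS sS cross_pair(2)[OF s b]]])
    qed
    have "image_idem \<nu> \<otimes>\<^bsub>P.\<Omega>\<^esub> ?x \<otimes>\<^bsub>P.\<Omega>\<^esub> image_idem \<mu> = \<zero>\<^bsub>P.\<Omega>\<^esub>"
      if nm: "\<nu> \<in> Irr G'" "\<mu> \<in> Irr G'" "(\<nu>, \<mu>) \<notin> ?r" for \<nu> \<mu>
    proof -
      \<comment> \<open>By orthogonality \<open>x\<^sub>b\<close> can be replaced by its commutator with the right-hand idempotent.\<close>
      let ?c = "?x \<otimes>\<^bsub>P.\<Omega>\<^esub> image_idem \<mu> \<ominus>\<^bsub>P.\<Omega>\<^esub> image_idem \<mu> \<otimes>\<^bsub>P.\<Omega>\<^esub> ?x"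
      have cT: "?c \<in> ?T" using jH[OF QD.decomp_facts(1)[OF nm(2)]] unfolding image_idem_def by simp
      have c: "?c \<in> carrier P.\<Omega>" using nm x by simp
      have e: "?x \<otimes>\<^bsub>P.\<Omega>\<^esub> image_idem \<mu> = ?c \<oplus>\<^bsub>P.\<Omega>\<^esub> image_idem \<mu> \<otimes>\<^bsub>P.\<Omega>\<^esub> ?x"
        using nm x by (simp add: a_minus_def P.W.a_assoc P.W.l_neg)
      have "image_idem \<mu> \<otimes>\<^bsub>P.\<Omega>\<^esub> image_idem \<mu> = image_idem \<mu>" using PI.F_orth[OF nm(2,2)] by simp
      then have "image_idem \<nu> \<otimes>\<^bsub>P.\<Omega>\<^esub> ?x \<otimes>\<^bsub>P.\<Omega>\<^esub> image_idem \<mu> =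
          image_idem \<nu> \<otimes>\<^bsub>P.\<Omega>\<^esub> ((?x \<otimes>\<^bsub>P.\<Omega>\<^esub> image_idem \<mu>) \<otimes>\<^bsub>P.\<Omega>\<^esub> image_idem \<mu>)"
        using nm x by (simp add: P.W.m_assoc)
      also have "\<dots> = image_idem \<nu> \<otimes>\<^bsub>P.\<Omega>\<^esub> ((?c \<oplus>\<^bsub>P.\<Omega>\<^esub> image_idem \<mu> \<otimes>\<^bsub>P.\<Omega>\<^esub> ?x) \<otimes>\<^bsub>P.\<Omega>\<^esub> image_idem \<mu>)"
        by (rule arg_cong[OF e])
      also have "\<dots> = image_idem \<nu> \<otimes>\<^bsub>P.\<Omega>\<^esub> ?c \<otimes>\<^bsub>P.\<Omega>\<^esub> image_idem \<mu> \<oplus>\<^bsub>P.\<Omega>\<^esub>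
          (image_idem \<nu> \<otimes>\<^bsub>P.\<Omega>\<^esub> image_idem \<mu>) \<otimes>\<^bsub>P.\<Omega>\<^esub> (?x \<otimes>\<^bsub>P.\<Omega>\<^esub> image_idem \<mu>)"
        using nm x c by (simp only: P.W.l_distr P.W.r_distr P.W.m_assoc P.W.m_closed image_idem_closed)
      also have "\<dots> = \<zero>\<^bsub>P.\<Omega>\<^esub>" using cT nm x orth[OF nm] by simp
      finally show ?thesis .
    qed
    then show ?thesis using x by simp
  qed
  have "?T = carrier P.\<Omega>"
  proof (rule P.Omega_generated[OF T eT _ sT])
    show "omega_x K G S s \<in> ?T" if "s \<in> S" for s using xA xB that S_eq by blast
  qed
  then have "(\<nu>, \<mu>) \<in> ?r" if "\<nu> \<in> Irr G'" "\<mu> \<in> Irr G'" "a \<in> carrier P.\<Omega>"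
    "image_idem \<nu> \<otimes>\<^bsub>P.\<Omega>\<^esub> a \<otimes>\<^bsub>P.\<Omega>\<^esub> image_idem \<mu> \<noteq> \<zero>\<^bsub>P.\<Omega>\<^esub>" for \<nu> \<mu> a
    using that by blast
  then show ?thesis using r by unfold_locales
qed

end

section \<open>Products of decompositions\<close>

locale wgraph_product = f1: factor_decomp K G S G1 S1 \<iota>1 B1 j1 F1 + f2: factor_decomp K G S G2 S2 \<iota>2 B2 j2 F2
  for K and G :: "('s, 'm) monoid_scheme" and S
    and G1 :: "('a, 'n1) monoid_scheme" and S1 \<iota>1 B1 j1 F1
    and G2 :: "('b, 'n2) monoid_scheme" and S2 \<iota>2 B2 j2 F2 +
  assumes B1_eq: "B1 = \<iota>2 ` S2" and B2_eq: "B2 = \<iota>1 ` S1"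
begin

abbreviation \<Omega> where "\<Omega> \<equiv> Omega K G S"
abbreviation P where "P \<equiv> f1.image_idem"
abbreviation Q where "Q \<equiv> f2.image_idem"

lemma cross_all: "a \<in> f1.A \<Longrightarrow> b \<in> f2.A \<Longrightarrow> commuting_pair G a b" "a \<in> f1.A \<Longrightarrow> b \<in> f2.A \<Longrightarrow> commuting_pair G b a"
  using f1.cross_pair B1_eq by blast+

text \<open>
  A double reduction to generators of \<open>\<Psi>\<close>. Projections commute with everything in the other image by
  \<open>j_Psi_commutes_e\<close>, and the elements \<open>E\<^sub>I x\<^sub>s E\<^sub>J\<close> of the two factors commute by \<open>transversal_commute\<close>.
\<close>

lemma Psi_images_commute:
  assumes a: "a \<in> Psi K G1 S1" and b: "b \<in> Psi K G2 S2"
  shows "j2 b \<otimes>\<^bsub>\<Omega>\<^esub> j1 a = j1 a \<otimes>\<^bsub>\<Omega>\<^esub> j2 b"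
proof -
  let ?Z = "\<lambda>y. {z \<in> carrier \<Omega>. y \<otimes>\<^bsub>\<Omega>\<^esub> z = z \<otimes>\<^bsub>\<Omega>\<^esub> y}"
  have bc: "j2 b \<in> carrier \<Omega>" using b f2.Q.Psi_carrier by (intro f2.J.hom_closed) blast
  have "j1 a \<in> ?Z (j2 b)"
  proof (rule f1.j_Psi_in_subring[OF f1.P.W.centralizer_subring[OF bc] _ _ _ a])
    show "omega_scalar K G S c \<in> ?Z (j2 b)" if "c \<in> K" for c
      using that f1.P.omega_scalar_closed[OF that] f1.P.omega_scalar_central[OF that bc] by simp
    fix I assume I: "I \<subseteq> f1.A"
    have "j2 b \<otimes>\<^bsub>\<Omega>\<^esub> f1.P.W.E f1.A I = f1.P.W.E f1.A I \<otimes>\<^bsub>\<Omega>\<^esub> j2 b"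
    proof (rule f1.P.W.commutes_with_E[OF bc f1.AS I])
      fix t assume "t \<in> f1.A"
      then show "j2 b \<otimes>\<^bsub>\<Omega>\<^esub> omega_e K G S t = omega_e K G S t \<otimes>\<^bsub>\<Omega>\<^esub> j2 b"
        using f2.j_Psi_commutes_e[OF b] B2_eq by simp
    qed
    then show "f1.P.W.E f1.A I \<in> ?Z (j2 b)" using f1.P.W.E_closed[OF f1.AS I] by simp
  next
    fix I J s r assume IJ: "I \<subseteq> f1.A" "J \<subseteq> f1.A" "s \<in> I - J" "r \<in> J - I" and ed: "compat_edge G S I J"
    let ?X = "f1.P.W.E f1.A I \<otimes>\<^bsub>\<Omega>\<^esub> omega_x K G S s \<otimes>\<^bsub>\<Omega>\<^esub> f1.P.W.E f1.A J"
    have m: "s \<in> f1.A" "r \<in> f1.A" "s \<in> S" using IJ f1.AS by auto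
    have U: "?X \<in> carrier \<Omega>" using IJ f1.AS m by simp
    have "j2 b \<in> ?Z ?X"
    proof (rule f2.j_Psi_in_subring[OF f1.P.W.centralizer_subring[OF U] _ _ _ b])
      show "omega_scalar K G S c \<in> ?Z ?X" if "c \<in> K" for c
        using that f1.P.omega_scalar_closed[OF that] f1.P.omega_scalar_central[OF that U] by simp
      fix I' assume I': "I' \<subseteq> f2.A"
      have "?X \<otimes>\<^bsub>\<Omega>\<^esub> f1.P.W.E f2.A I' = f1.P.W.E f2.A I' \<otimes>\<^bsub>\<Omega>\<^esub> ?X"
      proof (rule f1.P.W.commutes_with_E[OF U f2.AS I'])
        fix t assume t: "t \<in> f2.A"
        then have "t \<in> S" using f2.AS by auto
        then show "?X \<otimes>\<^bsub>\<Omega>\<^esub> omega_e K G S t = omega_e K G S t \<otimes>\<^bsub>\<Omega>\<^esub> ?X"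
          by (intro f1.P.W.transversal_commutes_e[OF f1.AS IJ(1,2,4) m(1)] cross_all(1) t m)
      qed
      then show "f1.P.W.E f2.A I' \<in> ?Z ?X" using f1.P.W.E_closed[OF f2.AS I'] by simp
    next
      fix I' J' s' r' assume IJ': "I' \<subseteq> f2.A" "J' \<subseteq> f2.A" "s' \<in> I' - J'" "r' \<in> J' - I'"
      let ?Y = "f1.P.W.E f2.A I' \<otimes>\<^bsub>\<Omega>\<^esub> omega_x K G S s' \<otimes>\<^bsub>\<Omega>\<^esub> f1.P.W.E f2.A J'"
      have m': "s' \<in> f2.A" "s' \<in> S" using IJ' f2.AS by auto
      have "?X \<otimes>\<^bsub>\<Omega>\<^esub> ?Y = ?Y \<otimes>\<^bsub>\<Omega>\<^esub> ?X"
        by (rule f1.P.W.transversal_commute[OF f1.AS IJ(1,2,4) m(1) f2.AS IJ'(1,2,4) m'(1)])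
          (fact cross_all(1), fact cross_all(2))
      then show "?Y \<in> ?Z ?X" using IJ' f2.AS m' by simp
    qed
    then show "?X \<in> ?Z (j2 b)" using U by simp
  qed
  then show ?thesis by simp
qed

lemma PQ_comm: "\<nu> \<in> Irr G1 \<Longrightarrow> \<mu> \<in> Irr G2 \<Longrightarrow> Q \<mu> \<otimes>\<^bsub>\<Omega>\<^esub> P \<nu> = P \<nu> \<otimes>\<^bsub>\<Omega>\<^esub> Q \<mu>"
  unfolding f1.image_idem_def f2.image_idem_def by (intro Psi_images_commute f1.QD.decomp_facts(7) f2.QD.decomp_facts(7))

definition prod_idem where "prod_idem = (\<lambda>(\<nu>, \<mu>). P \<nu> \<otimes>\<^bsub>\<Omega>\<^esub> Q \<mu>)"

definition prod_rel where
  "prod_rel = {((\<nu>, \<mu>), (\<nu>', \<mu>')). (\<nu>, \<nu>') \<in> f1.QD.ord_rel \<and> (\<mu>, \<mu>') \<in> f2.QD.ord_rel \<and>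
    \<nu> \<in> Irr G1 \<and> \<nu>' \<in> Irr G1 \<and> \<mu> \<in> Irr G2 \<and> \<mu>' \<in> Irr G2}"

lemma prod_idem_closed [simp]: "\<nu> \<in> Irr G1 \<Longrightarrow> \<mu> \<in> Irr G2 \<Longrightarrow> prod_idem (\<nu>, \<mu>) \<in> carrier \<Omega>"
  by (simp add: prod_idem_def)

text \<open>
  As \<open>P\<^sub>\<nu>\<close> and \<open>Q\<^sub>\<mu>\<close> commute, a nonzero element between two products is nonzero between the \<open>P\<close>s and between the \<open>Q\<close>s,
  so both components of the indices are comparable.
\<close>

lemma prod_idem_ordered: "ordered_idempotents \<Omega> (Irr G1 \<times> Irr G2) prod_idem prod_rel"
proof
  show "finite (Irr G1 \<times> Irr G2)" using f1.Q.finite_Irr f2.Q.finite_Irr by simp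
  show "prod_idem p \<in> carrier \<Omega>" if "p \<in> Irr G1 \<times> Irr G2" for p using that by (cases p) simp
  show "prod_idem p \<otimes>\<^bsub>\<Omega>\<^esub> prod_idem q = (if p = q then prod_idem p else \<zero>\<^bsub>\<Omega>\<^esub>)"
    if pq: "p \<in> Irr G1 \<times> Irr G2" "q \<in> Irr G1 \<times> Irr G2" for p q
  proof -
    obtain \<nu> \<mu> \<nu>' \<mu>' where e: "p = (\<nu>, \<mu>)" "q = (\<nu>', \<mu>')" by (cases p, cases q)
    have i: "\<nu> \<in> Irr G1" "\<mu> \<in> Irr G2" "\<nu>' \<in> Irr G1" "\<mu>' \<in> Irr G2" using pq e by auto
    have "prod_idem p \<otimes>\<^bsub>\<Omega>\<^esub> prod_idem q = P \<nu> \<otimes>\<^bsub>\<Omega>\<^esub> (Q \<mu> \<otimes>\<^bsub>\<Omega>\<^esub> P \<nu>') \<otimes>\<^bsub>\<Omega>\<^esub> Q \<mu>'"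
      unfolding e prod_idem_def using i by (simp add: f1.P.W.m_assoc)
    also have "\<dots> = (P \<nu> \<otimes>\<^bsub>\<Omega>\<^esub> P \<nu>') \<otimes>\<^bsub>\<Omega>\<^esub> (Q \<mu> \<otimes>\<^bsub>\<Omega>\<^esub> Q \<mu>')"
      unfolding PQ_comm[OF i(3,2)] using i by (simp add: f1.P.W.m_assoc)
    also have "\<dots> = (if p = q then prod_idem p else \<zero>\<^bsub>\<Omega>\<^esub>)"
      unfolding f1.PI.F_orth[OF i(1,3)] f2.PI.F_orth[OF i(2,4)] e prod_idem_def using i by simp
    finally show ?thesis .
  qed
  have "(\<Oplus>\<^bsub>\<Omega>\<^esub>p\<in>Irr G1 \<times> Irr G2. P (fst p) \<otimes>\<^bsub>\<Omega>\<^esub> Q (snd p)) = \<one>\<^bsub>\<Omega>\<^esub>"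
    using f1.P.W.finsum_Times_mult[OF f1.Q.finite_Irr f2.Q.finite_Irr, of P Q]
      f1.PI.F_sum f2.PI.F_sum by simp
  then show "(\<Oplus>\<^bsub>\<Omega>\<^esub>p\<in>Irr G1 \<times> Irr G2. prod_idem p) = \<one>\<^bsub>\<Omega>\<^esub>" by (simp add: prod_idem_def case_prod_beta')
  note o1 = ordered_idempotents.r_order[OF f1.image_idem_ordered]
  note o2 = ordered_idempotents.r_order[OF f2.image_idem_ordered]
  show "partial_order_on (Irr G1 \<times> Irr G2) prod_rel"
  proof -
    have t: "trans f1.QD.ord_rel" "trans f2.QD.ord_rel" and as: "antisym f1.QD.ord_rel" "antisym f2.QD.ord_rel"
      and rf: "refl_on (Irr G1) f1.QD.ord_rel" "refl_on (Irr G2) f2.QD.ord_rel"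
      using o1 o2 by (auto simp: partial_order_on_def preorder_on_def)
    have "trans prod_rel" unfolding prod_rel_def using t by (auto simp: trans_def)
    moreover have "antisym prod_rel" unfolding prod_rel_def using as by (auto simp: antisym_def)
    moreover have "refl_on (Irr G1 \<times> Irr G2) prod_rel" unfolding prod_rel_def using rf by (auto simp: refl_on_def)
    moreover have "prod_rel \<subseteq> (Irr G1 \<times> Irr G2) \<times> (Irr G1 \<times> Irr G2)" unfolding prod_rel_def by auto
    ultimately show ?thesis unfolding partial_order_on_def preorder_on_def by simp
  qed
  show "(p, q) \<in> prod_rel" if pq: "p \<in> Irr G1 \<times> Irr G2" "q \<in> Irr G1 \<times> Irr G2" "a \<in> carrier \<Omega>"
    "prod_idem p \<otimes>\<^bsub>\<Omega>\<^esub> a \<otimes>\<^bsub>\<Omega>\<^esub> prod_idem q \<noteq> \<zero>\<^bsub>\<Omega>\<^esub>" for p q a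
  proof -
    obtain \<nu> \<mu> \<nu>' \<mu>' where e: "p = (\<nu>, \<mu>)" "q = (\<nu>', \<mu>')" by (cases p, cases q)
    have i: "\<nu> \<in> Irr G1" "\<mu> \<in> Irr G2" "\<nu>' \<in> Irr G1" "\<mu>' \<in> Irr G2" using pq e by auto
    note a = pq(3)
    have 1: "prod_idem p \<otimes>\<^bsub>\<Omega>\<^esub> a \<otimes>\<^bsub>\<Omega>\<^esub> prod_idem q = P \<nu> \<otimes>\<^bsub>\<Omega>\<^esub> (Q \<mu> \<otimes>\<^bsub>\<Omega>\<^esub> a \<otimes>\<^bsub>\<Omega>\<^esub> Q \<mu>') \<otimes>\<^bsub>\<Omega>\<^esub> P \<nu>'"
      unfolding e prod_idem_def using i a by (simp add: f1.P.W.m_assoc PQ_comm)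
    have 2: "prod_idem p \<otimes>\<^bsub>\<Omega>\<^esub> a \<otimes>\<^bsub>\<Omega>\<^esub> prod_idem q = Q \<mu> \<otimes>\<^bsub>\<Omega>\<^esub> (P \<nu> \<otimes>\<^bsub>\<Omega>\<^esub> a \<otimes>\<^bsub>\<Omega>\<^esub> P \<nu>') \<otimes>\<^bsub>\<Omega>\<^esub> Q \<mu>'"
    proof -
      have "prod_idem p = Q \<mu> \<otimes>\<^bsub>\<Omega>\<^esub> P \<nu>" "prod_idem q = P \<nu>' \<otimes>\<^bsub>\<Omega>\<^esub> Q \<mu>'"
        unfolding e prod_idem_def using PQ_comm[OF i(1,2)] by simp_all
      then show ?thesis using i a by (simp add: f1.P.W.m_assoc)
    qed
    have "(\<nu>, \<nu>') \<in> f1.QD.ord_rel"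
      by (rule ordered_idempotents.F_ordered[OF f1.image_idem_ordered i(1,3)]) (use pq(4) 1 i a in simp_all)
    moreover have "(\<mu>, \<mu>') \<in> f2.QD.ord_rel"
      by (rule ordered_idempotents.F_ordered[OF f2.image_idem_ordered i(2,4)]) (use pq(4) 2 i a in simp_all)
    ultimately show ?thesis unfolding e prod_rel_def using i by simp
  qed
qed

sublocale O: ordered_idempotents \<Omega> "Irr G1 \<times> Irr G2" prod_idem prod_rel
  by (rule prod_idem_ordered)

lemma prod_idem_commutes_e:
  assumes i: "\<nu> \<in> Irr G1" "\<mu> \<in> Irr G2" and s: "s \<in> S"
  shows "prod_idem (\<nu>, \<mu>) \<otimes>\<^bsub>\<Omega>\<^esub> omega_e K G S s = omega_e K G S s \<otimes>\<^bsub>\<Omega>\<^esub> prod_idem (\<nu>, \<mu>)"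
proof -
  have "prod_idem (\<nu>, \<mu>) \<otimes>\<^bsub>\<Omega>\<^esub> omega_e K G S s = P \<nu> \<otimes>\<^bsub>\<Omega>\<^esub> (Q \<mu> \<otimes>\<^bsub>\<Omega>\<^esub> omega_e K G S s)"
    using i s by (simp add: prod_idem_def f1.P.W.m_assoc)
  also have "\<dots> = (P \<nu> \<otimes>\<^bsub>\<Omega>\<^esub> omega_e K G S s) \<otimes>\<^bsub>\<Omega>\<^esub> Q \<mu>"
    unfolding f2.image_idem_commutes_e[OF i(2) s] using i s by (simp add: f1.P.W.m_assoc)
  also have "\<dots> = omega_e K G S s \<otimes>\<^bsub>\<Omega>\<^esub> prod_idem (\<nu>, \<mu>)"
    unfolding f1.image_idem_commutes_e[OF i(1) s] using i s by (simp add: prod_idem_def f1.P.W.m_assoc)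
  finally show ?thesis .
qed

lemma prod_idem_commutes_E: "\<nu> \<in> Irr G1 \<Longrightarrow> \<mu> \<in> Irr G2 \<Longrightarrow> I \<subseteq> S \<Longrightarrow>
  prod_idem (\<nu>, \<mu>) \<otimes>\<^bsub>\<Omega>\<^esub> f1.P.W.E S I = f1.P.W.E S I \<otimes>\<^bsub>\<Omega>\<^esub> prod_idem (\<nu>, \<mu>)"
  by (rule f1.P.W.commutes_with_E) (simp_all add: prod_idem_commutes_e)

lemma prod_idem_Psi: "\<nu> \<in> Irr G1 \<Longrightarrow> \<mu> \<in> Irr G2 \<Longrightarrow> prod_idem (\<nu>, \<mu>) \<in> Psi K G S"
  using subringE(6)[OF f1.P.Psi_subring f1.image_idem_Psi f2.image_idem_Psi] by (simp add: prod_idem_def)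

text \<open>
  The corner \<open>F\<^sup>\<nu> a F\<^sup>\<nu>\<close> lies in \<open>\<Psi>\<^sub>1\<close>, so that its image commutes with \<open>Q\<^sub>\<mu>\<close> although the image of \<open>a\<close> need not.
\<close>

lemma prod_idem_corner_j1:
  assumes i: "\<nu> \<in> Irr G1" "\<mu> \<in> Irr G2" and a: "a \<in> carrier (Omega K G1 S1)"
  shows "prod_idem (\<nu>, \<mu>) \<otimes>\<^bsub>\<Omega>\<^esub> j1 a \<otimes>\<^bsub>\<Omega>\<^esub> prod_idem (\<nu>, \<mu>) =
    j1 (F1 \<nu> \<otimes>\<^bsub>Omega K G1 S1\<^esub> a \<otimes>\<^bsub>Omega K G1 S1\<^esub> F1 \<nu>) \<otimes>\<^bsub>\<Omega>\<^esub> Q \<mu>"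
proof -
  note F = f1.QD.decomp_facts(1)[OF i(1)]
  have ja: "j1 a \<in> carrier \<Omega>" using a by simp
  let ?c = "j1 (F1 \<nu> \<otimes>\<^bsub>Omega K G1 S1\<^esub> a \<otimes>\<^bsub>Omega K G1 S1\<^esub> F1 \<nu>)"
  have c: "?c = P \<nu> \<otimes>\<^bsub>\<Omega>\<^esub> j1 a \<otimes>\<^bsub>\<Omega>\<^esub> P \<nu>" using a F by (simp add: f1.image_idem_def)
  have comm: "Q \<mu> \<otimes>\<^bsub>\<Omega>\<^esub> ?c = ?c \<otimes>\<^bsub>\<Omega>\<^esub> Q \<mu>"
    unfolding f2.image_idem_def
    by (rule Psi_images_commute[OF f1.QD.corner_Psi[OF i(1) a] f2.QD.decomp_facts(7)[OF i(2)]])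
  have "prod_idem (\<nu>, \<mu>) \<otimes>\<^bsub>\<Omega>\<^esub> j1 a \<otimes>\<^bsub>\<Omega>\<^esub> prod_idem (\<nu>, \<mu>) = Q \<mu> \<otimes>\<^bsub>\<Omega>\<^esub> (P \<nu> \<otimes>\<^bsub>\<Omega>\<^esub> j1 a \<otimes>\<^bsub>\<Omega>\<^esub> P \<nu>) \<otimes>\<^bsub>\<Omega>\<^esub> Q \<mu>"
    unfolding prod_idem_def using i ja by (simp add: f1.P.W.m_assoc flip: PQ_comm[OF i])
  also have "\<dots> = ?c \<otimes>\<^bsub>\<Omega>\<^esub> Q \<mu> \<otimes>\<^bsub>\<Omega>\<^esub> Q \<mu>" unfolding c[symmetric] comm ..
  also have "\<dots> = ?c \<otimes>\<^bsub>\<Omega>\<^esub> Q \<mu>"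
    using i ja c f2.PI.F_orth[OF i(2,2)] by (simp add: f1.P.W.m_assoc)
  finally show ?thesis .
qed

lemma prod_idem_corner_j2:
  assumes i: "\<nu> \<in> Irr G1" "\<mu> \<in> Irr G2" and a: "a \<in> carrier (Omega K G2 S2)"
  shows "prod_idem (\<nu>, \<mu>) \<otimes>\<^bsub>\<Omega>\<^esub> j2 a \<otimes>\<^bsub>\<Omega>\<^esub> prod_idem (\<nu>, \<mu>) =
    P \<nu> \<otimes>\<^bsub>\<Omega>\<^esub> j2 (F2 \<mu> \<otimes>\<^bsub>Omega K G2 S2\<^esub> a \<otimes>\<^bsub>Omega K G2 S2\<^esub> F2 \<mu>)"
proof -
  note F = f2.QD.decomp_facts(1)[OF i(2)]
  have ja: "j2 a \<in> carrier \<Omega>" using a by simp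
  let ?c = "j2 (F2 \<mu> \<otimes>\<^bsub>Omega K G2 S2\<^esub> a \<otimes>\<^bsub>Omega K G2 S2\<^esub> F2 \<mu>)"
  have c: "?c = Q \<mu> \<otimes>\<^bsub>\<Omega>\<^esub> j2 a \<otimes>\<^bsub>\<Omega>\<^esub> Q \<mu>" using a F by (simp add: f2.image_idem_def)
  have comm: "?c \<otimes>\<^bsub>\<Omega>\<^esub> P \<nu> = P \<nu> \<otimes>\<^bsub>\<Omega>\<^esub> ?c"
    unfolding f1.image_idem_def
    by (rule Psi_images_commute[OF f1.QD.decomp_facts(7)[OF i(1)] f2.QD.corner_Psi[OF i(2) a]])
  have "prod_idem (\<nu>, \<mu>) \<otimes>\<^bsub>\<Omega>\<^esub> j2 a \<otimes>\<^bsub>\<Omega>\<^esub> prod_idem (\<nu>, \<mu>) = P \<nu> \<otimes>\<^bsub>\<Omega>\<^esub> ((Q \<mu> \<otimes>\<^bsub>\<Omega>\<^esub> j2 a \<otimes>\<^bsub>\<Omega>\<^esub> Q \<mu>) \<otimes>\<^bsub>\<Omega>\<^esub> P \<nu>)"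
    unfolding prod_idem_def using i ja by (simp add: f1.P.W.m_assoc PQ_comm[OF i])
  also have "\<dots> = (P \<nu> \<otimes>\<^bsub>\<Omega>\<^esub> P \<nu>) \<otimes>\<^bsub>\<Omega>\<^esub> ?c" unfolding c[symmetric] comm using i ja c by (simp add: f1.P.W.m_assoc)
  also have "\<dots> = P \<nu> \<otimes>\<^bsub>\<Omega>\<^esub> ?c"
    using f1.PI.F_orth[OF i(1,1)] by simp
  finally show ?thesis .
qed

lemma prod_idem_corner_x_Psi:
  assumes i: "\<nu> \<in> Irr G1" "\<mu> \<in> Irr G2" and s: "s \<in> S"
  shows "prod_idem (\<nu>, \<mu>) \<otimes>\<^bsub>\<Omega>\<^esub> omega_x K G S s \<otimes>\<^bsub>\<Omega>\<^esub> prod_idem (\<nu>, \<mu>) \<in> Psi K G S"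
proof -
  note R = subringE(6)[OF f1.P.Psi_subring]
  consider t where "s = \<iota>1 t" "t \<in> S1" | t where "s = \<iota>2 t" "t \<in> S2" using s f1.S_eq B1_eq by blast
  then show ?thesis
  proof cases
    case 1
    have x: "omega_x K G1 S1 t \<in> carrier (Omega K G1 S1)" using 1 by simp
    have "omega_x K G S s = j1 (omega_x K G1 S1 t)" using 1 f1.j_x by simp
    then show ?thesis unfolding prod_idem_corner_j1[OF i x, folded \<open>omega_x K G S s = _\<close>]
      using R[OF f1.j_Psi_Psi[OF f1.QD.corner_Psi[OF i(1) x]] f2.image_idem_Psi[OF i(2)]] by simp
  next
    case 2
    have x: "omega_x K G2 S2 t \<in> carrier (Omega K G2 S2)" using 2 by simp
    have "omega_x K G S s = j2 (omega_x K G2 S2 t)" using 2 f2.j_x by simp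
    then show ?thesis unfolding prod_idem_corner_j2[OF i x, folded \<open>omega_x K G S s = _\<close>]
      using R[OF f1.image_idem_Psi[OF i(1)] f2.j_Psi_Psi[OF f2.QD.corner_Psi[OF i(2) x]]] by simp
  qed
qed

lemma prod_idem_corner_X_Psi:
  assumes i: "\<nu> \<in> Irr G1" "\<mu> \<in> Irr G2" and ed: "compat_edge G S I J"
  shows "prod_idem (\<nu>, \<mu>) \<otimes>\<^bsub>\<Omega>\<^esub> X_elt K G S I J \<otimes>\<^bsub>\<Omega>\<^esub> prod_idem (\<nu>, \<mu>) \<in> Psi K G S"
proof -
  obtain s where IJ: "I \<subseteq> S" "J \<subseteq> S" "s \<in> I - J" using ed unfolding compat_edge_def by blast
  have s: "s \<in> S" using IJ by blast
  have "prod_idem (\<nu>, \<mu>) \<otimes>\<^bsub>\<Omega>\<^esub> X_elt K G S I J \<otimes>\<^bsub>\<Omega>\<^esub> prod_idem (\<nu>, \<mu>) =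
      (prod_idem (\<nu>, \<mu>) \<otimes>\<^bsub>\<Omega>\<^esub> f1.P.W.E S I) \<otimes>\<^bsub>\<Omega>\<^esub> omega_x K G S s \<otimes>\<^bsub>\<Omega>\<^esub> (f1.P.W.E S J \<otimes>\<^bsub>\<Omega>\<^esub> prod_idem (\<nu>, \<mu>))"
    unfolding f1.P.X_elt_eq[OF IJ] using i IJ s by (simp add: f1.P.W.m_assoc)
  also have "\<dots> = f1.P.W.E S I \<otimes>\<^bsub>\<Omega>\<^esub> (prod_idem (\<nu>, \<mu>) \<otimes>\<^bsub>\<Omega>\<^esub> omega_x K G S s \<otimes>\<^bsub>\<Omega>\<^esub> prod_idem (\<nu>, \<mu>)) \<otimes>\<^bsub>\<Omega>\<^esub> f1.P.W.E S J"
    unfolding prod_idem_commutes_E[OF i IJ(1)] prod_idem_commutes_E[OF i IJ(2), symmetric]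
    using i IJ s by (simp add: f1.P.W.m_assoc)
  also have "\<dots> \<in> Psi K G S"
    using prod_idem_corner_x_Psi[OF i s] f1.P.E_Psi[OF IJ(1)] f1.P.E_Psi[OF IJ(2)] subringE(6)[OF f1.P.Psi_subring] by simp
  finally show ?thesis .
qed

text \<open>
  Let \<open>\<alpha>\<close> and \<open>\<beta>\<close> be the matrix morphisms of the two factors, followed by \<open>j\<^sub>1\<close> and \<open>j\<^sub>2\<close>. Their values commute, so the
  products \<open>\<alpha>(E\<^sub>i\<^sub>j) \<beta>(E\<^sub>k\<^sub>l)\<close> are matrix units. The span \<open>T\<close> of these contains every \<open>\<alpha>(U) \<beta>(Y)\<close>, in particular the
  corners of the generators of \<open>\<Omega>\<close>, hence it contains the whole corner by \<open>corner_mult\<close>.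
\<close>

lemma prod_idem_surj_matrix_morphism:
  assumes i: "\<nu> \<in> Irr G1" "\<mu> \<in> Irr G2"
  shows "\<exists>\<psi>. surj_matrix_morphism K G S (char_degree G1 \<nu> * char_degree G2 \<mu>) (prod_idem (\<nu>, \<mu>)) \<psi>"
proof -
  define d1 where "d1 = char_degree G1 \<nu>"
  define d2 where "d2 = char_degree G2 \<mu>"
  obtain \<psi>1 where s1: "surj_matrix_morphism K G1 S1 d1 (F1 \<nu>) \<psi>1" using f1.QD.decomp_facts(5)[OF i(1)] d1_def by blast
  obtain \<psi>2 where s2: "surj_matrix_morphism K G2 S2 d2 (F2 \<mu>) \<psi>2" using f2.QD.decomp_facts(5)[OF i(2)] d2_def by blast
  note h1 = f1.QD.corner_morphism[OF i(1) s1]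
  note h2 = f2.QD.corner_morphism[OF i(2) s2]
  let ?M1 = "carrier (mat_ring_over K d1)" and ?M2 = "carrier (mat_ring_over K d2)"
  define \<alpha> where "\<alpha> U = j1 (\<psi>1 U)" for U
  define \<beta> where "\<beta> Y = j2 (\<psi>2 Y)" for Y
  have ac [simp]: "\<alpha> U \<in> carrier \<Omega>" if "U \<in> ?M1" for U
    unfolding \<alpha>_def using h1(1)[OF that] f1.Q.Psi_carrier by (intro f1.J.hom_closed) blast
  have bc [simp]: "\<beta> Y \<in> carrier \<Omega>" if "Y \<in> ?M2" for Y
    unfolding \<beta>_def using h2(1)[OF that] f2.Q.Psi_carrier by (intro f2.J.hom_closed) blast
  have c1: "\<psi>1 U \<in> carrier (Omega K G1 S1)" if "U \<in> ?M1" for U using h1(1)[OF that] f1.Q.Psi_carrier by blast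
  have c2: "\<psi>2 Y \<in> carrier (Omega K G2 S2)" if "Y \<in> ?M2" for Y using h2(1)[OF that] f2.Q.Psi_carrier by blast
  have comm: "\<beta> Y \<otimes>\<^bsub>\<Omega>\<^esub> \<alpha> U = \<alpha> U \<otimes>\<^bsub>\<Omega>\<^esub> \<beta> Y" if "U \<in> ?M1" "Y \<in> ?M2" for U Y
    unfolding \<alpha>_def \<beta>_def by (rule Psi_images_commute[OF h1(1)[OF that(1)] h2(1)[OF that(2)]])
  have a_mult: "\<alpha> (U * U') = \<alpha> U \<otimes>\<^bsub>\<Omega>\<^esub> \<alpha> U'" if "U \<in> ?M1" "U' \<in> ?M1" for U U'
    unfolding \<alpha>_def using h1(3)[OF that] c1 that by simp
  have b_mult: "\<beta> (Y * Y') = \<beta> Y \<otimes>\<^bsub>\<Omega>\<^esub> \<beta> Y'" if "Y \<in> ?M2" "Y' \<in> ?M2" for Y Y'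
    unfolding \<beta>_def using h2(3)[OF that] c2 that by simp
  have a_add: "\<alpha> (U + U') = \<alpha> U \<oplus>\<^bsub>\<Omega>\<^esub> \<alpha> U'" if "U \<in> ?M1" "U' \<in> ?M1" for U U'
    unfolding \<alpha>_def using h1(2)[OF that] c1 that by simp
  have b_add: "\<beta> (Y + Y') = \<beta> Y \<oplus>\<^bsub>\<Omega>\<^esub> \<beta> Y'" if "Y \<in> ?M2" "Y' \<in> ?M2" for Y Y'
    unfolding \<beta>_def using h2(2)[OF that] c2 that by simp
  have a_smult: "\<alpha> (z \<cdot>\<^sub>m U) = omega_scalar K G S z \<otimes>\<^bsub>\<Omega>\<^esub> \<alpha> U" if "z \<in> K" "U \<in> ?M1" for z U
    unfolding \<alpha>_def using h1(4)[OF that] c1[OF that(2)] f1.P.omega_scalar_closed[OF that(1), of G1 S1] f1.j_scalar[OF that(1)] by simp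
  have b_smult: "\<beta> (z \<cdot>\<^sub>m Y) = omega_scalar K G S z \<otimes>\<^bsub>\<Omega>\<^esub> \<beta> Y" if "z \<in> K" "Y \<in> ?M2" for z Y
    unfolding \<beta>_def using h2(4)[OF that] c2[OF that(2)] f1.P.omega_scalar_closed[OF that(1), of G2 S2] f2.j_scalar[OF that(1)] by simp
  have a_one: "\<alpha> (1\<^sub>m d1) = P \<nu>" unfolding \<alpha>_def f1.image_idem_def using h1(5) by simp
  have b_one: "\<beta> (1\<^sub>m d2) = Q \<mu>" unfolding \<beta>_def f2.image_idem_def using h2(5) by simp
  note cl = f1.P.mat_ring_over_closed
  have a_zero: "\<alpha> (0\<^sub>m d1 d1) = \<zero>\<^bsub>\<Omega>\<^esub>"
  proof -
    have "0\<^sub>m d1 d1 = 0 \<cdot>\<^sub>m (0\<^sub>m d1 d1 :: complex mat)" by auto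
    then have "\<alpha> (0\<^sub>m d1 d1) = omega_scalar K G S 0 \<otimes>\<^bsub>\<Omega>\<^esub> \<alpha> (0\<^sub>m d1 d1)"
      using a_smult[OF f1.P.K_closed(1) cl(1)] by metis
    also have "\<dots> = \<zero>\<^bsub>\<Omega>\<^esub>" using ac[OF cl(1)] f1.P.omega_scalar_hom(4)[of G S] by simp
    finally show ?thesis .
  qed
  have b_zero: "\<beta> (0\<^sub>m d2 d2) = \<zero>\<^bsub>\<Omega>\<^esub>"
  proof -
    have "0\<^sub>m d2 d2 = 0 \<cdot>\<^sub>m (0\<^sub>m d2 d2 :: complex mat)" by auto
    then have "\<beta> (0\<^sub>m d2 d2) = omega_scalar K G S 0 \<otimes>\<^bsub>\<Omega>\<^esub> \<beta> (0\<^sub>m d2 d2)"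
      using b_smult[OF f1.P.K_closed(1) cl(1)] by metis
    also have "\<dots> = \<zero>\<^bsub>\<Omega>\<^esub>" using bc[OF cl(1)] f1.P.omega_scalar_hom(4)[of G S] by simp
    finally show ?thesis .
  qed
  let ?d = "d1 * d2"
  \<comment> \<open>The pair of indices \<open>(i, k)\<close> is encoded as \<open>i * d2 + k\<close>.\<close>
  define c where "c r s = \<alpha> (unit_mat d1 (r div d2) (s div d2)) \<otimes>\<^bsub>\<Omega>\<^esub> \<beta> (unit_mat d2 (r mod d2) (s mod d2))" for r s
  have c_closed: "c r s \<in> carrier \<Omega>" for r s unfolding c_def using cl(3) by simp
  have interchange: "(\<alpha> U \<otimes>\<^bsub>\<Omega>\<^esub> \<beta> Y) \<otimes>\<^bsub>\<Omega>\<^esub> (\<alpha> U' \<otimes>\<^bsub>\<Omega>\<^esub> \<beta> Y') = \<alpha> (U * U') \<otimes>\<^bsub>\<Omega>\<^esub> \<beta> (Y * Y')"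
    if "U \<in> ?M1" "U' \<in> ?M1" "Y \<in> ?M2" "Y' \<in> ?M2" for U U' Y Y'
  proof -
    have "(\<alpha> U \<otimes>\<^bsub>\<Omega>\<^esub> \<beta> Y) \<otimes>\<^bsub>\<Omega>\<^esub> (\<alpha> U' \<otimes>\<^bsub>\<Omega>\<^esub> \<beta> Y') = \<alpha> U \<otimes>\<^bsub>\<Omega>\<^esub> (\<beta> Y \<otimes>\<^bsub>\<Omega>\<^esub> \<alpha> U') \<otimes>\<^bsub>\<Omega>\<^esub> \<beta> Y'"
      using that by (simp add: f1.P.W.m_assoc)
    also have "\<dots> = (\<alpha> U \<otimes>\<^bsub>\<Omega>\<^esub> \<alpha> U') \<otimes>\<^bsub>\<Omega>\<^esub> (\<beta> Y \<otimes>\<^bsub>\<Omega>\<^esub> \<beta> Y')"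
      unfolding comm[OF that(2,3)] using that by (simp add: f1.P.W.m_assoc)
    finally show ?thesis using that by (simp add: a_mult b_mult)
  qed
  interpret MU: matrix_units K \<Omega> "omega_scalar K G S" ?d c
  proof
    fix r s t u assume rs: "r < ?d" "s < ?d" "t < ?d" "u < ?d"
    note dm = div_mod_less[OF rs(1)] div_mod_less[OF rs(2)] div_mod_less[OF rs(3)] div_mod_less[OF rs(4)]
    have st: "s = t \<longleftrightarrow> s div d2 = t div d2 \<and> s mod d2 = t mod d2" by (metis div_mult_mod_eq)
    have "c r s \<otimes>\<^bsub>\<Omega>\<^esub> c t u = \<alpha> (unit_mat d1 (r div d2) (s div d2) * unit_mat d1 (t div d2) (u div d2)) \<otimes>\<^bsub>\<Omega>\<^esub>
        \<beta> (unit_mat d2 (r mod d2) (s mod d2) * unit_mat d2 (t mod d2) (u mod d2))"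
      unfolding c_def by (rule interchange) (rule cl(3))+
    then show "c r s \<otimes>\<^bsub>\<Omega>\<^esub> c t u = (if s = t then c r u else \<zero>\<^bsub>\<Omega>\<^esub>)"
      using dm st by (auto simp: unit_mat_mult c_def a_zero b_zero cl)
  qed (use c_closed f1.P.omega_scalar_closed f1.P.omega_scalar_central f1.P.omega_scalar_hom in simp_all)
  let ?M = "carrier (mat_ring_over K ?d)" and ?\<psi> = MU.mat_hom
  define T where "T = ?\<psi> ` ?M"
  have TI: "?\<psi> A \<in> T" if "A \<in> ?M" for A unfolding T_def using that by (rule imageI)
  have T_zero: "\<zero>\<^bsub>\<Omega>\<^esub> \<in> T" using TI[OF cl(1)] MU.mat_hom_zero by simp
  have T_add: "a \<oplus>\<^bsub>\<Omega>\<^esub> b \<in> T" if ab: "a \<in> T" "b \<in> T" for a b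
  proof -
    obtain A B where AB: "a = ?\<psi> A" "A \<in> ?M" "b = ?\<psi> B" "B \<in> ?M" using ab unfolding T_def by (elim imageE)
    then show ?thesis using MU.mat_hom_add[OF AB(2,4)] TI[OF cl(4)[OF AB(2,4)]] by simp
  qed
  have T_mult: "a \<otimes>\<^bsub>\<Omega>\<^esub> b \<in> T" if ab: "a \<in> T" "b \<in> T" for a b
  proof -
    obtain A B where AB: "a = ?\<psi> A" "A \<in> ?M" "b = ?\<psi> B" "B \<in> ?M" using ab unfolding T_def by (elim imageE)
    then show ?thesis using MU.mat_hom_mult[OF AB(2,4)] TI[OF cl(5)[OF AB(2,4)]] by simp
  qed
  have T_smult: "omega_scalar K G S z \<otimes>\<^bsub>\<Omega>\<^esub> a \<in> T" if za: "z \<in> K" "a \<in> T" for z a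
  proof -
    obtain A where A: "a = ?\<psi> A" "A \<in> ?M" using za unfolding T_def by (elim imageE)
    then show ?thesis using MU.mat_hom_smult[OF za(1) A(2)] TI[OF cl(6)[OF za(1) A(2)]] by simp
  qed
  have T_carrier: "a \<in> carrier \<Omega>" if "a \<in> T" for a
    using that MU.mat_hom_closed unfolding T_def by (elim imageE) simp
  have T_unit: "\<alpha> (unit_mat d1 r s) \<otimes>\<^bsub>\<Omega>\<^esub> \<beta> (unit_mat d2 t u) \<in> T" if "r < d1" "s < d1" "t < d2" "u < d2" for r s t u
  proof -
    have bound: "a * d2 + b < ?d" if "a < d1" "b < d2" for a b
    proof -
      have "a * d2 + b < Suc a * d2" using that by simp
      also have "\<dots> \<le> ?d" using that by (intro mult_le_mono1) simp
      finally show ?thesis .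
    qed
    have "?\<psi> (unit_mat ?d (r * d2 + t) (s * d2 + u)) = c (r * d2 + t) (s * d2 + u)"
      using that by (intro MU.mat_hom_unit bound)
    also have "\<dots> = \<alpha> (unit_mat d1 r s) \<otimes>\<^bsub>\<Omega>\<^esub> \<beta> (unit_mat d2 t u)" unfolding c_def using that by simp
    finally show ?thesis using TI[OF cl(3)] by metis
  qed
  \<comment> \<open>By bilinearity it suffices to consider matrix units \<open>U\<close> and \<open>Y\<close>.\<close>
  have T_prod: "\<alpha> U \<otimes>\<^bsub>\<Omega>\<^esub> \<beta> Y \<in> T" if U: "U \<in> ?M1" and Y: "Y \<in> ?M2" for U Y
    using U
  proof (induction U rule: f1.P.mat_ring_induct)
    case zero
    then show ?case using Y T_zero by (simp add: a_zero)
  next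
    case (add U z r s)
    have unit: "\<alpha> (unit_mat d1 r s) \<otimes>\<^bsub>\<Omega>\<^esub> \<beta> Y \<in> T"
      using Y
    proof (induction Y rule: f1.P.mat_ring_induct)
      case zero
      then show ?case using T_zero cl(3) by (simp add: b_zero)
    next
      case (add Y w t u)
      have "\<alpha> (unit_mat d1 r s) \<otimes>\<^bsub>\<Omega>\<^esub> \<beta> (Y + w \<cdot>\<^sub>m unit_mat d2 t u) =
          \<alpha> (unit_mat d1 r s) \<otimes>\<^bsub>\<Omega>\<^esub> \<beta> Y \<oplus>\<^bsub>\<Omega>\<^esub>
          (\<alpha> (unit_mat d1 r s) \<otimes>\<^bsub>\<Omega>\<^esub> omega_scalar K G S w) \<otimes>\<^bsub>\<Omega>\<^esub> \<beta> (unit_mat d2 t u)"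
        using add cl by (simp add: b_add b_smult f1.P.W.r_distr f1.P.W.m_assoc)
      also have "\<alpha> (unit_mat d1 r s) \<otimes>\<^bsub>\<Omega>\<^esub> omega_scalar K G S w = omega_scalar K G S w \<otimes>\<^bsub>\<Omega>\<^esub> \<alpha> (unit_mat d1 r s)"
        using f1.P.omega_scalar_central[OF add.hyps(2) ac[OF cl(3)]] by simp
      also have "omega_scalar K G S w \<otimes>\<^bsub>\<Omega>\<^esub> \<alpha> (unit_mat d1 r s) \<otimes>\<^bsub>\<Omega>\<^esub> \<beta> (unit_mat d2 t u) =
          omega_scalar K G S w \<otimes>\<^bsub>\<Omega>\<^esub> (\<alpha> (unit_mat d1 r s) \<otimes>\<^bsub>\<Omega>\<^esub> \<beta> (unit_mat d2 t u))"
        using add cl by (simp add: f1.P.W.m_assoc)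
      finally show ?case
        using T_add[OF add.IH T_smult[OF add.hyps(2) T_unit[OF \<open>r < d1\<close> \<open>s < d1\<close> add.hyps(3,4)]]] by simp
    qed
    have "\<alpha> (U + z \<cdot>\<^sub>m unit_mat d1 r s) \<otimes>\<^bsub>\<Omega>\<^esub> \<beta> Y =
        \<alpha> U \<otimes>\<^bsub>\<Omega>\<^esub> \<beta> Y \<oplus>\<^bsub>\<Omega>\<^esub> omega_scalar K G S z \<otimes>\<^bsub>\<Omega>\<^esub> (\<alpha> (unit_mat d1 r s) \<otimes>\<^bsub>\<Omega>\<^esub> \<beta> Y)"
      using add Y cl by (simp add: a_add a_smult f1.P.W.l_distr f1.P.W.m_assoc)
    then show ?case using T_add[OF add.IH T_smult[OF add.hyps(2) unit]] by simp
  qed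
  let ?f = "prod_idem (\<nu>, \<mu>)"
  have f_eq: "?f = \<alpha> (1\<^sub>m d1) \<otimes>\<^bsub>\<Omega>\<^esub> \<beta> (1\<^sub>m d2)" by (simp add: prod_idem_def a_one b_one)
  have fT: "?f \<in> T" unfolding f_eq by (rule T_prod[OF cl(2) cl(2)])
  have f_closed: "?f \<in> carrier \<Omega>" using i by simp
  have ff: "?f \<otimes>\<^bsub>\<Omega>\<^esub> ?f = ?f" using O.F_orth[of "(\<nu>, \<mu>)" "(\<nu>, \<mu>)"] i by simp
  have f_unit: "?f \<otimes>\<^bsub>\<Omega>\<^esub> c r s = c r s" "c r s \<otimes>\<^bsub>\<Omega>\<^esub> ?f = c r s" for r s
    unfolding f_eq c_def using interchange[OF cl(2) cl(3) cl(2) cl(3)] interchange[OF cl(3) cl(2) cl(3) cl(2)]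
      unit_mat_carrier left_mult_one_mat right_mult_one_mat by metis+
  have f_id: "?f \<otimes>\<^bsub>\<Omega>\<^esub> ?\<psi> A = ?\<psi> A \<and> ?\<psi> A \<otimes>\<^bsub>\<Omega>\<^esub> ?f = ?\<psi> A" if "A \<in> ?M" for A
    using that
  proof (induction A rule: f1.P.mat_ring_induct)
    case zero
    then show ?case using f_closed by (simp add: MU.mat_hom_zero)
  next
    case (add A z r s)
    have z: "omega_scalar K G S z \<in> carrier \<Omega>" by (rule f1.P.omega_scalar_closed[OF add.hyps(2)])
    have e: "?\<psi> (A + z \<cdot>\<^sub>m unit_mat ?d r s) = ?\<psi> A \<oplus>\<^bsub>\<Omega>\<^esub> omega_scalar K G S z \<otimes>\<^bsub>\<Omega>\<^esub> c r s"
      using add cl by (simp add: MU.mat_hom_add MU.mat_hom_smult MU.mat_hom_unit)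
    have "?f \<otimes>\<^bsub>\<Omega>\<^esub> (omega_scalar K G S z \<otimes>\<^bsub>\<Omega>\<^esub> c r s) = (?f \<otimes>\<^bsub>\<Omega>\<^esub> omega_scalar K G S z) \<otimes>\<^bsub>\<Omega>\<^esub> c r s"
      using z f_closed c_closed by (simp add: f1.P.W.m_assoc)
    also have "\<dots> = omega_scalar K G S z \<otimes>\<^bsub>\<Omega>\<^esub> (?f \<otimes>\<^bsub>\<Omega>\<^esub> c r s)"
      unfolding f1.P.omega_scalar_central[OF add.hyps(2) f_closed, symmetric]
      using z f_closed c_closed by (simp add: f1.P.W.m_assoc)
    finally have l: "?f \<otimes>\<^bsub>\<Omega>\<^esub> (omega_scalar K G S z \<otimes>\<^bsub>\<Omega>\<^esub> c r s) = omega_scalar K G S z \<otimes>\<^bsub>\<Omega>\<^esub> c r s"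
      unfolding f_unit .
    have r: "(omega_scalar K G S z \<otimes>\<^bsub>\<Omega>\<^esub> c r s) \<otimes>\<^bsub>\<Omega>\<^esub> ?f = omega_scalar K G S z \<otimes>\<^bsub>\<Omega>\<^esub> c r s"
      using z f_closed c_closed f_unit(2) by (simp add: f1.P.W.m_assoc)
    show ?case unfolding e using add.IH l r z f_closed c_closed MU.mat_hom_closed[OF add.hyps(1)]
      by (simp add: f1.P.W.r_distr f1.P.W.l_distr)
  qed
  \<comment> \<open>Both \<open>?f\<close> and the value at the identity matrix are units of the algebra \<open>T\<close>, so they agree.\<close>
  have psi_one: "?\<psi> (1\<^sub>m ?d) = ?f"
  proof -
    obtain A where A: "A \<in> ?M" "?f = ?\<psi> A" using fT unfolding T_def by (elim imageE)
    have "?\<psi> (1\<^sub>m ?d) = ?\<psi> A \<otimes>\<^bsub>\<Omega>\<^esub> ?\<psi> (1\<^sub>m ?d)" using f_id[OF cl(2)] A(2) by simp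
    also have "\<dots> = ?\<psi> (A * 1\<^sub>m ?d)" by (rule MU.mat_hom_mult[OF A(1) cl(2), symmetric])
    also have "A * 1\<^sub>m ?d = A"
      by (rule right_mult_one_mat[OF conjunct1[OF A(1)[unfolded f1.P.mat_ring_over_iff]]])
    finally show ?thesis using A(2) by simp
  qed
  \<comment> \<open>The elements whose corner lies in \<open>T\<close> form a ring, by multiplicativity of corners.\<close>
  let ?H = "{a \<in> carrier \<Omega>. ?f \<otimes>\<^bsub>\<Omega>\<^esub> a \<otimes>\<^bsub>\<Omega>\<^esub> ?f \<in> T}"
  have m1K: "- 1 \<in> K" using f1.P.K_closed(2,3) by blast
  have T_neg: "\<ominus>\<^bsub>\<Omega>\<^esub> a \<in> T" if a: "a \<in> T" for a
  proof -
    have "omega_scalar K G S (-1) \<oplus>\<^bsub>\<Omega>\<^esub> \<one>\<^bsub>\<Omega>\<^esub> = \<zero>\<^bsub>\<Omega>\<^esub>"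
      using f1.P.omega_scalar_hom(1)[OF m1K f1.P.K_closed(2), of G S] f1.P.omega_scalar_hom(3,4)[of G S] by simp
    then have "omega_scalar K G S (-1) \<otimes>\<^bsub>\<Omega>\<^esub> a \<oplus>\<^bsub>\<Omega>\<^esub> a = \<zero>\<^bsub>\<Omega>\<^esub>"
      using T_carrier[OF a] f1.P.omega_scalar_closed[OF m1K, of G S]
        f1.P.W.l_distr[of "omega_scalar K G S (-1)" "\<one>\<^bsub>\<Omega>\<^esub>" a] by simp
    then have "\<ominus>\<^bsub>\<Omega>\<^esub> a = omega_scalar K G S (-1) \<otimes>\<^bsub>\<Omega>\<^esub> a"
      using T_carrier[OF a] f1.P.omega_scalar_closed[OF m1K, of G S] by (intro f1.P.W.minus_equality) auto
    then show ?thesis using T_smult[OF m1K a] by simp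
  qed
  have "subring ?H \<Omega>"
  proof (rule f1.P.W.subringI)
    show "\<one>\<^bsub>\<Omega>\<^esub> \<in> ?H" using f_closed ff fT by simp
    fix a assume a: "a \<in> ?H"
    then show "\<ominus>\<^bsub>\<Omega>\<^esub> a \<in> ?H" using f_closed T_neg by (simp add: f1.P.W.r_minus f1.P.W.l_minus)
    fix b assume b: "b \<in> ?H"
    show "a \<oplus>\<^bsub>\<Omega>\<^esub> b \<in> ?H" using a b f_closed T_add by (simp add: f1.P.W.r_distr f1.P.W.l_distr)
    show "a \<otimes>\<^bsub>\<Omega>\<^esub> b \<in> ?H" using a b O.corner_mult[of "(\<nu>, \<mu>)" a b] i T_mult by simp
  qed auto
  moreover have j1H: "j1 a \<in> ?H" if a: "a \<in> carrier (Omega K G1 S1)" for a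
  proof -
    obtain U where U: "U \<in> ?M1" "F1 \<nu> \<otimes>\<^bsub>Omega K G1 S1\<^esub> a \<otimes>\<^bsub>Omega K G1 S1\<^esub> F1 \<nu> = \<psi>1 U" using h1(6)[OF a] by blast
    have "?f \<otimes>\<^bsub>\<Omega>\<^esub> j1 a \<otimes>\<^bsub>\<Omega>\<^esub> ?f = \<alpha> U \<otimes>\<^bsub>\<Omega>\<^esub> \<beta> (1\<^sub>m d2)"
      unfolding prod_idem_corner_j1[OF i a] U(2) \<alpha>_def b_one ..
    then show ?thesis using T_prod[OF U(1) cl(2)] a by simp
  qed
  moreover have j2H: "j2 a \<in> ?H" if a: "a \<in> carrier (Omega K G2 S2)" for a
  proof -
    obtain Y where Y: "Y \<in> ?M2" "F2 \<mu> \<otimes>\<^bsub>Omega K G2 S2\<^esub> a \<otimes>\<^bsub>Omega K G2 S2\<^esub> F2 \<mu> = \<psi>2 Y" using h2(6)[OF a] by blast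
    have "?f \<otimes>\<^bsub>\<Omega>\<^esub> j2 a \<otimes>\<^bsub>\<Omega>\<^esub> ?f = \<alpha> (1\<^sub>m d1) \<otimes>\<^bsub>\<Omega>\<^esub> \<beta> Y"
      unfolding prod_idem_corner_j2[OF i a] Y(2) \<beta>_def a_one ..
    then show ?thesis using T_prod[OF cl(2) Y(1)] a by simp
  qed
  ultimately have H: "?H = carrier \<Omega>"
  proof (elim f1.P.Omega_generated)
    fix s assume "s \<in> S"
    then consider t where "s = \<iota>1 t" "t \<in> S1" | t where "s = \<iota>2 t" "t \<in> S2" using f1.S_eq B1_eq by blast
    then have "omega_e K G S s \<in> ?H \<and> omega_x K G S s \<in> ?H"
    proof cases
      case 1
      then show ?thesis using j1H[of "omega_e K G1 S1 t"] j1H[of "omega_x K G1 S1 t"] f1.j_e f1.j_x by simp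
    next
      case 2
      then show ?thesis using j2H[of "omega_e K G2 S2 t"] j2H[of "omega_x K G2 S2 t"] f2.j_e f2.j_x by simp
    qed
    then show "omega_e K G S s \<in> ?H" "omega_x K G S s \<in> ?H" by blast+
  next
    fix z assume z: "z \<in> K"
    show "omega_scalar K G S z \<in> ?H"
      using j1H[OF f1.P.omega_scalar_closed[OF z]] f1.j_scalar[OF z] by simp
  qed
  have corner: "carrier (corner_ring \<Omega> ?f) = T"
  proof
    show "carrier (corner_ring \<Omega> ?f) \<subseteq> T" unfolding corner_ring_def using H by auto
    show "T \<subseteq> carrier (corner_ring \<Omega> ?f)"
    proof
      fix a assume a: "a \<in> T"
      then obtain A where A: "A \<in> ?M" "a = ?\<psi> A" unfolding T_def by (elim imageE)
      have "a = ?f \<otimes>\<^bsub>\<Omega>\<^esub> a \<otimes>\<^bsub>\<Omega>\<^esub> ?f" using f_id[OF A(1)] A(2) by simp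
      then show "a \<in> carrier (corner_ring \<Omega> ?f)" unfolding corner_ring_def using T_carrier[OF a] by auto
    qed
  qed
  have "?\<psi> \<in> Ring.ring_hom (mat_ring_over K ?d) (corner_ring \<Omega> ?f)"
  proof (rule ring_hom_memI)
    show "?\<psi> A \<in> carrier (corner_ring \<Omega> ?f)" if "A \<in> ?M" for A unfolding corner by (rule TI[OF that])
    show "?\<psi> (A \<otimes>\<^bsub>mat_ring_over K ?d\<^esub> B) = ?\<psi> A \<otimes>\<^bsub>corner_ring \<Omega> ?f\<^esub> ?\<psi> B"
      "?\<psi> (A \<oplus>\<^bsub>mat_ring_over K ?d\<^esub> B) = ?\<psi> A \<oplus>\<^bsub>corner_ring \<Omega> ?f\<^esub> ?\<psi> B" if "A \<in> ?M" "B \<in> ?M" for A B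
      using MU.mat_hom_mult[OF that] MU.mat_hom_add[OF that]
      by (simp_all add: f1.P.mat_ring_over_ops corner_ring_def)
    show "?\<psi> \<one>\<^bsub>mat_ring_over K ?d\<^esub> = \<one>\<^bsub>corner_ring \<Omega> ?f\<^esub>"
      using psi_one by (simp add: f1.P.mat_ring_over_ops corner_ring_def)
  qed
  then have "surj_matrix_morphism K G S ?d ?f ?\<psi>"
    unfolding surj_matrix_morphism_def corner using MU.mat_hom_smult T_def by blast
  then show ?thesis unfolding d1_def d2_def by blast
qed

end

section \<open>Direct products of Coxeter groups\<close>

lemma ord_inj_hom:
  assumes G: "group G" and H: "group H" and h: "h \<in> hom G H" and inj: "inj_on h (carrier G)"
    and x: "x \<in> carrier G"
  shows "group.ord H (h x) = group.ord G x"
proof -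
  interpret G: group G by (rule G)
  interpret H: group H by (rule H)
  interpret group_hom G H h using h by unfold_locales
  have "h x [^]\<^bsub>H\<^esub> n = \<one>\<^bsub>H\<^esub> \<longleftrightarrow> x [^]\<^bsub>G\<^esub> n = \<one>\<^bsub>G\<^esub>" for n :: nat
  proof -
    have "h x [^]\<^bsub>H\<^esub> n = h (x [^]\<^bsub>G\<^esub> n)" using x by (simp add: hom_nat_pow)
    then have "h x [^]\<^bsub>H\<^esub> n = \<one>\<^bsub>H\<^esub> \<longleftrightarrow> h (x [^]\<^bsub>G\<^esub> n) = h \<one>\<^bsub>G\<^esub>" by simp
    also have "\<dots> \<longleftrightarrow> x [^]\<^bsub>G\<^esub> n = \<one>\<^bsub>G\<^esub>" using inj x by (intro inj_on_eq_iff) auto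
    finally show ?thesis .
  qed
  then have "H.ord (h x) dvd n \<longleftrightarrow> G.ord x dvd n" for n
    using G.pow_eq_id[OF x] H.pow_eq_id[of "h x"] x by simp
  then show ?thesis by (meson dvd_antisym dvd_refl)
qed

lemma ord_DirProd:
  assumes G: "group G" and H: "group H"
  shows "g \<in> carrier G \<Longrightarrow> group.ord (G \<times>\<times> H) (g, \<one>\<^bsub>H\<^esub>) = group.ord G g"
    and "h \<in> carrier H \<Longrightarrow> group.ord (G \<times>\<times> H) (\<one>\<^bsub>G\<^esub>, h) = group.ord H h"
proof -
  interpret G: group G by (rule G)
  interpret H: group H by (rule H)
  have GH: "group (G \<times>\<times> H)" by (rule DirProd_group[OF G H])
  have "(\<lambda>g. (g, \<one>\<^bsub>H\<^esub>)) \<in> hom G (G \<times>\<times> H)" "(\<lambda>h. (\<one>\<^bsub>G\<^esub>, h)) \<in> hom H (G \<times>\<times> H)"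
    by (auto intro!: homI)
  then show "g \<in> carrier G \<Longrightarrow> group.ord (G \<times>\<times> H) (g, \<one>\<^bsub>H\<^esub>) = group.ord G g"
    "h \<in> carrier H \<Longrightarrow> group.ord (G \<times>\<times> H) (\<one>\<^bsub>G\<^esub>, h) = group.ord H h"
    using ord_inj_hom[OF G GH, of "\<lambda>g. (g, \<one>\<^bsub>H\<^esub>)" g] ord_inj_hom[OF H GH, of "\<lambda>h. (\<one>\<^bsub>G\<^esub>, h)" h]
    by (auto simp: inj_on_def)
qed

lemma wgraph_setup_coxeter:
  assumes K: "good_coeffs K" and G: "finite_coxeter_group G S"
  shows "wgraph_setup K G S"
  using assms unfolding finite_coxeter_group_def coxeter_group_def wgraph_setup_def wgraph_setup_axioms_def
    finite_group_def finite_group_axioms_def by blast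

lemma wgraph_setup_DirProd:
  assumes 1: "wgraph_setup K G1 S1" and 2: "wgraph_setup K G2 S2"
  shows "wgraph_setup K (G1 \<times>\<times> G2) (prod_reflections G1 S1 G2 S2)"
proof -
  interpret A: wgraph_setup K G1 S1 by (rule 1)
  interpret B: wgraph_setup K G2 S2 by (rule 2)
  interpret two_finite_groups G1 G2 by unfold_locales
  interpret AB: finite_group "G1 \<times>\<times> G2" by (rule finite_group_DirProd)
  show ?thesis
  proof
    show "prod_reflections G1 S1 G2 S2 \<subseteq> carrier (G1 \<times>\<times> G2)"
      using A.S_carrier B.S_carrier by (auto simp: prod_reflections_def)
    fix s assume "s \<in> prod_reflections G1 S1 G2 S2"
    then show "group.ord (G1 \<times>\<times> G2) s = 2"
      using A.S_carrier B.S_carrier ord_DirProd[OF A.is_group B.is_group] A.S_ord B.S_ord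
      by (auto simp: prod_reflections_def subset_iff)
  qed
qed

locale dir_prod_product =
  wgraph_product K "G1 \<times>\<times> G2" S G1 S1 \<iota>1 B1 j1 F1 G2 S2 \<iota>2 B2 j2 F2
  for K and G1 :: "('a, 'n1) monoid_scheme" and G2 :: "('b, 'n2) monoid_scheme" and S S1 \<iota>1 B1 j1 F1 S2 \<iota>2 B2 j2 F2
begin

sublocale two_finite_groups G1 G2
  by unfold_locales

abbreviation L where "L \<equiv> Irr G1 \<times> Irr G2"

text \<open>
  The pair of irreducible characters whose product is the given one; it indexes the idempotent of that character.
\<close>

definition char_pair where "char_pair = the_inv_into L (\<lambda>(\<chi>, \<psi>). outer_char G1 G2 \<chi> \<psi>)"

lemma char_pair_bij: "bij_betw char_pair (Irr (G1 \<times>\<times> G2)) L"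
  unfolding char_pair_def by (rule bij_betw_the_inv_into[OF outer_char_bij])

lemma char_pair_outer: "\<chi> \<in> Irr (G1 \<times>\<times> G2) \<Longrightarrow> outer_char G1 G2 (fst (char_pair \<chi>)) (snd (char_pair \<chi>)) = \<chi>"
  using f_the_inv_into_f_bij_betw[OF outer_char_bij, of \<chi>] by (simp add: char_pair_def case_prod_beta)

lemma char_pair_in: "\<chi> \<in> Irr (G1 \<times>\<times> G2) \<Longrightarrow> fst (char_pair \<chi>) \<in> Irr G1 \<and> snd (char_pair \<chi>) \<in> Irr G2"
  using bij_betwE[OF char_pair_bij] by (auto simp: mem_Times_iff)

lemma char_pair_inj: "\<chi> \<in> Irr (G1 \<times>\<times> G2) \<Longrightarrow> \<chi>' \<in> Irr (G1 \<times>\<times> G2) \<Longrightarrow> char_pair \<chi> = char_pair \<chi>' \<longleftrightarrow> \<chi> = \<chi>'"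
  using char_pair_bij by (auto simp: bij_betw_def inj_on_def)

lemma product_decomposition: "strong_wgraph_decomposition K (G1 \<times>\<times> G2) S (\<lambda>\<chi>. prod_idem (char_pair \<chi>))"
  unfolding strong_wgraph_decomposition_def f1.P.E_elt_eq
proof (intro conjI ballI allI impI)
  let ?I = "Irr (G1 \<times>\<times> G2)"
  have dL: "char_pair \<chi> \<in> L" if "\<chi> \<in> ?I" for \<chi> using char_pair_in[OF that] by (simp add: mem_Times_iff)
  note sp = prod.collapse
  show "prod_idem (char_pair \<nu>) \<in> carrier \<Omega>" if "\<nu> \<in> ?I" for \<nu>
    using O.F_closed[OF dL[OF that]] .
  show "prod_idem (char_pair \<nu>) \<otimes>\<^bsub>\<Omega>\<^esub> prod_idem (char_pair \<mu>) = (if \<nu> = \<mu> then prod_idem (char_pair \<nu>) else \<zero>\<^bsub>\<Omega>\<^esub>)" if "\<nu> \<in> ?I" "\<mu> \<in> ?I" for \<nu> \<mu>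
    using O.F_orth[OF dL[OF that(1)] dL[OF that(2)]] char_pair_inj[OF that] by simp
  show "\<one>\<^bsub>\<Omega>\<^esub> = (\<Oplus>\<^bsub>\<Omega>\<^esub>\<chi>\<in>?I. prod_idem (char_pair \<chi>))"
  proof -
    have d: "char_pair ` ?I = L" "inj_on char_pair ?I" using char_pair_bij by (auto simp: bij_betw_def)
    have "(\<Oplus>\<^bsub>\<Omega>\<^esub>p\<in>char_pair ` ?I. prod_idem p) = (\<Oplus>\<^bsub>\<Omega>\<^esub>\<chi>\<in>?I. prod_idem (char_pair \<chi>))"
      by (rule f1.P.W.finsum_reindex[OF _ d(2)]) (use O.F_closed d(1) in \<open>simp add: Pi_iff\<close>)
    then show ?thesis unfolding d(1) O.F_sum .
  qed
  show "f1.P.W.E S I \<otimes>\<^bsub>\<Omega>\<^esub> prod_idem (char_pair \<nu>) = prod_idem (char_pair \<nu>) \<otimes>\<^bsub>\<Omega>\<^esub> f1.P.W.E S I" if "\<nu> \<in> ?I" "I \<subseteq> S" for \<nu> I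
    using prod_idem_commutes_E[of "fst (char_pair \<nu>)" "snd (char_pair \<nu>)" I] char_pair_in[OF that(1)] that(2) by simp
  show "\<exists>r. partial_order_on ?I r \<and> (\<forall>\<nu>\<in>?I. \<forall>\<mu>\<in>?I.
      (\<exists>a\<in>carrier \<Omega>. prod_idem (char_pair \<nu>) \<otimes>\<^bsub>\<Omega>\<^esub> a \<otimes>\<^bsub>\<Omega>\<^esub> prod_idem (char_pair \<mu>) \<noteq> \<zero>\<^bsub>\<Omega>\<^esub>) \<longrightarrow> (\<nu>, \<mu>) \<in> r)"
  proof (intro exI conjI ballI impI)
    let ?r = "{(\<nu>, \<mu>). \<nu> \<in> ?I \<and> \<mu> \<in> ?I \<and> (char_pair \<nu>, char_pair \<mu>) \<in> prod_rel}"
    have po: "refl_on L prod_rel" "trans prod_rel" "antisym prod_rel"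
      using O.r_order by (auto simp: partial_order_on_def preorder_on_def)
    have "refl_on ?I ?r" unfolding refl_on_def using refl_onD[OF po(1) dL] by simp
    moreover have "trans ?r"
    proof (rule transI)
      fix x y z assume "(x, y) \<in> ?r" "(y, z) \<in> ?r"
      then show "(x, z) \<in> ?r" using transD[OF po(2), of "char_pair x" "char_pair y" "char_pair z"] by simp
    qed
    moreover have "antisym ?r"
    proof (rule antisymI)
      fix x y assume "(x, y) \<in> ?r" "(y, x) \<in> ?r"
      then show "x = y" using antisymD[OF po(3), of "char_pair x" "char_pair y"] char_pair_inj[of x y] by simp
    qed
    moreover have "?r \<subseteq> ?I \<times> ?I" by auto
    ultimately show "partial_order_on ?I ?r" unfolding partial_order_on_def preorder_on_def by (intro conjI)
    fix \<nu> \<mu> assume nm: "\<nu> \<in> ?I" "\<mu> \<in> ?I"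
      and "\<exists>a\<in>carrier \<Omega>. prod_idem (char_pair \<nu>) \<otimes>\<^bsub>\<Omega>\<^esub> a \<otimes>\<^bsub>\<Omega>\<^esub> prod_idem (char_pair \<mu>) \<noteq> \<zero>\<^bsub>\<Omega>\<^esub>"
    then obtain a where "a \<in> carrier \<Omega>" "prod_idem (char_pair \<nu>) \<otimes>\<^bsub>\<Omega>\<^esub> a \<otimes>\<^bsub>\<Omega>\<^esub> prod_idem (char_pair \<mu>) \<noteq> \<zero>\<^bsub>\<Omega>\<^esub>" by (elim bexE)
    then show "(\<nu>, \<mu>) \<in> ?r" using O.F_ordered[OF dL[OF nm(1)] dL[OF nm(2)]] nm by simp
  qed
  show "\<exists>\<psi>. surj_matrix_morphism K (G1 \<times>\<times> G2) S (char_degree (G1 \<times>\<times> G2) \<nu>) (prod_idem (char_pair \<nu>)) \<psi>" if "\<nu> \<in> ?I" for \<nu>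
  proof -
    have "char_degree (G1 \<times>\<times> G2) \<nu> = char_degree G1 (fst (char_pair \<nu>)) * char_degree G2 (snd (char_pair \<nu>))"
      using outer_char_Irr(2)[of "fst (char_pair \<nu>)" "snd (char_pair \<nu>)"] char_pair_in[OF that] char_pair_outer[OF that] by simp
    then show ?thesis using prod_idem_surj_matrix_morphism[of "fst (char_pair \<nu>)" "snd (char_pair \<nu>)"] char_pair_in[OF that] by simp
  qed
  show "prod_idem (char_pair \<nu>) \<otimes>\<^bsub>\<Omega>\<^esub> X_elt K (G1 \<times>\<times> G2) S I J \<otimes>\<^bsub>\<Omega>\<^esub> prod_idem (char_pair \<nu>) \<in> Psi K (G1 \<times>\<times> G2) S"
    if "\<nu> \<in> ?I" "compat_edge (G1 \<times>\<times> G2) S I J" for \<nu> I J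
    using prod_idem_corner_X_Psi[of "fst (char_pair \<nu>)" "snd (char_pair \<nu>)" I J] char_pair_in[OF that(1)] that(2) by simp
  show "prod_idem (char_pair \<nu>) \<in> Psi K (G1 \<times>\<times> G2) S" if "\<nu> \<in> ?I" for \<nu>
    using prod_idem_Psi[of "fst (char_pair \<nu>)" "snd (char_pair \<nu>)"] char_pair_in[OF that] by simp
qed

end

theorem theorem4p7:
  fixes G1 :: "'a monoid" and S1 :: "'a set"
    and G2 :: "'b monoid" and S2 :: "'b set"
    and K :: "complex set"
  assumes "finite_coxeter_group G1 S1" and "finite_coxeter_group G2 S2"
    and "good_ring K (G1 \<times>\<times> G2) (prod_reflections G1 S1 G2 S2)"
    and "strong_wgraph_conjecture K G1 S1" and "strong_wgraph_conjecture K G2 S2"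
  shows "strong_wgraph_conjecture K (G1 \<times>\<times> G2) (prod_reflections G1 S1 G2 S2)"
proof -
  define \<iota>1 where "\<iota>1 s = (s, \<one>\<^bsub>G2\<^esub>)" for s :: 'a
  define \<iota>2 where "\<iota>2 t = (\<one>\<^bsub>G1\<^esub>, t)" for t :: 'b
  let ?G = "G1 \<times>\<times> G2" and ?S = "prod_reflections G1 S1 G2 S2"
  have S: "?S = \<iota>1 ` S1 \<union> \<iota>2 ` S2" by (simp add: prod_reflections_def \<iota>1_def[abs_def] \<iota>2_def[abs_def])
  have K: "good_coeffs K" using assms(3) by (simp add: good_ring_def good_coeffs_def)
  interpret A: wgraph_setup K G1 S1 by (rule wgraph_setup_coxeter[OF K assms(1)])
  interpret B: wgraph_setup K G2 S2 by (rule wgraph_setup_coxeter[OF K assms(2)])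
  interpret AB: wgraph_setup K ?G ?S by (rule wgraph_setup_DirProd[OF A.wgraph_setup_axioms B.wgraph_setup_axioms])
  obtain F1 where F1: "strong_wgraph_decomposition K G1 S1 F1"
    using assms(4) unfolding strong_wgraph_conjecture_def by (elim exE)
  obtain F2 where F2: "strong_wgraph_decomposition K G2 S2 F2"
    using assms(5) unfolding strong_wgraph_conjecture_def by (elim exE)
  interpret DA: wgraph_decomp K G1 S1 F1 by unfold_locales (rule F1)
  interpret DB: wgraph_decomp K G2 S2 F2 by unfold_locales (rule F2)
  have not_one: "s \<noteq> \<one>\<^bsub>G1\<^esub>" if "s \<in> S1" for s using A.S_ord[OF that] by auto
  have not_one': "s \<noteq> \<one>\<^bsub>G2\<^esub>" if "s \<in> S2" for s using B.S_ord[OF that] by auto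
  have c1: "s \<in> carrier G1" if "s \<in> S1" for s using A.S_carrier that by blast
  have c2: "s \<in> carrier G2" if "s \<in> S2" for s using B.S_carrier that by blast
  obtain j1 where j1: "j1 \<in> Ring.ring_hom (Omega K G1 S1) (Omega K ?G ?S)"
    "\<And>s. s \<in> S1 \<Longrightarrow> j1 (omega_e K G1 S1 s) = omega_e K ?G ?S (\<iota>1 s)"
    "\<And>s. s \<in> S1 \<Longrightarrow> j1 (omega_x K G1 S1 s) = omega_x K ?G ?S (\<iota>1 s)"
    "\<And>c. c \<in> K \<Longrightarrow> j1 (omega_scalar K G1 S1 c) = omega_scalar K ?G ?S c"
  proof (rule A.Omega_map[of S1 \<iota>1 ?S ?G G1])
    show "group.ord ?G (\<iota>1 s \<otimes>\<^bsub>?G\<^esub> \<iota>1 t) = group.ord G1 (s \<otimes>\<^bsub>G1\<^esub> t)" if "s \<in> S1" "t \<in> S1" for s t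
      using ord_DirProd(1)[OF A.is_group B.is_group, of "s \<otimes>\<^bsub>G1\<^esub> t"] c1 that by (simp add: \<iota>1_def)
  qed (use S in blast)+
  obtain j2 where j2: "j2 \<in> Ring.ring_hom (Omega K G2 S2) (Omega K ?G ?S)"
    "\<And>s. s \<in> S2 \<Longrightarrow> j2 (omega_e K G2 S2 s) = omega_e K ?G ?S (\<iota>2 s)"
    "\<And>s. s \<in> S2 \<Longrightarrow> j2 (omega_x K G2 S2 s) = omega_x K ?G ?S (\<iota>2 s)"
    "\<And>c. c \<in> K \<Longrightarrow> j2 (omega_scalar K G2 S2 c) = omega_scalar K ?G ?S c"
  proof (rule A.Omega_map[of S2 \<iota>2 ?S ?G G2])
    show "group.ord ?G (\<iota>2 s \<otimes>\<^bsub>?G\<^esub> \<iota>2 t) = group.ord G2 (s \<otimes>\<^bsub>G2\<^esub> t)" if "s \<in> S2" "t \<in> S2" for s t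
      using ord_DirProd(2)[OF A.is_group B.is_group, of "s \<otimes>\<^bsub>G2\<^esub> t"] c2 that by (simp add: \<iota>2_def)
  qed (use S in blast)+
  have dis: "\<iota>1 ` S1 \<inter> \<iota>2 ` S2 = {}" using not_one by (auto simp: \<iota>1_def \<iota>2_def)
  have cross: "\<iota>1 s \<otimes>\<^bsub>?G\<^esub> \<iota>2 t = \<iota>2 t \<otimes>\<^bsub>?G\<^esub> \<iota>1 s" if "s \<in> S1" "t \<in> S2" for s t
    using c1[OF that(1)] c2[OF that(2)] by (simp add: \<iota>1_def \<iota>2_def)
  interpret P: dir_prod_product K G1 G2 ?S S1 \<iota>1 "\<iota>2 ` S2" j1 F1 S2 \<iota>2 "\<iota>1 ` S1" j2 F2
  proof
    show "inj_on \<iota>1 S1" "inj_on \<iota>2 S2" by (auto simp: inj_on_def \<iota>1_def \<iota>2_def)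
    show "?S = \<iota>1 ` S1 \<union> \<iota>2 ` S2" "?S = \<iota>2 ` S2 \<union> \<iota>1 ` S1" using S by auto
    show "\<iota>1 ` S1 \<inter> \<iota>2 ` S2 = {}" "\<iota>2 ` S2 \<inter> \<iota>1 ` S1 = {}" using dis by auto
    show "\<iota>1 s \<otimes>\<^bsub>?G\<^esub> b = b \<otimes>\<^bsub>?G\<^esub> \<iota>1 s" if "s \<in> S1" "b \<in> \<iota>2 ` S2" for s b using cross that by auto
    show "\<iota>2 s \<otimes>\<^bsub>?G\<^esub> b = b \<otimes>\<^bsub>?G\<^esub> \<iota>2 s" if "s \<in> S2" "b \<in> \<iota>1 ` S1" for s b using cross that by auto
    show "\<iota>1 s \<otimes>\<^bsub>?G\<^esub> \<iota>1 t = \<iota>1 t \<otimes>\<^bsub>?G\<^esub> \<iota>1 s \<longleftrightarrow> s \<otimes>\<^bsub>G1\<^esub> t = t \<otimes>\<^bsub>G1\<^esub> s" if "s \<in> S1" "t \<in> S1" for s t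
      by (simp add: \<iota>1_def)
    show "\<iota>2 s \<otimes>\<^bsub>?G\<^esub> \<iota>2 t = \<iota>2 t \<otimes>\<^bsub>?G\<^esub> \<iota>2 s \<longleftrightarrow> s \<otimes>\<^bsub>G2\<^esub> t = t \<otimes>\<^bsub>G2\<^esub> s" if "s \<in> S2" "t \<in> S2" for s t
      by (simp add: \<iota>2_def)
  qed (fact j1 j2 refl)+
  show ?thesis unfolding strong_wgraph_conjecture_def by (rule exI) (rule P.product_decomposition)
qed

end
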